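(* Let $\Omega=\omega\times(0,1)\subset\mathbb{R}^3$, where $\omega\subset\mathbb{R}^2$ is a bounded connected open set, and, with the sets $\varepsilon E^2$, measures $\mu_\varepsilon(B)=\varepsilon\mathcal{H}^2(B\cap\partial\,\varepsilon E^2)$ and spaces $\mathrm{LD}^2_{\mu_\varepsilon}(\Omega)$ described in the context, let $$F^\gamma_\varepsilon(u,\Omega)=\varepsilon^\gamma\int_\Omega\Bigl|\frac{dEu}{d\mu_\varepsilon}\Bigr|^2d\mu_\varepsilon,\qquad u\in\mathrm{LD}^2_{\mu_\varepsilon}(\Omega).$$ For $\gamma=2$ the functionals $F^\gamma_\varepsilon$ $\Gamma$-converge as $\varepsilon\to0$, on $\mathcal{R}\times\mathcal{U}$, to $$F(u_1,u_2;\Omega)=c_1\int_\Omega|(u_1)_\alpha-(u_2)_\alpha|^2\,dx+c_2\int_\Omega|(u_1)_3-(u_2)_3|^2\,dx,$$ with $c_1=\frac38\pi$ and $c_2=\frac\pi4$, with respect to the following convergence: $u_\varepsilon\in\mathrm{LD}^2_{\mu_\varepsilon}(\Omega)$ converges to $(u_1,u_2)\in L^2(\Omega;\mathbb{R}^3)\times L^2(\Omega;\mathbb{R}^3)$ if and only if $$\lim_{\varepsilon\to0}\int_{\varepsilon E^1}|u_\varepsilon-u_1|^2dx=0\quad\text{and}\quad\lim_{\varepsilon\to0}\int_{\varepsilon E^2}|u_\varepsilon-u_2|^2dx=0.$$ That is, for every $(u_1,u_2)\in\mathcal{R}\times\mathcal{U}$ and every sequence $\varepsilon_j\to0^+$: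 (a) for every sequence $u_j\in\mathrm{LD}^2_{\mu_{\varepsilon_j}}(\Omega)$ converging to $(u_1,u_2)$ in this sense, $F(u_1,u_2;\Omega)\le\liminf_jF^2_{\varepsilon_j}(u_j,\Omega)$; (b) there exists a sequence $u_j\in\mathrm{LD}^2_{\mu_{\varepsilon_j}}(\Omega)$ converging to $(u_1,u_2)$ in this sense with $F(u_1,u_2;\Omega)\ge\limsup_jF^2_{\varepsilon_j}(u_j,\Omega)$.
   Context: Write $x=(x_\alpha,x_3)\in\mathbb{R}^3$ with $x_\alpha=(x_1,x_2)$, and for $w\in\mathbb{R}^3$ write $w=(w_\alpha,w_3)$, $w_\alpha=(w_1,w_2)$. $\wedge$ is the vector product in $\mathbb{R}^3$, $\mathcal{H}^2$ is the Hausdorff measure, $a\odot b=\frac12(a\otimes b+b\otimes a)$ with the Euclidean matrix norm. For $i=(i_1,i_2)\in\mathbb{Z}^2$, $\varepsilon D_i$ is the two-dimensional disk centered at $x_i=(\varepsilon i_1+\frac\varepsilon2,\varepsilon i_2+\frac\varepsilon2)$ of radius $\varepsilon/4$; $\varepsilon E_i^2=\varepsilon D_i\times(0,1)$; $I_\varepsilon=\{i\in\mathbb{Z}^2:\varepsilon E_i^2\subset\Omega\}$; $\varepsilon E^2=\bigcup_{i\in I_\varepsilon}\varepsilon E_i^2$; $\varepsilon E^1=\Omega\setminus\varepsilon E^2$. $Eu$ is the symmetrized distributional gradient, $E_{ij}u=\frac12(D_iu_j+D_ju_i)$, and $BD(\Omega)$ is the space of $u\in L^1(\Omega;\mathbb{R}^3)$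 for which $Eu$ is a Radon measure with finite total variation in $\Omega$. $\mathrm{LD}^2_{\mu_\varepsilon}(\Omega)$ is the set of $u\in L^2(\Omega;\mathbb{R}^3)\cap BD(\Omega)$ with $Eu\ll\mu_\varepsilon$ and $\frac{dEu}{d\mu_\varepsilon}\in L^2_{\mu_\varepsilon}$. Here it consists of the functions which are rigid displacements on $\varepsilon E^1$ and on each $\varepsilon E_i^2$: $u\in\mathrm{LD}^2_{\mu_\varepsilon}(\Omega)$ iff there exist $c,d,a_i,b_i\in\mathbb{R}^3$ with $u=c\wedge x+d$ on $\varepsilon E^1$ and $u=a_i\wedge x+b_i$ on $\varepsilon E_i^2$ for each $i\in I_\varepsilon$; then $\frac{dEu}{d\mu_\varepsilon}=\frac1\varepsilon(c\wedge x+d-a_i\wedge x-b_i)\odot\nu$ on $\partial(\varepsilon E_i^2)\cap\Omega$, with $\nu$ the unit normal. $\mathcal{R}$ is the set of rigid displacements $x\mapsto a\wedge x+b$ ($a,b\in\mathbb{R}^3$) on $\Omega$. For $\eta>0$ and $k\in\mathbb{Z}^2$ let $T^k_\eta=(\eta k+(0,\eta)^2)\times(0,1)$ and $J=J_\eta=\{k\in\mathbb{Z}^2:T^k_\eta\cap\Omega\ne\emptyset\}$ (so the $T^k_\eta$, $k\in J$, cover $\Omega$ up to a null set). $\mathcal{U}$ is the set of $v\in L^2(\Omega;\mathbb{R}^3)$ such that for every $\eta>0$ there exist rigid displacements $A^k\wedge x+B^k$ ($A^k,B^k\in\mathbb{R}^3$, $k\in J$, depending on $\eta$) with $$\sum_{k\in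 J}\int_{T^k_\eta\cap\Omega}|v(x)-A^k\wedge x-B^k|^2dx\le o(\eta),$$ where $o(\eta)$ denotes a quantity tending to $0$ as $\eta\to0$. *)

theory Defs
  imports "HOL-Analysis.Analysis"
begin

section \<open>Geometry\<close>

definition alpha :: "real^3 \<Rightarrow> real^2" where
  "alpha x = vector [x $ 1, x $ 2]"

definition prism :: "(real^2) set \<Rightarrow> (real^3) set" where
  "prism S = {x. alpha x \<in> S \<and> 0 < x $ 3 \<and> x $ 3 < 1}"

definition center :: "real \<Rightarrow> int \<times> int \<Rightarrow> real^2" where
  "center \<epsilon> i = vector [\<epsilon> * of_int (fst i) + \<epsilon> / 2, \<epsilon> * of_int (snd i) + \<epsilon> / 2]"

text \<open>The disks are closed, so that a cylinder contained in \<open>prism \<omega>\<close> has its whole lateral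
  surface in \<open>prism \<omega>\<close>.\<close>

definition cyl :: "real \<Rightarrow> int \<times> int \<Rightarrow> (real^3) set" where
  "cyl \<epsilon> i = prism (cball (center \<epsilon> i) (\<epsilon> / 4))"

definition cyl_index :: "(real^3) set \<Rightarrow> real \<Rightarrow> (int \<times> int) set" where
  "cyl_index \<Omega> \<epsilon> = {i. cyl \<epsilon> i \<subseteq> \<Omega>}"

definition E2 :: "(real^3) set \<Rightarrow> real \<Rightarrow> (real^3) set" where
  "E2 \<Omega> \<epsilon> = (\<Union>i\<in>cyl_index \<Omega> \<epsilon>. cyl \<epsilon> i)"

definition E1 :: "(real^3) set \<Rightarrow> real \<Rightarrow> (real^3) set" where
  "E1 \<Omega> \<epsilon> = \<Omega> - E2 \<Omega> \<epsilon>"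


section \<open>Hausdorff measure and the measures \<open>\<mu>\<^sub>\<epsilon>\<close>\<close>

text \<open>Two-dimensional Hausdorff measure, normalised by the area \<open>\<pi> r\<^sup>2\<close> of the planar disk.
  Boundedness of the covering sets is required because \<^const>\<open>diameter\<close> is unspecified on
  unbounded sets; the empty set has diameter \<open>0\<close>, so finite covers are included.\<close>

definition hausdorff2_premeasure :: "real \<Rightarrow> 'a::metric_space set \<Rightarrow> ennreal" where
  "hausdorff2_premeasure \<delta> A =
     (INF U \<in> {U :: nat \<Rightarrow> 'a set. A \<subseteq> (\<Union>n. U n) \<and> (\<forall>n. bounded (U n) \<and> diameter (U n) \<le> \<delta>)}.
        \<Sum>n. ennreal (pi * (diameter (U n) / 2)\<^sup>2))"

definition hausdorff2_outer :: "'a::metric_space set \<Rightarrow> ennreal" where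
  "hausdorff2_outer A = (SUP \<delta>\<in>{0<..}. hausdorff2_premeasure \<delta> A)"

definition hausdorff2 :: "'a::metric_space measure" where
  "hausdorff2 = measure_of UNIV (sets borel) hausdorff2_outer"

definition mu :: "(real^3) set \<Rightarrow> real \<Rightarrow> (real^3) measure" where
  "mu \<Omega> \<epsilon> = measure_of UNIV (sets borel)
     (\<lambda>B. ennreal \<epsilon> * emeasure hausdorff2 (B \<inter> frontier (E2 \<Omega> \<epsilon>)))"


section \<open>Function spaces\<close>

text \<open>Functions are total; only their values on \<open>space M\<close>, up to null sets, matter.\<close>

definition L1_space :: "'a measure \<Rightarrow> ('a \<Rightarrow> 'b::{banach, second_countable_topology}) set" where
  "L1_space M = {u. integrable M u}"

definition L2_space :: "'a measure \<Rightarrow> ('a \<Rightarrow> 'b::real_normed_vector) set" where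
  "L2_space M = {u. u \<in> borel_measurable M \<and> integrable M (\<lambda>x. (norm (u x))\<^sup>2)}"

definition partial :: "3 \<Rightarrow> (real^3 \<Rightarrow> real) \<Rightarrow> real^3 \<Rightarrow> real" where
  "partial i f x = frechet_derivative f (at x) (axis i 1)"

primrec Ck :: "nat \<Rightarrow> (real^3 \<Rightarrow> real) \<Rightarrow> bool" where
  "Ck 0 f \<longleftrightarrow> continuous_on UNIV f"
| "Ck (Suc k) f \<longleftrightarrow> (\<forall>x. f differentiable (at x)) \<and> (\<forall>i. Ck k (partial i f))"

definition test_functions :: "(real^3) set \<Rightarrow> (real^3 \<Rightarrow> real) set" where
  "test_functions \<Omega> =
     {f. (\<forall>k. Ck k f) \<and> compact (closure {x. f x \<noteq> 0}) \<and> closure {x. f x \<noteq> 0} \<subseteq> \<Omega>}"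

definition E_distr :: "(real^3) set \<Rightarrow> (real^3 \<Rightarrow> real^3) \<Rightarrow> 3 \<Rightarrow> 3 \<Rightarrow> (real^3 \<Rightarrow> real) \<Rightarrow> real" where
  "E_distr \<Omega> u i j f =
     - (LINT x:\<Omega>|lebesgue. (u x $ j * partial i f x + u x $ i * partial j f x) / 2)"

text \<open>The distribution \<open>Eu\<close> on \<open>\<Omega>\<close> is the matrix-valued Radon measure \<open>\<Lambda>\<close> of finite total
  variation. Each entry of \<open>\<Lambda>\<close> is a difference of two finite positive Borel measures on \<open>\<Omega>\<close>
  (which, \<open>\<Omega>\<close> being open, are automatically Radon), and integrals against it are the differences
  of the integrals. Only the values of \<open>\<Lambda>\<close> on Borel subsets of \<open>\<Omega>\<close> matter.\<close>

definition is_Eu ::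
  "(real^3) set \<Rightarrow> (real^3 \<Rightarrow> real^3) \<Rightarrow> ((real^3) set \<Rightarrow> real^3^3) \<Rightarrow> bool" where
  "is_Eu \<Omega> u \<Lambda> \<longleftrightarrow>
     (\<exists>P N :: 3 \<Rightarrow> 3 \<Rightarrow> (real^3) measure. \<forall>i j.
        finite_measure (P i j) \<and> sets (P i j) = sets (restrict_space borel \<Omega>) \<and>
        finite_measure (N i j) \<and> sets (N i j) = sets (restrict_space borel \<Omega>) \<and>
        (\<forall>B\<in>sets (restrict_space borel \<Omega>). \<Lambda> B $ i $ j = measure (P i j) B - measure (N i j) B) \<and>
        (\<forall>f\<in>test_functions \<Omega>. E_distr \<Omega> u i j f = (LINT x|P i j. f x) - (LINT x|N i j. f x)))"

definition BD :: "(real^3) set \<Rightarrow> (real^3 \<Rightarrow> real^3) set" where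
  "BD \<Omega> = {u \<in> L1_space (lebesgue_on \<Omega>). \<exists>\<Lambda>. is_Eu \<Omega> u \<Lambda>}"

definition abs_cont ::
  "(real^3) set \<Rightarrow> ((real^3) set \<Rightarrow> real^3^3) \<Rightarrow> (real^3) measure \<Rightarrow> bool" where
  "abs_cont \<Omega> \<Lambda> \<mu> \<longleftrightarrow>
     (\<forall>B\<in>sets (restrict_space borel \<Omega>). emeasure \<mu> B = 0 \<longrightarrow> \<Lambda> B = 0)"

definition is_density ::
  "(real^3) set \<Rightarrow> ((real^3) set \<Rightarrow> real^3^3) \<Rightarrow> (real^3) measure \<Rightarrow> (real^3 \<Rightarrow> real^3^3) \<Rightarrow> bool" where
  "is_density \<Omega> \<Lambda> \<mu> g \<longleftrightarrow>
     set_integrable \<mu> \<Omega> g \<and> (\<forall>B\<in>sets (restrict_space borel \<Omega>). \<Lambda> B = (LINT x:B|\<mu>. g x))"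

text \<open>The norm on \<^typ>\<open>real^3^3\<close> is the Euclidean (Frobenius) matrix norm.\<close>

definition LD2 :: "(real^3) set \<Rightarrow> (real^3) measure \<Rightarrow> (real^3 \<Rightarrow> real^3) set" where
  "LD2 \<Omega> \<mu> = {u \<in> L2_space (lebesgue_on \<Omega>) \<inter> BD \<Omega>.
     \<exists>\<Lambda> g. is_Eu \<Omega> u \<Lambda> \<and> abs_cont \<Omega> \<Lambda> \<mu> \<and> is_density \<Omega> \<Lambda> \<mu> g \<and>
           g \<in> L2_space (restrict_space \<mu> \<Omega>)}"

text \<open>\<open>dEu/d\<mu>\<close>, a representative of a function that is unique up to \<open>\<mu>\<close>-null sets.\<close>

definition dEu :: "(real^3) set \<Rightarrow> (real^3) measure \<Rightarrow> (real^3 \<Rightarrow> real^3) \<Rightarrow> real^3 \<Rightarrow> real^3^3" where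
  "dEu \<Omega> \<mu> u = (SOME g. \<exists>\<Lambda>. is_Eu \<Omega> u \<Lambda> \<and> is_density \<Omega> \<Lambda> \<mu> g)"

text \<open>The members of \<open>rigid\<close> are, like all elements of \<open>L\<^sup>2(\<Omega>)\<close>, identified almost everywhere.\<close>

definition rigid :: "(real^3) set \<Rightarrow> (real^3 \<Rightarrow> real^3) set" where
  "rigid \<Omega> = {u. \<exists>a b. AE x in lebesgue_on \<Omega>. u x = cross3 a x + b}"

definition T_cell :: "real \<Rightarrow> int \<times> int \<Rightarrow> (real^3) set" where
  "T_cell \<eta> k = prism {y. \<eta> * of_int (fst k) < y $ 1 \<and> y $ 1 < \<eta> * of_int (fst k) + \<eta> \<and>
                          \<eta> * of_int (snd k) < y $ 2 \<and> y $ 2 < \<eta> * of_int (snd k) + \<eta>}"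

definition J_index :: "(real^3) set \<Rightarrow> real \<Rightarrow> (int \<times> int) set" where
  "J_index \<Omega> \<eta> = {k. T_cell \<eta> k \<inter> \<Omega> \<noteq> {}}"

definition U_space :: "(real^3) set \<Rightarrow> (real^3 \<Rightarrow> real^3) set" where
  "U_space \<Omega> = {v \<in> L2_space (lebesgue_on \<Omega>).
     \<exists>r :: real \<Rightarrow> real. (r \<longlongrightarrow> 0) (at_right 0) \<and>
       (\<forall>\<eta>>0. \<exists>A B :: int \<times> int \<Rightarrow> real^3.
          (\<Sum>k\<in>J_index \<Omega> \<eta>.
             LINT x:T_cell \<eta> k \<inter> \<Omega>|lebesgue. (norm (v x - cross3 (A k) x - B k))\<^sup>2) \<le> r \<eta>)}"


section \<open>Energies and convergence\<close>

definition F_eps :: "real \<Rightarrow> (real^3) set \<Rightarrow> real \<Rightarrow> (real^3 \<Rightarrow> real^3) \<Rightarrow> real" where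
  "F_eps \<gamma> \<Omega> \<epsilon> u =
     \<epsilon> powr \<gamma> * (LINT x:\<Omega>|mu \<Omega> \<epsilon>. (norm (dEu \<Omega> (mu \<Omega> \<epsilon>) u x))\<^sup>2)"

definition F_lim ::
  "real \<Rightarrow> real \<Rightarrow> (real^3) set \<Rightarrow> (real^3 \<Rightarrow> real^3) \<Rightarrow> (real^3 \<Rightarrow> real^3) \<Rightarrow> real" where
  "F_lim c\<^sub>1 c\<^sub>2 \<Omega> u\<^sub>1 u\<^sub>2 =
     c\<^sub>1 * (LINT x:\<Omega>|lebesgue. (norm (alpha (u\<^sub>1 x) - alpha (u\<^sub>2 x)))\<^sup>2) +
     c\<^sub>2 * (LINT x:\<Omega>|lebesgue. \<bar>u\<^sub>1 x $ 3 - u\<^sub>2 x $ 3\<bar>\<^sup>2)"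

definition converges_to ::
  "(real^3) set \<Rightarrow> (nat \<Rightarrow> real) \<Rightarrow> (nat \<Rightarrow> real^3 \<Rightarrow> real^3) \<Rightarrow>
   (real^3 \<Rightarrow> real^3) \<Rightarrow> (real^3 \<Rightarrow> real^3) \<Rightarrow> bool" where
  "converges_to \<Omega> \<epsilon> u u\<^sub>1 u\<^sub>2 \<longleftrightarrow>
     (\<lambda>j. LINT x:E1 \<Omega> (\<epsilon> j)|lebesgue. (norm (u j x - u\<^sub>1 x))\<^sup>2) \<longlonglongrightarrow> 0 \<and>
     (\<lambda>j. LINT x:E2 \<Omega> (\<epsilon> j)|lebesgue. (norm (u j x - u\<^sub>2 x))\<^sup>2) \<longlonglongrightarrow> 0"

end

theory Submission
  imports Defs "HOL-Real_Asymp.Real_Asymp"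
begin

text \<open>
  A displacement in \<open>LD2\<close> has strain only on the lateral surfaces of the cylinders, where its density is
  \<open>1 / \<epsilon>\<close> times the symmetrised product of the jump and the unit normal \<open>\<nu>\<close>. For a constant jump \<open>w\<close>
  the square of the norm of this product is \<open>(\<bar>w\<bar>\<^sup>2 + (w \<bullet> \<nu>)\<^sup>2) / 2\<close>; its integral over a circle of
  radius \<open>\<epsilon> / 4\<close>, multiplied by the factor \<open>\<epsilon>\<close> of the measure, is
  \<open>\<epsilon>\<^sup>2 (3/8 \<pi> \<bar>w\<^sub>\<alpha>\<bar>\<^sup>2 + \<pi>/4 w\<^sub>3\<^sup>2)\<close>, and \<open>\<epsilon>\<^sup>2\<close> is the area of a cell. This is where the two constants
  come from.

  The lower bound is obtained by duality, without describing the displacements of finite energy. For a smooth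
  symmetric matrix field \<open>\<Phi>\<close> of compact support,
  \<open>\<epsilon>\<^sup>2 \<integral> \<bar>dEu/d\<mu>\<bar>\<^sup>2 d\<mu> \<ge> 2 \<epsilon>\<^sup>2 \<langle>Eu, \<Phi>\<rangle> - \<epsilon>\<^sup>2 \<integral> \<bar>\<Phi>\<bar>\<^sup>2 d\<mu>\<close>, and \<open>\<langle>Eu, \<Phi>\<rangle> = - \<integral> u \<bullet> div \<Phi>\<close>.
  As \<open>\<Phi>\<close> serves \<open>1 / \<epsilon>\<close> times the symmetrised product of a smooth vector field \<open>\<zeta>\<close>, frozen horizontally on
  each cell, and of an extension of \<open>\<nu>\<close> that is cut off inside the cell. Then \<open>\<epsilon>\<^sup>2 div \<Phi>\<close> stays bounded, so
  that in the limit \<open>u\<close> may be replaced by \<open>u\<^sub>1\<close> outside and by \<open>u\<^sub>2\<close> inside the cylinders; the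
  rigid displacement \<open>u\<^sub>1\<close> gives zero when it is paired with \<open>div \<Phi>\<close> over all of \<open>\<Omega>\<close>, and there remains
  \<open>u\<^sub>1 - u\<^sub>2\<close> on the cylinders, where \<open>\<epsilon>\<^sup>2 div \<Phi>\<close> is \<open>16 / \<pi>\<close> times the weighted \<open>\<zeta>\<close> up to
  \<open>O(\<epsilon>)\<close>. Since \<open>\<pi> / 16\<close> is the volume fraction of the cylinders, choosing \<open>\<zeta>\<close> close to
  \<open>u\<^sub>1 - u\<^sub>2\<close> in the \<open>L\<^sup>2\<close> norm yields the limit functional (\<open>energy_duality\<close>, \<open>lower_bound_static\<close>,
  \<open>liminf_inequality\<close>).

  For the upper bound, membership of \<open>u\<^sub>2\<close> in \<open>U_space\<close>, used with \<open>\<eta> = \<epsilon>\<close>, provides rigid displacements that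
  are close to \<open>u\<^sub>2\<close> on the cells. The recovery sequence equals these on the cylinders whose cells lie in
  \<open>\<Omega>\<close>, and \<open>u\<^sub>1\<close> elsewhere. The energy that one cylinder contributes is at most the weighted square integral
  of the rigid jump over the whole cell (\<open>cell_inequality\<close>), an inequality without error term, and summation
  over the cells gives the limit functional (\<open>recovery_energy\<close>, \<open>limsup_inequality\<close>).

  Two general facts are needed to get at the energy at all. On a lateral surface the Hausdorff measure is arc
  length times height (\<open>hausdorff2_lateral\<close>): a Vitali cover bounds it from above and the isodiametric
  inequality from below. And a density of \<open>Eu\<close> is determined almost everywhere by the values of the distribution
  on test functions (\<open>density_unique\<close>), so that the energy can be computed from any density.
\<close>

section \<open>Smooth functions\<close>

lemma partial_eqI:
  assumes "(f has_derivative D) (at x)"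
  shows "partial i f x = D (axis i 1)"
  unfolding partial_def using frechet_derivative_at[OF assms] by metis

lemma has_derivative_frechet:
  "f differentiable (at x) \<Longrightarrow> (f has_derivative frechet_derivative f (at x)) (at x)"
  using frechet_derivative_works by blast

lemma Ck_continuous:
  assumes "Ck k f"
  shows "continuous_on UNIV f"
proof (cases k)
  case 0
  then show ?thesis using assms by simp
next
  case (Suc n)
  then have "f differentiable (at x)" for x using assms by simp
  then show ?thesis
    by (intro continuous_at_imp_continuous_on ballI differentiable_imp_continuous_within)
qed

lemma Ck_Suc_imp: "Ck (Suc k) f \<Longrightarrow> Ck k f"
proof (induction k arbitrary: f)
  case 0
  show ?case using Ck_continuous[OF 0] by simp
next
  case (Suc k)
  then show ?case by (metis Ck.simps(2))
qed

lemma partial_const: "partial i (\<lambda>x. c) = (\<lambda>x. 0)"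
  by (rule ext, subst partial_eqI[where D = "\<lambda>_. 0"]) auto

lemma Ck_const: "Ck k (\<lambda>x. c)"
  by (induction k arbitrary: c) (auto simp: partial_const)

lemma partial_proj: "partial i (\<lambda>x. x $ j) = (\<lambda>x. if i = j then 1 else 0)"
proof
  fix x :: "real^3"
  have "((\<lambda>x. x $ j) has_derivative (\<lambda>x. x $ j)) (at x)"
    by (rule bounded_linear.has_derivative[OF bounded_linear_vec_nth]) auto
  from partial_eqI[OF this, of i] show "partial i (\<lambda>x. x $ j) x = (if i = j then 1 else 0)"
    by (auto simp: axis_def)
qed

lemma Ck_proj: "Ck k (\<lambda>x. x $ j)"
proof (cases k)
  case 0
  then show ?thesis by (auto intro: continuous_intros)
next
  case (Suc n)
  have "(\<lambda>x::real^3. x $ j) differentiable at x" for x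
    using bounded_linear.has_derivative[OF bounded_linear_vec_nth, OF has_derivative_ident]
    unfolding differentiable_def by blast
  then show ?thesis using Suc by (auto simp: partial_proj Ck_const)
qed

lemma partial_add:
  assumes "f differentiable (at x)" "g differentiable (at x)"
  shows "partial i (\<lambda>x. f x + g x) x = partial i f x + partial i g x"
  using partial_eqI[OF has_derivative_add[OF has_derivative_frechet[OF assms(1)] has_derivative_frechet[OF assms(2)]], of i]
  unfolding partial_def by simp

lemma partial_mult:
  assumes "f differentiable (at x)" "g differentiable (at x)"
  shows "partial i (\<lambda>x. f x * g x) x = f x * partial i g x + partial i f x * g x"
  using partial_eqI[OF has_derivative_mult[OF has_derivative_frechet[OF assms(1)] has_derivative_frechet[OF assms(2)]], of i]
  unfolding partial_def by simp

lemma partial_chain: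
  assumes "f differentiable (at x)" "(F has_real_derivative D) (at (f x))"
  shows "partial i (\<lambda>x. F (f x)) x = D * partial i f x"
    and "(\<lambda>x. F (f x)) differentiable (at x)"
proof -
  have "((\<lambda>x. F (f x)) has_derivative (\<lambda>h. D * frechet_derivative f (at x) h)) (at x)"
    using has_derivative_compose[OF has_derivative_frechet[OF assms(1)], of F "(*) D"] assms(2)
    by (simp add: has_field_derivative_def o_def)
  from partial_eqI[OF this, of i] this show "partial i (\<lambda>x. F (f x)) x = D * partial i f x"
    "(\<lambda>x. F (f x)) differentiable (at x)"
    unfolding partial_def differentiable_def by auto
qed

lemma Ck_add: "Ck k f \<Longrightarrow> Ck k g \<Longrightarrow> Ck k (\<lambda>x. f x + g x)"
proof (induction k arbitrary: f g)
  case 0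
  then show ?case by (auto intro: continuous_intros)
next
  case (Suc k)
  have "partial i (\<lambda>x. f x + g x) = (\<lambda>x. partial i f x + partial i g x)" for i
    using Suc.prems by (auto simp: partial_add)
  then show ?case using Suc by (auto intro: derivative_intros)
qed

text \<open>By the product rule the partial derivatives of a product are again sums of products, of one order less.\<close>

lemma Ck_mult: "Ck k f \<Longrightarrow> Ck k g \<Longrightarrow> Ck k (\<lambda>x. f x * g x)"
proof (induction k arbitrary: f g)
  case 0
  then show ?case by (auto intro: continuous_intros)
next
  case (Suc k)
  have "partial i (\<lambda>x. f x * g x) = (\<lambda>x. f x * partial i g x + partial i f x * g x)" for i
    using Suc.prems by (auto simp: partial_mult)
  moreover have "Ck k f" "Ck k g" using Suc.prems Ck_Suc_imp by blast+
  ultimately show ?case using Suc by (auto intro!: derivative_intros Ck_add)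
qed

definition smooth :: "(real^3 \<Rightarrow> real) \<Rightarrow> bool" where
  "smooth f \<longleftrightarrow> (\<forall>k. Ck k f)"

lemma smooth_differentiable: "smooth f \<Longrightarrow> f differentiable (at x)"
  unfolding smooth_def by (metis Ck.simps(2))

lemma smooth_partial: "smooth f \<Longrightarrow> smooth (partial i f)"
  unfolding smooth_def by (metis Ck.simps(2))

lemma smooth_continuous: "smooth f \<Longrightarrow> continuous_on S f"
  unfolding smooth_def using Ck_continuous continuous_on_subset by blast

lemma smooth_const [intro]: "smooth (\<lambda>x. c)"
  and smooth_proj [intro]: "smooth (\<lambda>x. x $ j)"
  and smooth_add [intro]: "smooth f \<Longrightarrow> smooth g \<Longrightarrow> smooth (\<lambda>x. f x + g x)"
  and smooth_mult [intro]: "smooth f \<Longrightarrow> smooth g \<Longrightarrow> smooth (\<lambda>x. f x * g x)"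
  unfolding smooth_def by (auto intro: Ck_const Ck_proj Ck_add Ck_mult)

lemma smooth_minus [intro]: "smooth f \<Longrightarrow> smooth (\<lambda>x. - f x)"
  using smooth_mult[of "\<lambda>x. -1" f] by auto

lemma smooth_diff [intro]: "smooth f \<Longrightarrow> smooth g \<Longrightarrow> smooth (\<lambda>x. f x - g x)"
  using smooth_add[of f "\<lambda>x. - g x"] by auto

lemma smooth_sum [intro]: "(\<And>k. k \<in> K \<Longrightarrow> smooth (f k)) \<Longrightarrow> smooth (\<lambda>x. \<Sum>k\<in>K. f k x)"
  by (induction K rule: infinite_finite_induct) auto

lemma partial_cmult:
  assumes "smooth f"
  shows "partial i (\<lambda>x. c * f x) x = c * partial i f x"
  using partial_mult[of "\<lambda>x. c" x f i] smooth_differentiable[OF assms] by (simp add: partial_const)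

lemma partial_sum:
  assumes "\<And>k. k \<in> K \<Longrightarrow> smooth (f k)"
  shows "partial i (\<lambda>x. \<Sum>k\<in>K. f k x) x = (\<Sum>k\<in>K. partial i (f k) x)"
  using assms
proof (induction K rule: infinite_finite_induct)
  case (insert k K)
  have "partial i (\<lambda>x. f k x + (\<Sum>k\<in>K. f k x)) x = partial i (f k) x + partial i (\<lambda>x. \<Sum>k\<in>K. f k x) x"
    using insert.prems by (intro partial_add smooth_differentiable smooth_sum) auto
  then show ?case using insert by simp
qed (simp_all add: partial_const)

text \<open>Each partial derivative contains the function itself as a factor, which is why the order can be raised step by
  step.\<close>

lemma smooth_exp [intro]:
  assumes "smooth f"
  shows "smooth (\<lambda>x. exp (f x))"
proof -
  have 1: "partial i (\<lambda>x. exp (f x)) = (\<lambda>x. exp (f x) * partial i f x)" for i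
    using partial_chain(1)[OF smooth_differentiable[OF assms] DERIV_exp] by blast
  have "Ck k (\<lambda>x. exp (f x))" for k
  proof (induction k)
    case 0
    show ?case using smooth_continuous[OF assms, of UNIV] by (auto intro: continuous_intros)
  next
    case (Suc k)
    then show ?case
      using partial_chain(2)[OF smooth_differentiable[OF assms] DERIV_exp] smooth_partial[OF assms]
      by (auto simp: 1 smooth_def intro: Ck_mult)
  qed
  then show ?thesis by (simp add: smooth_def)
qed

lemma smooth_inverse [intro]:
  assumes "smooth f" and nz: "\<And>x. f x \<noteq> 0"
  shows "smooth (\<lambda>x. inverse (f x))"
proof -
  have D: "(inverse has_real_derivative - (inverse (f x) * inverse (f x))) (at (f x))" for x
    using DERIV_inverse[OF nz[of x]] by (simp add: power2_eq_square numeral_2_eq_2)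
  have 1: "partial i (\<lambda>x. inverse (f x)) = (\<lambda>x. (- 1 * (inverse (f x) * inverse (f x))) * partial i f x)" for i
    using partial_chain(1)[OF smooth_differentiable[OF assms(1)] D] by fastforce
  have "Ck k (\<lambda>x. inverse (f x))" for k
  proof (induction k)
    case 0
    show ?case using smooth_continuous[OF assms(1), of UNIV] nz by (auto intro: continuous_intros)
  next
    case (Suc k)
    have "Ck k (\<lambda>x. (- 1 * (inverse (f x) * inverse (f x))) * partial i f x)" for i
      using smooth_partial[OF assms(1)] Suc Ck_const by (intro Ck_mult) (auto simp: smooth_def)
    then show ?case
      using partial_chain(2)[OF smooth_differentiable[OF assms(1)] D]
      by (simp only: Ck.simps 1) auto
  qed
  then show ?thesis by (simp add: smooth_def)
qed

text \<open>The powers in the denominator make the family closed under differentiation.\<close>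

definition flat_exp :: "nat \<Rightarrow> real \<Rightarrow> real" where
  "flat_exp m t = (if t \<le> 0 then 0 else exp (- 1 / t) / t ^ m)"

lemma flat_exp_pos: "0 < t \<Longrightarrow> 0 < flat_exp m t"
  and flat_exp_zero: "t \<le> 0 \<Longrightarrow> flat_exp m t = 0"
  and flat_exp_nonneg: "0 \<le> flat_exp m t"
  by (auto simp: flat_exp_def)

lemma flat_exp_deriv:
  "(flat_exp m has_real_derivative (flat_exp (m + 2) t - m * flat_exp (m + 1) t)) (at t)"
proof -
  consider "t > 0" | "t < 0" | "t = 0" by linarith
  then show ?thesis
  proof cases
    case 1
    have "((\<lambda>t. exp (- 1 / t) / t ^ m) has_real_derivative
       (exp (- 1 / t) * (1 / t^2) * t ^ m - exp (- 1 / t) * (real m * t ^ (m - 1))) / (t ^ m * t ^ m)) (at t)"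
      using 1 by (auto intro!: derivative_eq_intros simp: power2_eq_square)
    moreover have "(exp (- 1 / t) * (1 / t^2) * t ^ m - exp (- 1 / t) * (real m * t ^ (m - 1))) / (t ^ m * t ^ m)
       = flat_exp (m + 2) t - m * flat_exp (m + 1) t"
      using 1 by (cases m) (auto simp: flat_exp_def field_simps power2_eq_square)
    ultimately have "((\<lambda>t. exp (- 1 / t) / t ^ m) has_real_derivative
        (flat_exp (m + 2) t - m * flat_exp (m + 1) t)) (at t)" by simp
    then show ?thesis
      by (rule has_field_derivative_transform_within_open[where S = "{0<..}"])
         (use 1 in \<open>auto simp: flat_exp_def\<close>)
  next
    case 2
    have "((\<lambda>t. 0) has_real_derivative 0) (at t)" by simp
    then have "(flat_exp m has_real_derivative 0) (at t)"
      by (rule has_field_derivative_transform_within_open[where S = "{..<0}"])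
         (use 2 in \<open>auto simp: flat_exp_def\<close>)
    then show ?thesis using 2 by (simp add: flat_exp_def)
  next
    case 3
    have "((\<lambda>h. (flat_exp m (0 + h) - flat_exp m 0) / h) \<longlongrightarrow> 0) (at_right 0)"
    proof (rule Lim_transform_eventually)
      show "((\<lambda>h::real. exp (- 1 / h) / h ^ m / h) \<longlongrightarrow> 0) (at_right 0)"
        by real_asymp
      show "\<forall>\<^sub>F h in at_right 0. exp (- 1 / h) / h ^ m / h = (flat_exp m (0 + h) - flat_exp m 0) / h"
        by (rule eventually_at_rightI[of 0 1]) (auto simp: flat_exp_def)
    qed
    moreover have "((\<lambda>h. (flat_exp m (0 + h) - flat_exp m 0) / h) \<longlongrightarrow> 0) (at_left 0)"
    proof (rule Lim_transform_eventually)
      show "((\<lambda>h::real. 0) \<longlongrightarrow> 0) (at_left 0)" by simp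
      show "\<forall>\<^sub>F h in at_left 0. (0::real) = (flat_exp m (0 + h) - flat_exp m 0) / h"
        by (rule eventually_at_leftI[of "-1" 0]) (auto simp: flat_exp_def)
    qed
    ultimately have "(flat_exp m has_real_derivative 0) (at 0)"
      unfolding DERIV_def using filterlim_split_at by blast
    then show ?thesis using 3 by (simp add: flat_exp_def)
  qed
qed

lemma smooth_flat_exp [intro]:
  assumes "smooth f"
  shows "smooth (\<lambda>x. flat_exp m (f x))"
proof -
  note df = smooth_differentiable[OF assms]
  have 1: "partial i (\<lambda>x. flat_exp m (f x)) =
     (\<lambda>x. (flat_exp (m + 2) (f x) + (- real m) * flat_exp (m + 1) (f x)) * partial i f x)" for i m
    using partial_chain(1)[OF df flat_exp_deriv] by fastforce
  have "Ck k (\<lambda>x. flat_exp m (f x))" for k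
  proof (induction k arbitrary: m)
    case 0
    have "continuous_on UNIV (flat_exp m)"
      using flat_exp_deriv DERIV_isCont continuous_at_imp_continuous_on by blast
    then show ?case using smooth_continuous[OF assms, of UNIV]
      by (simp add: continuous_on_compose2[of UNIV "flat_exp m"])
  next
    case (Suc k)
    have "Ck k (\<lambda>x. (flat_exp (m + 2) (f x) + (- real m) * flat_exp (m + 1) (f x)) * partial i f x)" for i
      using Suc smooth_partial[OF assms, unfolded smooth_def]
      by (intro Ck_mult Ck_add Ck_const) auto
    then show ?case
      using partial_chain(2)[OF df flat_exp_deriv] by (simp only: Ck.simps 1) auto
  qed
  then show ?thesis by (simp add: smooth_def)
qed

text \<open>Maps that are affine in each coordinate separately suffice to freeze and to rescale coordinates.\<close>

lemma affine_has_derivative: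
  fixes a b :: "real^3"
  shows "((\<lambda>x. \<chi> j. a $ j * x $ j + b $ j) has_derivative (\<lambda>x. \<chi> j. a $ j * x $ j)) (at x)"
proof -
  have "linear (\<lambda>x::real^3. \<chi> j. a $ j * x $ j)"
    by (auto intro!: linearI simp: vec_eq_iff algebra_simps)
  then have "((\<lambda>x. \<chi> j. a $ j * x $ j) has_derivative (\<lambda>x::real^3. \<chi> j. a $ j * x $ j)) (at x)"
    using linear_linear linear_imp_has_derivative by blast
  from has_derivative_add_const[OF this, of b] show ?thesis
    by (simp add: plus_vec_def)
qed

lemma partial_affine:
  fixes a b :: "real^3"
  assumes "f differentiable (at (\<chi> j. a $ j * x $ j + b $ j))"
  shows "partial i (\<lambda>x. f (\<chi> j. a $ j * x $ j + b $ j)) x = a $ i * partial i f (\<chi> j. a $ j * x $ j + b $ j)"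
    and "(\<lambda>x. f (\<chi> j. a $ j * x $ j + b $ j)) differentiable (at x)"
proof -
  let ?L = "\<lambda>x. \<chi> j. a $ j * x $ j + b $ j"
  let ?D = "frechet_derivative f (at (?L x))"
  have d: "((\<lambda>x. f (?L x)) has_derivative (\<lambda>x. ?D (\<chi> j. a $ j * x $ j))) (at x)"
    using has_derivative_compose[OF affine_has_derivative has_derivative_frechet[OF assms]] by simp
  have "(\<chi> j. a $ j * axis i 1 $ j) = a $ i *\<^sub>R axis i (1::real)"
    by (auto simp: vec_eq_iff axis_def)
  moreover have "linear ?D" using has_derivative_frechet[OF assms] has_derivative_linear by blast
  ultimately have "?D (\<chi> j. a $ j * axis i 1 $ j) = a $ i * ?D (axis i 1)"
    by (simp add: linear_cmul)
  with partial_eqI[OF d, of i] show "partial i (\<lambda>x. f (?L x)) x = a $ i * partial i f (?L x)"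
    by (simp add: partial_def)
  show "(\<lambda>x. f (?L x)) differentiable (at x)" using d differentiable_def by blast
qed

lemma smooth_affine:
  fixes a b :: "real^3"
  assumes "smooth f"
  shows "smooth (\<lambda>x. f (\<chi> j. a $ j * x $ j + b $ j))"
proof -
  have "Ck k f \<Longrightarrow> Ck k (\<lambda>x. f (\<chi> j. a $ j * x $ j + b $ j))" for k
  proof (induction k arbitrary: f)
    case 0
    have "continuous_on UNIV (\<lambda>x. \<chi> j. a $ j * x $ j + b $ j)"
      by (intro continuous_intros)
    then show ?case using 0 by (simp add: continuous_on_compose2[of UNIV f])
  next
    case (Suc k)
    have "partial i (\<lambda>x. f (\<chi> j. a $ j * x $ j + b $ j)) =
        (\<lambda>x. a $ i * partial i f (\<chi> j. a $ j * x $ j + b $ j))" for i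
      using Suc.prems partial_affine(1) by fastforce
    then show ?case using Suc partial_affine(2) by (auto intro!: Ck_mult Ck_const)
  qed
  then show ?thesis using assms by (simp add: smooth_def)
qed

lemma partial_cong_open:
  assumes "open S" "x \<in> S" "\<And>y. y \<in> S \<Longrightarrow> f y = g y" "g differentiable (at x)"
  shows "partial i f x = partial i g x"
proof -
  have "(f has_derivative frechet_derivative g (at x)) (at x)"
    using has_derivative_transform_within_open[OF has_derivative_frechet[OF assms(4)] assms(1,2)] assms(3) by metis
  from partial_eqI[OF this] show ?thesis by (simp add: partial_def)
qed

section \<open>Test functions\<close>

lemma test_functionsI:
  assumes "smooth f" "compact K" "K \<subseteq> \<Omega>" "\<And>x. x \<notin> K \<Longrightarrow> f x = 0"
  shows "f \<in> test_functions \<Omega>"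
proof -
  have "closure {x. f x \<noteq> 0} \<subseteq> K"
    using assms(2,4) by (intro closure_minimal compact_imp_closed) auto
  moreover then have "compact (closure {x. f x \<noteq> 0})"
    using compact_Int_closed[OF assms(2), of "closure {x. f x \<noteq> 0}"] by (simp add: Int_absorb1)
  ultimately show ?thesis using assms(1,3) unfolding test_functions_def smooth_def by auto
qed

lemma test_functions_smooth: "f \<in> test_functions \<Omega> \<Longrightarrow> smooth f"
  by (simp add: test_functions_def smooth_def)

lemma test_functions_support:
  assumes "f \<in> test_functions \<Omega>"
  obtains K where "compact K" "K \<subseteq> \<Omega>" "\<And>x. x \<notin> K \<Longrightarrow> f x = 0"
proof
  show "compact (closure {x. f x \<noteq> 0})" "closure {x. f x \<noteq> 0} \<subseteq> \<Omega>"
    using assms by (auto simp: test_functions_def)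
  show "f x = 0" if "x \<notin> closure {x. f x \<noteq> 0}" for x
    using that closure_subset[of "{x. f x \<noteq> 0}"] by blast
qed

lemma test_functions_outside: "f \<in> test_functions \<Omega> \<Longrightarrow> x \<notin> \<Omega> \<Longrightarrow> f x = 0"
  by (metis test_functions_support subsetD)

lemma test_functions_mult:
  assumes "f \<in> test_functions \<Omega>" "smooth g"
  shows "(\<lambda>x. f x * g x) \<in> test_functions \<Omega>"
proof -
  obtain K where "compact K" "K \<subseteq> \<Omega>" "\<And>x. x \<notin> K \<Longrightarrow> f x = 0"
    by (rule test_functions_support[OF assms(1)]) blast
  then show ?thesis
    using test_functions_smooth[OF assms(1)] assms(2) by (intro test_functionsI[of _ K]) auto
qed

lemma test_functions_add:
  assumes "f \<in> test_functions \<Omega>" "g \<in> test_functions \<Omega>"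
  shows "(\<lambda>x. f x + g x) \<in> test_functions \<Omega>"
proof -
  obtain K where K: "compact K" "K \<subseteq> \<Omega>" "\<And>x. x \<notin> K \<Longrightarrow> f x = 0"
    by (rule test_functions_support[OF assms(1)]) blast
  obtain L where L: "compact L" "L \<subseteq> \<Omega>" "\<And>x. x \<notin> L \<Longrightarrow> g x = 0"
    by (rule test_functions_support[OF assms(2)]) blast
  show ?thesis
    using K L test_functions_smooth[OF assms(1)] test_functions_smooth[OF assms(2)]
    by (intro test_functionsI[of _ "K \<union> L"]) auto
qed

lemma test_functions_zero: "(\<lambda>x. 0) \<in> test_functions \<Omega>"
  by (rule test_functionsI[of _ "{}"]) auto

lemma test_functions_sum:
  "(\<And>k. k \<in> K \<Longrightarrow> f k \<in> test_functions \<Omega>) \<Longrightarrow> (\<lambda>x. \<Sum>k\<in>K. f k x) \<in> test_functions \<Omega>"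
  by (induction K rule: infinite_finite_induct) (auto intro: test_functions_zero test_functions_add)

lemma test_functions_cmult:
  "f \<in> test_functions \<Omega> \<Longrightarrow> (\<lambda>x. c * f x) \<in> test_functions \<Omega>"
  using test_functions_mult[of f \<Omega> "\<lambda>x. c"] by (auto simp: mult.commute)

lemma test_functions_partial:
  assumes "f \<in> test_functions \<Omega>"
  shows "partial i f \<in> test_functions \<Omega>"
proof -
  obtain K where K: "compact K" "K \<subseteq> \<Omega>" "\<And>x. x \<notin> K \<Longrightarrow> f x = 0"
    by (rule test_functions_support[OF assms(1)]) blast
  show ?thesis
  proof (rule test_functionsI)
    show "smooth (partial i f)" using assms test_functions_smooth smooth_partial by blast
    fix x assume x: "x \<notin> K"
    have "partial i f x = partial i (\<lambda>x. 0) x"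
      using x K by (intro partial_cong_open[of "- K"]) (auto simp: compact_imp_closed open_Compl)
    then show "partial i f x = 0" by (simp add: partial_const)
  qed (use K in auto)
qed

lemma test_functions_bounded:
  assumes "f \<in> test_functions \<Omega>"
  obtains B where "B \<ge> 0" "\<And>x. \<bar>f x\<bar> \<le> B"
proof -
  obtain K where K: "compact K" "K \<subseteq> \<Omega>" "\<And>x. x \<notin> K \<Longrightarrow> f x = 0"
    by (rule test_functions_support[OF assms(1)]) blast
  have "bounded (f ` K)"
    using K smooth_continuous[OF test_functions_smooth[OF assms]]
    by (intro compact_imp_bounded compact_continuous_image) auto
  then obtain B where B: "\<And>x. x \<in> K \<Longrightarrow> \<bar>f x\<bar> \<le> B" by (auto simp: bounded_iff)
  show ?thesis
  proof (rule that[of "\<bar>B\<bar>"])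
    show "\<bar>f x\<bar> \<le> \<bar>B\<bar>" for x
      using B[of x] K(3)[of x] by (cases "x \<in> K") force+
  qed simp
qed

lemma smooth_borel [measurable]: "smooth f \<Longrightarrow> f \<in> borel_measurable borel"
  using smooth_continuous borel_measurable_continuous_onI by blast

lemma test_functions_borel [measurable]: "f \<in> test_functions \<Omega> \<Longrightarrow> f \<in> borel_measurable borel"
  using test_functions_smooth smooth_borel by blast

lemma test_functions_integrable:
  assumes "f \<in> test_functions \<Omega>"
  shows "integrable lborel f"
proof -
  obtain K where K: "compact K" "K \<subseteq> \<Omega>" "\<And>x. x \<notin> K \<Longrightarrow> f x = 0"
    by (rule test_functions_support[OF assms(1)]) blast
  have "set_integrable lborel K f"
    unfolding set_integrable_def
    by (rule borel_integrable_compact[OF K(1) smooth_continuous[OF test_functions_smooth[OF assms]]])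
  moreover have "(\<lambda>x. indicator K x *\<^sub>R f x) = f"
    using K(3) by (auto simp: indicator_def fun_eq_iff)
  ultimately show ?thesis by (simp add: set_integrable_def)
qed

lemma test_functions_set_integral:
  assumes "f \<in> test_functions \<Omega>"
  shows "(LINT x:\<Omega>|lebesgue. f x) = (LINT x|lborel. f x)"
proof -
  have "(\<lambda>x. indicator \<Omega> x *\<^sub>R f x) = f"
    using test_functions_outside[OF assms] by (auto simp: indicator_def fun_eq_iff)
  then show ?thesis
    using test_functions_borel[OF assms] by (simp add: set_lebesgue_integral_def integral_completion)
qed

lemma smooth_line_derivative:
  assumes "smooth f"
  shows "((\<lambda>t. f (x + t *\<^sub>R axis i 1)) has_real_derivative partial i f (x + t *\<^sub>R axis i 1)) (at t)"
proof -
  let ?D = "frechet_derivative f (at (x + t *\<^sub>R axis i 1))"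
  have 1: "((\<lambda>t. x + t *\<^sub>R axis i 1) has_derivative (\<lambda>h. h *\<^sub>R axis i 1)) (at t)"
    by (auto intro!: derivative_eq_intros)
  have d: "(f has_derivative ?D) (at (x + t *\<^sub>R axis i 1))"
    using smooth_differentiable[OF assms] has_derivative_frechet by blast
  have "((\<lambda>t. f (x + t *\<^sub>R axis i 1)) has_derivative (\<lambda>h. ?D (h *\<^sub>R axis i 1))) (at t)"
    using has_derivative_compose[OF 1 d] .
  moreover have "?D (h *\<^sub>R axis i 1) = partial i f (x + t *\<^sub>R axis i 1) * h" for h
    using linear_cmul[OF has_derivative_linear[OF d]] by (simp add: partial_def)
  ultimately show ?thesis by (simp add: has_field_derivative_def)
qed

text \<open>The integral is invariant under translations, so the difference quotients have integral zero; they converge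
  under a common integrable bound.\<close>

lemma integral_partial_zero:
  assumes "f \<in> test_functions \<Omega>"
  shows "(LINT x|lborel. partial i f x) = 0"
proof -
  have sm: "smooth f" using assms test_functions_smooth by blast
  obtain K where K: "compact K" "K \<subseteq> \<Omega>" "\<And>x. x \<notin> K \<Longrightarrow> f x = 0"
    by (rule test_functions_support[OF assms(1)]) blast
  obtain B where B: "B \<ge> 0" "\<And>x. \<bar>partial i f x\<bar> \<le> B"
    by (rule test_functions_bounded[OF test_functions_partial[OF assms]]) blast
  obtain R where R: "R > 0" "K \<subseteq> ball 0 R"
    using compact_imp_bounded[OF K(1)] bounded_subset_ballD by blast
  let ?e = "axis i 1 :: real^3"
  let ?g = "\<lambda>n x. (f (x + (1 / Suc n) *\<^sub>R ?e) - f x) * Suc n"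
  have int: "integrable lborel (\<lambda>x. f (c + x))" "(LINT x|lborel. f (c + x)) = (LINT x|lborel. f x)" for c
  proof -
    show "integrable lborel (\<lambda>x. f (c + x))"
      using test_functions_integrable[OF assms] test_functions_borel[OF assms]
        integrable_distr_eq[of "(+) c" lborel borel f] by (simp add: lborel_distr_plus)
    show "(LINT x|lborel. f (c + x)) = (LINT x|lborel. f x)"
      using test_functions_borel[OF assms]
        integral_distr[of "(+) c" lborel borel f] by (simp add: lborel_distr_plus)
  qed
  have "(\<lambda>n. LINT x|lborel. ?g n x) \<longlonglongrightarrow> (LINT x|lborel. partial i f x)"
  proof (rule integral_dominated_convergence[where w = "\<lambda>x. B * indicator (ball 0 (R + 1)) x"])
    show "partial i f \<in> borel_measurable lborel"
      using smooth_borel[OF smooth_partial[OF sm]] by simp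
    have "(\<lambda>x. f (x + c)) \<in> borel_measurable borel" for c
      by (rule measurable_compose[OF _ smooth_borel[OF sm]]) simp
    then show "(\<lambda>x. ?g n x) \<in> borel_measurable lborel" for n
      using smooth_borel[OF sm] by simp
    show "integrable lborel (\<lambda>x. B * indicator (ball 0 (R + 1)) x)"
      by (intro integrable_mult_right integrable_real_indicator) (use emeasure_bounded_finite[OF bounded_ball] in auto)
    show "AE x in lborel. (\<lambda>n. ?g n x) \<longlonglongrightarrow> partial i f x"
    proof (rule AE_I2)
      fix x
      have "((\<lambda>h. (f (x + (0 + h) *\<^sub>R ?e) - f (x + 0 *\<^sub>R ?e)) / h) \<longlongrightarrow> partial i f (x + 0 *\<^sub>R ?e)) (at 0)"
        using smooth_line_derivative[OF sm, of x i 0] unfolding DERIV_def .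
      moreover have "filterlim (\<lambda>n. 1 / real (Suc n)) (at 0) sequentially"
        unfolding filterlim_at using LIMSEQ_Suc[OF lim_1_over_n] by auto
      ultimately have "(\<lambda>n. (f (x + (0 + 1 / real (Suc n)) *\<^sub>R ?e) - f (x + 0 *\<^sub>R ?e)) / (1 / real (Suc n))) \<longlonglongrightarrow> partial i f (x + 0 *\<^sub>R ?e)"
        by (rule filterlim_compose)
      then show "(\<lambda>n. ?g n x) \<longlonglongrightarrow> partial i f x" by simp
    qed
    show "AE x in lborel. norm (?g n x) \<le> B * indicator (ball 0 (R + 1)) x" for n
    proof (rule AE_I2)
      fix x
      let ?h = "1 / real (Suc n)"
      have h: "0 < ?h" "?h \<le> 1" by auto
      show "norm (?g n x) \<le> B * indicator (ball 0 (R + 1)) x"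
      proof (cases "x \<in> ball 0 (R + 1)")
        case True
        obtain t where "f (x + ?h *\<^sub>R ?e) - f (x + 0 *\<^sub>R ?e) = (?h - 0) * partial i f (x + t *\<^sub>R ?e)"
          using MVT2[OF h(1), of "\<lambda>t. f (x + t *\<^sub>R ?e)" "\<lambda>t. partial i f (x + t *\<^sub>R ?e)"]
            smooth_line_derivative[OF sm] by blast
        then have "?g n x = partial i f (x + t *\<^sub>R ?e)" by simp
        then show ?thesis using B True by simp
      next
        case False
        have 1: "norm (?h *\<^sub>R ?e) \<le> 1" using h by (simp add: norm_axis_1)
        have n1: "R + 1 \<le> norm (x + ?h *\<^sub>R ?e) + norm (?h *\<^sub>R ?e)"
          using False norm_triangle_ineq4[of "x + ?h *\<^sub>R ?e" "?h *\<^sub>R ?e"] by simp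
        have "R \<le> norm (x + ?h *\<^sub>R ?e)" "R \<le> norm x"
          subgoal using n1 1 by linarith
          subgoal using False by auto
          done
        then have "x + ?h *\<^sub>R ?e \<notin> K" "x \<notin> K" using R(2) by (meson mem_ball_0 not_less subsetD)+
        then show ?thesis using K(3) B(1) by simp
      qed
    qed
  qed
  moreover have "(LINT x|lborel. ?g n x) = 0" for n
    using int[of "(1 / real (Suc n)) *\<^sub>R ?e"] int[of 0] by (simp add: add.commute)
  ultimately have "(\<lambda>n. 0) \<longlonglongrightarrow> (LINT x|lborel. partial i f x)" by simp
  then show ?thesis by (simp add: LIMSEQ_const_iff)
qed

lemma cross3_component_derivative:
  "((\<lambda>x. (cross3 a x + b) $ j) has_derivative (\<lambda>h. cross3 a h $ j)) (at x)"
proof -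
  have "linear (\<lambda>h. cross3 a h $ j)"
    by (rule linearI) (auto simp: cross_add_right cross_mult_right)
  then have "((\<lambda>x. cross3 a x $ j) has_derivative (\<lambda>h. cross3 a h $ j)) (at x)"
    using linear_linear linear_imp_has_derivative by blast
  then show ?thesis by (simp add: has_derivative_add_const)
qed

lemma smooth_rigid: "smooth (\<lambda>x. (cross3 a x + b) $ j)"
proof -
  have "smooth (\<lambda>x. a $ k * x $ l - a $ l * x $ k + b $ j)" for k l
    by (intro smooth_add smooth_diff smooth_mult smooth_const smooth_proj)
  then show ?thesis
    using exhaust_3[of j] by (auto simp: cross3_def)
qed

lemma partial_rigid_skew:
  "partial i (\<lambda>x. (cross3 a x + b) $ j) x + partial j (\<lambda>x. (cross3 a x + b) $ i) x = 0"
proof -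
  have "\<forall>i j. cross3 a (axis i 1) $ j + cross3 a (axis j 1) $ i = 0"
    by (simp add: forall_3 cross3_def axis_def)
  then show ?thesis using partial_eqI[OF cross3_component_derivative] by metis
qed

text \<open>The divergence-like expression tested against a rigid displacement is a sum of pure
  derivatives, because the symmetrised gradient of the rigid displacement vanishes.\<close>

lemma rigid_partial_identity:
  assumes "smooth f"
  shows "(cross3 a x + b) $ j * partial i f x + (cross3 a x + b) $ i * partial j f x =
     partial i (\<lambda>x. f x * (cross3 a x + b) $ j) x + partial j (\<lambda>x. f x * (cross3 a x + b) $ i) x"
proof -
  note d = smooth_differentiable[OF assms] smooth_differentiable[OF smooth_rigid]
  have 1: "f x * partial i (\<lambda>x. (cross3 a x + b) $ j) x + f x * partial j (\<lambda>x. (cross3 a x + b) $ i) x = 0"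
    using partial_rigid_skew[of i a b j x] by (simp flip: distrib_left)
  show ?thesis
    unfolding partial_mult[OF d] using 1 by (simp add: algebra_simps)
qed

lemma E_distr_rigid:
  assumes "f \<in> test_functions \<Omega>"
  shows "E_distr \<Omega> (\<lambda>x. cross3 a x + b) i j f = 0"
proof -
  let ?F = "\<lambda>k x. f x * (cross3 a x + b) $ k"
  have t: "?F k \<in> test_functions \<Omega>" for k
    using test_functions_mult[OF assms smooth_rigid] .
  have p: "partial i (?F j) \<in> test_functions \<Omega>" "partial j (?F i) \<in> test_functions \<Omega>"
    using t test_functions_partial by blast+
  have q: "(\<lambda>x. (partial i (?F j) x + partial j (?F i) x) / 2) \<in> test_functions \<Omega>"
    using test_functions_cmult[OF test_functions_add[OF p], of "1 / 2"] by simp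
  have "E_distr \<Omega> (\<lambda>x. cross3 a x + b) i j f =
      - (LINT x:\<Omega>|lebesgue. (partial i (?F j) x + partial j (?F i) x) / 2)"
    unfolding E_distr_def using rigid_partial_identity[OF test_functions_smooth[OF assms], of a _ b j i]
    by (simp add: mult.commute)
  also have "\<dots> = - (LINT x|lborel. (partial i (?F j) x + partial j (?F i) x) / 2)"
    using test_functions_set_integral[OF q] by simp
  also have "\<dots> = 0"
    using integral_partial_zero[OF t] test_functions_integrable[OF p(1)] test_functions_integrable[OF p(2)]
    by simp
  finally show ?thesis .
qed

subsection \<open>Smooth approximation of indicator functions\<close>

definition box_bump :: "(real^3) \<times> (real^3) \<Rightarrow> real^3 \<Rightarrow> real" where
  "box_bump c x = flat_exp 0 (x$1 - fst c$1) * flat_exp 0 (snd c$1 - x$1) *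
     (flat_exp 0 (x$2 - fst c$2) * flat_exp 0 (snd c$2 - x$2) *
     (flat_exp 0 (x$3 - fst c$3) * flat_exp 0 (snd c$3 - x$3)))"

lemma smooth_box_bump: "smooth (box_bump c)"
  unfolding box_bump_def[abs_def]
  by (intro smooth_mult smooth_flat_exp smooth_diff smooth_const smooth_proj)

lemma box_bump_nonneg: "0 \<le> box_bump c x"
  unfolding box_bump_def by (intro mult_nonneg_nonneg flat_exp_nonneg)

lemma box_bump_pos: "x \<in> box (fst c) (snd c) \<Longrightarrow> 0 < box_bump c x"
  unfolding box_bump_def by (intro mult_pos_pos flat_exp_pos) (auto simp: mem_box_cart)

lemma box_bump_zero:
  assumes "x \<notin> box (fst c) (snd c)"
  shows "box_bump c x = 0"
proof -
  obtain i where "x $ i - fst c $ i \<le> 0 \<or> snd c $ i - x $ i \<le> 0"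
    using assms by (auto simp: mem_box_cart not_less)
  then show ?thesis using exhaust_3[of i] unfolding box_bump_def by (auto simp: flat_exp_zero)
qed

text \<open>A sum of bumps, positive exactly on a union of open boxes, is saturated to a smooth function with values in
  \<open>[0, 1]\<close> that tends to the indicator of the union.\<close>

definition box_approx :: "((real^3) \<times> (real^3)) set \<Rightarrow> nat \<Rightarrow> real^3 \<Rightarrow> real" where
  "box_approx C n x = 1 - exp (- (real n * (\<Sum>c\<in>C. box_bump c x)))"

lemma box_approx_bounds: "0 \<le> box_approx C n x" "box_approx C n x \<le> 1"
  unfolding box_approx_def by (auto intro!: mult_nonneg_nonneg sum_nonneg box_bump_nonneg)

lemma exp_saturation: "0 < s \<Longrightarrow> (\<lambda>n. 1 - exp (- (real n * s))) \<longlonglongrightarrow> 1"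
  by real_asymp

lemma box_approx_tendsto:
  assumes "finite C"
  shows "(\<lambda>n. box_approx C n x) \<longlonglongrightarrow> indicator (\<Union>c\<in>C. box (fst c) (snd c)) x"
proof (cases "x \<in> (\<Union>c\<in>C. box (fst c) (snd c))")
  case True
  then obtain c where c: "c \<in> C" "x \<in> box (fst c) (snd c)" by auto
  let ?s = "\<Sum>c\<in>C. box_bump c x"
  have "?s > 0"
    using c assms by (intro sum_pos2[of C c]) (auto intro: box_bump_pos box_bump_nonneg)
  then have "(\<lambda>n. 1 - exp (- (real n * ?s))) \<longlonglongrightarrow> 1"
    by (rule exp_saturation)
  then show ?thesis using True by (simp add: box_approx_def)
next
  case False
  then have "(\<Sum>c\<in>C. box_bump c x) = 0" by (intro sum.neutral) (auto intro: box_bump_zero)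
  then show ?thesis using False by (simp add: box_approx_def)
qed

lemma box_approx_test:
  assumes "finite C" "\<And>c. c \<in> C \<Longrightarrow> cbox (fst c) (snd c) \<subseteq> \<Omega>"
  shows "box_approx C n \<in> test_functions \<Omega>"
proof (rule test_functionsI)
  show "smooth (box_approx C n)"
    unfolding box_approx_def[abs_def]
    by (intro smooth_diff smooth_const smooth_exp smooth_minus smooth_mult smooth_sum smooth_box_bump)
  show "compact (\<Union>c\<in>C. cbox (fst c) (snd c))" "(\<Union>c\<in>C. cbox (fst c) (snd c)) \<subseteq> \<Omega>"
    using assms by (auto intro!: compact_UN)
  show "box_approx C n x = 0" if "x \<notin> (\<Union>c\<in>C. cbox (fst c) (snd c))" for x
  proof -
    have "(\<Sum>c\<in>C. box_bump c x) = 0"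
      using that box_subset_cbox by (intro sum.neutral) (auto intro!: box_bump_zero)
    then show ?thesis by (simp add: box_approx_def)
  qed
qed

text \<open>With regularity of measures, this reduces statements about measurable sets to finite unions of boxes.\<close>

lemma compact_box_cover:
  fixes K G :: "(real^3) set"
  assumes "compact K" "open G" "K \<subseteq> G"
  obtains C where "finite C" "K \<subseteq> (\<Union>c\<in>C. box (fst c) (snd c))" "\<And>c. c \<in> C \<Longrightarrow> cbox (fst c) (snd c) \<subseteq> G"
proof -
  let ?B = "{c. cbox (fst c) (snd c) \<subseteq> G}"
  have cov: "K \<subseteq> (\<Union>c\<in>?B. box (fst c) (snd c))"
  proof
    fix x assume "x \<in> K"
    then obtain a b where "x \<in> box a b" "cbox a b \<subseteq> G"
      by (meson open_contains_cbox[OF assms(2)] assms(3) subsetD)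
    then show "x \<in> (\<Union>c\<in>?B. box (fst c) (snd c))" by (intro UN_I[of "(a, b)"]) auto
  qed
  obtain C where "C \<subseteq> ?B" "finite C" "K \<subseteq> (\<Union>c\<in>C. box (fst c) (snd c))"
    by (rule compactE_image[OF assms(1) _ cov]) auto
  then show ?thesis using that by blast
qed

definition L2_approximable :: "(real^3) set \<Rightarrow> (real^3 \<Rightarrow> real) \<Rightarrow> bool" where
  "L2_approximable \<Omega> w \<longleftrightarrow> (\<forall>\<delta>>0. \<exists>f\<in>test_functions \<Omega>.
     integrable (lebesgue_on \<Omega>) (\<lambda>x. (w x - f x)\<^sup>2) \<and> (LINT x|lebesgue_on \<Omega>. (w x - f x)\<^sup>2) < \<delta>)"

lemma square_sum_bound: "(a + b :: real)\<^sup>2 \<le> 2 * a\<^sup>2 + 2 * b\<^sup>2"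
  using zero_le_power2[of "a - b"] by (simp add: power2_sum power2_diff)

lemma test_functions_lebesgue_on_measurable:
  "f \<in> test_functions \<Omega> \<Longrightarrow> f \<in> borel_measurable (lebesgue_on \<Omega>)"
  by (intro measurable_restrict_space1 measurable_completion) (use test_functions_borel in simp)

lemma L2_approximable_limit:
  assumes "\<And>\<delta>. \<delta> > 0 \<Longrightarrow> \<exists>v. L2_approximable \<Omega> v \<and> v \<in> borel_measurable (lebesgue_on \<Omega>) \<and>
       integrable (lebesgue_on \<Omega>) (\<lambda>x. (w x - v x)\<^sup>2) \<and> (LINT x|lebesgue_on \<Omega>. (w x - v x)\<^sup>2) < \<delta>"
    and [measurable]: "w \<in> borel_measurable (lebesgue_on \<Omega>)"
  shows "L2_approximable \<Omega> w"
  unfolding L2_approximable_def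
proof (intro allI impI)
  fix \<delta> :: real assume "\<delta> > 0"
  then have d: "\<delta> / 4 > 0" by simp
  obtain v where v: "L2_approximable \<Omega> v" "integrable (lebesgue_on \<Omega>) (\<lambda>x. (w x - v x)\<^sup>2)"
      "(LINT x|lebesgue_on \<Omega>. (w x - v x)\<^sup>2) < \<delta> / 4"
    and [measurable]: "v \<in> borel_measurable (lebesgue_on \<Omega>)" using assms(1)[OF d] by blast
  obtain f where f: "f \<in> test_functions \<Omega>" "integrable (lebesgue_on \<Omega>) (\<lambda>x. (v x - f x)\<^sup>2)"
     "(LINT x|lebesgue_on \<Omega>. (v x - f x)\<^sup>2) < \<delta> / 4"
    using v(1) d unfolding L2_approximable_def by blast
  have [measurable]: "f \<in> borel_measurable (lebesgue_on \<Omega>)"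
    using f(1) test_functions_lebesgue_on_measurable by blast
  have b: "(w x - f x)\<^sup>2 \<le> 2 * (w x - v x)\<^sup>2 + 2 * (v x - f x)\<^sup>2" for x
    using square_sum_bound[of "w x - v x" "v x - f x"] by simp
  have i: "integrable (lebesgue_on \<Omega>) (\<lambda>x. 2 * (w x - v x)\<^sup>2 + 2 * (v x - f x)\<^sup>2)"
    using v(2) f(2) by simp
  have i2: "integrable (lebesgue_on \<Omega>) (\<lambda>x. (w x - f x)\<^sup>2)"
    by (rule Bochner_Integration.integrable_bound[OF i]) (use b in auto)
  have "(LINT x|lebesgue_on \<Omega>. (w x - f x)\<^sup>2) \<le> (LINT x|lebesgue_on \<Omega>. 2 * (w x - v x)\<^sup>2 + 2 * (v x - f x)\<^sup>2)"
    using i i2 b by (intro integral_mono) auto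
  also have "\<dots> < \<delta>" using v(2,3) f(2,3) by simp
  finally show "\<exists>f\<in>test_functions \<Omega>. integrable (lebesgue_on \<Omega>) (\<lambda>x. (w x - f x)\<^sup>2) \<and>
      (LINT x|lebesgue_on \<Omega>. (w x - f x)\<^sup>2) < \<delta>" using f(1) i2 by blast
qed

text \<open>By regularity the set lies between a compact and an open set of nearly the same measure, and finitely many
  boxes fit in between.\<close>

lemma L2_approximable_indicator:
  assumes "open \<Omega>" "bounded \<Omega>" "A \<in> sets lebesgue" "A \<subseteq> \<Omega>"
  shows "L2_approximable \<Omega> (indicator A)"
  unfolding L2_approximable_def
proof (intro allI impI)
  fix \<delta> :: real assume d: "\<delta> > 0"
  have \<Omega>: "\<Omega> \<in> lmeasurable" using assms(1,2) lmeasurable_open by blast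
  obtain G where G: "open G" "A \<subseteq> G" "G - A \<in> lmeasurable" "emeasure lebesgue (G - A) < ennreal (\<delta> / 2)"
    by (rule sets_lebesgue_outer_open[OF assms(3), of "\<delta> / 2"]) (use d in auto)
  obtain K where K: "closed K" "K \<subseteq> A" "A - K \<in> lmeasurable" "emeasure lebesgue (A - K) < ennreal (\<delta> / 2)"
    by (rule sets_lebesgue_inner_closed[OF assms(3), of "\<delta> / 2"]) (use d in auto)
  have Kc: "compact K"
    using K assms by (metis bounded_subset compact_eq_bounded_closed)
  have m2: "measure lebesgue (G - A) < \<delta> / 2" "measure lebesgue (A - K) < \<delta> / 2"
    using G(3,4) K(3,4) d by (auto simp: emeasure_eq_measure2 ennreal_less_iff)
  obtain C where C: "finite C" "K \<subseteq> (\<Union>c\<in>C. box (fst c) (snd c))" "\<And>c. c \<in> C \<Longrightarrow> cbox (fst c) (snd c) \<subseteq> G \<inter> \<Omega>"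
    by (rule compact_box_cover[of K "G \<inter> \<Omega>"]) (use Kc K G assms in auto)
  let ?U = "\<Union>c\<in>C. box (fst c) (snd c)"
  have U: "?U \<subseteq> G \<inter> \<Omega>" using C(3) box_subset_cbox by blast
  let ?M = "lebesgue_on \<Omega>"
  interpret finite_measure ?M
    using \<Omega> by (intro finite_measure_lebesgue_on)
  have [measurable]: "A \<in> sets ?M" using assms \<Omega> by (simp add: sets_restrict_space_iff fmeasurableD)
  have Ul: "?U \<in> sets lebesgue" by (auto intro: sets.finite_UN C)
  have [measurable]: "?U \<in> sets ?M"
    using U Ul \<Omega> by (auto simp: sets_restrict_space_iff fmeasurableD)
  have t: "box_approx C n \<in> test_functions \<Omega>" for n using box_approx_test[OF C(1)] C(3) by blast
  note [measurable] = test_functions_lebesgue_on_measurable[OF t]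
  have b: "\<bar>(indicator A x - box_approx C n x)\<^sup>2\<bar> \<le> 1" for n and x
    using box_approx_bounds[of C n x] by (auto simp: abs_square_le_1 indicator_def split: if_splits)
  have "(\<lambda>n. LINT x|?M. (indicator A x - box_approx C n x)\<^sup>2) \<longlonglongrightarrow>
      (LINT x|?M. (indicator A x - indicator ?U x)\<^sup>2)"
    by (rule integral_dominated_convergence[where w = "\<lambda>x. 1"])
       (use b in \<open>auto intro!: tendsto_intros box_approx_tendsto C(1)\<close>)
  moreover have "(LINT x|?M. (indicator A x - indicator ?U x :: real)\<^sup>2) < \<delta>"
  proof -
    have GK: "(G - K) \<inter> \<Omega> \<in> sets ?M"
      using G K \<Omega> by (auto simp: sets_restrict_space_iff fmeasurableD)
    have i1: "integrable ?M (\<lambda>x. (indicator A x - indicator ?U x :: real)\<^sup>2)"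
    proof (rule integrable_const_bound[where B = 1])
      show "(\<lambda>x. (indicator A x - indicator ?U x :: real)\<^sup>2) \<in> borel_measurable ?M" by measurable
    qed (auto simp: indicator_def)
    have i2: "integrable ?M (\<lambda>x. indicator ((G - K) \<inter> \<Omega>) x :: real)"
      using GK by (intro integrable_real_indicator) (simp_all add: less_top[symmetric])
    have "(LINT x|?M. (indicator A x - indicator ?U x)\<^sup>2) \<le> (LINT x|?M. (indicator ((G - K) \<inter> \<Omega>) x :: real))"
      using K(2) C(2) G(2) U assms(4)
      by (intro integral_mono i1 i2) (auto simp: indicator_def)
    also have "\<dots> = measure ?M ((G - K) \<inter> \<Omega>)"
      using GK by simp
    also have "\<dots> = measure lebesgue ((G - K) \<inter> \<Omega>)"
      using \<Omega> by (intro measure_restrict_space) (auto simp: fmeasurableD)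
    also have "\<dots> \<le> measure lebesgue ((G - A) \<union> (A - K))"
      using G K \<Omega> by (intro measure_mono_fmeasurable) (auto simp: fmeasurableD fmeasurable.Un)
    also have "\<dots> \<le> measure lebesgue (G - A) + measure lebesgue (A - K)"
      using G K by (intro measure_Un_le) (auto simp: fmeasurableD)
    finally show ?thesis using m2 by simp
  qed
  ultimately have "\<forall>\<^sub>F n in sequentially. (LINT x|?M. (indicator A x - box_approx C n x)\<^sup>2) < \<delta>"
    by (rule order_tendstoD)
  then obtain n where "(LINT x|?M. (indicator A x - box_approx C n x)\<^sup>2) < \<delta>"
    using eventually_happens' sequentially_bot by blast
  moreover have "integrable ?M (\<lambda>x. (indicator A x - box_approx C n x)\<^sup>2)"
    using b by (intro integrable_const_bound[where B = 1]) auto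
  ultimately show "\<exists>f\<in>test_functions \<Omega>. integrable ?M (\<lambda>x. (indicator A x - f x)\<^sup>2) \<and>
      (LINT x|?M. (indicator A x - f x)\<^sup>2) < \<delta>" using t by blast
qed

lemma L2_approximable_add:
  assumes "L2_approximable \<Omega> v" "L2_approximable \<Omega> w"
    and [measurable]: "v \<in> borel_measurable (lebesgue_on \<Omega>)" "w \<in> borel_measurable (lebesgue_on \<Omega>)"
  shows "L2_approximable \<Omega> (\<lambda>x. v x + w x)"
  unfolding L2_approximable_def
proof (intro allI impI)
  fix \<delta> :: real assume "\<delta> > 0"
  then have d: "\<delta> / 4 > 0" by simp
  obtain f where f: "f \<in> test_functions \<Omega>" "integrable (lebesgue_on \<Omega>) (\<lambda>x. (v x - f x)\<^sup>2)"
     "(LINT x|lebesgue_on \<Omega>. (v x - f x)\<^sup>2) < \<delta> / 4"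
    using assms(1) d unfolding L2_approximable_def by blast
  obtain g where g: "g \<in> test_functions \<Omega>" "integrable (lebesgue_on \<Omega>) (\<lambda>x. (w x - g x)\<^sup>2)"
     "(LINT x|lebesgue_on \<Omega>. (w x - g x)\<^sup>2) < \<delta> / 4"
    using assms(2) d unfolding L2_approximable_def by blast
  note [measurable] = test_functions_lebesgue_on_measurable[OF f(1)] test_functions_lebesgue_on_measurable[OF g(1)]
  have b: "(v x + w x - (f x + g x))\<^sup>2 \<le> 2 * (v x - f x)\<^sup>2 + 2 * (w x - g x)\<^sup>2" for x
    using square_sum_bound[of "v x - f x" "w x - g x"] by (simp add: algebra_simps)
  have i: "integrable (lebesgue_on \<Omega>) (\<lambda>x. 2 * (v x - f x)\<^sup>2 + 2 * (w x - g x)\<^sup>2)"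
    using f(2) g(2) by simp
  have i2: "integrable (lebesgue_on \<Omega>) (\<lambda>x. (v x + w x - (f x + g x))\<^sup>2)"
    by (rule Bochner_Integration.integrable_bound[OF i]) (use b in auto)
  have "(LINT x|lebesgue_on \<Omega>. (v x + w x - (f x + g x))\<^sup>2) \<le> (LINT x|lebesgue_on \<Omega>. 2 * (v x - f x)\<^sup>2 + 2 * (w x - g x)\<^sup>2)"
    using i i2 b by (intro integral_mono) auto
  also have "\<dots> < \<delta>" using f(2,3) g(2,3) by simp
  finally show "\<exists>f\<in>test_functions \<Omega>. integrable (lebesgue_on \<Omega>) (\<lambda>x. (v x + w x - f x)\<^sup>2) \<and>
      (LINT x|lebesgue_on \<Omega>. (v x + w x - f x)\<^sup>2) < \<delta>"
    using test_functions_add[OF f(1) g(1)] i2 by (intro bexI[of _ "\<lambda>x. f x + g x"]) auto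
qed

lemma L2_approximable_cmult:
  assumes "L2_approximable \<Omega> w"
  shows "L2_approximable \<Omega> (\<lambda>x. c * w x)"
  unfolding L2_approximable_def
proof (intro allI impI)
  fix \<delta> :: real assume "\<delta> > 0"
  then have d: "\<delta> / (1 + c\<^sup>2) > 0" by (simp add: add_pos_nonneg)
  obtain f where f: "f \<in> test_functions \<Omega>" "integrable (lebesgue_on \<Omega>) (\<lambda>x. (w x - f x)\<^sup>2)"
     "(LINT x|lebesgue_on \<Omega>. (w x - f x)\<^sup>2) < \<delta> / (1 + c\<^sup>2)"
    using assms(1) d unfolding L2_approximable_def by blast
  have e: "(c * w x - c * f x)\<^sup>2 = c\<^sup>2 * (w x - f x)\<^sup>2" for x
    by (simp add: power_mult_distrib flip: right_diff_distrib)
  have "(1 + c\<^sup>2) * (LINT x|lebesgue_on \<Omega>. (w x - f x)\<^sup>2) < \<delta>"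
    using f(3) by (simp add: field_simps add_pos_nonneg)
  moreover have "0 \<le> (LINT x|lebesgue_on \<Omega>. (w x - f x)\<^sup>2)" by simp
  ultimately have "c\<^sup>2 * (LINT x|lebesgue_on \<Omega>. (w x - f x)\<^sup>2) < \<delta>"
    by (simp only: distrib_right)
  then show "\<exists>f\<in>test_functions \<Omega>. integrable (lebesgue_on \<Omega>) (\<lambda>x. (c * w x - f x)\<^sup>2) \<and>
      (LINT x|lebesgue_on \<Omega>. (c * w x - f x)\<^sup>2) < \<delta>"
    using test_functions_cmult[OF f(1), of c] f(2) by (intro bexI[of _ "\<lambda>x. c * f x"]) (auto simp: e)
qed

lemma L2_approximable_zero: "L2_approximable \<Omega> (\<lambda>x. 0)"
  unfolding L2_approximable_def using test_functions_zero[of \<Omega>]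
  by (auto intro!: bexI[of _ "\<lambda>x. 0"])

theorem test_functions_dense_L2:
  assumes "open \<Omega>" "bounded \<Omega>"
    and [measurable]: "w \<in> borel_measurable (lebesgue_on \<Omega>)"
    and int: "integrable (lebesgue_on \<Omega>) (\<lambda>x. (w x)\<^sup>2)"
  shows "L2_approximable \<Omega> w"
proof -
  let ?M = "lebesgue_on \<Omega>"
  have \<Omega>: "\<Omega> \<in> lmeasurable" using assms(1,2) lmeasurable_open by blast
  interpret finite_measure ?M
    using \<Omega> by (intro finite_measure_lebesgue_on)
  obtain s where s: "\<And>i. simple_function ?M (s i)" "\<And>x. x \<in> space ?M \<Longrightarrow> (\<lambda>i. s i x) \<longlonglongrightarrow> w x"
     "\<And>i x. x \<in> space ?M \<Longrightarrow> dist (s i x) 0 \<le> 2 * dist (w x) 0"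
    using borel_measurable_implies_sequence_metric[OF assms(3), of 0] by blast
  have [measurable]: "s i \<in> borel_measurable ?M" for i using s(1) borel_measurable_simple_function by blast
  have sapx: "L2_approximable \<Omega> (s i)" for i
  proof -
    let ?r = "\<lambda>x. \<Sum>y\<in>s i ` space ?M. y * indicator (s i -` {y} \<inter> space ?M) x"
    have fin: "finite (s i ` space ?M)" using s(1) simple_functionD(1) by blast
    have m: "(s i -` {y} \<inter> space ?M) \<in> sets ?M" for y using s(1)[of i] simple_functionD(2) by blast
    have "F \<subseteq> s i ` space ?M \<Longrightarrow> L2_approximable \<Omega> (\<lambda>x. \<Sum>y\<in>F. y * indicator (s i -` {y} \<inter> space ?M) x)" if "finite F" for F
      using that
    proof (induction F rule: finite_induct)
      case empty
      then show ?case by (simp add: L2_approximable_zero)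
    next
      case (insert y F)
      have "(s i -` {y} \<inter> space ?M) \<in> sets lebesgue \<and> (s i -` {y} \<inter> space ?M) \<subseteq> \<Omega>"
        using m[of y] \<Omega> by (auto simp: sets_restrict_space_iff fmeasurableD)
      then have "L2_approximable \<Omega> (\<lambda>x. y * indicator (s i -` {y} \<inter> space ?M) x)"
        using L2_approximable_indicator[OF assms(1,2)] by (intro L2_approximable_cmult) auto
      moreover have "(\<lambda>x. y * indicator (s i -` {y} \<inter> space ?M) x) \<in> borel_measurable ?M"
         "(\<lambda>x. \<Sum>y\<in>F. y * indicator (s i -` {y} \<inter> space ?M) x) \<in> borel_measurable ?M"
        using m by measurable
      ultimately have "L2_approximable \<Omega> (\<lambda>x. y * indicator (s i -` {y} \<inter> space ?M) x +
          (\<Sum>y\<in>F. y * indicator (s i -` {y} \<inter> space ?M) x))"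
        using insert by (intro L2_approximable_add) auto
      then show ?case by (simp only: sum.insert[OF insert(1,2)])
    qed
    from this[OF fin] have r: "L2_approximable \<Omega> ?r" by simp
    have eq: "s i x = ?r x" if "x \<in> space ?M" for x
      using simple_function_indicator_representation_banach[OF s(1) that]
      by (simp only: real_scaleR_def mult.commute)
    have "integrable ?M (\<lambda>x. (s i x - f x)\<^sup>2) = integrable ?M (\<lambda>x. (?r x - f x)\<^sup>2)" for f
      by (rule Bochner_Integration.integrable_cong[OF refl]) (simp only: eq)
    moreover have "(LINT x|?M. (s i x - f x)\<^sup>2) = (LINT x|?M. (?r x - f x)\<^sup>2)" for f
      by (rule Bochner_Integration.integral_cong[OF refl]) (simp only: eq)
    ultimately show ?thesis using r unfolding L2_approximable_def by simp
  qed
  have b: "(w x - s i x)\<^sup>2 \<le> 9 * (w x)\<^sup>2" if "x \<in> space ?M" for x i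
  proof -
    have "\<bar>w x - s i x\<bar> \<le> 3 * \<bar>w x\<bar>" using s(3)[OF that, of i] by (auto simp: dist_real_def)
    from power_mono[OF this, of 2] show ?thesis by (simp add: power_mult_distrib)
  qed
  have i: "integrable ?M (\<lambda>x. (w x - s i x)\<^sup>2)" for i
    by (rule Bochner_Integration.integrable_bound[of _ "\<lambda>x. 9 * (w x)\<^sup>2"]) (use int b in \<open>auto intro!: AE_I2\<close>)
  have "(\<lambda>i. LINT x|?M. (w x - s i x)\<^sup>2) \<longlonglongrightarrow> (LINT x|?M. 0)"
  proof (rule integral_dominated_convergence[where w = "\<lambda>x. 9 * (w x)\<^sup>2"])
    show "AE x in ?M. (\<lambda>i. (w x - s i x)\<^sup>2) \<longlonglongrightarrow> 0"
    proof (rule AE_I2)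
      fix x assume "x \<in> space ?M"
      from s(2)[OF this] have "(\<lambda>i. (w x - s i x)\<^sup>2) \<longlonglongrightarrow> (w x - w x)\<^sup>2"
        by (intro tendsto_intros)
      then show "(\<lambda>i. (w x - s i x)\<^sup>2) \<longlonglongrightarrow> 0" by simp
    qed
  qed (use b int in \<open>auto intro!: AE_I2\<close>)
  then have lim: "(\<lambda>i. LINT x|?M. (w x - s i x)\<^sup>2) \<longlonglongrightarrow> 0" by simp
  show ?thesis
  proof (rule L2_approximable_limit)
    fix \<delta> :: real assume "\<delta> > 0"
    from order_tendstoD(2)[OF lim this] obtain i where "(LINT x|?M. (w x - s i x)\<^sup>2) < \<delta>"
      using eventually_happens' sequentially_bot by blast
    then show "\<exists>v. L2_approximable \<Omega> v \<and> v \<in> borel_measurable ?M \<and> integrable ?M (\<lambda>x. (w x - v x)\<^sup>2) \<and>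
        (LINT x|?M. (w x - v x)\<^sup>2) < \<delta>" using i sapx by (intro exI[of _ "s i"]) auto
  qed simp
qed

section \<open>Hausdorff measure is a Borel measure\<close>

abbreviation "premeasure \<equiv> hausdorff2_premeasure"

abbreviation "outer \<equiv> hausdorff2_outer"

definition covers :: "real \<Rightarrow> 'a::metric_space set \<Rightarrow> (nat \<Rightarrow> 'a set) set" where
  "covers \<delta> A = {U. A \<subseteq> (\<Union>n. U n) \<and> (\<forall>n. bounded (U n) \<and> diameter (U n) \<le> \<delta>)}"

definition gauge :: "'a::metric_space set \<Rightarrow> ennreal" where
  "gauge V = ennreal (pi * (diameter V / 2)\<^sup>2)"

lemma premeasure_alt: "premeasure \<delta> A = (INF U\<in>covers \<delta> A. \<Sum>n. gauge (U n))"
  unfolding hausdorff2_premeasure_def covers_def gauge_def ..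

lemma premeasure_upper: "U \<in> covers \<delta> A \<Longrightarrow> premeasure \<delta> A \<le> (\<Sum>n. gauge (U n))"
  unfolding premeasure_alt by (rule INF_lower)

lemma premeasure_lower:
  "(\<And>U. U \<in> covers \<delta> A \<Longrightarrow> c \<le> (\<Sum>n. gauge (U n))) \<Longrightarrow> c \<le> premeasure \<delta> A"
  unfolding premeasure_alt by (rule INF_greatest)

lemma premeasure_mono: "A \<subseteq> B \<Longrightarrow> premeasure \<delta> A \<le> premeasure \<delta> B"
  by (rule premeasure_lower, rule premeasure_upper) (auto simp: covers_def)

lemma premeasure_antimono:
  "\<delta> \<le> \<delta>' \<Longrightarrow> premeasure \<delta>' A \<le> premeasure \<delta> A"
  by (rule premeasure_lower, rule premeasure_upper) (auto simp: covers_def intro: order_trans)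

lemma premeasure_empty: "\<delta> > 0 \<Longrightarrow> premeasure \<delta> {} = 0"
  using premeasure_upper[of "\<lambda>n. {}" \<delta> "{}"] by (simp add: covers_def gauge_def)

text \<open>Covers of the single sets that are optimal up to a geometric series are joined into one sequence by a pairing
  function.\<close>

lemma premeasure_countably_subadditive:
  "premeasure \<delta> (\<Union>i. A i) \<le> (\<Sum>i. premeasure \<delta> (A i))"
proof (rule ennreal_le_epsilon)
  fix e :: real
  assume fin: "(\<Sum>i. premeasure \<delta> (A i)) < top" and e: "0 < e"
  have fi: "premeasure \<delta> (A i) < \<infinity>" for i
    using fin ennreal_suminf_lessD by (metis infinity_ennreal_def)
  have "\<exists>U\<in>covers \<delta> (A i). (\<Sum>n. gauge (U n)) \<le> premeasure \<delta> (A i) + ennreal (e * (1/2) ^ Suc i)" for i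
  proof -
    have "premeasure \<delta> (A i) < premeasure \<delta> (A i) + ennreal (e * (1/2) ^ Suc i)"
      using fi[of i] e by (cases "premeasure \<delta> (A i)") (auto simp flip: ennreal_plus intro!: ennreal_lessI add_nonneg_pos)
    then show ?thesis
      unfolding premeasure_alt[of \<delta> "A i"] INF_less_iff by (auto intro: less_imp_le)
  qed
  then obtain U where U: "\<And>i. U i \<in> covers \<delta> (A i)"
     "\<And>i. (\<Sum>n. gauge (U i n)) \<le> premeasure \<delta> (A i) + ennreal (e * (1/2) ^ Suc i)"
    by metis
  let ?V = "\<lambda>k. case prod_decode k of (i, n) \<Rightarrow> U i n"
  have "?V \<in> covers \<delta> (\<Union>i. A i)"
  proof -
    have "\<exists>k. x \<in> ?V k" if x: "x \<in> A i" for x i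
    proof -
      obtain n where "x \<in> U i n" using U(1)[of i] x by (auto simp: covers_def)
      then have "x \<in> ?V (prod_encode (i, n))" by simp
      then show ?thesis by (rule exI[of _ "prod_encode (i, n)"])
    qed
    moreover have "bounded (?V k) \<and> diameter (?V k) \<le> \<delta>" for k
      using U(1) by (auto simp: covers_def split: prod.split)
    ultimately show ?thesis by (auto simp: covers_def)
  qed
  then have "premeasure \<delta> (\<Union>i. A i) \<le> (\<Sum>k. gauge (?V k))"
    by (rule premeasure_upper)
  also have "\<dots> = (\<Sum>k. (\<lambda>(i, n). gauge (U i n)) (prod_decode k))"
    by (intro suminf_cong) (auto split: prod.split)
  also have "\<dots> = (\<Sum>i. \<Sum>n. gauge (U i n))"
    by (rule suminf_ennreal_2dimen) simp
  also have "\<dots> \<le> (\<Sum>i. premeasure \<delta> (A i) + ennreal (e * (1/2) ^ Suc i))"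
    by (intro suminf_le U(2)) auto
  also have "\<dots> = (\<Sum>i. premeasure \<delta> (A i)) + (\<Sum>i. ennreal (e * (1/2) ^ Suc i))"
    by (intro suminf_add[symmetric]) auto
  also have "(\<Sum>i. ennreal (e * (1/2) ^ Suc i)) = ennreal e"
  proof -
    have "(\<lambda>i. e * (1/2) ^ Suc i) sums (e * 1)"
      by (intro sums_mult power_half_series)
    then show ?thesis using e by (intro suminf_ennreal_eq) auto
  qed
  finally show "premeasure \<delta> (\<Union>i. A i) \<le> (\<Sum>i. premeasure \<delta> (A i)) + ennreal e" .
qed

lemma premeasure_le_outer: "\<delta> > 0 \<Longrightarrow> premeasure \<delta> A \<le> outer A"
  unfolding hausdorff2_outer_def by (rule SUP_upper) auto

lemma outer_least:
  "(\<And>\<delta>. \<delta> > 0 \<Longrightarrow> premeasure \<delta> A \<le> c) \<Longrightarrow> outer A \<le> c"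
  unfolding hausdorff2_outer_def by (rule SUP_least) auto

lemma outer_mono: "A \<subseteq> B \<Longrightarrow> outer A \<le> outer B"
  by (rule outer_least) (meson premeasure_mono premeasure_le_outer order_trans)

lemma outer_empty: "outer {} = 0"
  using outer_least[of "{}" 0] premeasure_empty by fastforce

lemma outer_countably_subadditive: "outer (\<Union>i. A i) \<le> (\<Sum>i. outer (A i))"
proof (rule outer_least)
  fix \<delta> :: real assume "\<delta> > 0"
  then show "premeasure \<delta> (\<Union>i. A i) \<le> (\<Sum>i. outer (A i))"
    by (intro order_trans[OF premeasure_countably_subadditive] suminf_le premeasure_le_outer) auto
qed

lemma outer_measure_space_hausdorff: "outer_measure_space UNIV outer"
  unfolding outer_measure_space_def positive_def increasing_def countably_subadditive_def
  by (auto simp: outer_empty intro: outer_mono outer_countably_subadditive)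

lemma outer_subadditive: "outer (A \<union> B) \<le> outer A + outer B"
proof -
  have "subadditive UNIV outer"
    using outer_measure_space_hausdorff ring_of_sets.countably_subadditive_subadditive[of UNIV UNIV outer]
    by (auto simp: outer_measure_space_def ring_of_sets_iff)
  then have "outer (A \<union> (B - A)) \<le> outer A + outer (B - A)"
    unfolding subadditive_def by blast
  also have "\<dots> \<le> outer A + outer B"
    by (intro add_left_mono outer_mono) auto
  finally show ?thesis by simp
qed

text \<open>No set of diameter at most \<open>\<delta>\<close> meets both \<open>A\<close> and \<open>B\<close>, so every cover splits into two.\<close>

lemma premeasure_separated:
  assumes "\<delta> > 0" "\<delta> < d" and sep: "\<And>x y. x \<in> A \<Longrightarrow> y \<in> B \<Longrightarrow> d \<le> dist x y"
  shows "premeasure \<delta> A + premeasure \<delta> B \<le> premeasure \<delta> (A \<union> B)"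
proof (rule premeasure_lower)
  fix U assume U: "U \<in> covers \<delta> (A \<union> B)"
  let ?U = "\<lambda>S n. if U n \<inter> S = {} then {} else U n"
  have cov: "?U S \<in> covers \<delta> S" if "S \<subseteq> A \<union> B" for S
  proof -
    have "x \<in> (\<Union>n. ?U S n)" if "x \<in> S" for x
    proof -
      have "A \<union> B \<subseteq> (\<Union>n. U n)" using U by (simp add: covers_def)
      then obtain n where "x \<in> U n" using \<open>S \<subseteq> A \<union> B\<close> \<open>x \<in> S\<close> by blast
      then have "x \<in> ?U S n" using that by auto
      then show ?thesis by blast
    qed
    then have "S \<subseteq> (\<Union>n. ?U S n)" by blast
    moreover have "bounded (?U S n) \<and> diameter (?U S n) \<le> \<delta>" for n
      using U assms(1) by (simp add: covers_def)
    ultimately show ?thesis unfolding covers_def by blast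
  qed
  have g0: "gauge {} = 0" by (simp add: gauge_def)
  have le: "gauge (?U A n) + gauge (?U B n) \<le> gauge (U n)" for n
  proof (cases "U n \<inter> A = {} \<or> U n \<inter> B = {}")
    case True
    then show ?thesis by (auto simp: g0)
  next
    case False
    then obtain x y where xy: "x \<in> U n" "x \<in> A" "y \<in> U n" "y \<in> B" by auto
    have "dist x y \<le> diameter (U n)"
      using U xy by (intro diameter_bounded_bound) (auto simp: covers_def)
    also have "\<dots> \<le> \<delta>" using U by (auto simp: covers_def)
    finally show ?thesis using sep[of x y] xy assms(2) by auto
  qed
  have "premeasure \<delta> A + premeasure \<delta> B \<le> (\<Sum>n. gauge (?U A n)) + (\<Sum>n. gauge (?U B n))"
    by (intro add_mono premeasure_upper cov) auto
  also have "\<dots> = (\<Sum>n. gauge (?U A n) + gauge (?U B n))"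
    by (intro suminf_add) auto
  also have "\<dots> \<le> (\<Sum>n. gauge (U n))"
    by (intro suminf_le le) auto
  finally show "premeasure \<delta> A + premeasure \<delta> B \<le> (\<Sum>n. gauge (U n))" .
qed

lemma outer_separated:
  assumes "d > 0" and sep: "\<And>x y. x \<in> A \<Longrightarrow> y \<in> B \<Longrightarrow> d \<le> dist x y"
  shows "outer A + outer B \<le> outer (A \<union> B)"
proof -
  have 1: "premeasure \<delta> A + premeasure \<delta>' B \<le> outer (A \<union> B)"
    if "\<delta> > 0" "\<delta>' > 0" for \<delta> \<delta>'
  proof -
    let ?m = "min (d / 2) (min \<delta> \<delta>')"
    have m: "?m > 0" "?m < d" using assms(1) that by auto
    have "premeasure \<delta> A + premeasure \<delta>' B \<le> premeasure ?m A + premeasure ?m B"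
      by (intro add_mono premeasure_antimono) auto
    also have "\<dots> \<le> premeasure ?m (A \<union> B)"
      using premeasure_separated[OF m sep] by blast
    also have "\<dots> \<le> outer (A \<union> B)" using m(1) by (rule premeasure_le_outer)
    finally show ?thesis .
  qed
  have ne: "{0::real<..} \<noteq> {}" by auto
  have 2: "premeasure \<delta> A + outer B \<le> outer (A \<union> B)" if "\<delta> > 0" for \<delta>
    unfolding hausdorff2_outer_def[of B] ennreal_SUP_add_right[OF ne]
    using 1 that by (intro SUP_least) auto
  show ?thesis
    unfolding hausdorff2_outer_def[of A] ennreal_SUP_add_left[OF ne, symmetric]
    using 2 by (intro SUP_least) auto
qed

text \<open>Caratheodory's criterion for metric outer measures: the set is exhausted from outside a closed
  set \<open>C\<close> by the points whose distance to \<open>C\<close> is at least \<open>1 / (n + 1)\<close>, and the rings between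
  consecutive members of this exhaustion carry a convergent series of outer measures.\<close>

lemma outer_caratheodory_closed:
  assumes C: "closed C"
  shows "outer (X \<inter> C) + outer (X - C) \<le> outer X"
proof (cases "C = {} \<or> outer X = \<infinity>")
  case True
  then show ?thesis by (auto simp: outer_empty)
next
  case False
  then have ne: "C \<noteq> {}" and fin: "outer X < \<infinity>" by (auto simp: less_top)
  let ?m = outer
  let ?d = "\<lambda>x. infdist x C"
  define Y where "Y n = {x\<in>X. 1 / real (Suc n) \<le> ?d x}" for n
  define R where "R k = {x\<in>X. 1 / real (Suc (Suc k)) \<le> ?d x \<and> ?d x < 1 / real (Suc k)}" for k
  have lip: "?d x - ?d y \<le> dist x y" for x y
    using infdist_triangle[of x C y] by simp
  have sepC: "?m (X \<inter> C) + ?m (Y n) \<le> ?m X" for n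
  proof -
    have "?m (X \<inter> C) + ?m (Y n) \<le> ?m ((X \<inter> C) \<union> Y n)"
    proof (rule outer_separated[of "1 / real (Suc n)"])
      fix x y assume x: "x \<in> X \<inter> C" and y: "y \<in> Y n"
      have "1 / real (Suc n) \<le> ?d y" using y by (simp add: Y_def)
      also have "\<dots> \<le> dist y x" using x by (intro infdist_le) auto
      finally show "1 / real (Suc n) \<le> dist x y" by (simp add: dist_commute)
    qed simp
    also have "\<dots> \<le> ?m X" by (rule outer_mono) (auto simp: Y_def)
    finally show ?thesis .
  qed
  have dec: "1 / real (Suc b) \<le> 1 / real (Suc a)" if "a \<le> b" for a b
    using that by (simp add: frac_le)
  have half: "(\<Sum>k<n. ?m (R (2 * k + p))) \<le> ?m (\<Union>k<n. R (2 * k + p))" for n p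
  proof (induction n)
    case 0
    then show ?case by simp
  next
    case (Suc n)
    have "?m (\<Union>k<n. R (2 * k + p)) + ?m (R (2 * n + p)) \<le> ?m ((\<Union>k<n. R (2 * k + p)) \<union> R (2 * n + p))"
    proof (cases "n = 0")
      case False
      then have n: "2 * n + p \<ge> 1" by simp
      let ?e = "1 / real (2 * n + p) - 1 / real (Suc (2 * n + p))"
      show ?thesis
      proof (rule outer_separated[of ?e])
        have "1 / real (Suc (2 * n + p)) < 1 / real (2 * n + p)"
          using n by (intro divide_strict_left_mono) auto
        then show "?e > 0" by simp
        fix x y assume x: "x \<in> (\<Union>k<n. R (2 * k + p))" and y: "y \<in> R (2 * n + p)"
        obtain k where k: "k < n" "1 / real (Suc (Suc (2 * k + p))) \<le> ?d x" using x by (auto simp: R_def)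
        have "1 / real (2 * n + p) \<le> 1 / real (Suc (Suc (2 * k + p)))"
          using k(1) by (intro frac_le) auto
        then have "1 / real (2 * n + p) \<le> ?d x" using k by simp
        moreover have "?d y < 1 / real (Suc (2 * n + p))" using y by (simp add: R_def)
        ultimately show "?e \<le> dist x y" using lip[of x y] by linarith
      qed
    qed (simp add: outer_empty)
    then show ?case using Suc.IH
      by (simp add: lessThan_Suc Un_commute add.commute) (meson add_left_mono order_trans)
  qed
  have halfX: "(\<Sum>k<n. ?m (R (2 * k + p))) \<le> ?m X" for n p
    using half[of p n] outer_mono[of "\<Union>k<n. R (2 * k + p)" X] by (auto simp: R_def intro: order_trans)
  have part: "(\<Sum>k<n. ?m (R k)) \<le> 2 * ?m X" for n
  proof -
    have "(\<Sum>k<n. ?m (R k)) \<le> (\<Sum>k<2*n. ?m (R k))"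
      by (intro sum_mono2) auto
    also have "(\<Sum>k<2*n. ?m (R k)) = (\<Sum>k<n. ?m (R (2 * k + 0))) + (\<Sum>k<n. ?m (R (2 * k + 1)))"
      by (induction n) (auto simp: algebra_simps)
    also have "\<dots> \<le> ?m X + ?m X" by (intro add_mono halfX)
    finally show ?thesis by (simp add: mult_2)
  qed
  have tot: "(\<Sum>k. ?m (R k)) < \<infinity>"
  proof -
    have "(\<Sum>k. ?m (R k)) \<le> 2 * ?m X"
      unfolding suminf_eq_SUP by (intro SUP_least part)
    also have "\<dots> < \<infinity>" using fin by (simp add: ennreal_mult_less_top)
    finally show ?thesis .
  qed
  let ?S = "\<Sum>k. ?m (R k)"
  have dpos: "?d x > 0" if "x \<notin> C" for x
    using in_closed_iff_infdist_zero[OF C ne, of x] infdist_nonneg[of x C] that by linarith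
  have cover: "X - C \<subseteq> Y n \<union> (\<Union>k. R (k + n))" for n
  proof
    fix x assume x: "x \<in> X - C"
    show "x \<in> Y n \<union> (\<Union>k. R (k + n))"
    proof (cases "x \<in> Y n")
      case False
      then have lt: "?d x < 1 / real (Suc n)" using x by (simp add: Y_def)
      obtain N where N: "inverse (real (Suc N)) < ?d x" using dpos x reals_Archimedean by blast
      define P where "P j \<longleftrightarrow> 1 / real (Suc j) \<le> ?d x" for j
      have ex: "P N" using N by (simp add: P_def inverse_eq_divide)
      define j where "j = (LEAST j. P j)"
      have j: "P j" "\<And>i. i < j \<Longrightarrow> \<not> P i"
        unfolding j_def using ex LeastI not_less_Least by blast+
      have "n < j"
      proof (rule ccontr)
        assume "\<not> n < j"
        then have "1 / real (Suc n) \<le> 1 / real (Suc j)" by (intro dec) auto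
        then show False using j(1) lt by (simp add: P_def)
      qed
      then obtain k where k: "j = Suc (k + n)" by (metis add.commute less_imp_Suc_add)
      have "x \<in> R (k + n)" using j(1) j(2)[of "k + n"] x k by (auto simp: R_def P_def)
      then show ?thesis by blast
    qed simp
  qed
  have step: "?m (X \<inter> C) + ?m (X - C) + (\<Sum>k<n. ?m (R k)) \<le> ?m X + ?S" for n
  proof -
    have "?m (X - C) \<le> ?m (Y n) + ?m (\<Union>k. R (k + n))"
      using outer_mono[OF cover[of n]] outer_subadditive[of "Y n" "\<Union>k. R (k + n)"] by (meson order_trans)
    also have "\<dots> \<le> ?m (Y n) + (\<Sum>k. ?m (R (k + n)))"
      by (intro add_left_mono outer_countably_subadditive)
    finally have "?m (X \<inter> C) + ?m (X - C) + (\<Sum>k<n. ?m (R k))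
        \<le> ?m (X \<inter> C) + (?m (Y n) + (\<Sum>k. ?m (R (k + n)))) + (\<Sum>k<n. ?m (R k))"
      by (intro add_mono) auto
    also have "\<dots> = (?m (X \<inter> C) + ?m (Y n)) + ((\<Sum>k. ?m (R (k + n))) + (\<Sum>k<n. ?m (R k)))"
      by (simp add: ac_simps)
    also have "(\<Sum>k. ?m (R (k + n))) + (\<Sum>k<n. ?m (R k)) = ?S"
      using suminf_offset[of "\<lambda>k. ?m (R k)" n] by simp
    also have "(?m (X \<inter> C) + ?m (Y n)) + ?S \<le> ?m X + ?S"
      by (intro add_right_mono sepC)
    finally show ?thesis .
  qed
  have "?m (X \<inter> C) + ?m (X - C) + ?S = (SUP n. ?m (X \<inter> C) + ?m (X - C) + (\<Sum>k<n. ?m (R k)))"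
    unfolding suminf_eq_SUP by (rule ennreal_SUP_add_right) simp
  also have "\<dots> \<le> ?m X + ?S" by (intro SUP_least step)
  finally have "?m (X \<inter> C) + ?m (X - C) + ?S \<le> ?m X + ?S" .
  then show ?thesis
    using tot by (auto simp: ennreal_add_left_cancel_le add.commute[of _ ?S])
qed

text \<open>All closed sets satisfy the Caratheodory condition, hence the outer measure is countably additive on the Borel
  sets, on which \<^const>\<open>measure_of\<close> then returns it.\<close>

lemma emeasure_hausdorff2:
  assumes "B \<in> sets borel"
  shows "emeasure hausdorff2 B = outer B"
proof -
  let ?L = "lambda_system UNIV UNIV outer :: 'a set set"
  interpret sa: sigma_algebra UNIV "UNIV :: 'a set set"
    using sigma_algebra_Pow[of UNIV] by simp
  have ms: "measure_space UNIV ?L outer"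
    using sa.caratheodory_lemma[OF outer_measure_space_hausdorff] .
  have cl: "C \<in> ?L" if "closed C" for C :: "'a set"
    unfolding sa.lambda_system_eq
  proof (intro CollectI conjI ballI)
    fix X :: "'a set"
    have "outer X \<le> outer (X \<inter> C) + outer (X - C)"
      using outer_subadditive[of "X \<inter> C" "X - C"] by (simp add: Int_Diff_Un)
    then show "outer (X \<inter> C) + outer (X - C) = outer X"
      using outer_caratheodory_closed[OF that] by (intro antisym)
  qed simp
  interpret L: sigma_algebra UNIV ?L using ms by (simp add: measure_space_def)
  have sub: "sets borel \<subseteq> ?L"
  proof -
    have "sigma_sets UNIV (Collect closed) \<subseteq> ?L"
      by (rule L.sigma_sets_subset) (use cl in auto)
    then show ?thesis unfolding borel_eq_closed by simp
  qed
  have "measure_space UNIV (sets (borel :: 'a measure)) outer"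
    unfolding measure_space_def
  proof (intro conjI)
    show "sigma_algebra UNIV (sets (borel :: 'a measure))"
      using sets.sigma_algebra_axioms[of "borel :: 'a measure"] by simp
    show "positive (sets borel) (outer :: 'a set \<Rightarrow> _)"
      by (simp add: positive_def outer_empty)
    show "countably_additive (sets borel) (outer :: 'a set \<Rightarrow> _)"
      unfolding countably_additive_def
    proof (intro allI impI)
      fix A :: "nat \<Rightarrow> 'a set"
      assume A: "range A \<subseteq> sets borel" "disjoint_family A" "(\<Union>i. A i) \<in> sets borel"
      then have "range A \<subseteq> ?L" "(\<Union>i. A i) \<in> ?L" using sub by blast+
      then show "(\<Sum>i. outer (A i)) = outer (\<Union>i. A i)"
        using ms A(2) unfolding measure_space_def countably_additive_def by simp
    qed
  qed
  then show ?thesis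
    unfolding hausdorff2_def measure_space_def
    by (intro emeasure_measure_of_sigma) (use assms in auto)
qed

lemma sets_hausdorff2 [simp, measurable_cong]: "sets hausdorff2 = sets borel"
  and space_hausdorff2 [simp]: "space hausdorff2 = UNIV"
  unfolding hausdorff2_def using sets.sigma_sets_eq[of borel] by auto

section \<open>Hausdorff measure and area\<close>

lemma line_length_le_diameter:
  fixes A :: "real set"
  assumes "\<And>x y. x \<in> A \<Longrightarrow> y \<in> A \<Longrightarrow> x - y \<le> D"
  shows "emeasure lborel A \<le> ennreal D"
proof (cases "A = {}")
  case False
  then obtain a where a: "a \<in> A" by blast
  have b: "bdd_above A" "bdd_below A"
    using assms[of _ a] assms[of a] a by (auto intro!: bdd_aboveI[of _ "D + a"] bdd_belowI[of _ "a - D"]) force+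
  have 1: "Sup A \<le> D + Inf A"
  proof (rule cSup_least[OF False])
    fix x assume x: "x \<in> A"
    have "x - D \<le> Inf A" using assms x by (intro cInf_greatest[OF False]) (force simp: algebra_simps)
    then show "x \<le> D + Inf A" by simp
  qed
  have le: "Inf A \<le> Sup A" using b a by (meson cInf_lower cSup_upper order_trans)
  have "A \<subseteq> {Inf A..Sup A}" using b by (auto intro: cInf_lower cSup_upper)
  then have "emeasure lborel A \<le> emeasure lborel {Inf A..Sup A}" by (intro emeasure_mono) auto
  also have "\<dots> \<le> ennreal D" using 1 le by (auto intro!: ennreal_leI)
  finally show ?thesis .
qed simp

text \<open>The spans of the two sets add up to at least \<open>4 t\<close>, and also to
  \<open>(max A - min B) + (max B - min A)\<close>.\<close>

lemma slices_far_apart: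
  fixes A B :: "real set"
  assumes "compact A" "compact B" "ennreal (2 * t) \<le> emeasure lborel A" "ennreal (2 * t) \<le> emeasure lborel B" "t > 0"
  obtains a b where "a \<in> A" "b \<in> B" "2 * t \<le> \<bar>a - b\<bar>"
proof -
  have ends: "\<exists>u l. u \<in> S \<and> l \<in> S \<and> 2 * t \<le> u - l" if S: "compact S" "ennreal (2 * t) \<le> emeasure lborel S" for S
  proof -
    have ne: "S \<noteq> {}" using S(2) assms(5) by auto
    obtain u where u: "u \<in> S" "\<And>x. x \<in> S \<Longrightarrow> x \<le> u" using compact_attains_sup[OF S(1) ne] by blast
    obtain l where l: "l \<in> S" "\<And>x. x \<in> S \<Longrightarrow> l \<le> x" using compact_attains_inf[OF S(1) ne] by blast
    have "emeasure lborel S \<le> ennreal (u - l)"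
      using u l by (intro line_length_le_diameter) (smt (verit))
    then have "ennreal (2 * t) \<le> ennreal (u - l)" using S(2) by simp
    then have "2 * t \<le> u - l" using assms(5) l(2)[OF u(1)] by (simp add: ennreal_le_iff)
    then show ?thesis using u l by blast
  qed
  obtain ua la where a: "ua \<in> A" "la \<in> A" "2 * t \<le> ua - la" using ends[OF assms(1,3)] by blast
  obtain ub lb where b: "ub \<in> B" "lb \<in> B" "2 * t \<le> ub - lb" using ends[OF assms(2,4)] by blast
  have "2 * t \<le> \<bar>ua - lb\<bar> \<or> 2 * t \<le> \<bar>la - ub\<bar>" using a b by linarith
  then show ?thesis using that a b by blast
qed

text \<open>The isodiametric inequality in the plane. The set \<open>{(x, y). 2 \<bar>y\<bar> \<le> m x}\<close>, with \<open>m x\<close> the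
  length of the vertical slice over \<open>x\<close>, has the same area as \<open>K\<close>; each of its horizontal slices is no
  longer than the corresponding slice of the disk of the same diameter.\<close>

theorem isodiametric:
  fixes K :: "(real \<times> real) set"
  assumes "compact K"
  shows "emeasure lborel K \<le> ennreal (pi * (diameter K / 2)\<^sup>2)"
proof -
  let ?d = "diameter K"
  have d0: "?d \<ge> 0" using assms diameter_ge_0 compact_imp_bounded by blast
  have Kb [measurable]: "K \<in> sets borel" using assms borel_compact by blast
  define m where "m x = emeasure lborel (Pair x -` K)" for x
  let ?S = "{(x::real, y::real). ennreal (2 * \<bar>y\<bar>) \<le> m x}"
  have slice: "compact (Pair x -` K)" for x
  proof -
    have "Pair x -` K = snd ` (K \<inter> {x} \<times> UNIV)" by force
    moreover have "compact (K \<inter> {x} \<times> UNIV)"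
      using assms by (intro compact_Int_closed closed_Times) auto
    ultimately show ?thesis by (auto intro!: compact_continuous_image continuous_intros)
  qed
  have mfin: "m x < \<infinity>" for x unfolding m_def using emeasure_compact_finite[OF slice[of x]] by simp
  have Kp: "K \<in> sets (lborel \<Otimes>\<^sub>M lborel)" using Kb by (simp only: lborel_prod sets_lborel)
  have [measurable]: "m \<in> borel_measurable borel"
    unfolding m_def using lborel.measurable_emeasure_Pair[OF Kp] by simp
  have "emeasure lborel K = (\<integral>\<^sup>+x. m x \<partial>lborel)"
    using lborel.emeasure_pair_measure_alt[OF Kp] by (simp add: lborel_prod m_def)
  also have "\<dots> = (\<integral>\<^sup>+x. (\<integral>\<^sup>+y. indicator ?S (x, y) \<partial>lborel) \<partial>lborel)"
  proof (intro nn_integral_cong)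
    fix x
    obtain M where M: "m x = ennreal M" "M \<ge> 0" using mfin[of x] by (cases "m x") auto
    have "(\<integral>\<^sup>+y. indicator ?S (x, y) \<partial>lborel) = (\<integral>\<^sup>+y. indicator {- M / 2..M / 2} y \<partial>lborel)"
      using M by (intro nn_integral_cong) (auto simp: indicator_def ennreal_le_iff)
    also have "\<dots> = ennreal M" using M by simp
    finally show "m x = (\<integral>\<^sup>+y. indicator ?S (x, y) \<partial>lborel)" using M by simp
  qed
  also have "\<dots> = (\<integral>\<^sup>+y. (\<integral>\<^sup>+x. indicator ?S (x, y) \<partial>lborel) \<partial>lborel)"
  proof (rule lborel_pair.Fubini'[symmetric])
    have "{(x::real, y::real). ennreal (2 * \<bar>y\<bar>) \<le> m x} \<in> sets (borel \<Otimes>\<^sub>M borel)"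
    proof -
      have "(\<lambda>p::real \<times> real. ennreal (2 * \<bar>snd p\<bar>)) \<in> borel_measurable (borel \<Otimes>\<^sub>M borel)"
        "(\<lambda>p::real \<times> real. m (fst p)) \<in> borel_measurable (borel \<Otimes>\<^sub>M borel)"
        by measurable
      then have "{p \<in> space (borel \<Otimes>\<^sub>M borel). ennreal (2 * \<bar>snd p :: real\<bar>) \<le> m (fst p)} \<in> sets (borel \<Otimes>\<^sub>M borel)"
        by measurable
      then show ?thesis by (simp add: case_prod_beta' space_pair_measure)
    qed
    then show "case_prod (\<lambda>x y. indicator ?S (x, y) :: ennreal) \<in> borel_measurable (lborel \<Otimes>\<^sub>M lborel)"
      by (simp add: case_prod_beta')
  qed
  also have "\<dots> \<le> (\<integral>\<^sup>+y. emeasure lborel ((\<lambda>x. (x, y)) -` cball (0 :: real \<times> real) (?d / 2)) \<partial>lborel)"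
  proof (rule nn_integral_mono_AE)
    show "AE y in lborel. (\<integral>\<^sup>+x. indicator ?S (x, y) \<partial>lborel) \<le> emeasure lborel ((\<lambda>x. (x, y)) -` cball (0 :: real \<times> real) (?d / 2))"
      using AE_lborel_singleton[of "0::real"]
    proof (rule AE_mp, intro AE_I2 impI)
      fix y :: real assume y: "y \<noteq> 0"
      let ?A = "{x. ennreal (2 * \<bar>y\<bar>) \<le> m x}"
      have pair: "\<bar>x - x'\<bar>\<^sup>2 + (2 * \<bar>y\<bar>)\<^sup>2 \<le> ?d\<^sup>2" if "x \<in> ?A" "x' \<in> ?A" for x x'
      proof -
        have xm: "x \<in> ?A" "x' \<in> ?A" using that by auto
        obtain a b where ab: "a \<in> Pair x -` K" "b \<in> Pair x' -` K" "2 * \<bar>y\<bar> \<le> \<bar>a - b\<bar>"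
          by (rule slices_far_apart[OF slice slice, of "\<bar>y\<bar>" x x']) (use xm y in \<open>auto simp: m_def\<close>)
        have "dist (x, a) (x', b) \<le> ?d"
          using ab assms by (intro diameter_bounded_bound compact_imp_bounded) auto
        then have "(x - x')\<^sup>2 + (a - b)\<^sup>2 \<le> ?d\<^sup>2"
          using d0 by (simp add: dist_Pair_Pair dist_real_def sqrt_le_D)
        moreover have "(2 * \<bar>y\<bar>)\<^sup>2 \<le> \<bar>a - b\<bar>\<^sup>2" using ab(3) by (intro power_mono) auto
        ultimately show ?thesis by simp
      qed
      have "{x \<in> space lborel. ennreal (2 * \<bar>y\<bar>) \<le> m x} \<in> sets lborel" by measurable
      then have mA: "?A \<in> sets lborel" by simp
      have "(\<integral>\<^sup>+x. indicator ?S (x, y) \<partial>lborel) = (\<integral>\<^sup>+x. indicator ?A x \<partial>lborel)"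
        by (intro nn_integral_cong) (auto simp: indicator_def)
      then have eq: "(\<integral>\<^sup>+x. indicator ?S (x, y) \<partial>lborel) = emeasure lborel ?A"
        using nn_integral_indicator[OF mA] by simp
      show "(\<integral>\<^sup>+x. indicator ?S (x, y) \<partial>lborel) \<le> emeasure lborel ((\<lambda>x. (x, y)) -` cball (0 :: real \<times> real) (?d / 2))"
      proof (cases "?A = {}")
        case False
        then obtain x where "x \<in> ?A" by blast
        from pair[OF this this] have q: "0 \<le> ?d\<^sup>2 - (2 * \<bar>y\<bar>)\<^sup>2" by simp
        let ?s = "sqrt (?d\<^sup>2 - (2 * \<bar>y\<bar>)\<^sup>2)"
        have "emeasure lborel ?A \<le> ennreal ?s"
        proof (rule line_length_le_diameter)
          fix x x' assume "x \<in> ?A" "x' \<in> ?A"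
          from pair[OF this] show "x - x' \<le> ?s"
            by (intro real_le_rsqrt) (simp add: power2_abs)
        qed
        also have "\<dots> = emeasure lborel {- ?s / 2..?s / 2}" using q by simp
        also have "\<dots> \<le> emeasure lborel ((\<lambda>x. (x, y)) -` cball (0 :: real \<times> real) (?d / 2))"
        proof (rule emeasure_mono)
          show "{- ?s / 2..?s / 2} \<subseteq> (\<lambda>x. (x, y)) -` cball (0 :: real \<times> real) (?d / 2)"
          proof
            fix x assume "x \<in> {- ?s / 2..?s / 2}"
            then have "\<bar>2 * x\<bar> \<le> ?s" by auto
            then have "(2 * x)\<^sup>2 \<le> ?s\<^sup>2" by (metis abs_ge_zero power2_abs power_mono)
            then have "(2 * x)\<^sup>2 + (2 * \<bar>y\<bar>)\<^sup>2 \<le> ?d\<^sup>2" using q by simp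
            then have "x\<^sup>2 + y\<^sup>2 \<le> (?d / 2)\<^sup>2" by (simp add: power_mult_distrib power_divide)
            then have "sqrt (x\<^sup>2 + y\<^sup>2) \<le> ?d / 2" using d0 by (intro real_le_lsqrt) auto
            then show "x \<in> (\<lambda>x. (x, y)) -` cball (0 :: real \<times> real) (?d / 2)" by (simp add: norm_Pair)
          qed
          have "closed ((\<lambda>x. (x, y)) -` cball (0 :: real \<times> real) (?d / 2))"
            by (intro closed_vimage continuous_intros) auto
          then show "(\<lambda>x. (x, y)) -` cball (0 :: real \<times> real) (?d / 2) \<in> sets lborel" by simp
        qed
        finally show ?thesis unfolding eq .
      qed (simp add: eq)
    qed
  qed
  also have "\<dots> = emeasure lborel (cball (0 :: real \<times> real) (?d / 2))"
  proof -
    have "cball (0 :: real \<times> real) (?d / 2) \<in> sets (lborel \<Otimes>\<^sub>M lborel)"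
      by (simp only: lborel_prod sets_lborel borel_closed closed_cball)
    from lborel_pair.emeasure_pair_measure_alt2[OF this] show ?thesis
      by (simp only: lborel_prod)
  qed
  also have "\<dots> = ennreal (pi * (?d / 2)\<^sup>2)"
    using d0 by (subst emeasure_cball) (auto simp: unit_ball_vol_2 power2_eq_square)
  finally show ?thesis .
qed

text \<open>Covers are indexed by all natural numbers, so a countable family is padded with empty sets.\<close>

lemma premeasure_countable_cover:
  assumes "countable C" "A \<subseteq> (\<Union>c\<in>C. V c)" "\<And>c. c \<in> C \<Longrightarrow> bounded (V c) \<and> diameter (V c) \<le> \<delta>" "\<delta> > 0"
  shows "premeasure \<delta> A \<le> (\<integral>\<^sup>+c. gauge (V c) \<partial>count_space C)"
proof -
  let ?U = "\<lambda>n. if n \<in> to_nat_on C ` C then V (from_nat_into C n) else {}"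
  have g0: "gauge ({} :: 'b set) = 0" by (simp add: gauge_def)
  have inj: "inj_on (to_nat_on C) C" using assms(1) by (rule inj_on_to_nat_on)
  have "?U \<in> covers \<delta> A"
  proof -
    have "A \<subseteq> (\<Union>n. ?U n)"
    proof
      fix x assume "x \<in> A"
      then obtain c where c: "c \<in> C" "x \<in> V c" using assms(2) by auto
      then have "x \<in> ?U (to_nat_on C c)" using assms(1) by simp
      then show "x \<in> (\<Union>n. ?U n)" by blast
    qed
    moreover have "bounded (?U n) \<and> diameter (?U n) \<le> \<delta>" for n
      using assms by auto
    ultimately show ?thesis unfolding covers_def by blast
  qed
  then have "premeasure \<delta> A \<le> (\<Sum>n. gauge (?U n))" by (rule premeasure_upper)
  also have "\<dots> = (\<integral>\<^sup>+n. gauge (?U n) \<partial>count_space UNIV)" by (simp add: nn_integral_count_space_nat)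
  also have "\<dots> = (\<integral>\<^sup>+n. gauge (?U n) \<partial>count_space (to_nat_on C ` C))"
    by (intro nn_integral_count_space_eq) (auto simp: g0)
  also have "\<dots> = (\<integral>\<^sup>+c. gauge (?U (to_nat_on C c)) \<partial>count_space C)"
    using inj by (intro nn_integral_bij_count_space[symmetric]) (auto simp: bij_betw_def)
  also have "\<dots> = (\<integral>\<^sup>+c. gauge (V c) \<partial>count_space C)"
    using assms(1) by (intro nn_integral_cong) auto
  finally show ?thesis .
qed

lemma nn_integral_disjoint_cballs:
  fixes C :: "((real \<times> real) \<times> real) set"
  assumes "countable C" and "pairwise (\<lambda>i j. disjnt (cball (fst i) (snd i)) (cball (fst j) (snd j))) C"
    and r: "\<And>c. c \<in> C \<Longrightarrow> snd c > 0" and G: "G \<in> sets borel" "\<And>c. c \<in> C \<Longrightarrow> cball (fst c) (snd c) \<subseteq> G"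
  shows "(\<integral>\<^sup>+c. ennreal (pi * (snd c)\<^sup>2) \<partial>count_space C) \<le> emeasure lborel G"
proof -
  have "(\<integral>\<^sup>+c. ennreal (pi * (snd c)\<^sup>2) \<partial>count_space C) = (\<integral>\<^sup>+c. emeasure lborel (cball (fst c) (snd c)) \<partial>count_space C)"
    using r by (intro nn_integral_cong) (auto simp: emeasure_cball unit_ball_vol_2 less_imp_le power2_eq_square)
  also have "\<dots> = emeasure lborel (\<Union>c\<in>C. cball (fst c) (snd c))"
    using assms by (intro emeasure_UN_countable[symmetric]) (auto simp: disjoint_family_on_def pairwise_def disjnt_def)
  also have "\<dots> \<le> emeasure lborel G"
    using G by (intro emeasure_mono) auto
  finally show ?thesis .
qed

text \<open>The null set lies in an open set of small area; disjoint disks in it, selected by the covering lemma,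
  cover the null set when they are enlarged five times.\<close>

lemma premeasure_image_null:
  fixes p :: "real \<times> real \<Rightarrow> 'b::metric_space"
  assumes lip: "\<And>x y. dist (p x) (p y) \<le> dist x y" and "negligible N" and \<delta>: "\<delta> > 0"
  shows "premeasure \<delta> (p ` N) = 0"
proof -
  have eps: "premeasure \<delta> (p ` N) \<le> 0 + ennreal e" if e: "e > 0" for e :: real
  proof -
    have N: "N \<in> sets lebesgue" "emeasure lebesgue N = 0"
      using assms(2) by (auto simp: negligible_iff_null_sets)
    obtain G where G: "open G" "N \<subseteq> G" "G - N \<in> lmeasurable" "emeasure lebesgue (G - N) < ennreal (e / 25)"
      by (rule sets_lebesgue_outer_open[OF N(1), of "e / 25"]) (use e in auto)
    have "emeasure lebesgue G \<le> emeasure lebesgue N + emeasure lebesgue (G - N)"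
      using G N emeasure_subadditive[of N lebesgue "G - N"] by (simp add: Un_absorb1 fmeasurableD)
    then have Gm: "emeasure lborel G \<le> ennreal (e / 25)" using G(1,4) N by simp
    let ?K = "{c :: (real \<times> real) \<times> real. 0 < snd c \<and> snd c \<le> \<delta> / 10 \<and> cball (fst c) (snd c) \<subseteq> G}"
    have "N \<subseteq> (\<Union>c\<in>?K. cball (fst c) (snd c))"
    proof
      fix x assume "x \<in> N"
      then obtain s where s: "s > 0" "cball x s \<subseteq> G" using G open_contains_cball by blast
      have "cball x (min s (\<delta> / 10)) \<subseteq> cball x s" by auto
      then have "(x, min s (\<delta> / 10)) \<in> ?K" using s \<delta> by auto
      moreover have "x \<in> cball x (min s (\<delta> / 10))" using s \<delta> by simp
      ultimately show "x \<in> (\<Union>c\<in>?K. cball (fst c) (snd c))" by (intro UN_I[of "(x, min s (\<delta> / 10))"]) auto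
    qed
    then obtain C where C: "countable C" "C \<subseteq> ?K"
        "pairwise (\<lambda>i j. disjnt (cball (fst i) (snd i)) (cball (fst j) (snd j))) C"
        "N \<subseteq> (\<Union>c\<in>C. cball (fst c) (5 * snd c))"
      by (rule Vitali_covering_lemma_cballs[where B = "\<delta> / 10"]) auto
    have dia: "bounded (p ` cball (fst c) (5 * snd c)) \<and> diameter (p ` cball (fst c) (5 * snd c)) \<le> 10 * snd c"
      if "c \<in> C" for c
    proof -
      have d: "dist (p x) (p y) \<le> 10 * snd c" if "x \<in> cball (fst c) (5 * snd c)" "y \<in> cball (fst c) (5 * snd c)" for x y
        using lip[of x y] dist_triangle2[of x y "fst c"] that by (simp add: dist_commute)
      have "bounded (p ` cball (fst c) (5 * snd c))"
        unfolding bounded_two_points using d by (intro exI[of _ "10 * snd c"]) auto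
      moreover have "diameter (p ` cball (fst c) (5 * snd c)) \<le> 10 * snd c"
        using d C(2) that unfolding diameter_def by (auto intro!: cSUP_least)
      ultimately show ?thesis by blast
    qed
    have "premeasure \<delta> (p ` N) \<le> (\<integral>\<^sup>+c. gauge (p ` cball (fst c) (5 * snd c)) \<partial>count_space C)"
    proof (rule premeasure_countable_cover[OF C(1) _ _ \<delta>])
      show "p ` N \<subseteq> (\<Union>c\<in>C. p ` cball (fst c) (5 * snd c))"
        using image_mono[OF C(4), of p] by (simp only: image_UN)
      show "bounded (p ` cball (fst c) (5 * snd c)) \<and> diameter (p ` cball (fst c) (5 * snd c)) \<le> \<delta>" if "c \<in> C" for c
        using dia[OF that] C(2) that by force
    qed
    also have "\<dots> \<le> (\<integral>\<^sup>+c. ennreal 25 * ennreal (pi * (snd c)\<^sup>2) \<partial>count_space C)"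
    proof (intro nn_integral_mono)
      fix c assume "c \<in> space (count_space C)"
      then have c: "c \<in> C" by simp
      have "0 \<le> diameter (p ` cball (fst c) (5 * snd c))" using dia[OF c] diameter_ge_0 by blast
      then have "(diameter (p ` cball (fst c) (5 * snd c)) / 2)\<^sup>2 \<le> (5 * snd c)\<^sup>2"
        using dia[OF c] by (intro power_mono) auto
      then have "pi * (diameter (p ` cball (fst c) (5 * snd c)) / 2)\<^sup>2 \<le> 25 * (pi * (snd c)\<^sup>2)"
        by (simp add: power_mult_distrib)
      then show "gauge (p ` cball (fst c) (5 * snd c)) \<le> ennreal 25 * ennreal (pi * (snd c)\<^sup>2)"
        unfolding gauge_def by (subst ennreal_mult[symmetric]) (auto intro!: ennreal_leI)
    qed
    also have "\<dots> = ennreal 25 * (\<integral>\<^sup>+c. ennreal (pi * (snd c)\<^sup>2) \<partial>count_space C)"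
      by (intro nn_integral_cmult) auto
    also have "\<dots> \<le> ennreal 25 * ennreal (e / 25)"
    proof (intro mult_left_mono order_trans[OF _ Gm] nn_integral_disjoint_cballs[OF C(1) C(3)])
      show "G \<in> sets borel" using G(1) by simp
    qed (use C(2) in auto)
    also have "\<dots> = ennreal e" using e by (subst ennreal_mult[symmetric]) auto
    finally show ?thesis by simp
  qed
  have "premeasure \<delta> (p ` N) \<le> 0" by (rule ennreal_le_epsilon) (rule eps)
  then show ?thesis by simp
qed

text \<open>A Vitali cover by small disks has total area at most that of the set and leaves out a null set.\<close>

lemma outer_image_open:
  fixes p :: "real \<times> real \<Rightarrow> 'b::metric_space"
  assumes lip: "\<And>x y. dist (p x) (p y) \<le> dist x y" and G: "open G"
  shows "outer (p ` G) \<le> emeasure lborel G"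
proof (rule outer_least)
  fix \<delta> :: real assume \<delta>: "\<delta> > 0"
  let ?K = "{c :: (real \<times> real) \<times> real. 0 < snd c \<and> snd c \<le> \<delta> / 2 \<and> cball (fst c) (snd c) \<subseteq> G}"
  have small: "\<exists>i. i \<in> ?K \<and> x \<in> cball (fst i) (snd i) \<and> snd i < d" if x: "x \<in> G" and d: "0 < d" for x d
  proof -
    obtain s where s: "s > 0" "cball x s \<subseteq> G" using G x open_contains_cball by blast
    let ?s = "min s (min (\<delta> / 2) (d / 2))"
    have "cball x ?s \<subseteq> cball x s" by auto
    then have "(x, ?s) \<in> ?K" using s \<delta> d by auto
    moreover have "x \<in> cball x ?s" "?s < d" using s \<delta> d by auto
    ultimately show ?thesis by (intro exI[of _ "(x, ?s)"]) auto
  qed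
  obtain C where C: "countable C" "C \<subseteq> ?K"
      "pairwise (\<lambda>i j. disjnt (cball (fst i) (snd i)) (cball (fst j) (snd j))) C"
      "negligible (G - (\<Union>i\<in>C. cball (fst i) (snd i)))"
    by (rule Vitali_covering_theorem_cballs[of ?K snd G fst]) (use small in auto)
  let ?N = "G - (\<Union>i\<in>C. cball (fst i) (snd i))"
  let ?U = "\<Union>i\<in>C. cball (fst i) (snd i)"
  have dia: "bounded (p ` cball (fst c) (snd c)) \<and> diameter (p ` cball (fst c) (snd c)) \<le> 2 * snd c"
    if "c \<in> C" for c
  proof -
    have d: "dist (p x) (p y) \<le> 2 * snd c" if "x \<in> cball (fst c) (snd c)" "y \<in> cball (fst c) (snd c)" for x y
      using lip[of x y] dist_triangle2[of x y "fst c"] that by (simp add: dist_commute)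
    have "bounded (p ` cball (fst c) (snd c))"
      unfolding bounded_two_points using d by (intro exI[of _ "2 * snd c"]) auto
    moreover have "diameter (p ` cball (fst c) (snd c)) \<le> 2 * snd c"
      using d C(2) that unfolding diameter_def by (auto intro!: cSUP_least)
    ultimately show ?thesis by blast
  qed
  have "premeasure \<delta> (p ` ?U) \<le> (\<integral>\<^sup>+c. gauge (p ` cball (fst c) (snd c)) \<partial>count_space C)"
  proof (rule premeasure_countable_cover[OF C(1) _ _ \<delta>])
    show "p ` ?U \<subseteq> (\<Union>c\<in>C. p ` cball (fst c) (snd c))" by auto
    show "bounded (p ` cball (fst c) (snd c)) \<and> diameter (p ` cball (fst c) (snd c)) \<le> \<delta>" if "c \<in> C" for c
      using dia[OF that] C(2) that by force
  qed
  also have "\<dots> \<le> (\<integral>\<^sup>+c. ennreal (pi * (snd c)\<^sup>2) \<partial>count_space C)"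
  proof (intro nn_integral_mono)
    fix c assume "c \<in> space (count_space C)"
    then have c: "c \<in> C" by simp
    have "0 \<le> diameter (p ` cball (fst c) (snd c))" using dia[OF c] diameter_ge_0 by blast
    then have "(diameter (p ` cball (fst c) (snd c)) / 2)\<^sup>2 \<le> (snd c)\<^sup>2"
      using dia[OF c] by (intro power_mono) auto
    then show "gauge (p ` cball (fst c) (snd c)) \<le> ennreal (pi * (snd c)\<^sup>2)"
      unfolding gauge_def by (auto intro!: ennreal_leI)
  qed
  also have "\<dots> \<le> emeasure lborel G"
    by (rule nn_integral_disjoint_cballs[OF C(1) C(3)]) (use C(2) G in auto)
  finally have 1: "premeasure \<delta> (p ` ?U) \<le> emeasure lborel G" .
  let ?A = "\<lambda>i::nat. if i = 0 then p ` ?U else if i = 1 then p ` ?N else {}"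
  have "premeasure \<delta> (p ` G) \<le> premeasure \<delta> (\<Union>i. ?A i)"
  proof (rule premeasure_mono)
    show "p ` G \<subseteq> (\<Union>i. ?A i)"
    proof
      fix y assume "y \<in> p ` G"
      then have "y \<in> ?A 0 \<or> y \<in> ?A 1" by auto
      then show "y \<in> (\<Union>i. ?A i)" by blast
    qed
  qed
  also have "\<dots> \<le> (\<Sum>i. premeasure \<delta> (?A i))"
    by (rule premeasure_countably_subadditive)
  also have "\<dots> = (\<Sum>i<2. premeasure \<delta> (?A i))"
    by (intro suminf_finite) (auto simp: premeasure_empty[OF \<delta>] lessThan_iff)
  also have "\<dots> = premeasure \<delta> (p ` ?U) + premeasure \<delta> (p ` ?N)"
    by (simp add: numeral_2_eq_2)
  also have "\<dots> \<le> emeasure lborel G"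
    using 1 premeasure_image_null[OF lip C(4) \<delta>] by simp
  finally show "premeasure \<delta> (p ` G) \<le> emeasure lborel G" .
qed

lemma outer_image_borel:
  fixes p :: "real \<times> real \<Rightarrow> 'b::metric_space"
  assumes lip: "\<And>x y. dist (p x) (p y) \<le> dist x y" and A: "A \<in> sets borel"
  shows "outer (p ` A) \<le> emeasure lborel A"
proof (rule ennreal_le_epsilon)
  fix e :: real assume e: "0 < e"
  have A': "A \<in> sets lebesgue" using A by simp
  obtain G where G: "open G" "A \<subseteq> G" "G - A \<in> lmeasurable" "emeasure lebesgue (G - A) < ennreal e"
    by (rule sets_lebesgue_outer_open[OF A' e])
  have "outer (p ` A) \<le> outer (p ` G)" using G by (intro outer_mono) auto
  also have "\<dots> \<le> emeasure lborel G" using outer_image_open[OF lip G(1)] .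
  also have "\<dots> \<le> emeasure lborel A + emeasure lborel (G - A)"
    using G A emeasure_subadditive[of A lborel "G - A"] by (simp add: Un_absorb1)
  also have "\<dots> \<le> emeasure lborel A + ennreal e"
    using G A by (intro add_left_mono) auto
  finally show "outer (p ` A) \<le> emeasure lborel A + ennreal e" .
qed

text \<open>The members of a fine cover of the image have preimages of almost the same diameter at most, whose area the
  isodiametric inequality bounds.\<close>

lemma outer_image_lower:
  fixes p :: "real \<times> real \<Rightarrow> 'b::metric_space"
  assumes Q: "Q \<in> sets borel" "bounded Q"
    and loc: "\<And>\<kappa>. \<kappa> > 0 \<Longrightarrow> \<exists>\<delta>>0. \<forall>x\<in>Q. \<forall>y\<in>Q. dist (p x) (p y) \<le> \<delta> \<longrightarrow> dist x y \<le> (1 + \<kappa>) * dist (p x) (p y)"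
  shows "emeasure lborel Q \<le> outer (p ` Q)"
proof -
  have main: "emeasure lborel Q \<le> ennreal ((1 + \<kappa>)\<^sup>2) * outer (p ` Q)" if \<kappa>: "\<kappa> > 0" for \<kappa> :: real
  proof -
    obtain \<delta> where \<delta>: "\<delta> > 0" "\<And>x y. x \<in> Q \<Longrightarrow> y \<in> Q \<Longrightarrow> dist (p x) (p y) \<le> \<delta> \<Longrightarrow> dist x y \<le> (1 + \<kappa>) * dist (p x) (p y)"
      using loc[OF \<kappa>] by blast
    have each: "emeasure lborel Q \<le> ennreal ((1 + \<kappa>)\<^sup>2) * (\<Sum>n. gauge (U n))" if U: "U \<in> covers \<delta> (p ` Q)" for U
    proof -
      let ?V = "\<lambda>n. closure (Q \<inter> p -` U n)"
      have Ub: "bounded (U n)" "diameter (U n) \<le> \<delta>" for n using U by (auto simp: covers_def)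
      have bV: "bounded (Q \<inter> p -` U n)" for n using Q(2) by (rule bounded_subset) auto
      have cV: "compact (?V n)" for n using bV by simp
      have dV: "diameter (?V n) \<le> (1 + \<kappa>) * diameter (U n)" for n
      proof -
        have "diameter (Q \<inter> p -` U n) \<le> (1 + \<kappa>) * diameter (U n)"
        proof (rule diameter_le)
          show "Q \<inter> p -` U n \<noteq> {} \<or> 0 \<le> (1 + \<kappa>) * diameter (U n)"
            using diameter_ge_0[OF Ub(1)[of n]] \<kappa> by simp
          fix x y assume x: "x \<in> Q \<inter> p -` U n" and y: "y \<in> Q \<inter> p -` U n"
          have d: "dist (p x) (p y) \<le> diameter (U n)"
            using x y Ub(1)[of n] by (intro diameter_bounded_bound) auto
          then have "dist x y \<le> (1 + \<kappa>) * dist (p x) (p y)" using \<delta>(2)[of x y] x y Ub(2)[of n] by auto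
          also have "\<dots> \<le> (1 + \<kappa>) * diameter (U n)" using d \<kappa> by (intro mult_left_mono) auto
          finally show "norm (x - y) \<le> (1 + \<kappa>) * diameter (U n)" by (simp add: dist_norm)
        qed
        then show ?thesis using bV diameter_closure by metis
      qed
      have "Q \<subseteq> (\<Union>n. ?V n)"
      proof
        fix x assume "x \<in> Q"
        moreover from this obtain n where "p x \<in> U n" using U by (auto simp: covers_def)
        ultimately have "x \<in> ?V n" by (intro subsetD[OF closure_subset]) auto
        then show "x \<in> (\<Union>n. ?V n)" by blast
      qed
      then have "emeasure lborel Q \<le> emeasure lborel (\<Union>n. ?V n)"
        by (intro emeasure_mono) auto
      also have "\<dots> \<le> (\<Sum>n. emeasure lborel (?V n))"
        by (intro emeasure_subadditive_countably) auto
      also have "\<dots> \<le> (\<Sum>n. ennreal ((1 + \<kappa>)\<^sup>2) * gauge (U n))"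
      proof (intro suminf_le)
        fix n
        have "emeasure lborel (?V n) \<le> ennreal (pi * (diameter (?V n) / 2)\<^sup>2)"
          using isodiametric[OF cV] .
        also have "\<dots> \<le> ennreal ((1 + \<kappa>)\<^sup>2 * (pi * (diameter (U n) / 2)\<^sup>2))"
        proof (rule ennreal_leI)
          have "(diameter (?V n) / 2)\<^sup>2 \<le> ((1 + \<kappa>) * diameter (U n) / 2)\<^sup>2"
            using dV[of n] diameter_ge_0[OF compact_imp_bounded[OF cV[of n]]] by (intro power_mono) auto
          then show "pi * (diameter (?V n) / 2)\<^sup>2 \<le> (1 + \<kappa>)\<^sup>2 * (pi * (diameter (U n) / 2)\<^sup>2)"
            by (simp add: power_mult_distrib power_divide)
        qed
        also have "\<dots> = ennreal ((1 + \<kappa>)\<^sup>2) * gauge (U n)"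
          unfolding gauge_def by (intro ennreal_mult) auto
        finally show "emeasure lborel (?V n) \<le> ennreal ((1 + \<kappa>)\<^sup>2) * gauge (U n)" .
      qed auto
      also have "\<dots> = ennreal ((1 + \<kappa>)\<^sup>2) * (\<Sum>n. gauge (U n))" by simp
      finally show ?thesis .
    qed
    let ?c = "ennreal ((1 + \<kappa>)\<^sup>2)" and ?d = "ennreal (inverse ((1 + \<kappa>)\<^sup>2))"
    have cd: "?d * ?c = 1" "?c * ?d = 1"
      using \<kappa> by (simp_all flip: ennreal_mult add: ennreal_1[symmetric] del: ennreal_1)
    have "?d * emeasure lborel Q \<le> premeasure \<delta> (p ` Q)"
    proof (rule premeasure_lower)
      fix U assume "U \<in> covers \<delta> (p ` Q)"
      from mult_left_mono[OF each[OF this], of ?d]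
      show "?d * emeasure lborel Q \<le> (\<Sum>n. gauge (U n))" by (simp add: mult.assoc[symmetric] cd)
    qed
    also have "\<dots> \<le> outer (p ` Q)" using \<delta>(1) by (rule premeasure_le_outer)
    finally have "?c * (?d * emeasure lborel Q) \<le> ?c * outer (p ` Q)" by (rule mult_left_mono) simp
    then show ?thesis by (simp add: mult.assoc[symmetric] cd)
  qed
  show ?thesis
  proof (cases "outer (p ` Q)")
    case (real h)
    obtain q where q: "emeasure lborel Q = ennreal q" "q \<ge> 0"
      using main[of 1] real by (cases "emeasure lborel Q") (auto simp: top_unique ennreal_mult_eq_top_iff)
    have "q \<le> (1 + inverse (real (Suc n)))\<^sup>2 * h" for n
      using main[of "inverse (real (Suc n))"] real q by (simp flip: ennreal_mult add: ennreal_le_iff)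
    moreover have "(\<lambda>n. (1 + inverse (real (Suc n)))\<^sup>2 * h) \<longlonglongrightarrow> (1 + 0)\<^sup>2 * h"
      by (intro tendsto_intros LIMSEQ_inverse_real_of_nat)
    ultimately have "q \<le> (1 + 0)\<^sup>2 * h"
      by (intro LIMSEQ_le_const) auto
    then show ?thesis using q real by (simp add: ennreal_leI)
  qed simp
qed

section \<open>The lateral surface of a cylinder\<close>

text \<open>The parametrisation of a lateral surface by arc length and height, used on \<open>strip r\<close>.\<close>

definition wrap :: "real^2 \<Rightarrow> real \<Rightarrow> real \<times> real \<Rightarrow> real^3" where
  "wrap c r q = vector [c$1 + r * cos (fst q / r), c$2 + r * sin (fst q / r), snd q]"

definition strip :: "real \<Rightarrow> (real \<times> real) set" where
  "strip r = {0..<2 * pi * r} \<times> {0<..<1}"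

definition lateral :: "real^2 \<Rightarrow> real \<Rightarrow> (real^3) set" where
  "lateral c r = {x. (x$1 - c$1)\<^sup>2 + (x$2 - c$2)\<^sup>2 = r\<^sup>2 \<and> 0 < x$3 \<and> x$3 < 1}"

lemma wrap_nth [simp]:
  "wrap c r q $ 1 = c$1 + r * cos (fst q / r)"
  "wrap c r q $ 2 = c$2 + r * sin (fst q / r)"
  "wrap c r q $ 3 = snd q"
  by (simp_all add: wrap_def)

lemma continuous_wrap: "continuous_on S (wrap c r)"
proof -
  have "continuous_on S (\<lambda>q. c$1 + r * cos (fst q / r))" "continuous_on S (\<lambda>q. c$2 + r * sin (fst q / r))"
    "continuous_on S (snd :: real \<times> real \<Rightarrow> real)"
    unfolding divide_inverse by (intro continuous_intros)+
  then have "continuous_on S (\<lambda>q. wrap c r q $ i)" for i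
    using exhaust_3[of i] by auto
  then have "continuous_on S (\<lambda>q. \<chi> i. wrap c r q $ i)"
    by (intro continuous_on_vec_lambda)
  then show ?thesis by simp
qed

lemma wrap_borel [measurable]: "wrap c r \<in> borel_measurable borel"
  using continuous_wrap borel_measurable_continuous_onI by blast

lemma strip_borel [measurable]: "strip r \<in> sets borel"
  unfolding strip_def borel_prod[symmetric] by (intro pair_measureI) auto

lemma lateral_borel [measurable]: "lateral c r \<in> sets borel"
  unfolding lateral_def by measurable

lemma wrap_image_strip:
  assumes "r > 0"
  shows "wrap c r ` strip r = lateral c r"
proof
  show "wrap c r ` strip r \<subseteq> lateral c r"
    using assms by (auto simp: strip_def lateral_def power_mult_distrib simp flip: distrib_left)
  show "lateral c r \<subseteq> wrap c r ` strip r"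
  proof
    fix x assume x: "x \<in> lateral c r"
    have "((x$1 - c$1) / r)\<^sup>2 + ((x$2 - c$2) / r)\<^sup>2 = 1"
      using x assms by (simp add: lateral_def power_divide flip: add_divide_distrib)
    from sincos_total_2pi[OF this] obtain t where t: "0 \<le> t" "t < 2 * pi" "(x$1 - c$1) / r = cos t" "(x$2 - c$2) / r = sin t" .
    have "(r * t, x$3) \<in> strip r"
      using t x assms by (auto simp: strip_def lateral_def mult_strict_left_mono mult.commute)
    moreover have "wrap c r (r * t, x$3) = x"
      using t(3,4) assms by (auto simp: vec_eq_iff forall_3 field_simps)
    ultimately show "x \<in> wrap c r ` strip r" by (metis image_eqI)
  qed
qed

lemma dist_wrap:
  assumes "r > 0"
  shows "(dist (wrap c r q) (wrap c r q'))\<^sup>2 = (2 * r * sin ((fst q - fst q') / (2 * r)))\<^sup>2 + (snd q - snd q')\<^sup>2"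
proof -
  define a b where "a = fst q / r" and "b = fst q' / r"
  have ab: "(fst q - fst q') / (2 * r) = (a - b) / 2" using assms by (simp add: a_def b_def field_simps)
  have s: "(sin ((a - b) / 2))\<^sup>2 = (1 - cos (a - b)) / 2"
  proof -
    have "cos (2 * ((a - b) / 2)) = 1 - 2 * (sin ((a - b) / 2))\<^sup>2" by (rule cos_double_sin)
    moreover have "2 * ((a - b) / 2) = a - b" by simp
    ultimately have "cos (a - b) = 1 - 2 * (sin ((a - b) / 2))\<^sup>2" by (simp only:)
    then show ?thesis by simp
  qed
  have "(cos a - cos b)\<^sup>2 + (sin a - sin b)\<^sup>2 = 2 - 2 * cos (a - b)"
    using sin_cos_squared_add[of a] sin_cos_squared_add[of b] by (simp add: power2_diff cos_diff algebra_simps)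
  then have c: "(cos a - cos b)\<^sup>2 + (sin a - sin b)\<^sup>2 = 4 * (sin ((a - b) / 2))\<^sup>2" using s by simp
  have "(dist (wrap c r q) (wrap c r q'))\<^sup>2 = (r * cos a - r * cos b)\<^sup>2 + (r * sin a - r * sin b)\<^sup>2 + (snd q - snd q')\<^sup>2"
    by (simp add: dist_norm norm_eq_sqrt_inner inner_vec_def sum_3 power2_eq_square a_def b_def)
  also have "\<dots> = r\<^sup>2 * ((cos a - cos b)\<^sup>2 + (sin a - sin b)\<^sup>2) + (snd q - snd q')\<^sup>2"
    by (simp add: power_mult_distrib distrib_left flip: right_diff_distrib)
  finally show ?thesis unfolding c ab by (simp add: power_mult_distrib)
qed

lemma wrap_nonexpansive:
  assumes "r > 0"
  shows "dist (wrap c r q) (wrap c r q') \<le> dist q q'"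
proof -
  let ?t = "(fst q - fst q') / (2 * r)"
  have "\<bar>2 * r * sin ?t\<bar> \<le> \<bar>fst q - fst q'\<bar>"
    using abs_sin_x_le_abs_x[of ?t] assms by (simp add: abs_mult field_simps)
  then have "(2 * r * sin ?t)\<^sup>2 \<le> (fst q - fst q')\<^sup>2" by (simp add: abs_le_square_iff)
  then have "(dist (wrap c r q) (wrap c r q'))\<^sup>2 \<le> (dist q q')\<^sup>2"
    unfolding dist_wrap[OF assms] by (cases q; cases q') (simp add: dist_Pair_Pair dist_real_def)
  then show ?thesis by (rule power2_le_imp_le) simp
qed

text \<open>Short chords of a circle are nearly as long as their arcs.\<close>

lemma sin_lower:
  assumes "\<kappa> > 0"
  shows "\<exists>s>0. \<forall>t. \<bar>t\<bar> \<le> pi / 2 \<and> \<bar>sin t\<bar> \<le> s \<longrightarrow> \<bar>t\<bar> \<le> (1 + \<kappa>) * \<bar>sin t\<bar>"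
proof -
  have "((\<lambda>x::real. sin x / x) \<longlongrightarrow> 1) (at 0)" by real_asymp
  moreover have "1 / (1 + \<kappa>) < 1" using assms by simp
  ultimately have "\<forall>\<^sub>F x in at 0. 1 / (1 + \<kappa>) < sin x / (x::real)" by (rule order_tendstoD(1))
  then obtain d where d: "d > 0" "\<And>x::real. x \<noteq> 0 \<Longrightarrow> dist x 0 < d \<Longrightarrow> 1 / (1 + \<kappa>) < sin x / x"
    unfolding eventually_at by auto
  define d' where "d' = min (d / 2) (pi / 2)"
  have d': "0 < d'" "d' < d" "d' \<le> pi / 2" using d pi_gt_zero by (auto simp: d'_def)
  have sd: "sin d' > 0" using d' by (intro sin_gt_zero) auto
  show ?thesis
  proof (intro exI[of _ "sin d' / 2"] conjI allI impI)
    show "sin d' / 2 > 0" using sd by simp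
    fix t :: real assume t: "\<bar>t\<bar> \<le> pi / 2 \<and> \<bar>sin t\<bar> \<le> sin d' / 2"
    have as: "\<bar>sin t\<bar> = sin \<bar>t\<bar>" using t sin_ge_zero[of t] sin_ge_zero[of "- t"] pi_gt_zero
      by (cases "t \<ge> 0") auto
    have "sin \<bar>t\<bar> < sin d'" using t sd as by linarith
    then have td: "\<bar>t\<bar> < d'" using t d' sin_mono_less_eq[of "\<bar>t\<bar>" d'] by auto
    show "\<bar>t\<bar> \<le> (1 + \<kappa>) * \<bar>sin t\<bar>"
    proof (cases "t = 0")
      case False
      then have "1 / (1 + \<kappa>) < sin \<bar>t\<bar> / \<bar>t\<bar>" using d(2)[of "\<bar>t\<bar>"] td d' by auto
      then show ?thesis using False assms as by (simp add: field_simps)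
    qed simp
  qed
qed

text \<open>The arc is at most half a turn, since on a longer one the endpoints may be close in space without being close
  along the arc.\<close>

lemma hausdorff_arc_lower:
  assumes r: "r > 0" and ab: "a \<le> b" "b \<le> a + pi * r"
  shows "ennreal (b - a) \<le> outer (wrap c r ` ({a<..<b} \<times> {0<..<1}))"
proof -
  let ?Q = "{a<..<b} \<times> {0<..<1::real}"
  have "emeasure lborel ?Q = emeasure (lborel \<Otimes>\<^sub>M lborel) ?Q" by (simp add: lborel_prod)
  also have "\<dots> = emeasure lborel {a<..<b} * emeasure lborel {0<..<1::real}"
    by (intro lborel.emeasure_pair_measure_Times) auto
  finally have e: "emeasure lborel ?Q = ennreal (b - a)" using ab by simp
  have "emeasure lborel ?Q \<le> outer (wrap c r ` ?Q)"
  proof (rule outer_image_lower)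
    show "?Q \<in> sets borel" unfolding borel_prod[symmetric] by (intro pair_measureI) auto
    show "bounded ?Q" by (intro bounded_Times) auto
    fix \<kappa> :: real assume \<kappa>: "\<kappa> > 0"
    obtain s where s: "s > 0" "\<And>t. \<bar>t\<bar> \<le> pi / 2 \<Longrightarrow> \<bar>sin t\<bar> \<le> s \<Longrightarrow> \<bar>t\<bar> \<le> (1 + \<kappa>) * \<bar>sin t\<bar>"
      using sin_lower[OF \<kappa>] by blast
    show "\<exists>\<delta>>0. \<forall>x\<in>?Q. \<forall>y\<in>?Q. dist (wrap c r x) (wrap c r y) \<le> \<delta> \<longrightarrow> dist x y \<le> (1 + \<kappa>) * dist (wrap c r x) (wrap c r y)"
    proof (intro exI[of _ "2 * r * s"] conjI ballI impI)
      show "2 * r * s > 0" using r s by simp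
      fix x y assume x: "x \<in> ?Q" and y: "y \<in> ?Q" and d: "dist (wrap c r x) (wrap c r y) \<le> 2 * r * s"
      let ?t = "(fst x - fst y) / (2 * r)"
      have "\<bar>fst x - fst y\<bar> \<le> pi * r" using x y ab by auto
      then have t1: "\<bar>?t\<bar> \<le> pi / 2" using r by (simp add: field_simps)
      have "(2 * r * sin ?t)\<^sup>2 \<le> (dist (wrap c r x) (wrap c r y))\<^sup>2" unfolding dist_wrap[OF r] by simp
      also have "\<dots> \<le> (2 * r * s)\<^sup>2" using d by (intro power_mono) auto
      finally have "\<bar>2 * r * sin ?t\<bar> \<le> 2 * r * s" using r s abs_le_square_iff[of "2 * r * sin ?t" "2 * r * s"] by simp
      then have t2: "\<bar>sin ?t\<bar> \<le> s" using r by (simp add: abs_mult)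
      have "\<bar>fst x - fst y\<bar> \<le> (1 + \<kappa>) * \<bar>2 * r * sin ?t\<bar>"
        using s(2)[OF t1 t2] r by (simp add: abs_mult field_simps)
      then have "\<bar>fst x - fst y\<bar>\<^sup>2 \<le> ((1 + \<kappa>) * \<bar>2 * r * sin ?t\<bar>)\<^sup>2" by (intro power_mono) auto
      then have 1: "(fst x - fst y)\<^sup>2 \<le> (1 + \<kappa>)\<^sup>2 * (2 * r * sin ?t)\<^sup>2" by (simp add: power_mult_distrib)
      have "1 \<le> (1 + \<kappa>)\<^sup>2" using \<kappa> by (simp add: one_le_power)
      then have 2: "(snd x - snd y)\<^sup>2 \<le> (1 + \<kappa>)\<^sup>2 * (snd x - snd y)\<^sup>2"
        using mult_right_mono[of 1 "(1 + \<kappa>)\<^sup>2" "(snd x - snd y)\<^sup>2"] by simp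
      have "(dist x y)\<^sup>2 = (fst x - fst y)\<^sup>2 + (snd x - snd y)\<^sup>2"
        by (cases x; cases y) (simp add: dist_Pair_Pair dist_real_def)
      also have "\<dots> \<le> (1 + \<kappa>)\<^sup>2 * ((2 * r * sin ?t)\<^sup>2 + (snd x - snd y)\<^sup>2)"
        using 1 2 by (simp add: distrib_left)
      also have "\<dots> = ((1 + \<kappa>) * dist (wrap c r x) (wrap c r y))\<^sup>2"
        unfolding power_mult_distrib[of "1 + \<kappa>"] dist_wrap[OF r] ..
      finally show "dist x y \<le> (1 + \<kappa>) * dist (wrap c r x) (wrap c r y)"
        by (rule power2_le_imp_le) (use \<kappa> in simp)
    qed
  qed
  then show ?thesis unfolding e .
qed

lemma emeasure_strip: "r > 0 \<Longrightarrow> emeasure lborel (strip r) = ennreal (2 * pi * r)"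
proof -
  assume r: "r > 0"
  have "emeasure lborel (strip r) = emeasure (lborel \<Otimes>\<^sub>M lborel) (strip r)" by (simp add: lborel_prod)
  also have "\<dots> = emeasure lborel {0..<2 * pi * r} * emeasure lborel {0<..<1::real}"
    unfolding strip_def by (intro lborel.emeasure_pair_measure_Times) auto
  finally show ?thesis using r by simp
qed

text \<open>One inequality holds for every Borel part of the surface and the reverse one, by half turns, for the whole
  surface. The measures being finite, they agree on every part.\<close>

theorem hausdorff2_lateral:
  assumes r: "r > 0" and B: "B \<in> sets borel"
  shows "emeasure hausdorff2 (B \<inter> lateral c r) = emeasure lborel (strip r \<inter> wrap c r -` B)"
proof -
  let ?H = "emeasure (hausdorff2 :: (real^3) measure)" and ?S = "lateral c r" and ?l = "emeasure lborel"
  let ?W = "\<lambda>B. strip r \<inter> wrap c r -` B"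
  have Wb: "?W B \<in> sets borel" if "B \<in> sets borel" for B
    using that wrap_borel by (metis Int_commute borel_prod measurable_sets_borel sets.Int strip_borel)
  have le: "?H (B \<inter> ?S) \<le> ?l (?W B)" if B: "B \<in> sets borel" for B
  proof -
    have "B \<inter> ?S = wrap c r ` ?W B" unfolding wrap_image_strip[OF r, symmetric] by auto
    moreover have "B \<inter> ?S \<in> sets borel" using B by auto
    ultimately have "?H (B \<inter> ?S) = outer (wrap c r ` ?W B)"
      using emeasure_hausdorff2 by metis
    also have "\<dots> \<le> ?l (?W B)"
      by (rule outer_image_borel[OF wrap_nonexpansive[OF r] Wb[OF B]])
    finally show ?thesis .
  qed
  have tot: "ennreal (2 * pi * r) \<le> ?H ?S"
  proof -
    let ?U = "{x. x$2 > c$2} :: (real^3) set" and ?L = "{x. x$2 < c$2} :: (real^3) set"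
    have m: "?U \<in> sets borel" "?L \<in> sets borel" by measurable
    have up: "ennreal (pi * r) \<le> ?H (?U \<inter> ?S)"
    proof -
      have "wrap c r ` ({0<..<pi * r} \<times> {0<..<1}) \<subseteq> ?U \<inter> ?S"
      proof (intro subsetI, elim imageE)
        fix x q assume x: "x = wrap c r q" and q: "q \<in> {0<..<pi * r} \<times> {0<..<1}"
        have "q \<in> strip r" using q r by (auto simp: strip_def)
        then have "x \<in> ?S" using x wrap_image_strip[OF r] by blast
        moreover have "sin (fst q / r) > 0" using q r by (intro sin_gt_zero) (auto simp: field_simps)
        ultimately show "x \<in> ?U \<inter> ?S" using x r by simp
      qed
      then have "outer (wrap c r ` ({0<..<pi * r} \<times> {0<..<1})) \<le> ?H (?U \<inter> ?S)"
        using m by (subst emeasure_hausdorff2) (auto intro!: outer_mono)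
      then show ?thesis using hausdorff_arc_lower[OF r, of 0 "pi * r" c] r by simp
    qed
    have lo: "ennreal (pi * r) \<le> ?H (?L \<inter> ?S)"
    proof -
      have "wrap c r ` ({pi * r<..<2 * pi * r} \<times> {0<..<1}) \<subseteq> ?L \<inter> ?S"
      proof (intro subsetI, elim imageE)
        fix x q assume x: "x = wrap c r q" and q: "q \<in> {pi * r<..<2 * pi * r} \<times> {0<..<1}"
        have "0 < pi * r" using r by simp
        then have "q \<in> strip r" using q by (auto simp: strip_def)
        then have "x \<in> ?S" using x wrap_image_strip[OF r] by blast
        moreover have "sin (fst q / r) < 0" using q r by (intro sin_lt_zero) (auto simp: field_simps)
        ultimately show "x \<in> ?L \<inter> ?S" using x r by (simp add: mult_pos_neg)
      qed
      then have "outer (wrap c r ` ({pi * r<..<2 * pi * r} \<times> {0<..<1})) \<le> ?H (?L \<inter> ?S)"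
        using m by (subst emeasure_hausdorff2) (auto intro!: outer_mono)
      then show ?thesis using hausdorff_arc_lower[OF r, of "pi * r" "2 * pi * r" c] r by simp
    qed
    have "ennreal (2 * pi * r) = ennreal (pi * r) + ennreal (pi * r)"
      using r by (simp flip: ennreal_plus)
    also have "\<dots> \<le> ?H (?U \<inter> ?S) + ?H (?L \<inter> ?S)" using up lo by (rule add_mono)
    also have "\<dots> = ?H ((?U \<inter> ?S) \<union> (?L \<inter> ?S))"
      using m by (intro plus_emeasure) auto
    also have "\<dots> \<le> ?H ?S" by (intro emeasure_mono) auto
    finally show ?thesis .
  qed
  have B': "- B \<in> sets borel" using B by auto
  have "?H ?S = ?H (B \<inter> ?S) + ?H (- B \<inter> ?S)"
    using B by (subst plus_emeasure) (auto intro!: arg_cong2[where f = emeasure])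
  moreover have "?l (strip r) = ?l (?W B) + ?l (?W (- B))"
    using Wb[OF B] Wb[OF B'] by (subst plus_emeasure) (auto intro!: arg_cong2[where f = emeasure])
  ultimately have sum: "?l (?W B) + ?l (?W (- B)) \<le> ?H (B \<inter> ?S) + ?H (- B \<inter> ?S)"
    using tot emeasure_strip[OF r] by simp
  have fin: "?l (?W (- B)) < \<infinity>"
    using emeasure_strip[OF r] emeasure_mono[of "?W (- B)" "strip r" lborel] Wb[OF B'] by (auto simp: less_top[symmetric] top_unique)
  have "?l (?W B) + ?l (?W (- B)) \<le> ?H (B \<inter> ?S) + ?l (?W (- B))"
    using sum le[OF B'] by (meson add_left_mono order_trans)
  then have "?l (?W B) \<le> ?H (B \<inter> ?S)"
    using fin by (auto simp: add.commute[of _ "?l (?W (- B))"] ennreal_add_left_cancel_le)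
  then show ?thesis using le[OF B] by (intro antisym)
qed

section \<open>Geometry of the cylinders\<close>

lemma alpha_nth [simp]: "alpha x $ 1 = x $ 1" "alpha x $ 2 = x $ 2"
  by (simp_all add: alpha_def)

lemma center_nth [simp]:
  "center \<epsilon> i $ 1 = \<epsilon> * of_int (fst i) + \<epsilon> / 2" "center \<epsilon> i $ 2 = \<epsilon> * of_int (snd i) + \<epsilon> / 2"
  by (simp_all add: center_def)

lemma dist2: "(dist (x::real^2) y)\<^sup>2 = (x$1 - y$1)\<^sup>2 + (x$2 - y$2)\<^sup>2"
  by (simp add: dist_norm norm_eq_sqrt_inner inner_vec_def sum_2 power2_eq_square)

lemma dist3: "(dist (x::real^3) y)\<^sup>2 = (x$1 - y$1)\<^sup>2 + (x$2 - y$2)\<^sup>2 + (x$3 - y$3)\<^sup>2"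
  by (simp add: dist_norm norm_eq_sqrt_inner inner_vec_def sum_3 power2_eq_square)

lemma mem_cball2:
  fixes y :: "real^2"
  assumes "r \<ge> 0"
  shows "y \<in> cball c r \<longleftrightarrow> (y$1 - c$1)\<^sup>2 + (y$2 - c$2)\<^sup>2 \<le> r\<^sup>2"
  using assms abs_le_square_iff[of "dist y c" r] unfolding mem_cball dist2[symmetric]
  by (simp add: dist_commute)

lemma continuous_alpha: "continuous_on S alpha"
proof -
  have "continuous_on S (\<lambda>x. alpha x $ i)" for i
    using exhaust_2[of i] linear_continuous_on[OF bounded_linear_vec_nth] by fastforce
  then have "continuous_on S (\<lambda>x. \<chi> i. alpha x $ i)" by (intro continuous_on_vec_lambda)
  then show ?thesis by simp
qed

lemma alpha_borel [measurable]: "alpha \<in> borel_measurable borel"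
  using continuous_alpha borel_measurable_continuous_onI by blast

lemma open_prism:
  assumes "open S"
  shows "open (prism S)"
proof -
  have "open (alpha -` S)" using assms continuous_alpha by (auto intro: open_vimage)
  moreover have "open {x::real^3. 0 < x$3}" "open {x::real^3. x$3 < 1}"
    by (auto intro!: open_Collect_less continuous_intros)
  moreover have "prism S = alpha -` S \<inter> {x. 0 < x$3} \<inter> {x. x$3 < 1}"
    by (auto simp: prism_def)
  ultimately show ?thesis by auto
qed

lemma bounded_prism:
  assumes "bounded S"
  shows "bounded (prism S)"
proof -
  obtain B where B: "\<And>y. y \<in> S \<Longrightarrow> norm y \<le> B" using assms by (auto simp: bounded_iff)
  have "norm x \<le> B + B + 1" if "x \<in> prism S" for x
  proof -
    have "norm x \<le> \<bar>x$1\<bar> + \<bar>x$2\<bar> + \<bar>x$3\<bar>"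
      using norm_le_l1_cart[of x] by (simp add: sum_3)
    moreover have "\<bar>x$1\<bar> \<le> norm (alpha x)" "\<bar>x$2\<bar> \<le> norm (alpha x)"
      using component_le_norm_cart[of "alpha x" 1] component_le_norm_cart[of "alpha x" 2] by auto
    ultimately show ?thesis using that B[of "alpha x"] by (auto simp: prism_def)
  qed
  then show ?thesis by (auto simp: bounded_iff)
qed

lemma mem_cyl:
  assumes "\<epsilon> > 0"
  shows "x \<in> cyl \<epsilon> i \<longleftrightarrow> (x$1 - center \<epsilon> i$1)\<^sup>2 + (x$2 - center \<epsilon> i$2)\<^sup>2 \<le> (\<epsilon>/4)\<^sup>2 \<and> 0 < x$3 \<and> x$3 < 1"
  using assms mem_cball2[of "\<epsilon> / 4" "alpha x" "center \<epsilon> i"] by (simp add: cyl_def prism_def)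

lemma mem_centred_interval:
  fixes a h t :: real
  shows "\<bar>t - (a + h / 2)\<bar> < h / 2 \<longleftrightarrow> a < t \<and> t < a + h"
proof
  assume "\<bar>t - (a + h / 2)\<bar> < h / 2"
  then have "t - (a + h / 2) < h / 2" "- (t - (a + h / 2)) < h / 2" by (simp_all only: abs_less_iff)
  then show "a < t \<and> t < a + h" by (intro conjI) linarith+
next
  assume "a < t \<and> t < a + h"
  then have "t - (a + h / 2) < h / 2" "- (t - (a + h / 2)) < h / 2" by linarith+
  then show "\<bar>t - (a + h / 2)\<bar> < h / 2" by (simp only: abs_less_iff)
qed

lemma mem_T_cell:
  "x \<in> T_cell \<epsilon> i \<longleftrightarrow> \<bar>x$1 - center \<epsilon> i$1\<bar> < \<epsilon> / 2 \<and> \<bar>x$2 - center \<epsilon> i$2\<bar> < \<epsilon> / 2 \<and> 0 < x$3 \<and> x$3 < 1"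
  unfolding center_nth mem_centred_interval by (auto simp: T_cell_def prism_def)

lemma square_sum_abs_less:
  fixes a b s :: real
  assumes "a\<^sup>2 + b\<^sup>2 < s\<^sup>2" "s > 0"
  shows "\<bar>a\<bar> < s" "\<bar>b\<bar> < s"
proof -
  have "a\<^sup>2 < s\<^sup>2" "b\<^sup>2 < s\<^sup>2" using assms zero_le_power2[of a] zero_le_power2[of b] by linarith+
  then show "\<bar>a\<bar> < s" "\<bar>b\<bar> < s" using assms(2) 
    by (metis power2_abs power2_less_imp_less less_imp_le)+
qed

text \<open>The disk of radius \<open>\<epsilon> / 2\<close> about a centre lies in the cell, so distinct cylinders are well
  separated.\<close>

lemma near_center_in_cell:
  assumes "\<epsilon> > 0" "(x$1 - center \<epsilon> i$1)\<^sup>2 + (x$2 - center \<epsilon> i$2)\<^sup>2 < (\<epsilon>/2)\<^sup>2" "0 < x$3" "x$3 < 1"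
  shows "x \<in> T_cell \<epsilon> i"
  using assms square_sum_abs_less[OF assms(2)] by (auto simp: mem_T_cell)

lemma cyl_subset_T_cell: "\<epsilon> > 0 \<Longrightarrow> cyl \<epsilon> i \<subseteq> T_cell \<epsilon> i"
proof
  fix x assume e: "\<epsilon> > 0" and "x \<in> cyl \<epsilon> i"
  moreover have "(\<epsilon>/4)\<^sup>2 < (\<epsilon>/2)\<^sup>2" using e by (intro power_strict_mono) auto
  ultimately show "x \<in> T_cell \<epsilon> i" by (intro near_center_in_cell) (auto simp: mem_cyl)
qed

lemma T_cell_disjoint:
  assumes "\<epsilon> > 0" "x \<in> T_cell \<epsilon> i" "x \<in> T_cell \<epsilon> k"
  shows "i = k"
proof -
  have u: "m = n" if "\<epsilon> * of_int m < t" "t < \<epsilon> * of_int m + \<epsilon>" "\<epsilon> * of_int n < t" "t < \<epsilon> * of_int n + \<epsilon>"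
    for m n :: int and t :: real
  proof -
    have "\<epsilon> * of_int m < \<epsilon> * of_int (n + 1)" "\<epsilon> * of_int n < \<epsilon> * of_int (m + 1)"
      using that by (auto simp: distrib_left)
    then have "m < n + 1" "n < m + 1"
      using assms(1) by (simp_all only: mult_less_cancel_left_pos of_int_less_iff)
    then show ?thesis by simp
  qed
  show ?thesis using assms(2,3) u[of "fst i" "x$1" "fst k"] u[of "snd i" "x$2" "snd k"]
    by (auto simp: T_cell_def prism_def prod_eq_iff)
qed

lemma finite_cells:
  assumes "bounded S" "\<epsilon> > 0"
  shows "finite {i. T_cell \<epsilon> i \<inter> S \<noteq> {}}"
proof -
  obtain B where B: "\<And>x. x \<in> S \<Longrightarrow> norm x \<le> B" using assms(1) by (auto simp: bounded_iff)
  define N where "N = \<lceil>B / \<epsilon>\<rceil> + 1"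
  have "{i. T_cell \<epsilon> i \<inter> S \<noteq> {}} \<subseteq> {- N - 1..N} \<times> {- N - 1..N}"
  proof
    fix i assume "i \<in> {i. T_cell \<epsilon> i \<inter> S \<noteq> {}}"
    then obtain x where x: "x \<in> T_cell \<epsilon> i" "x \<in> S" by auto
    have b: "n \<in> {- N - 1..N}" if "\<epsilon> * of_int n < t" "t < \<epsilon> * of_int n + \<epsilon>" "\<bar>t\<bar> \<le> B" for n :: int and t
    proof -
      have "of_int n < B / \<epsilon>" "- (B / \<epsilon>) < of_int n + 1"
        using that assms(2) by (auto simp: field_simps)
      moreover have "B / \<epsilon> \<le> of_int \<lceil>B / \<epsilon>\<rceil>" by linarith
      ultimately have "of_int n < (of_int N :: real)" "- of_int N < (of_int n + 1 :: real)"
        unfolding N_def of_int_add of_int_1 by linarith+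
      then have "of_int n < (of_int N :: real)" "of_int (- N) < (of_int (n + 1) :: real)" by auto
      then show ?thesis unfolding of_int_less_iff by auto
    qed
    have "\<bar>x$1\<bar> \<le> B" "\<bar>x$2\<bar> \<le> B" using B[OF x(2)] component_le_norm_cart[of x] by (meson order_trans)+
    then show "i \<in> {- N - 1..N} \<times> {- N - 1..N}"
      using x(1) b[of "fst i" "x$1"] b[of "snd i" "x$2"] by (cases i) (auto simp: T_cell_def prism_def)
  qed
  then show ?thesis by (rule finite_subset) auto
qed

lemma T_cell_center: "\<epsilon> > 0 \<Longrightarrow> (\<chi> j. if j = 3 then 1 / 2 else if j = 1 then center \<epsilon> i$1 else center \<epsilon> i$2) \<in> cyl \<epsilon> i"
  by (simp add: mem_cyl)

lemma finite_cyl_index: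
  assumes "bounded \<Omega>" "\<epsilon> > 0"
  shows "finite (cyl_index \<Omega> \<epsilon>)"
proof (rule finite_subset[OF _ finite_cells[OF assms]])
  show "cyl_index \<Omega> \<epsilon> \<subseteq> {i. T_cell \<epsilon> i \<inter> \<Omega> \<noteq> {}}"
    using T_cell_center[OF assms(2)] cyl_subset_T_cell[OF assms(2)] unfolding cyl_index_def by blast
qed

lemma T_cell_borel [measurable]: "T_cell \<epsilon> i \<in> sets borel"
proof -
  have "{x::real^3. \<bar>x$1 - center \<epsilon> i$1\<bar> < \<epsilon> / 2 \<and> \<bar>x$2 - center \<epsilon> i$2\<bar> < \<epsilon> / 2 \<and> 0 < x$3 \<and> x$3 < 1} \<in> sets borel"
    by measurable
  moreover have "T_cell \<epsilon> i = {x::real^3. \<bar>x$1 - center \<epsilon> i$1\<bar> < \<epsilon> / 2 \<and> \<bar>x$2 - center \<epsilon> i$2\<bar> < \<epsilon> / 2 \<and> 0 < x$3 \<and> x$3 < 1}"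
    by (rule set_eqI) (simp only: mem_T_cell mem_Collect_eq)
  ultimately show ?thesis by simp
qed

lemma cyl_borel [measurable]: "\<epsilon> > 0 \<Longrightarrow> cyl \<epsilon> i \<in> sets borel"
proof -
  assume e: "\<epsilon> > 0"
  have "{x::real^3. (x$1 - center \<epsilon> i$1)\<^sup>2 + (x$2 - center \<epsilon> i$2)\<^sup>2 \<le> (\<epsilon>/4)\<^sup>2 \<and> 0 < x$3 \<and> x$3 < 1} \<in> sets borel"
    by measurable
  moreover have "cyl \<epsilon> i = {x::real^3. (x$1 - center \<epsilon> i$1)\<^sup>2 + (x$2 - center \<epsilon> i$2)\<^sup>2 \<le> (\<epsilon>/4)\<^sup>2 \<and> 0 < x$3 \<and> x$3 < 1}"
    by (rule set_eqI) (simp only: mem_cyl[OF e] mem_Collect_eq)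
  ultimately show ?thesis by simp
qed

lemma E2_borel: "bounded \<Omega> \<Longrightarrow> \<epsilon> > 0 \<Longrightarrow> E2 \<Omega> \<epsilon> \<in> sets borel"
  unfolding E2_def using finite_cyl_index by (intro sets.finite_UN) auto

lemma E2_subset: "E2 \<Omega> \<epsilon> \<subseteq> \<Omega>"
  by (auto simp: E2_def cyl_index_def)

text \<open>A union of finitely many cylinders is closed relative to the slab, and a point of a lateral surface can be moved
  radially outwards without entering another cylinder.\<close>

lemma frontier_E2:
  assumes "\<epsilon> > 0" "bounded \<Omega>" "\<Omega> = prism \<omega>" "open \<omega>"
  shows "\<Omega> \<inter> frontier (E2 \<Omega> \<epsilon>) = (\<Union>i\<in>cyl_index \<Omega> \<epsilon>. lateral (center \<epsilon> i) (\<epsilon> / 4))"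
proof -
  let ?I = "cyl_index \<Omega> \<epsilon>" and ?r = "\<epsilon> / 4"
  let ?q = "\<lambda>i x::real^3. (x$1 - center \<epsilon> i$1)\<^sup>2 + (x$2 - center \<epsilon> i$2)\<^sup>2"
  have fin: "finite ?I" using finite_cyl_index assms by blast
  have slab: "0 < x$3 \<and> x$3 < 1" if "x \<in> \<Omega>" for x using that assms(3) by (simp add: prism_def)
  have cq: "continuous_on UNIV (?q i)" for i by (intro continuous_intros)
  let ?D = "\<Union>i\<in>?I. {x::real^3. ?q i x \<le> ?r\<^sup>2}"
  have D: "closed ?D" using fin by (intro closed_UN ballI) (auto intro!: closed_Collect_le continuous_intros)
  have E2D: "E2 \<Omega> \<epsilon> = ?D \<inter> {x. 0 < x$3 \<and> x$3 < 1}"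
    using mem_cyl[OF assms(1)] by (auto simp: E2_def)
  have cl: "x \<in> ?D" if "x \<in> closure (E2 \<Omega> \<epsilon>)" for x
    using that closure_minimal[OF _ D, of "E2 \<Omega> \<epsilon>"] E2D by blast
  show ?thesis
  proof (intro equalityI subsetI)
    fix x assume x: "x \<in> \<Omega> \<inter> frontier (E2 \<Omega> \<epsilon>)"
    then obtain i where i: "i \<in> ?I" "?q i x \<le> ?r\<^sup>2" using cl[of x] unfolding frontier_def by blast
    have "\<not> ?q i x < ?r\<^sup>2"
    proof
      assume lt: "?q i x < ?r\<^sup>2"
      let ?O = "{y. ?q i y < ?r\<^sup>2} \<inter> {y. 0 < y$3} \<inter> {y. y$3 < 1}"
      have "open ?O" by (intro open_Int open_Collect_less continuous_intros)
      moreover have "?O \<subseteq> E2 \<Omega> \<epsilon>" using i(1) by (auto simp: E2D intro!: bexI[of _ i])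
      moreover have "x \<in> ?O" using lt slab[of x] x by simp
      ultimately have "x \<in> interior (E2 \<Omega> \<epsilon>)" by (meson interiorI)
      then show False using x by (simp add: frontier_def)
    qed
    then show "x \<in> (\<Union>i\<in>?I. lateral (center \<epsilon> i) ?r)"
      using i slab[of x] x by (auto simp: lateral_def intro!: bexI[of _ i])
  next
    fix x assume "x \<in> (\<Union>i\<in>?I. lateral (center \<epsilon> i) ?r)"
    then obtain i where i: "i \<in> ?I" "?q i x = ?r\<^sup>2" "0 < x$3" "x$3 < 1" by (auto simp: lateral_def)
    have xc: "x \<in> cyl \<epsilon> i" using i mem_cyl[OF assms(1)] by simp
    then have xE: "x \<in> E2 \<Omega> \<epsilon>" "x \<in> \<Omega>" using i(1) unfolding E2_def cyl_index_def by blast+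
    have "x \<notin> interior (E2 \<Omega> \<epsilon>)"
    proof
      assume "x \<in> interior (E2 \<Omega> \<epsilon>)"
      then obtain e where e: "e > 0" "ball x e \<subseteq> E2 \<Omega> \<epsilon>" by (meson mem_interior)
      define t where "t = min (1 / 2) (e / \<epsilon>)"
      have t: "0 < t" "t < 1" "t * \<epsilon> \<le> e"
        using e assms(1) by (auto simp: t_def min_def field_simps)
      \<comment> \<open>moving radially outwards by the factor \<open>1 + t\<close> leaves the cylinder but stays in the cell\<close>
      define y :: "real^3" where "y = (\<chi> j. if j = 3 then x$3 else if j = 1 then x$1 + t * (x$1 - center \<epsilon> i$1)
           else x$2 + t * (x$2 - center \<epsilon> i$2))"
      have y: "y$3 = x$3" "y$1 = x$1 + t * (x$1 - center \<epsilon> i$1)" "y$2 = x$2 + t * (x$2 - center \<epsilon> i$2)"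
        by (auto simp: y_def)
      have "(dist x y)\<^sup>2 = t\<^sup>2 * ?q i x"
        unfolding dist3 y by (simp add: power_mult_distrib distrib_left del: center_nth)
      also have "\<dots> = (t * ?r)\<^sup>2" by (simp only: i(2) power_mult_distrib)
      finally have "dist x y = t * ?r" using t assms(1) by (simp add: power2_eq_iff_nonneg)
      also have "\<dots> < e" using t assms(1) e by (simp add: field_simps)
      finally have "y \<in> E2 \<Omega> \<epsilon>" using e(2) by auto
      then obtain k where k: "k \<in> ?I" "y \<in> cyl \<epsilon> k" by (auto simp: E2_def)
      have "?q i y = (1 + t)\<^sup>2 * ?q i x" by (simp add: y power2_eq_square algebra_simps)
      then have qy: "?q i y = ((1 + t) * ?r)\<^sup>2" by (simp only: i(2) power_mult_distrib)
      have "((1 + t) * ?r)\<^sup>2 < (\<epsilon> / 2)\<^sup>2" using t assms(1) by (intro power_strict_mono) auto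
      then have "y \<in> T_cell \<epsilon> i"
        using qy i y by (intro near_center_in_cell assms(1)) auto
      then have "k = i" using k cyl_subset_T_cell[OF assms(1)] T_cell_disjoint[OF assms(1)] by blast
      then have "((1 + t) * ?r)\<^sup>2 \<le> ?r\<^sup>2" using k qy mem_cyl[OF assms(1)] by simp
      then have "(1 + t) * ?r \<le> ?r" by (rule power2_le_imp_le) (use assms(1) in simp)
      then show False using mult_pos_pos[OF t(1) assms(1)] by (simp add: field_simps)
    qed
    then show "x \<in> \<Omega> \<inter> frontier (E2 \<Omega> \<epsilon>)" using xE closure_subset by (auto simp: frontier_def)
  qed
qed

section \<open>Integration against \<open>\<mu>\<^sub>\<epsilon>\<close>\<close>

lemma sets_mu [simp, measurable_cong]: "sets (mu \<Omega> \<epsilon>) = sets borel"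
  and space_mu [simp]: "space (mu \<Omega> \<epsilon>) = UNIV"
  unfolding mu_def using sets.sigma_sets_eq[of borel] by auto

text \<open>The set function in the definition is countably additive, so that \<^const>\<open>measure_of\<close> does not fall back
  to the zero measure.\<close>

lemma emeasure_mu:
  assumes "B \<in> sets borel"
  shows "emeasure (mu \<Omega> \<epsilon>) B = ennreal \<epsilon> * emeasure hausdorff2 (B \<inter> frontier (E2 \<Omega> \<epsilon>))"
proof -
  let ?F = "frontier (E2 \<Omega> \<epsilon>)"
  let ?m = "\<lambda>B. ennreal \<epsilon> * emeasure hausdorff2 (B \<inter> ?F)"
  have "countably_additive (sets borel) ?m"
  proof (rule countably_additiveI)
    fix A :: "nat \<Rightarrow> (real^3) set"
    assume A: "range A \<subseteq> sets borel" "disjoint_family A" "(\<Union>i. A i) \<in> sets borel"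
    have "range (\<lambda>i. A i \<inter> ?F) \<subseteq> sets hausdorff2" using A(1) by (auto simp: image_subset_iff)
    moreover have "disjoint_family (\<lambda>i. A i \<inter> ?F)" using A(2) by (auto simp: disjoint_family_on_def)
    ultimately have "(\<Sum>i. emeasure hausdorff2 (A i \<inter> ?F)) = emeasure hausdorff2 (\<Union>i. A i \<inter> ?F)"
      by (rule suminf_emeasure)
    then show "(\<Sum>i. ?m (A i)) = ?m (\<Union>i. A i)" by simp
  qed
  then show ?thesis
    unfolding mu_def
    by (intro emeasure_measure_of_sigma)
       (use assms sets.sigma_algebra_axioms[of borel] in \<open>auto simp: positive_def\<close>)
qed

locale perforated =
  fixes \<omega> :: "(real^2) set" and \<Omega> :: "(real^3) set" and \<epsilon> :: real
  assumes open_\<omega>: "open \<omega>" and bounded_\<omega>: "bounded \<omega>" and \<Omega>_eq: "\<Omega> = prism \<omega>" and \<epsilon>_pos: "\<epsilon> > 0"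
begin

abbreviation "I \<equiv> cyl_index \<Omega> \<epsilon>"
abbreviation "rad \<equiv> \<epsilon> / 4"
abbreviation "M \<equiv> mu \<Omega> \<epsilon>"
abbreviation "wr i \<equiv> wrap (center \<epsilon> i) rad"

lemma open_\<Omega>: "open \<Omega>" and bounded_\<Omega>: "bounded \<Omega>"
  using open_prism[OF open_\<omega>] bounded_prism[OF bounded_\<omega>] by (simp_all add: \<Omega>_eq)

lemma \<Omega>_borel [measurable]: "\<Omega> \<in> sets borel" using open_\<Omega> by simp

lemma \<Omega>_lmeasurable: "\<Omega> \<in> lmeasurable" using open_\<Omega> bounded_\<Omega> lmeasurable_open by blast

lemma rad_pos: "rad > 0" using \<epsilon>_pos by simp

lemma finite_I: "finite I" using finite_cyl_index bounded_\<Omega> \<epsilon>_pos by blast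

lemma lateral_subset_cyl: "lateral (center \<epsilon> i) rad \<subseteq> cyl \<epsilon> i"
proof
  fix x assume "x \<in> lateral (center \<epsilon> i) rad"
  then show "x \<in> cyl \<epsilon> i" unfolding mem_cyl[OF \<epsilon>_pos] lateral_def by simp
qed

lemma wr_cyl: "q \<in> strip rad \<Longrightarrow> wr i q \<in> cyl \<epsilon> i"
  using wrap_image_strip[OF rad_pos, of "center \<epsilon> i"] lateral_subset_cyl by blast

lemma wr_\<Omega>: "i \<in> I \<Longrightarrow> q \<in> strip rad \<Longrightarrow> wr i q \<in> \<Omega>"
  using wr_cyl[of q i] unfolding cyl_index_def by blast

lemma emeasure_M:
  assumes B: "B \<in> sets borel" "B \<subseteq> \<Omega>"
  shows "emeasure M B = ennreal \<epsilon> * (\<Sum>i\<in>I. emeasure lborel (strip rad \<inter> wr i -` B))"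
proof -
  have fr: "B \<inter> frontier (E2 \<Omega> \<epsilon>) = (\<Union>i\<in>I. B \<inter> lateral (center \<epsilon> i) rad)"
    using frontier_E2[OF \<epsilon>_pos bounded_\<Omega> \<Omega>_eq open_\<omega>] B(2) by blast
  have lc: "lateral (center \<epsilon> i) rad \<subseteq> T_cell \<epsilon> i" for i
    using cyl_subset_T_cell[OF \<epsilon>_pos] lateral_subset_cyl by blast
  have "disjoint_family_on (\<lambda>i. B \<inter> lateral (center \<epsilon> i) rad) I"
    using T_cell_disjoint[OF \<epsilon>_pos] lc unfolding disjoint_family_on_def by blast
  moreover have "(\<lambda>i. B \<inter> lateral (center \<epsilon> i) rad) ` I \<subseteq> sets hausdorff2" using B by auto
  ultimately have "emeasure hausdorff2 (\<Union>i\<in>I. B \<inter> lateral (center \<epsilon> i) rad) = (\<Sum>i\<in>I. emeasure hausdorff2 (B \<inter> lateral (center \<epsilon> i) rad))"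
    using finite_I by (intro sum_emeasure[symmetric])
  then show ?thesis
    unfolding emeasure_mu[OF B(1)] fr using hausdorff2_lateral[OF rad_pos B(1)] by simp
qed

text \<open>On \<open>\<Omega>\<close> the measure \<open>\<mu>\<^sub>\<epsilon>\<close> is \<open>\<epsilon>\<close> times the sum of the area measures transported from the strips.\<close>

lemma nn_integral_M:
  assumes "f \<in> borel_measurable borel"
  shows "(\<integral>\<^sup>+x. f x * indicator \<Omega> x \<partial>M) = ennreal \<epsilon> * (\<Sum>i\<in>I. \<integral>\<^sup>+q. f (wr i q) * indicator (strip rad) q \<partial>lborel)"
  using assms
proof (induction f rule: borel_measurable_induct)
  case (cong f g)
  then show ?case by simp
next
  case (set A)
  have [measurable]: "A \<in> sets borel" using set by simp
  have W: "strip rad \<inter> wr i -` A \<in> sets borel" for i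
    using measurable_sets_borel[OF wrap_borel, of A "center \<epsilon> i" rad] strip_borel by auto
  have "(\<integral>\<^sup>+x. indicator A x * indicator \<Omega> x \<partial>M) = (\<integral>\<^sup>+x. indicator (A \<inter> \<Omega>) x \<partial>M)"
    by (intro nn_integral_cong) (auto simp: indicator_def)
  also have "\<dots> = emeasure M (A \<inter> \<Omega>)" by (rule nn_integral_indicator) simp
  also have "\<dots> = ennreal \<epsilon> * (\<Sum>i\<in>I. emeasure lborel (strip rad \<inter> wr i -` (A \<inter> \<Omega>)))"
    by (intro emeasure_M) auto
  also have "(\<Sum>i\<in>I. emeasure lborel (strip rad \<inter> wr i -` (A \<inter> \<Omega>))) = (\<Sum>i\<in>I. emeasure lborel (strip rad \<inter> wr i -` A))"
    using wr_\<Omega> by (intro sum.cong arg_cong2[where f = emeasure]) auto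
  also have "\<dots> = (\<Sum>i\<in>I. \<integral>\<^sup>+q. indicator A (wr i q) * indicator (strip rad) q \<partial>lborel)"
  proof (intro sum.cong refl)
    fix i
    have "emeasure lborel (strip rad \<inter> wr i -` A) = (\<integral>\<^sup>+q. indicator (strip rad \<inter> wr i -` A) q \<partial>lborel)"
      using W by simp
    also have "\<dots> = (\<integral>\<^sup>+q. indicator A (wr i q) * indicator (strip rad) q \<partial>lborel)"
      by (intro nn_integral_cong) (auto simp: indicator_def)
    finally show "emeasure lborel (strip rad \<inter> wr i -` A) = (\<integral>\<^sup>+q. indicator A (wr i q) * indicator (strip rad) q \<partial>lborel)" .
  qed
  finally show ?case .
next
  case (mult u c)
  note [measurable] = mult(2)
  have "(\<integral>\<^sup>+x. c * u x * indicator \<Omega> x \<partial>M) = c * (\<integral>\<^sup>+x. u x * indicator \<Omega> x \<partial>M)"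
    by (subst nn_integral_cmult[symmetric]) (auto simp: mult.assoc)
  moreover have "(\<integral>\<^sup>+q. c * u (wr i q) * indicator (strip rad) q \<partial>lborel) = c * (\<integral>\<^sup>+q. u (wr i q) * indicator (strip rad) q \<partial>lborel)" for i
    by (subst nn_integral_cmult[symmetric]) (auto simp: mult.assoc)
  ultimately show ?case using mult by (simp add: sum_distrib_left[symmetric] mult.left_commute)
next
  case (add u v)
  note [measurable] = add(1) add(3)
  have "(\<integral>\<^sup>+x. (u x + v x) * indicator \<Omega> x \<partial>M) = (\<integral>\<^sup>+x. u x * indicator \<Omega> x \<partial>M) + (\<integral>\<^sup>+x. v x * indicator \<Omega> x \<partial>M)"
    by (subst nn_integral_add[symmetric]) (auto simp: distrib_right)
  moreover have "(\<integral>\<^sup>+q. (u (wr i q) + v (wr i q)) * indicator (strip rad) q \<partial>lborel) =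
      (\<integral>\<^sup>+q. u (wr i q) * indicator (strip rad) q \<partial>lborel) + (\<integral>\<^sup>+q. v (wr i q) * indicator (strip rad) q \<partial>lborel)" for i
    by (subst nn_integral_add[symmetric]) (auto simp: distrib_right)
  ultimately show ?case using add by (simp add: sum.distrib distrib_left add_ac)
next
  case (seq U)
  note [measurable] = seq(1)
  have inc: "incseq (\<lambda>j. U j x * c)" for x and c :: ennreal
    using seq(3) by (auto simp: incseq_def le_fun_def intro!: mult_right_mono)
  have s: "(SUP j. U j) x * c = (SUP j. U j x * c)" for x and c :: ennreal
    by (simp add: Sup_fun_def image_image SUP_mult_right_ennreal)
  have "(\<integral>\<^sup>+x. (SUP j. U j) x * indicator \<Omega> x \<partial>M) = (SUP j. \<integral>\<^sup>+x. U j x * indicator \<Omega> x \<partial>M)"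
    unfolding s using inc by (intro nn_integral_monotone_convergence_SUP) (auto simp: incseq_def le_fun_def)
  also have "\<dots> = (SUP j. ennreal \<epsilon> * (\<Sum>i\<in>I. \<integral>\<^sup>+q. U j (wr i q) * indicator (strip rad) q \<partial>lborel))"
    by (simp only: seq.IH)
  also have "\<dots> = ennreal \<epsilon> * (SUP j. (\<Sum>i\<in>I. \<integral>\<^sup>+q. U j (wr i q) * indicator (strip rad) q \<partial>lborel))"
    by (simp add: SUP_mult_left_ennreal)
  also have "(SUP j. (\<Sum>i\<in>I. \<integral>\<^sup>+q. U j (wr i q) * indicator (strip rad) q \<partial>lborel)) =
      (\<Sum>i\<in>I. SUP j. \<integral>\<^sup>+q. U j (wr i q) * indicator (strip rad) q \<partial>lborel)"
  proof (rule ennreal_SUP_sum)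
    fix i
    show "incseq (\<lambda>j. \<integral>\<^sup>+q. U j (wr i q) * indicator (strip rad) q \<partial>lborel)"
      using inc by (auto simp: incseq_def intro!: nn_integral_mono)
  qed
  also have "\<dots> = (\<Sum>i\<in>I. \<integral>\<^sup>+q. (SUP j. U j) (wr i q) * indicator (strip rad) q \<partial>lborel)"
    unfolding s using inc
    by (intro sum.cong refl nn_integral_monotone_convergence_SUP[symmetric]) (auto simp: incseq_def le_fun_def)
  finally show ?case .
qed

lemma emeasure_M_finite: "emeasure M \<Omega> < \<infinity>"
proof -
  have "emeasure lborel (strip rad \<inter> wr i -` \<Omega>) < \<infinity>" for i
  proof -
    have "emeasure lborel (strip rad \<inter> wr i -` \<Omega>) \<le> emeasure lborel (strip rad)" by (intro emeasure_mono) auto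
    also have "\<dots> < \<infinity>" using emeasure_strip[OF rad_pos] by simp
    finally show ?thesis .
  qed
  then show ?thesis using emeasure_M[of \<Omega>] finite_I by (simp add: ennreal_mult_less_top)
qed

lemma bounded_integrable_M:
  fixes f :: "real^3 \<Rightarrow> 'b::{banach, second_countable_topology}"
  assumes [measurable]: "f \<in> borel_measurable borel" and b: "\<And>x. x \<in> \<Omega> \<Longrightarrow> norm (f x) \<le> B"
  shows "set_integrable M \<Omega> f"
proof -
  have "integrable M (\<lambda>x. B * indicator \<Omega> x)"
    using emeasure_M_finite by (intro integrable_mult_right integrable_real_indicator) auto
  then show ?thesis
    unfolding set_integrable_def
    by (rule Bochner_Integration.integrable_bound) (auto simp: indicator_def intro!: AE_I2 dest: b intro: order_trans[OF _ abs_ge_self])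
qed

lemma strip_integrable:
  assumes [measurable]: "f \<in> borel_measurable borel" and b: "\<And>q. q \<in> strip rad \<Longrightarrow> \<bar>f q\<bar> \<le> B"
  shows "set_integrable lborel (strip rad) (f :: _ \<Rightarrow> real)"
proof -
  have "integrable lborel (\<lambda>x. B * indicator (strip rad) x)"
    using emeasure_strip[OF rad_pos] by (intro integrable_mult_right integrable_real_indicator) auto
  then show ?thesis
    unfolding set_integrable_def
    by (rule Bochner_Integration.integrable_bound) (auto simp: indicator_def intro!: AE_I2 dest: b intro: order_trans[OF _ abs_ge_self])
qed

lemma integral_M_nonneg:
  assumes [measurable]: "f \<in> borel_measurable borel" and b: "\<And>x. x \<in> \<Omega> \<Longrightarrow> 0 \<le> f x \<and> f x \<le> (B::real)"
  shows "(LINT x:\<Omega>|M. f x) = \<epsilon> * (\<Sum>i\<in>I. LINT q:strip rad|lborel. f (wr i q))"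
proof -
  have 1: "ennreal (LINT x:\<Omega>|M. f x) = (\<integral>\<^sup>+x. ennreal (f x) * indicator \<Omega> x \<partial>M)"
  proof -
    have "set_integrable M \<Omega> f" by (rule bounded_integrable_M[where B = B]) (use b in auto)
    then have "(\<integral>\<^sup>+x. ennreal (indicator \<Omega> x *\<^sub>R f x) \<partial>M) = ennreal (LINT x:\<Omega>|M. f x)"
      unfolding set_integrable_def set_lebesgue_integral_def
      by (intro nn_integral_eq_integral) (auto simp: indicator_def dest: b)
    moreover have "(\<integral>\<^sup>+x. ennreal (indicator \<Omega> x *\<^sub>R f x) \<partial>M) = (\<integral>\<^sup>+x. ennreal (f x) * indicator \<Omega> x \<partial>M)"
      by (intro nn_integral_cong) (auto simp: indicator_def)
    ultimately show ?thesis by simp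
  qed
  have 2: "(\<integral>\<^sup>+q. ennreal (f (wr i q)) * indicator (strip rad) q \<partial>lborel) = ennreal (LINT q:strip rad|lborel. f (wr i q))"
    and 3: "0 \<le> (LINT q:strip rad|lborel. f (wr i q))" if i: "i \<in> I" for i
  proof -
    have bb: "0 \<le> f (wr i q) \<and> f (wr i q) \<le> B" if "q \<in> strip rad" for q using b wr_\<Omega>[OF i that] by blast
    have "set_integrable lborel (strip rad) (\<lambda>q. f (wr i q))"
      by (rule strip_integrable[where B = B]) (use bb in auto)
    then have "(\<integral>\<^sup>+q. ennreal (indicator (strip rad) q *\<^sub>R f (wr i q)) \<partial>lborel) = ennreal (LINT q:strip rad|lborel. f (wr i q))"
      unfolding set_integrable_def set_lebesgue_integral_def
      by (intro nn_integral_eq_integral) (auto simp: indicator_def dest: bb)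
    moreover have "(\<integral>\<^sup>+q. ennreal (indicator (strip rad) q *\<^sub>R f (wr i q)) \<partial>lborel) = (\<integral>\<^sup>+q. ennreal (f (wr i q)) * indicator (strip rad) q \<partial>lborel)"
      by (intro nn_integral_cong) (auto simp: indicator_def)
    ultimately show "(\<integral>\<^sup>+q. ennreal (f (wr i q)) * indicator (strip rad) q \<partial>lborel) = ennreal (LINT q:strip rad|lborel. f (wr i q))" by simp
    show "0 \<le> (LINT q:strip rad|lborel. f (wr i q))"
      unfolding set_lebesgue_integral_def by (intro integral_nonneg_AE AE_I2) (auto simp: indicator_def dest: bb)
  qed
  have "ennreal (LINT x:\<Omega>|M. f x) = ennreal \<epsilon> * (\<Sum>i\<in>I. \<integral>\<^sup>+q. ennreal (f (wr i q)) * indicator (strip rad) q \<partial>lborel)"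
    unfolding 1 by (intro nn_integral_M) auto
  also have "\<dots> = ennreal \<epsilon> * (\<Sum>i\<in>I. ennreal (LINT q:strip rad|lborel. f (wr i q)))"
    using 2 by simp
  also have "\<dots> = ennreal (\<epsilon> * (\<Sum>i\<in>I. LINT q:strip rad|lborel. f (wr i q)))"
    using 3 \<epsilon>_pos by (simp add: sum_ennreal ennreal_mult sum_nonneg)
  finally show ?thesis
  proof (rule ennreal_inj[THEN iffD1, rotated -1])
    show "0 \<le> (LINT x:\<Omega>|M. f x)"
      unfolding set_lebesgue_integral_def by (intro integral_nonneg_AE AE_I2) (auto simp: indicator_def dest: b)
    show "0 \<le> \<epsilon> * (\<Sum>i\<in>I. LINT q:strip rad|lborel. f (wr i q))"
      using 3 \<epsilon>_pos by (intro mult_nonneg_nonneg sum_nonneg) auto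
  qed
qed

theorem integral_M:
  assumes [measurable]: "f \<in> borel_measurable borel" and b: "\<And>x. x \<in> \<Omega> \<Longrightarrow> \<bar>f x\<bar> \<le> (B::real)"
  shows "(LINT x:\<Omega>|M. f x) = \<epsilon> * (\<Sum>i\<in>I. LINT q:strip rad|lborel. f (wr i q))"
proof -
  have i1: "set_integrable M \<Omega> f" by (rule bounded_integrable_M[where B = B]) (use b in auto)
  have i2: "set_integrable lborel (strip rad) (\<lambda>q. f (wr i q))" if "i \<in> I" for i
    by (rule strip_integrable[where B = B]) (use b wr_\<Omega>[OF that] in auto)
  have c1: "set_integrable M \<Omega> (\<lambda>x. B)" by (rule bounded_integrable_M[where B = "\<bar>B\<bar>"]) auto
  have c2: "set_integrable lborel (strip rad) (\<lambda>x. B)" by (rule strip_integrable[where B = "\<bar>B\<bar>"]) auto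
  have B0: "0 \<le> B" if "x \<in> \<Omega>" for x using b[OF that] by linarith
  have "(LINT x:\<Omega>|M. f x + B) = \<epsilon> * (\<Sum>i\<in>I. LINT q:strip rad|lborel. f (wr i q) + B)"
    by (rule integral_M_nonneg[where B = "2 * B"]) (use b in \<open>auto simp: abs_le_iff\<close>, fastforce)
  moreover have "(LINT x:\<Omega>|M. B) = \<epsilon> * (\<Sum>i\<in>I. LINT q:strip rad|lborel. B)"
    by (rule integral_M_nonneg[where B = B]) (use B0 in auto)
  moreover have "(LINT x:\<Omega>|M. f x + B) = (LINT x:\<Omega>|M. f x) + (LINT x:\<Omega>|M. B)"
    using i1 c1 by (rule set_integral_add)
  moreover have "(\<Sum>i\<in>I. LINT q:strip rad|lborel. f (wr i q) + B) =
      (\<Sum>i\<in>I. LINT q:strip rad|lborel. f (wr i q)) + (\<Sum>i\<in>I. LINT q:strip rad|lborel. B)"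
    unfolding sum.distrib[symmetric] using i2 c2 by (intro sum.cong refl set_integral_add)
  ultimately show ?thesis by (simp add: distrib_left)
qed

end

section \<open>Cartesian coordinates\<close>

text \<open>Space as a product of the horizontal plane and the height, for iterated integration.\<close>

definition mk3 :: "(real \<times> real) \<times> real \<Rightarrow> real^3" where
  "mk3 p = vector [fst (fst p), snd (fst p), snd p]"

lemma mk3_nth [simp]: "mk3 p $ 1 = fst (fst p)" "mk3 p $ 2 = snd (fst p)" "mk3 p $ 3 = snd p"
  by (simp_all add: mk3_def)

lemma continuous_mk3: "continuous_on S mk3"
proof -
  have "continuous_on S (\<lambda>p::(real \<times> real) \<times> real. fst (fst p))"
    "continuous_on S (\<lambda>p::(real \<times> real) \<times> real. snd (fst p))"
    "continuous_on S (snd :: (real \<times> real) \<times> real \<Rightarrow> real)"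
    by (intro continuous_intros)+
  then have "continuous_on S (\<lambda>p. mk3 p $ i)" for i
    using exhaust_3[of i] by auto
  then have "continuous_on S (\<lambda>p. \<chi> i. mk3 p $ i)" by (intro continuous_on_vec_lambda)
  then show ?thesis by simp
qed

lemma mk3_borel [measurable]: "mk3 \<in> borel_measurable borel"
  using continuous_mk3 borel_measurable_continuous_onI by blast

lemma lborel_mk3: "distr lborel borel mk3 = lborel"
proof (rule lborel_eqI[symmetric])
  fix l u :: "real^3"
  assume le: "\<And>b. b \<in> Basis \<Longrightarrow> l \<bullet> b \<le> u \<bullet> b"
  have le': "l $ i \<le> u $ i" for i using le[of "axis i 1"] by (simp add: inner_axis axis_in_Basis_iff)
  have "mk3 -` box l u = ({l$1<..<u$1} \<times> {l$2<..<u$2}) \<times> {l$3<..<u$3}"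
    by (auto simp: mem_box_cart forall_3)
  then have "emeasure (distr lborel borel mk3) (box l u) = emeasure lborel (({l$1<..<u$1} \<times> {l$2<..<u$2}) \<times> {l$3<..<u$3})"
    by (subst emeasure_distr) auto
  also have "\<dots> = emeasure (lborel \<Otimes>\<^sub>M lborel) (({l$1<..<u$1} \<times> {l$2<..<u$2}) \<times> {l$3<..<u$3})"
    by (simp only: lborel_prod)
  also have "\<dots> = emeasure lborel ({l$1<..<u$1} \<times> {l$2<..<u$2}) * emeasure lborel {l$3<..<u$3}"
  proof (rule lborel.emeasure_pair_measure_Times)
    have "open ({l$1<..<u$1} \<times> {l$2<..<u$2})" by (intro open_Times) auto
    then show "{l$1<..<u$1} \<times> {l$2<..<u$2} \<in> sets lborel" by simp
  qed simp
  also have "emeasure lborel ({l$1<..<u$1} \<times> {l$2<..<u$2}) = emeasure (lborel \<Otimes>\<^sub>M lborel) ({l$1<..<u$1} \<times> {l$2<..<u$2})"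
    by (simp only: lborel_prod)
  also have "\<dots> = emeasure lborel {l$1<..<u$1} * emeasure lborel {l$2<..<u$2}"
    by (intro lborel.emeasure_pair_measure_Times) auto
  also have "emeasure lborel {l$1<..<u$1} * emeasure lborel {l$2<..<u$2} * emeasure lborel {l$3<..<u$3} =
     ennreal ((u$1 - l$1) * (u$2 - l$2) * (u$3 - l$3))"
    using le' by (simp add: ennreal_mult)
  also have "(u$1 - l$1) * (u$2 - l$2) * (u$3 - l$3) = (\<Prod>b\<in>Basis. (u - l) \<bullet> b)"
  proof -
    have B: "(Basis :: (real^3) set) = range (\<lambda>i. axis i 1)" by (auto simp: Basis_vec_def)
    have "inj (\<lambda>i::3. axis i (1::real))" by (auto simp: inj_on_def axis_eq_axis)
    from prod.reindex[OF this, of "\<lambda>b. (u - l) \<bullet> b"]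
    have "(\<Prod>b\<in>Basis. (u - l) \<bullet> b) = (\<Prod>i\<in>UNIV. (u - l) $ i)"
      unfolding B by (simp only: o_def inner_axis inner_real_def mult_1_right)
    then show ?thesis by (simp only: UNIV_3) simp
  qed
  finally show "emeasure (distr lborel borel mk3) (box l u) = ennreal (\<Prod>b\<in>Basis. (u - l) \<bullet> b)" by (simp add: prod_ennreal)
qed simp

lemma integral_mk3:
  fixes f :: "real^3 \<Rightarrow> real"
  assumes [measurable]: "f \<in> borel_measurable borel"
  shows "(LINT x|lborel. f x) = (LINT p|lborel. f (mk3 p))" and "integrable lborel f \<longleftrightarrow> integrable lborel (\<lambda>p. f (mk3 p))"
proof -
  show "(LINT x|lborel. f x) = (LINT p|lborel. f (mk3 p))"
    by (subst lborel_mk3[symmetric], subst integral_distr) auto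
  show "integrable lborel f \<longleftrightarrow> integrable lborel (\<lambda>p. f (mk3 p))"
    by (subst lborel_mk3[symmetric], subst integrable_distr_eq) auto
qed

section \<open>Gauss' theorem on a cylinder\<close>

lemma smooth_bounded_on:
  assumes "smooth f" "bounded S"
  obtains B where "\<And>x. x \<in> S \<Longrightarrow> \<bar>f x\<bar> \<le> B" "B \<ge> 0"
proof -
  have "compact (closure S)" using assms(2) by simp
  then have "bounded (f ` closure S)"
    using smooth_continuous[OF assms(1)] by (intro compact_imp_bounded compact_continuous_image) auto
  then obtain B where "\<And>x. x \<in> closure S \<Longrightarrow> \<bar>f x\<bar> \<le> B" by (auto simp: bounded_iff)
  then show ?thesis using closure_subset[of S] by (intro that[of "\<bar>B\<bar>"]) (auto intro: order_trans[OF _ abs_ge_self])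
qed

lemma bounded_set_integrable:
  fixes f :: "'a::euclidean_space \<Rightarrow> real"
  assumes [measurable]: "f \<in> borel_measurable borel" "S \<in> sets borel" and "bounded S" and b: "\<And>x. x \<in> S \<Longrightarrow> \<bar>f x\<bar> \<le> B"
  shows "set_integrable lborel S f"
proof -
  have "integrable lborel (\<lambda>x. B * indicator S x)"
    using emeasure_bounded_finite[OF assms(3)] by (intro integrable_mult_right integrable_real_indicator) auto
  then show ?thesis
    unfolding set_integrable_def
    by (rule Bochner_Integration.integrable_bound) (auto simp: indicator_def intro!: AE_I2 dest: b intro: order_trans[OF _ abs_ge_self])
qed

lemma smooth_set_integrable:
  assumes "smooth f" "S \<in> sets borel" "bounded S"
  shows "set_integrable lborel S f"
proof -
  obtain B where "\<And>x. x \<in> S \<Longrightarrow> \<bar>f x\<bar> \<le> B" by (rule smooth_bounded_on[OF assms(1,3)]) blast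
  then show ?thesis using bounded_set_integrable[OF smooth_borel[OF assms(1)] assms(2,3)] by blast
qed

text \<open>The base is a set of pairs, so that its area is taken with respect to a product measure.\<close>

definition column :: "(real \<times> real) set \<Rightarrow> (real^3) set" where
  "column D = {x. (x$1, x$2) \<in> D \<and> 0 < x$3 \<and> x$3 < 1}"

lemma mk3_column: "mk3 (p, z) \<in> column D \<longleftrightarrow> p \<in> D \<and> z \<in> {0<..<1}"
  by (auto simp: column_def)

lemma column_integral:
  fixes f :: "real^3 \<Rightarrow> real"
  assumes [measurable]: "f \<in> borel_measurable borel" and int: "set_integrable lborel (column D) f"
    and [measurable]: "column D \<in> sets borel"
  shows "(LINT x:column D|lborel. f x) = (LINT z:{0<..<1}|lborel. LINT p:D|lborel. f (mk3 (p, z)))"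
    and "(LINT x:column D|lborel. f x) = (LINT p:D|lborel. LINT z:{0<..<1}|lborel. f (mk3 (p, z)))"
proof -
  let ?g = "\<lambda>x. indicator (column D) x *\<^sub>R f x"
  have g: "integrable lborel ?g" using int by (simp add: set_integrable_def)
  have ind: "indicator (column D) (mk3 (p, z)) = indicator {0<..<1} z * (indicator D p :: real)" for p z
    by (auto simp: indicator_def mk3_column)
  have "integrable lborel (\<lambda>p. ?g (mk3 p))" using g integral_mk3(2)[of ?g] by simp
  then have g2: "integrable (lborel \<Otimes>\<^sub>M lborel) (\<lambda>(p, z). ?g (mk3 (p, z)))"
    by (simp only: lborel_prod case_prod_beta' prod.collapse)
  have "(LINT x:column D|lborel. f x) = (LINT x|lborel. ?g x)" by (simp add: set_lebesgue_integral_def)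
  also have "\<dots> = (LINT p|lborel. ?g (mk3 p))" by (rule integral_mk3(1)) simp
  finally have e: "(LINT x:column D|lborel. f x) = (LINT p|(lborel \<Otimes>\<^sub>M lborel). (case p of (p, z) \<Rightarrow> ?g (mk3 (p, z))))"
    by (simp only: lborel_prod case_prod_beta' prod.collapse)
  have "(LINT z|lborel. LINT p|lborel. ?g (mk3 (p, z))) = (LINT x:column D|lborel. f x)"
    unfolding e by (rule lborel_pair.integral_snd[OF g2])
  then show "(LINT x:column D|lborel. f x) = (LINT z:{0<..<1}|lborel. LINT p:D|lborel. f (mk3 (p, z)))"
    by (simp add: set_lebesgue_integral_def ind mult.assoc)
  have ind2: "indicator (column D) (mk3 (p, z)) = indicator D p * (indicator {0<..<1} z :: real)" for p z
    by (simp add: ind)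
  have "(LINT p|lborel. LINT z|lborel. ?g (mk3 (p, z))) = (LINT x:column D|lborel. f x)"
    unfolding e by (rule lborel_pair.integral_fst[OF g2])
  then show "(LINT x:column D|lborel. f x) = (LINT p:D|lborel. LINT z:{0<..<1}|lborel. f (mk3 (p, z)))"
    by (simp add: set_lebesgue_integral_def ind2 mult.assoc)
qed

lemma rectangle_integral:
  fixes f :: "real \<times> real \<Rightarrow> real"
  assumes "integrable lborel f"
  shows "(LINT p|lborel. f p) = (LINT y|lborel. LINT x|lborel. f (x, y))"
    and "(LINT p|lborel. f p) = (LINT x|lborel. LINT y|lborel. f (x, y))"
proof -
  have i: "integrable (lborel \<Otimes>\<^sub>M lborel) (\<lambda>(x, y). f (x, y))" using assms by (simp add: lborel_prod)
  have e: "(LINT p|lborel. f p) = (LINT p|(lborel \<Otimes>\<^sub>M lborel). (case p of (x, y) \<Rightarrow> f (x, y)))"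
    by (simp add: lborel_prod)
  show "(LINT p|lborel. f p) = (LINT y|lborel. LINT x|lborel. f (x, y))"
    unfolding e by (rule lborel_pair.integral_snd[OF i, symmetric])
  show "(LINT p|lborel. f p) = (LINT x|lborel. LINT y|lborel. f (x, y))"
    unfolding e by (rule lborel_pair.integral_fst[OF i, symmetric])
qed

lemma set_integral_endpoints:
  fixes f :: "real \<Rightarrow> real"
  assumes [measurable]: "f \<in> borel_measurable borel"
  shows "(LINT s:{a..<b}|lborel. f s) = (LINT s:{a..b}|lborel. f s)"
    and "(LINT s:{a<..<b}|lborel. f s) = (LINT s:{a..b}|lborel. f s)"
proof -
  have ae: "AE s in lborel. s \<noteq> a \<and> s \<noteq> b"
    using AE_lborel_singleton[of a] AE_lborel_singleton[of b] by eventually_elim simp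
  show "(LINT s:{a..<b}|lborel. f s) = (LINT s:{a..b}|lborel. f s)"
    unfolding set_lebesgue_integral_def
  proof (rule integral_cong_AE)
    show "AE s in lborel. indicator {a..<b} s *\<^sub>R f s = indicator {a..b} s *\<^sub>R f s"
      using ae by eventually_elim (auto simp: indicator_def)
  qed simp_all
  show "(LINT s:{a<..<b}|lborel. f s) = (LINT s:{a..b}|lborel. f s)"
    unfolding set_lebesgue_integral_def
  proof (rule integral_cong_AE)
    show "AE s in lborel. indicator {a<..<b} s *\<^sub>R f s = indicator {a..b} s *\<^sub>R f s"
      using ae by eventually_elim (auto simp: indicator_def)
  qed simp_all
qed

lemma set_integral_continuous:
  fixes f :: "real \<Rightarrow> real"
  assumes "continuous_on {a..b} f"
  shows "(LINT s:{a..b}|lborel. f s) = integral {a..b} f"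
  using set_borel_integral_eq_integral(2)[OF borel_integrable_atLeastAtMost'[OF assms]] .

lemma smooth_coordinate_derivative:
  assumes "smooth F"
  shows "((\<lambda>x. F (mk3 ((x, y), z))) has_real_derivative partial 1 F (mk3 ((x, y), z))) (at x)"
    and "((\<lambda>y. F (mk3 ((x, y), z))) has_real_derivative partial 2 F (mk3 ((x, y), z))) (at y)"
    and "((\<lambda>z. F (mk3 ((x, y), z))) has_real_derivative partial 3 F (mk3 ((x, y), z))) (at z)"
proof -
  have "mk3 ((0, y), z) + t *\<^sub>R axis 1 1 = mk3 ((t, y), z)" "mk3 ((x, 0), z) + t *\<^sub>R axis 2 1 = mk3 ((x, t), z)"
    "mk3 ((x, y), 0) + t *\<^sub>R axis 3 1 = mk3 ((x, y), t)" for x y z t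
    by (auto simp: vec_eq_iff forall_3 axis_def)
  then show "((\<lambda>x. F (mk3 ((x, y), z))) has_real_derivative partial 1 F (mk3 ((x, y), z))) (at x)"
    "((\<lambda>y. F (mk3 ((x, y), z))) has_real_derivative partial 2 F (mk3 ((x, y), z))) (at y)"
    "((\<lambda>z. F (mk3 ((x, y), z))) has_real_derivative partial 3 F (mk3 ((x, y), z))) (at z)"
    using smooth_line_derivative[OF assms, of "mk3 ((0, y), z)" 1 x] smooth_line_derivative[OF assms, of "mk3 ((x, 0), z)" 2 y]
      smooth_line_derivative[OF assms, of "mk3 ((x, y), 0)" 3 z] by simp_all
qed

lemma smooth_mk3_continuous:
  assumes "continuous_on S p" "continuous_on S z" "smooth F"
  shows "continuous_on S (\<lambda>t. F (mk3 (p t, z t)))"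
proof -
  have "continuous_on S (\<lambda>t. (p t, z t))" using assms(1,2) by (rule continuous_on_Pair)
  then have "continuous_on S (\<lambda>t. mk3 (p t, z t))"
    by (rule continuous_on_compose2[OF continuous_mk3[of UNIV]]) auto
  then show ?thesis
    by (rule continuous_on_compose2[OF smooth_continuous[OF assms(3), of UNIV]]) auto
qed

lemma integral_derivative:
  fixes f f' :: "real \<Rightarrow> real"
  assumes "a \<le> b" "\<And>x. (f has_real_derivative f' x) (at x)"
  shows "integral {a..b} f' = f b - f a"
  using assms by (intro integral_unique fundamental_theorem_of_calculus)
    (auto simp flip: has_real_derivative_iff_has_vector_derivative intro: has_field_derivative_at_within)

lemma substitution_cos:
  fixes H :: "real \<Rightarrow> real"
  assumes r: "r > 0" and ab: "a \<le> b" and H: "continuous_on {m - r..m + r} H"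
  shows "integral {a..b} (\<lambda>s. sin (s / r) * H (m + r * cos (s / r))) =
    integral {m + r * cos (b / r)..m + r * cos (a / r)} H - integral {m + r * cos (a / r)..m + r * cos (b / r)} H"
proof -
  have "((\<lambda>s. (- sin (s / r)) *\<^sub>R H (m + r * cos (s / r))) has_integral
    (integral {m + r * cos (a / r)..m + r * cos (b / r)} H - integral {m + r * cos (b / r)..m + r * cos (a / r)} H)) {a..b}"
  proof (rule has_integral_substitution_general[where s = "{}", OF _ ab _ H])
    have "\<bar>r * cos t\<bar> \<le> r" for t using abs_cos_le_one[of t] r by (simp add: abs_mult)
    then have bb: "- r \<le> r * cos t \<and> r * cos t \<le> r" for t by (simp add: abs_le_iff minus_le_iff)
    show "(\<lambda>s. m + r * cos (s / r)) ` {a..b} \<subseteq> {m - r..m + r}"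
    proof (rule image_subsetI)
      fix s show "m + r * cos (s / r) \<in> {m - r..m + r}" using bb[of "s / r"] by simp
    qed
    show "continuous_on {a..b} (\<lambda>s. m + r * cos (s / r))" unfolding divide_inverse by (intro continuous_intros)
    show "((\<lambda>s. m + r * cos (s / r)) has_real_derivative - sin (x / r)) (at x within {a..b})" for x
      using r by (auto intro!: derivative_eq_intros)
  qed simp
  from has_integral_neg[OF this] show ?thesis by (simp add: integral_unique)
qed

text \<open>The boundary integral over the circle, cut where the sine changes sign, is the integral of the difference of
  the two end values over the vertical chords.\<close>

lemma circle_to_chords_2:
  fixes G :: "real \<Rightarrow> real \<Rightarrow> real"
  assumes r: "r > 0" and G: "continuous_on UNIV (\<lambda>p. G (fst p) (snd p))"
  shows "integral {0..2 * pi * r} (\<lambda>s. G (a + r * cos (s / r)) (b + r * sin (s / r)) * sin (s / r)) =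
    integral {a - r..a + r} (\<lambda>x. G x (b + sqrt (r\<^sup>2 - (x - a)\<^sup>2)) - G x (b - sqrt (r\<^sup>2 - (x - a)\<^sup>2)))"
proof -
  let ?f = "\<lambda>s. G (a + r * cos (s / r)) (b + r * sin (s / r)) * sin (s / r)"
  let ?l = "\<lambda>x. sqrt (r\<^sup>2 - (x - a)\<^sup>2)"
  define H where "H x = G x (b + ?l x)" for x
  define K where "K x = G x (b - ?l x)" for x
  have Gc: "continuous_on S (\<lambda>t. G (u t) (v t))" if "continuous_on S u" "continuous_on S v" for S :: "real set" and u v
    using continuous_on_compose2[OF G, of S "\<lambda>t. (u t, v t)"] that by (auto intro: continuous_intros)
  have Hc: "continuous_on S H" "continuous_on S K" for S
    unfolding H_def K_def by (intro Gc continuous_intros)+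
  have fc: "continuous_on S ?f" for S unfolding divide_inverse by (intro continuous_intros Gc)
  have l: "?l (a + r * cos t) = r * \<bar>sin t\<bar>" for t
  proof -
    have "r\<^sup>2 - (r * cos t)\<^sup>2 = (r * sin t)\<^sup>2"
    proof -
      have "(r * sin t)\<^sup>2 + (r * cos t)\<^sup>2 = r\<^sup>2" by (simp add: power_mult_distrib flip: distrib_left)
      then show ?thesis by linarith
    qed
    then show ?thesis using r by (simp add: abs_mult)
  qed
  have seg: "integral {u..v} ?f = integral {u..v} (\<lambda>s. sin (s / r) * P (a + r * cos (s / r)))"
    if "\<And>s. s \<in> {u..v} \<Longrightarrow> G (a + r * cos (s / r)) (b + r * sin (s / r)) = P (a + r * cos (s / r))" for u v P
    using that by (intro Henstock_Kurzweil_Integration.integral_cong) (simp add: mult.commute)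
  have pr: "0 < pi * r" using r by simp
  have sv: "pi * r / r = pi" "2 * pi * r / r = 2 * pi" using r by auto
  have fi: "?f integrable_on {0..2 * pi * r}" using fc by (intro integrable_continuous_real)
  have split: "integral {0..2 * pi * r} ?f = integral {0..pi * r} ?f + integral {pi * r..2 * pi * r} ?f"
    using pr r fi by (intro Henstock_Kurzweil_Integration.integral_combine[symmetric]) auto
  have 1: "integral {0..pi * r} ?f = integral {a - r..a + r} H"
  proof -
    have "integral {0..pi * r} ?f = integral {0..pi * r} (\<lambda>s. sin (s / r) * H (a + r * cos (s / r)))"
    proof (rule seg)
      fix s assume s: "s \<in> {0..pi * r}"
      then have "0 \<le> sin (s / r)" using r by (intro sin_ge_zero) (auto simp: field_simps)
      then show "G (a + r * cos (s / r)) (b + r * sin (s / r)) = H (a + r * cos (s / r))"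
        unfolding H_def l by simp
    qed
    also have "\<dots> = integral {a - r..a + r} H"
      using pr r by (subst substitution_cos[OF r _ Hc(1)]) (auto simp: sv)
    finally show ?thesis .
  qed
  have 2: "integral {pi * r..2 * pi * r} ?f = - integral {a - r..a + r} K"
  proof -
    have "integral {pi * r..2 * pi * r} ?f = integral {pi * r..2 * pi * r} (\<lambda>s. sin (s / r) * K (a + r * cos (s / r)))"
    proof (rule seg)
      fix s assume s: "s \<in> {pi * r..2 * pi * r}"
      then have "pi \<le> s / r" "s / r \<le> 2 * pi" using r by (auto simp: field_simps)
      then have "0 \<le> sin (s / r - pi)" by (intro sin_ge_zero) linarith+
      then have "sin (s / r) \<le> 0" by simp
      then show "G (a + r * cos (s / r)) (b + r * sin (s / r)) = K (a + r * cos (s / r))"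
        unfolding K_def l by simp
    qed
    also have "\<dots> = - integral {a - r..a + r} K"
      using pr r by (subst substitution_cos[OF r _ Hc(2)]) (auto simp: sv)
    finally show ?thesis .
  qed
  have Hi: "H integrable_on {a - r..a + r}" "K integrable_on {a - r..a + r}"
    using Hc by (auto intro: integrable_continuous_real)
  have "integral {0..2 * pi * r} ?f = integral {a - r..a + r} H - integral {a - r..a + r} K"
    unfolding split 1 2 by simp
  also have "\<dots> = integral {a - r..a + r} (\<lambda>y. H y - K y)"
    using Hi by (intro Henstock_Kurzweil_Integration.integral_diff[symmetric]) auto
  finally show ?thesis by (simp add: H_def K_def)
qed

lemma integral_periodic_reflect:
  fixes f :: "real \<Rightarrow> real"
  assumes f: "continuous_on UNIV f" "\<And>s. f (s + p) = f s" and q: "0 \<le> q" "q \<le> p"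
  shows "integral {0..p} (\<lambda>s. f (q - s)) = integral {0..p} f"
proof -
  have c: "continuous_on S f" for S using f(1) continuous_on_subset by blast
  have comb: "integral {u..v} f + integral {v..w} f = integral {u..w} f" if "u \<le> v" "v \<le> w" for u v w
    using that c by (intro Henstock_Kurzweil_Integration.integral_combine integrable_continuous_real) auto
  have "integral {0..p} (\<lambda>s. f (q - s)) = integral {- p..0} (f \<circ> (+) q)"
    using Henstock_Kurzweil_Integration.integral_reflect_real[of 0 "- p" "\<lambda>s. f (q + s)"] by (simp add: o_def)
  also have "\<dots> = integral {q - p..q} f"
    unfolding integral_shift_Icc_real by simp
  also have "\<dots> = integral {q - p..0} f + integral {0..q} f" using comb q by simp
  also have "integral {q - p..0} f = integral {q..p} f"
    using integral_shift_Icc_real[of "q - p" 0 f p] f(2) by (simp add: o_def add.commute)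
  finally show ?thesis using comb[OF q] by simp
qed

text \<open>The reflection that exchanges the coordinate axes reduces horizontal chords to vertical ones.\<close>

lemma circle_to_chords_1:
  fixes G :: "real \<Rightarrow> real \<Rightarrow> real"
  assumes r: "r > 0" and G: "continuous_on UNIV (\<lambda>p. G (fst p) (snd p))"
  shows "integral {0..2 * pi * r} (\<lambda>s. G (a + r * cos (s / r)) (b + r * sin (s / r)) * cos (s / r)) =
    integral {b - r..b + r} (\<lambda>y. G (a + sqrt (r\<^sup>2 - (y - b)\<^sup>2)) y - G (a - sqrt (r\<^sup>2 - (y - b)\<^sup>2)) y)"
proof -
  let ?f = "\<lambda>s. G (a + r * cos (s / r)) (b + r * sin (s / r)) * cos (s / r)"
  have Gc: "continuous_on S (\<lambda>t. G (u t) (v t))" if "continuous_on S u" "continuous_on S v" for S :: "'b::topological_space set" and u v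
    using continuous_on_compose2[OF G, of S "\<lambda>t. (u t, v t)"] that by (auto intro: continuous_intros)
  have "integral {0..2 * pi * r} ?f = integral {0..2 * pi * r} (\<lambda>s. ?f (pi * r / 2 - s))"
  proof (rule integral_periodic_reflect[symmetric])
    show "continuous_on UNIV ?f" unfolding divide_inverse by (intro continuous_intros Gc)
    show "?f (s + 2 * pi * r) = ?f s" for s using r by (simp add: add_divide_distrib)
    have "pi * r > 0" using r by simp
    then show "pi * r / 2 \<le> 2 * pi * r" by linarith
  qed (use r in simp)
  also have "\<dots> = integral {0..2 * pi * r} (\<lambda>s. G (a + r * sin (s / r)) (b + r * cos (s / r)) * sin (s / r))"
  proof -
    have "(pi * r / 2 - s) / r = pi / 2 - s / r" for s using r by (simp add: diff_divide_distrib)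
    moreover have "cos (pi / 2 - t) = sin t" "sin (pi / 2 - t) = cos t" for t :: real by (simp_all add: sin_diff cos_diff)
    ultimately show ?thesis by (simp only:)
  qed
  also have "\<dots> = integral {b - r..b + r} (\<lambda>y. G (a + sqrt (r\<^sup>2 - (y - b)\<^sup>2)) y - G (a - sqrt (r\<^sup>2 - (y - b)\<^sup>2)) y)"
    by (rule circle_to_chords_2[OF r, of "\<lambda>x y. G y x"]) (intro Gc continuous_intros)
  finally show ?thesis .
qed

abbreviation disk :: "real^2 \<Rightarrow> real \<Rightarrow> (real \<times> real) set" where
  "disk c r \<equiv> {p. (fst p - c$1)\<^sup>2 + (snd p - c$2)\<^sup>2 \<le> r\<^sup>2}"

lemma disk_borel [measurable]: "disk c r \<in> sets borel"
  by (intro borel_closed closed_Collect_le continuous_intros)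

lemma bounded_disk: "bounded (disk c r)"
proof -
  have "disk c r \<subseteq> {c$1 - \<bar>r\<bar>..c$1 + \<bar>r\<bar>} \<times> {c$2 - \<bar>r\<bar>..c$2 + \<bar>r\<bar>}"
  proof
    fix p assume "p \<in> disk c r"
    then have "(fst p - c$1)\<^sup>2 + (snd p - c$2)\<^sup>2 \<le> r\<^sup>2" by simp
    then have "(fst p - c$1)\<^sup>2 \<le> \<bar>r\<bar>\<^sup>2" "(snd p - c$2)\<^sup>2 \<le> \<bar>r\<bar>\<^sup>2"
      using zero_le_power2[of "fst p - c$1"] zero_le_power2[of "snd p - c$2"] unfolding power2_abs by linarith+
    then have "\<bar>fst p - c$1\<bar> \<le> \<bar>r\<bar>" "\<bar>snd p - c$2\<bar> \<le> \<bar>r\<bar>" by (simp_all add: abs_le_square_iff)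
    then show "p \<in> {c$1 - \<bar>r\<bar>..c$1 + \<bar>r\<bar>} \<times> {c$2 - \<bar>r\<bar>..c$2 + \<bar>r\<bar>}" by (cases p) auto
  qed
  then show ?thesis by (rule bounded_subset[rotated]) (intro bounded_Times bounded_closed_interval)
qed

lemma chord_mem:
  fixes r t s :: real
  assumes "r > 0"
  shows "t\<^sup>2 + s\<^sup>2 \<le> r\<^sup>2 \<longleftrightarrow> s \<in> {- r..r} \<and> t \<in> {- sqrt (r\<^sup>2 - s\<^sup>2)..sqrt (r\<^sup>2 - s\<^sup>2)}"
proof -
  have "t\<^sup>2 + s\<^sup>2 \<le> r\<^sup>2 \<longleftrightarrow> s\<^sup>2 \<le> r\<^sup>2 \<and> t\<^sup>2 \<le> r\<^sup>2 - s\<^sup>2"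
    by (smt (verit) zero_le_power2)
  also have "s\<^sup>2 \<le> r\<^sup>2 \<longleftrightarrow> s \<in> {- r..r}" using assms abs_le_square_iff[of s r] by (auto simp: abs_le_iff)
  also have "t\<^sup>2 \<le> r\<^sup>2 - s\<^sup>2 \<longleftrightarrow> \<bar>t\<bar> \<le> sqrt (r\<^sup>2 - s\<^sup>2)"
    by (metis power2_abs real_le_rsqrt real_sqrt_abs real_sqrt_le_iff)
  finally show ?thesis by (auto simp: abs_le_iff)
qed

lemma smooth_slice_integrable:
  assumes "smooth f" "S \<in> sets borel" "bounded S"
  shows "set_integrable lborel S (\<lambda>p. f (mk3 (p, z)))"
proof -
  have "bounded (S \<times> {z})" using assms(3) by (intro bounded_Times) auto
  then have "compact (closure (S \<times> {z}))" by simp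
  then have "bounded (mk3 ` closure (S \<times> {z}))"
    using continuous_mk3 by (intro compact_imp_bounded compact_continuous_image)
  then obtain B where B: "\<And>x. x \<in> mk3 ` closure (S \<times> {z}) \<Longrightarrow> \<bar>f x\<bar> \<le> B"
    by (rule smooth_bounded_on[OF assms(1)]) blast
  show ?thesis
  proof (rule bounded_set_integrable[OF _ assms(2,3)])
    have "(\<lambda>p. mk3 (p, z)) \<in> borel_measurable borel"
      by (intro borel_measurable_continuous_onI continuous_on_compose2[OF continuous_mk3[of UNIV]] continuous_intros) auto
    then show "(\<lambda>p. f (mk3 (p, z))) \<in> borel_measurable borel"
      using smooth_borel[OF assms(1)] measurable_compose by blast
    show "\<bar>f (mk3 (p, z))\<bar> \<le> B" if "p \<in> S" for p
      using B closure_subset[of "S \<times> {z}"] that by blast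
  qed
qed

text \<open>On every chord the derivative integrates to the difference of the end values.\<close>

lemma disk_gauss:
  assumes F: "smooth F" and r: "r > 0"
  shows "(LINT p:disk c r|lborel. partial 1 F (mk3 (p, z))) = integral {0..2 * pi * r} (\<lambda>s. F (wrap c r (s, z)) * cos (s / r))"
    and "(LINT p:disk c r|lborel. partial 2 F (mk3 (p, z))) = integral {0..2 * pi * r} (\<lambda>s. F (wrap c r (s, z)) * sin (s / r))"
proof -
  let ?G = "\<lambda>x y. F (mk3 ((x, y), z))"
  have Gc: "continuous_on UNIV (\<lambda>p. ?G (fst p) (snd p))"
    using F by (intro smooth_mk3_continuous continuous_intros) auto
  have w: "F (wrap c r (s, z)) = ?G (c$1 + r * cos (s / r)) (c$2 + r * sin (s / r))" for s
    by (intro arg_cong[of _ _ F]) (simp add: vec_eq_iff forall_3)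
  note si = smooth_slice_integrable[OF smooth_partial[OF F] disk_borel bounded_disk, unfolded set_integrable_def]
  have cont: "continuous_on S (\<lambda>x. partial 1 F (mk3 ((x, y), z)))" "continuous_on S (\<lambda>y. partial 2 F (mk3 ((x, y), z)))" for x y S
    using smooth_partial[OF F] by (auto intro!: smooth_mk3_continuous continuous_intros)
  have "(LINT p:disk c r|lborel. partial 1 F (mk3 (p, z))) =
      (LINT y|lborel. LINT x|lborel. indicator (disk c r) (x, y) *\<^sub>R partial 1 F (mk3 ((x, y), z)))"
    unfolding set_lebesgue_integral_def by (rule rectangle_integral(1)[OF si])
  also have "\<dots> = (LINT y:{c$2 - r..c$2 + r}|lborel. ?G (c$1 + sqrt (r\<^sup>2 - (y - c$2)\<^sup>2)) y - ?G (c$1 - sqrt (r\<^sup>2 - (y - c$2)\<^sup>2)) y)"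
    unfolding set_lebesgue_integral_def
  proof (intro Bochner_Integration.integral_cong refl)
    fix y
    let ?l = "sqrt (r\<^sup>2 - (y - c$2)\<^sup>2)"
    have ind: "indicator (disk c r) (x, y) = indicator {c$2 - r..c$2 + r} y * (indicator {c$1 - ?l..c$1 + ?l} x :: real)" for x
      using chord_mem[OF r, of "x - c$1" "y - c$2"] by (auto simp: indicator_def)
    show "(LINT x|lborel. indicator (disk c r) (x, y) *\<^sub>R partial 1 F (mk3 ((x, y), z))) =
        indicator {c$2 - r..c$2 + r} y *\<^sub>R (?G (c$1 + ?l) y - ?G (c$1 - ?l) y)"
    proof (cases "y \<in> {c$2 - r..c$2 + r}")
      case True
      then have "\<bar>y - c$2\<bar> \<le> \<bar>r\<bar>" using r by auto
      then have "(y - c$2)\<^sup>2 \<le> r\<^sup>2" by (simp add: abs_le_square_iff)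
      then have l0: "0 \<le> ?l" by simp
      have "(LINT x|lborel. indicator (disk c r) (x, y) *\<^sub>R partial 1 F (mk3 ((x, y), z))) = (LINT x:{c$1 - ?l..c$1 + ?l}|lborel. partial 1 F (mk3 ((x, y), z)))"
        unfolding set_lebesgue_integral_def ind using True by simp
      also have "\<dots> = integral {c$1 - ?l..c$1 + ?l} (\<lambda>x. partial 1 F (mk3 ((x, y), z)))"
        by (intro set_integral_continuous cont)
      also have "\<dots> = ?G (c$1 + ?l) y - ?G (c$1 - ?l) y"
        using l0 smooth_coordinate_derivative(1)[OF F] by (intro integral_derivative) auto
      finally show ?thesis using True by simp
    qed (simp add: ind)
  qed
  also have "\<dots> = integral {c$2 - r..c$2 + r} (\<lambda>y. ?G (c$1 + sqrt (r\<^sup>2 - (y - c$2)\<^sup>2)) y - ?G (c$1 - sqrt (r\<^sup>2 - (y - c$2)\<^sup>2)) y)"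
    using F by (intro set_integral_continuous continuous_intros smooth_mk3_continuous) auto
  finally show "(LINT p:disk c r|lborel. partial 1 F (mk3 (p, z))) = integral {0..2 * pi * r} (\<lambda>s. F (wrap c r (s, z)) * cos (s / r))"
    unfolding w circle_to_chords_1[OF r Gc] .
  have "(LINT p:disk c r|lborel. partial 2 F (mk3 (p, z))) =
      (LINT x|lborel. LINT y|lborel. indicator (disk c r) (x, y) *\<^sub>R partial 2 F (mk3 ((x, y), z)))"
    unfolding set_lebesgue_integral_def by (rule rectangle_integral(2)[OF si])
  also have "\<dots> = (LINT x:{c$1 - r..c$1 + r}|lborel. ?G x (c$2 + sqrt (r\<^sup>2 - (x - c$1)\<^sup>2)) - ?G x (c$2 - sqrt (r\<^sup>2 - (x - c$1)\<^sup>2)))"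
    unfolding set_lebesgue_integral_def
  proof (intro Bochner_Integration.integral_cong refl)
    fix x
    let ?l = "sqrt (r\<^sup>2 - (x - c$1)\<^sup>2)"
    have ind: "indicator (disk c r) (x, y) = indicator {c$1 - r..c$1 + r} x * (indicator {c$2 - ?l..c$2 + ?l} y :: real)" for y
      using chord_mem[OF r, of "y - c$2" "x - c$1"] by (auto simp: indicator_def add.commute)
    show "(LINT y|lborel. indicator (disk c r) (x, y) *\<^sub>R partial 2 F (mk3 ((x, y), z))) =
        indicator {c$1 - r..c$1 + r} x *\<^sub>R (?G x (c$2 + ?l) - ?G x (c$2 - ?l))"
    proof (cases "x \<in> {c$1 - r..c$1 + r}")
      case True
      then have "\<bar>x - c$1\<bar> \<le> \<bar>r\<bar>" using r by auto
      then have "(x - c$1)\<^sup>2 \<le> r\<^sup>2" by (simp add: abs_le_square_iff)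
      then have l0: "0 \<le> ?l" by simp
      have "(LINT y|lborel. indicator (disk c r) (x, y) *\<^sub>R partial 2 F (mk3 ((x, y), z))) = (LINT y:{c$2 - ?l..c$2 + ?l}|lborel. partial 2 F (mk3 ((x, y), z)))"
        unfolding set_lebesgue_integral_def ind using True by simp
      also have "\<dots> = integral {c$2 - ?l..c$2 + ?l} (\<lambda>y. partial 2 F (mk3 ((x, y), z)))"
        by (intro set_integral_continuous cont)
      also have "\<dots> = ?G x (c$2 + ?l) - ?G x (c$2 - ?l)"
        using l0 smooth_coordinate_derivative(2)[OF F] by (intro integral_derivative) auto
      finally show ?thesis using True by simp
    qed (simp add: ind)
  qed
  also have "\<dots> = integral {c$1 - r..c$1 + r} (\<lambda>x. ?G x (c$2 + sqrt (r\<^sup>2 - (x - c$1)\<^sup>2)) - ?G x (c$2 - sqrt (r\<^sup>2 - (x - c$1)\<^sup>2)))"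
    using F by (intro set_integral_continuous continuous_intros smooth_mk3_continuous) auto
  finally show "(LINT p:disk c r|lborel. partial 2 F (mk3 (p, z))) = integral {0..2 * pi * r} (\<lambda>s. F (wrap c r (s, z)) * sin (s / r))"
    unfolding w circle_to_chords_2[OF r Gc] .
qed

lemma strip_integral:
  fixes g :: "real \<times> real \<Rightarrow> real"
  assumes [measurable]: "g \<in> borel_measurable borel" and int: "set_integrable lborel (strip r) g"
    and c: "\<And>z. continuous_on {0..2 * pi * r} (\<lambda>s. g (s, z))"
  shows "(LINT q:strip r|lborel. g q) = (LINT z:{0<..<1}|lborel. integral {0..2 * pi * r} (\<lambda>s. g (s, z)))"
proof -
  have "(LINT q:strip r|lborel. g q) = (LINT z|lborel. LINT s|lborel. indicator (strip r) (s, z) *\<^sub>R g (s, z))"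
    unfolding set_lebesgue_integral_def by (rule rectangle_integral(1)[OF int[unfolded set_integrable_def]])
  also have "\<dots> = (LINT z|lborel. indicator {0<..<1} z *\<^sub>R integral {0..2 * pi * r} (\<lambda>s. g (s, z)))"
  proof (intro Bochner_Integration.integral_cong refl)
    fix z
    have ind: "indicator (strip r) (s, z) = indicator {0<..<1} z * (indicator {0..<2 * pi * r} s :: real)" for s
      by (auto simp: strip_def indicator_def)
    have [measurable]: "(\<lambda>s. g (s, z)) \<in> borel_measurable borel"
      by (intro measurable_compose[OF _ assms(1)] borel_measurable_continuous_onI continuous_intros)
    have "(LINT s|lborel. indicator (strip r) (s, z) *\<^sub>R g (s, z)) = indicator {0<..<1} z * (LINT s:{0..<2 * pi * r}|lborel. g (s, z))"
      unfolding ind set_lebesgue_integral_def by (simp add: mult.assoc)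
    also have "(LINT s:{0..<2 * pi * r}|lborel. g (s, z)) = integral {0..2 * pi * r} (\<lambda>s. g (s, z))"
      by (subst set_integral_endpoints(1)) (auto intro!: set_integral_continuous c)
    finally show "(LINT s|lborel. indicator (strip r) (s, z) *\<^sub>R g (s, z)) = indicator {0<..<1} z *\<^sub>R integral {0..2 * pi * r} (\<lambda>s. g (s, z))"
      by simp
  qed
  finally show ?thesis by (simp add: set_lebesgue_integral_def)
qed

lemma column_disk: "column (disk c r) = {x. (x$1 - c$1)\<^sup>2 + (x$2 - c$2)\<^sup>2 \<le> r\<^sup>2 \<and> 0 < x$3 \<and> x$3 < 1}"
  by (auto simp: column_def)

lemma bounded_column:
  assumes "bounded D"
  shows "bounded (column D)"
proof -
  obtain B where B: "\<And>p. p \<in> D \<Longrightarrow> norm p \<le> B" using assms by (auto simp: bounded_iff)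
  have "norm x \<le> B + B + 1" if x: "x \<in> column D" for x
  proof -
    have "norm x \<le> \<bar>x$1\<bar> + \<bar>x$2\<bar> + \<bar>x$3\<bar>" using norm_le_l1_cart[of x] by (simp add: sum_3)
    moreover have "\<bar>x$1\<bar> \<le> norm (x$1, x$2)" "\<bar>x$2\<bar> \<le> norm (x$1, x$2)"
      using norm_fst_le[of "x$1" "x$2"] norm_snd_le[of "x$2" "x$1"] by simp_all
    ultimately show ?thesis using x B[of "(x$1, x$2)"] by (auto simp: column_def)
  qed
  then show ?thesis by (auto simp: bounded_iff)
qed

lemma column_borel [measurable]: "D \<in> sets borel \<Longrightarrow> column D \<in> sets borel"
proof -
  assume [measurable]: "D \<in> sets borel"
  have m: "(\<lambda>x::real^3. (x$1, x$2)) \<in> borel_measurable borel"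
    by (intro borel_measurable_continuous_onI continuous_intros)
  have [measurable]: "(\<lambda>x::real^3. (x$1, x$2)) -` D \<in> sets borel"
    by (rule measurable_sets_borel[OF m]) simp
  have "{x::real^3. 0 < x$3 \<and> x$3 < 1} \<in> sets borel" by measurable
  moreover have "column D = (\<lambda>x. (x$1, x$2)) -` D \<inter> {x. 0 < x$3 \<and> x$3 < 1}" by (auto simp: column_def)
  ultimately show ?thesis by simp
qed

lemma strip_smooth:
  assumes "smooth F" "r > 0" and t: "\<And>s. \<bar>t s\<bar> \<le> 1" "continuous_on UNIV t"
  shows "set_integrable lborel (strip r) (\<lambda>q. F (wrap c r q) * t (fst q))"
    and "(\<lambda>q. F (wrap c r q) * t (fst q)) \<in> borel_measurable borel"
    and "continuous_on S (\<lambda>s. F (wrap c r (s, z)) * t s)"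
proof -
  have tb: "(\<lambda>q. t (fst q)) \<in> borel_measurable (borel :: (real \<times> real) measure)"
    by (intro borel_measurable_continuous_onI continuous_on_compose2[OF t(2)] continuous_intros) auto
  show m: "(\<lambda>q. F (wrap c r q) * t (fst q)) \<in> borel_measurable borel"
    by (intro borel_measurable_times tb measurable_compose[OF wrap_borel smooth_borel[OF assms(1)]])
  have "bounded (strip r)" unfolding strip_def by (intro bounded_Times) auto
  then have "compact (closure (strip r))" by simp
  then have "bounded (wrap c r ` closure (strip r))"
    using continuous_wrap by (intro compact_imp_bounded compact_continuous_image)
  then obtain B where B: "\<And>x. x \<in> wrap c r ` closure (strip r) \<Longrightarrow> \<bar>F x\<bar> \<le> B" "B \<ge> 0"
    by (rule smooth_bounded_on[OF assms(1)]) blast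
  show "set_integrable lborel (strip r) (\<lambda>q. F (wrap c r q) * t (fst q))"
  proof (rule bounded_set_integrable[OF m strip_borel])
    show "bounded (strip r)" by fact
    fix q assume "q \<in> strip r"
    then have "\<bar>F (wrap c r q)\<bar> \<le> B" using B(1) closure_subset[of "strip r"] by blast
    then show "\<bar>F (wrap c r q) * t (fst q)\<bar> \<le> B"
      using mult_mono[of "\<bar>F (wrap c r q)\<bar>" B "\<bar>t (fst q)\<bar>" 1] t(1)[of "fst q"] B(2) by (simp add: abs_mult)
  qed
  have "continuous_on S (\<lambda>s. wrap c r (s, z))"
    by (intro continuous_on_compose2[OF continuous_wrap[of UNIV]] continuous_intros) auto
  then have "continuous_on S (\<lambda>s. F (wrap c r (s, z)))"
    by (rule continuous_on_compose2[OF smooth_continuous[OF assms(1), of UNIV]]) auto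
  then show "continuous_on S (\<lambda>s. F (wrap c r (s, z)) * t s)"
    using continuous_on_subset[OF t(2), of S] by (intro continuous_on_mult) auto
qed

theorem cylinder_gauss:
  assumes F: "smooth F" and r: "r > 0"
  shows "(LINT x:column (disk c r)|lborel. partial 1 F x) = (LINT q:strip r|lborel. F (wrap c r q) * cos (fst q / r))"
    and "(LINT x:column (disk c r)|lborel. partial 2 F x) = (LINT q:strip r|lborel. F (wrap c r q) * sin (fst q / r))"
    and "(\<And>x. x$3 = 0 \<or> x$3 = 1 \<Longrightarrow> F x = 0) \<Longrightarrow> (LINT x:column (disk c r)|lborel. partial 3 F x) = 0"
proof -
  have ci: "set_integrable lborel (column (disk c r)) (partial a F)" for a
    by (intro smooth_set_integrable smooth_partial F column_borel disk_borel bounded_column bounded_disk)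
  have tc: "continuous_on UNIV (\<lambda>s. cos (s / r))" "continuous_on UNIV (\<lambda>s. sin (s / r))"
    unfolding divide_inverse by (intro continuous_intros)+
  note col = column_integral[OF smooth_borel[OF smooth_partial[OF F]] ci column_borel[OF disk_borel]]
  show "(LINT x:column (disk c r)|lborel. partial 1 F x) = (LINT q:strip r|lborel. F (wrap c r q) * cos (fst q / r))"
    unfolding col(1) disk_gauss[OF F r]
    by (subst strip_integral[OF strip_smooth(2,1)[OF F r _ tc(1)]]) (use strip_smooth(3)[OF F r _ tc(1)] in auto)
  show "(LINT x:column (disk c r)|lborel. partial 2 F x) = (LINT q:strip r|lborel. F (wrap c r q) * sin (fst q / r))"
    unfolding col(1) disk_gauss[OF F r]
    by (subst strip_integral[OF strip_smooth(2,1)[OF F r _ tc(2)]]) (use strip_smooth(3)[OF F r _ tc(2)] in auto)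
  assume z: "\<And>x. x$3 = 0 \<or> x$3 = 1 \<Longrightarrow> F x = 0"
  have "(LINT z:{0<..<1}|lborel. partial 3 F (mk3 (p, z))) = 0" for p
  proof -
    have c3: "continuous_on S (\<lambda>z. partial 3 F (mk3 (p, z)))" for S
      using smooth_partial[OF F] by (intro smooth_mk3_continuous continuous_intros) auto
    then have "(LINT z:{0<..<1}|lborel. partial 3 F (mk3 (p, z))) = integral {0..1} (\<lambda>z. partial 3 F (mk3 (p, z)))"
      by (subst set_integral_endpoints(2)) (auto intro!: set_integral_continuous borel_measurable_continuous_onI)
    also have "\<dots> = F (mk3 (p, 1)) - F (mk3 (p, 0))"
      using smooth_coordinate_derivative(3)[OF F] by (cases p) (intro integral_derivative, auto)
    finally show ?thesis using z[of "mk3 (p, 1)"] z[of "mk3 (p, 0)"] by simp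
  qed
  then show "(LINT x:column (disk c r)|lborel. partial 3 F x) = 0"
    unfolding col(2) by (simp add: set_lebesgue_integral_def)
qed

lemma circle_integral:
  assumes r: "r > 0"
  shows "integral {0..2 * pi * r} (\<lambda>s. A + B * cos (s / r) + C * sin (s / r) + D * (cos (s / r))\<^sup>2 + E * (cos (s / r) * sin (s / r)) + G * (sin (s / r))\<^sup>2)
     = 2 * pi * r * A + pi * r * D + pi * r * G"
proof -
  let ?P = "\<lambda>s. A * s + B * (r * sin (s / r)) - C * (r * cos (s / r)) + D * (s / 2 + r / 2 * (sin (s / r) * cos (s / r)))
     + E * (r / 2 * (sin (s / r))\<^sup>2) + G * (s / 2 - r / 2 * (sin (s / r) * cos (s / r)))"
  have "(?P has_real_derivative A + B * cos (s / r) + C * sin (s / r) + D * (cos (s / r))\<^sup>2 + E * (cos (s / r) * sin (s / r)) + G * (sin (s / r))\<^sup>2) (at s)" for s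
  proof -
    have 1: "((\<lambda>s. sin (s / r)) has_real_derivative cos (s / r) / r) (at s)" "((\<lambda>s. cos (s / r)) has_real_derivative - sin (s / r) / r) (at s)"
      using r by (auto intro!: derivative_eq_intros)
    have "(?P has_real_derivative A + B * (r * (cos (s / r) / r)) - C * (r * (- sin (s / r) / r))
       + D * (1 / 2 + r / 2 * (cos (s / r) / r * cos (s / r) + - sin (s / r) / r * sin (s / r)))
       + E * (r / 2 * (2 * sin (s / r) * (cos (s / r) / r)))
       + G * (1 / 2 - r / 2 * (cos (s / r) / r * cos (s / r) + - sin (s / r) / r * sin (s / r)))) (at s)"
      by (auto intro!: derivative_eq_intros 1 simp: power2_eq_square)
    moreover have e: "r / 2 * (cos (s / r) / r * cos (s / r) + - sin (s / r) / r * sin (s / r)) = (cos (s / r))\<^sup>2 / 2 - (sin (s / r))\<^sup>2 / 2"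
      using r by (simp add: power2_eq_square field_simps)
    have k1: "1 / 2 + r / 2 * (cos (s / r) / r * cos (s / r) + - sin (s / r) / r * sin (s / r)) = (cos (s / r))\<^sup>2"
      and k2: "1 / 2 - r / 2 * (cos (s / r) / r * cos (s / r) + - sin (s / r) / r * sin (s / r)) = (sin (s / r))\<^sup>2"
      unfolding e using sin_cos_squared_add[of "s / r"] by linarith+
    have k3: "B * (r * (cos (s / r) / r)) = B * cos (s / r)" "C * (r * (- sin (s / r) / r)) = - (C * sin (s / r))"
      "E * (r / 2 * (2 * sin (s / r) * (cos (s / r) / r))) = E * (cos (s / r) * sin (s / r))"
      using r by simp_all
    ultimately show ?thesis unfolding k1 k2 k3 by simp
  qed
  then have "integral {0..2 * pi * r} (\<lambda>s. A + B * cos (s / r) + C * sin (s / r) + D * (cos (s / r))\<^sup>2 + E * (cos (s / r) * sin (s / r)) + G * (sin (s / r))\<^sup>2)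
     = ?P (2 * pi * r) - ?P 0"
    using r by (intro integral_derivative) auto
  also have "\<dots> = 2 * pi * r * A + pi * r * D + pi * r * G"
    using r by (simp add: algebra_simps)
  finally show ?thesis .
qed

section \<open>Strains with a density\<close>

text \<open>For nonnegative integrands the identity is moved to sums of positive terms, which makes sense
  for all measurable functions and survives monotone limits.\<close>

lemma signed_measure_nn_integral:
  fixes h :: "'a \<Rightarrow> real"
  assumes P: "finite_measure P" "sets P = sets K" and N: "finite_measure N" "sets N = sets K"
    and h: "integrable K h"
    and eq: "\<And>A. A \<in> sets K \<Longrightarrow> measure P A - measure N A = (LINT x:A|K. h x)"
    and f: "f \<in> borel_measurable K"
  shows "(\<integral>\<^sup>+x. f x \<partial>P) + (\<integral>\<^sup>+x. f x * ennreal (- h x) \<partial>K) = (\<integral>\<^sup>+x. f x \<partial>N) + (\<integral>\<^sup>+x. f x * ennreal (h x) \<partial>K)"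
  using f
proof (induction f rule: borel_measurable_induct)
  case (cong f g)
  have "space P = space K" "space N = space K" using P(2) N(2) by (auto dest: sets_eq_imp_space_eq)
  then have "(\<integral>\<^sup>+x. f x \<partial>P) = (\<integral>\<^sup>+x. g x \<partial>P)" "(\<integral>\<^sup>+x. f x \<partial>N) = (\<integral>\<^sup>+x. g x \<partial>N)"
    "(\<integral>\<^sup>+x. f x * ennreal (- h x) \<partial>K) = (\<integral>\<^sup>+x. g x * ennreal (- h x) \<partial>K)"
    "(\<integral>\<^sup>+x. f x * ennreal (h x) \<partial>K) = (\<integral>\<^sup>+x. g x * ennreal (h x) \<partial>K)"
    using cong(3) by (auto intro!: nn_integral_cong)
  then show ?case using cong(4) by simp
next
  case (set A)
  interpret P: finite_measure P by fact
  interpret N: finite_measure N by fact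
  have hA: "integrable K (\<lambda>x. indicator A x *\<^sub>R h x)"
    using h set by (rule integrable_mult_indicator[rotated])
  define a where "a = (\<integral>\<^sup>+x. ennreal (indicator A x *\<^sub>R h x) \<partial>K)"
  define b where "b = (\<integral>\<^sup>+x. ennreal (- (indicator A x *\<^sub>R h x)) \<partial>K)"
  have fin: "a < top" "b < top"
    using hA unfolding a_def b_def by (auto simp: real_integrable_def top.not_eq_extremum)
  have ab: "measure P A - measure N A = enn2real a - enn2real b"
    unfolding eq[OF set] set_lebesgue_integral_def a_def b_def by (rule real_lebesgue_integral_def[OF hA])
  then have "measure P A + enn2real b = measure N A + enn2real a" by linarith
  then have "ennreal (measure P A) + ennreal (enn2real b) = ennreal (measure N A) + ennreal (enn2real a)"
    by (simp flip: ennreal_plus)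
  then have "emeasure P A + b = emeasure N A + a"
    using fin by (simp add: P.emeasure_eq_measure N.emeasure_eq_measure)
  moreover have "(\<integral>\<^sup>+x. indicator A x * ennreal (h x) \<partial>K) = a" "(\<integral>\<^sup>+x. indicator A x * ennreal (- h x) \<partial>K) = b"
    unfolding a_def b_def by (auto intro!: nn_integral_cong simp: indicator_def)
  moreover have "A \<in> sets P" "A \<in> sets N" using set P(2) N(2) by auto
  ultimately show ?case by simp
next
  case (mult u c)
  have [measurable]: "u \<in> borel_measurable P" "u \<in> borel_measurable N" "u \<in> borel_measurable K"
    using mult(2) by (simp_all add: measurable_cong_sets[OF P(2) refl] measurable_cong_sets[OF N(2) refl])
  have [measurable]: "h \<in> borel_measurable K" using h by simp
  have "(\<integral>\<^sup>+x. c * u x \<partial>P) + (\<integral>\<^sup>+x. c * u x * ennreal (- h x) \<partial>K) = c * ((\<integral>\<^sup>+x. u x \<partial>P) + (\<integral>\<^sup>+x. u x * ennreal (- h x) \<partial>K))"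
    by (simp add: nn_integral_cmult distrib_left mult.assoc)
  also have "\<dots> = c * ((\<integral>\<^sup>+x. u x \<partial>N) + (\<integral>\<^sup>+x. u x * ennreal (h x) \<partial>K))" by (simp only: mult.IH)
  also have "\<dots> = (\<integral>\<^sup>+x. c * u x \<partial>N) + (\<integral>\<^sup>+x. c * u x * ennreal (h x) \<partial>K)"
    by (simp add: nn_integral_cmult distrib_left mult.assoc)
  finally show ?case .
next
  case (add u v)
  have [measurable]: "u \<in> borel_measurable P" "u \<in> borel_measurable N" "u \<in> borel_measurable K"
    "v \<in> borel_measurable P" "v \<in> borel_measurable N" "v \<in> borel_measurable K"
    using add(1) add(3) by (simp_all add: measurable_cong_sets[OF P(2) refl] measurable_cong_sets[OF N(2) refl])
  have [measurable]: "h \<in> borel_measurable K" using h by simp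
  have "(\<integral>\<^sup>+x. v x + u x \<partial>P) + (\<integral>\<^sup>+x. (v x + u x) * ennreal (- h x) \<partial>K) =
     ((\<integral>\<^sup>+x. v x \<partial>P) + (\<integral>\<^sup>+x. v x * ennreal (- h x) \<partial>K)) + ((\<integral>\<^sup>+x. u x \<partial>P) + (\<integral>\<^sup>+x. u x * ennreal (- h x) \<partial>K))"
    by (simp add: nn_integral_add distrib_right add_ac)
  also have "\<dots> = ((\<integral>\<^sup>+x. v x \<partial>N) + (\<integral>\<^sup>+x. v x * ennreal (h x) \<partial>K)) + ((\<integral>\<^sup>+x. u x \<partial>N) + (\<integral>\<^sup>+x. u x * ennreal (h x) \<partial>K))"
    by (simp only: add.IH)
  also have "\<dots> = (\<integral>\<^sup>+x. v x + u x \<partial>N) + (\<integral>\<^sup>+x. (v x + u x) * ennreal (h x) \<partial>K)"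
    by (simp add: nn_integral_add distrib_right add_ac)
  finally show ?case .
next
  case (seq U)
  have [measurable]: "U j \<in> borel_measurable P" "U j \<in> borel_measurable N" "U j \<in> borel_measurable K" for j
    using seq(1) by (simp_all add: measurable_cong_sets[OF P(2) refl] measurable_cong_sets[OF N(2) refl])
  have [measurable]: "h \<in> borel_measurable K" using h by simp
  have incU: "incseq U" using seq by simp
  have inc: "incseq (\<lambda>j x. U j x * g x)" for g :: "'a \<Rightarrow> ennreal"
    using incU by (auto simp: incseq_def le_fun_def intro!: mult_right_mono)
  have incI: "incseq (\<lambda>j. \<integral>\<^sup>+x. U j x \<partial>Q)" "incseq (\<lambda>j. \<integral>\<^sup>+x. U j x * g x \<partial>Q)" for Q :: "'a measure" and g
    using incU inc[of g] by (auto simp: incseq_def le_fun_def intro!: nn_integral_mono)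
  have s: "(SUP j. U j) x = (SUP j. U j x)" for x by (simp add: Sup_fun_def image_image)
  have sm: "(SUP j. U j) x * g x = (SUP j. U j x * g x)" for x and g :: "'a \<Rightarrow> ennreal"
    unfolding s by (rule SUP_mult_right_ennreal)
  have lim1: "(\<integral>\<^sup>+x. (SUP j. U j) x \<partial>Q) = (SUP j. \<integral>\<^sup>+x. U j x \<partial>Q)" if "\<And>j. U j \<in> borel_measurable Q" for Q
    unfolding s using incU that by (intro nn_integral_monotone_convergence_SUP) auto
  have lim2: "(\<integral>\<^sup>+x. (SUP j. U j) x * ennreal (t * h x) \<partial>K) = (SUP j. \<integral>\<^sup>+x. U j x * ennreal (t * h x) \<partial>K)" for t
    unfolding sm[of _ "\<lambda>x. ennreal (t * h x)"] using inc[of "\<lambda>x. ennreal (t * h x)"] by (intro nn_integral_monotone_convergence_SUP) auto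
  have "(\<integral>\<^sup>+x. (SUP j. U j) x \<partial>P) + (\<integral>\<^sup>+x. (SUP j. U j) x * ennreal (- h x) \<partial>K) =
      (SUP j. (\<integral>\<^sup>+x. U j x \<partial>P) + (\<integral>\<^sup>+x. U j x * ennreal (- h x) \<partial>K))"
    using lim1[of P] lim2[of "-1"] ennreal_SUP_add[OF incI(1)[of P] incI(2)[of K "\<lambda>x. ennreal (- h x)"]] by simp
  also have "\<dots> = (SUP j. (\<integral>\<^sup>+x. U j x \<partial>N) + (\<integral>\<^sup>+x. U j x * ennreal (h x) \<partial>K))" by (simp only: seq.IH)
  also have "\<dots> = (\<integral>\<^sup>+x. (SUP j. U j) x \<partial>N) + (\<integral>\<^sup>+x. (SUP j. U j) x * ennreal (h x) \<partial>K)"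
    using lim1[of N] lim2[of 1] ennreal_SUP_add[OF incI(1)[of N] incI(2)[of K "\<lambda>x. ennreal (h x)"]] by simp
  finally show ?case .
qed

lemma signed_measure_integral:
  fixes f h :: "'a \<Rightarrow> real"
  assumes P: "finite_measure P" "sets P = sets K" and N: "finite_measure N" "sets N = sets K"
    and h: "integrable K h"
    and eq: "\<And>A. A \<in> sets K \<Longrightarrow> measure P A - measure N A = (LINT x:A|K. h x)"
    and f: "f \<in> borel_measurable K" "\<And>x. \<bar>f x\<bar> \<le> B"
  shows "(LINT x|P. f x) - (LINT x|N. f x) = (LINT x|K. f x * h x)"
proof -
  interpret P: finite_measure P by fact
  interpret N: finite_measure N by fact
  note [measurable] = f(1)
  have [measurable]: "h \<in> borel_measurable K" using h by simp
  have nonneg: "(LINT x|P. g x) - (LINT x|N. g x) = (LINT x|K. g x * h x)"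
    if g: "g \<in> borel_measurable K" "\<And>x. 0 \<le> g x" "\<And>x. g x \<le> C" for g C
  proof -
    note [measurable] = g(1)
    have C: "0 \<le> C" using g(2,3) order_trans by blast
    have gm: "g \<in> borel_measurable P" "g \<in> borel_measurable N"
      using g(1) by (simp_all add: measurable_cong_sets[OF P(2) refl] measurable_cong_sets[OF N(2) refl])
    have gi: "integrable P g" "integrable N g"
      using g gm by (auto intro!: P.integrable_const_bound[where B = C] N.integrable_const_bound[where B = C])
    have gh: "integrable K (\<lambda>x. g x * h x)"
    proof (rule Bochner_Integration.integrable_bound)
      show "integrable K (\<lambda>x. C * h x)" using h by simp
      show "AE x in K. norm (g x * h x) \<le> norm (C * h x)"
        using g(2,3) C by (auto simp: abs_mult intro!: mult_right_mono)
    qed simp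
    have m: "ennreal (g x) * ennreal (t * h x) = ennreal (t * (g x * h x))" for x t
      using g(2)[of x] by (subst ennreal_mult'[symmetric]) (auto simp: ac_simps)
    have id: "(\<integral>\<^sup>+x. g x \<partial>P) + (\<integral>\<^sup>+x. ennreal (- (g x * h x)) \<partial>K) = (\<integral>\<^sup>+x. g x \<partial>N) + (\<integral>\<^sup>+x. ennreal (g x * h x) \<partial>K)"
      using signed_measure_nn_integral[OF P N h eq, of "\<lambda>x. ennreal (g x)"] m[of _ "-1"] m[of _ 1] by simp
    define a where "a = (\<integral>\<^sup>+x. ennreal (g x * h x) \<partial>K)"
    define b where "b = (\<integral>\<^sup>+x. ennreal (- (g x * h x)) \<partial>K)"
    have fin: "a < top" "b < top"
      using gh unfolding a_def b_def by (auto simp: real_integrable_def top.not_eq_extremum)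
    have "ennreal (LINT x|P. g x) + b = ennreal (LINT x|N. g x) + a"
      using id nn_integral_eq_integral[OF gi(1)] nn_integral_eq_integral[OF gi(2)] g(2) by (simp add: a_def b_def)
    then have "ennreal (LINT x|P. g x) + ennreal (enn2real b) = ennreal (LINT x|N. g x) + ennreal (enn2real a)"
      using fin by simp
    then have "(LINT x|P. g x) + enn2real b = (LINT x|N. g x) + enn2real a"
      using g(2) by (simp flip: ennreal_plus add: integral_nonneg_AE)
    then show ?thesis
      using real_lebesgue_integral_def[OF gh] by (simp add: a_def b_def)
  qed
  have B: "0 \<le> B" using f(2) abs_ge_zero order_trans by blast
  have fm: "f \<in> borel_measurable P" "f \<in> borel_measurable N"
    using f(1) by (simp_all add: measurable_cong_sets[OF P(2) refl] measurable_cong_sets[OF N(2) refl])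
  have fi: "integrable P f" "integrable N f"
    using f fm by (auto intro!: P.integrable_const_bound[where B = B] N.integrable_const_bound[where B = B])
  have fh: "integrable K (\<lambda>x. f x * h x)"
  proof (rule Bochner_Integration.integrable_bound)
    show "integrable K (\<lambda>x. B * h x)" using h by simp
    show "AE x in K. norm (f x * h x) \<le> norm (B * h x)"
      using f(2) B by (auto simp: abs_mult intro!: mult_right_mono)
  qed simp
  have 1: "0 \<le> f x + B" "f x + B \<le> 2 * B" for x using f(2)[of x] by auto
  have "(LINT x|P. f x + B) - (LINT x|N. f x + B) = (LINT x|K. (f x + B) * h x)"
    using 1 by (intro nonneg[where C = "2 * B"]) auto
  moreover have "(LINT x|P. B) - (LINT x|N. B) = (LINT x|K. B * h x)"
    using B by (intro nonneg[where C = B]) auto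
  moreover have "(LINT x|P. f x + B) = (LINT x|P. f x) + (LINT x|P. B)" "(LINT x|N. f x + B) = (LINT x|N. f x) + (LINT x|N. B)"
    by (rule Bochner_Integration.integral_add[OF fi(1)], simp, rule Bochner_Integration.integral_add[OF fi(2)], simp)
  moreover have "(LINT x|K. (f x + B) * h x) = (LINT x|K. f x * h x) + (LINT x|K. B * h x)"
    unfolding distrib_right by (rule Bochner_Integration.integral_add[OF fh]) (use h in simp)
  ultimately show ?thesis by linarith
qed

text \<open>Smooth approximations of indicators show that \<open>h\<close> integrates to zero over finite unions of boxes, and
  regularity of the measure with density \<open>\<bar>h\<bar>\<close> extends this to all Borel sets.\<close>

lemma integrable_zero_on_test_functions:
  fixes h :: "real^3 \<Rightarrow> real"
  assumes \<Omega>: "open \<Omega>" and K: "sets K = sets borel" and h: "integrable K h" and supp: "\<And>x. x \<notin> \<Omega> \<Longrightarrow> h x = 0"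
    and z: "\<And>f. f \<in> test_functions \<Omega> \<Longrightarrow> (LINT x|K. f x * h x) = 0"
  shows "AE x in K. h x = 0"
proof -
  have sp: "space K = UNIV" using sets_eq_imp_space_eq[OF K] by simp
  have [measurable]: "h \<in> borel_measurable K" using h by simp
  let ?\<nu> = "density K (\<lambda>x. ennreal \<bar>h x\<bar>)"
  have em: "emeasure ?\<nu> A = ennreal (LINT x:A|K. \<bar>h x\<bar>)" if "A \<in> sets K" for A
  proof -
    have i: "integrable K (\<lambda>x. indicator A x *\<^sub>R \<bar>h x\<bar>)" using h that by (intro integrable_mult_indicator) auto
    have "emeasure ?\<nu> A = (\<integral>\<^sup>+x. ennreal (indicator A x *\<^sub>R \<bar>h x\<bar>) \<partial>K)"
      using that by (subst emeasure_density) (auto intro!: nn_integral_cong simp: indicator_def)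
    also have "\<dots> = ennreal (LINT x:A|K. \<bar>h x\<bar>)"
      unfolding set_lebesgue_integral_def by (rule nn_integral_eq_integral[OF i]) (auto simp: indicator_def)
    finally show ?thesis .
  qed
  have fin: "emeasure ?\<nu> (space ?\<nu>) \<noteq> \<infinity>" using em[of UNIV] K sp by simp
  interpret \<nu>: finite_measure ?\<nu> by standard (rule fin)
  have set0: "(LINT x:A|K. h x) = 0" if A: "A \<in> sets K" for A
  proof -
    let ?A = "A \<inter> \<Omega>"
    have [measurable]: "\<Omega> \<in> sets K" using \<Omega> K by simp
    have AB: "?A \<in> sets borel" using A \<Omega> K by simp
    have "\<bar>LINT x:A|K. h x\<bar> \<le> 0 + e" if e: "e > 0" for e :: real
    proof -
      have "\<exists>C. finite C \<and> (\<forall>c\<in>C. cbox (fst c) (snd c) \<subseteq> \<Omega>) \<and>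
          (LINT x|K. \<bar>indicator A x - indicator (\<Union>c\<in>C. box (fst c) (snd c)) x\<bar> * \<bar>h x\<bar>) < e"
      proof -
        have s': "sets ?\<nu> = sets borel" using K by simp
        have lt: "emeasure ?\<nu> ?A < emeasure ?\<nu> ?A + ennreal (e / 2)"
          using e by (auto simp: \<nu>.emeasure_eq_measure intro!: ennreal_lessI add_nonneg_pos simp flip: ennreal_plus)
        obtain G where G: "?A \<subseteq> G" "open G" "emeasure ?\<nu> G < emeasure ?\<nu> ?A + ennreal (e / 2)"
          using lt unfolding outer_regular[OF s' fin AB] INF_less_iff by blast
        obtain L where L: "L \<subseteq> ?A" "compact L" "emeasure ?\<nu> ?A < emeasure ?\<nu> L + ennreal (e / 2)"
        proof -
          have "emeasure ?\<nu> ?A < (SUP L\<in>{L. L \<subseteq> ?A \<and> compact L}. emeasure ?\<nu> L + ennreal (e / 2))"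
            using lt ennreal_SUP_add_left[of "{L. L \<subseteq> ?A \<and> compact L}" "emeasure ?\<nu>" "ennreal (e / 2)"]
            unfolding inner_regular[OF s' fin AB, symmetric] by (metis (no_types, lifting) compact_empty empty_iff empty_subsetI mem_Collect_eq)
          then show ?thesis using that unfolding less_SUP_iff by blast
        qed
        obtain C where C: "finite C" "L \<subseteq> (\<Union>c\<in>C. box (fst c) (snd c))" "\<And>c. c \<in> C \<Longrightarrow> cbox (fst c) (snd c) \<subseteq> G \<inter> \<Omega>"
          by (rule compact_box_cover[of L "G \<inter> \<Omega>"]) (use G L \<Omega> in auto)
        let ?U = "\<Union>c\<in>C. box (fst c) (snd c)"
        have U: "?U \<subseteq> G \<inter> \<Omega>" using C(3) box_subset_cbox by blast
        have m: "G \<in> sets K" "L \<in> sets K" unfolding K using G L borel_compact by simp_all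
        have GL: "measure ?\<nu> G < measure ?\<nu> ?A + e / 2" "measure ?\<nu> ?A < measure ?\<nu> L + e / 2"
          using G(3) L(3) e by (auto simp: \<nu>.emeasure_eq_measure ennreal_less_iff simp flip: ennreal_plus)
        have "(LINT x|K. \<bar>indicator A x - indicator ?U x\<bar> * \<bar>h x\<bar>) \<le> (LINT x:G - L|K. \<bar>h x\<bar>)"
          unfolding set_lebesgue_integral_def
        proof (intro integral_mono')
          show "integrable K (\<lambda>x. indicator (G - L) x *\<^sub>R \<bar>h x\<bar>)"
            using h m by (intro integrable_mult_indicator) auto
          show "\<bar>indicator A x - indicator ?U x\<bar> * \<bar>h x\<bar> \<le> indicator (G - L) x *\<^sub>R \<bar>h x\<bar>" for x
            using U G(1) L(1) C(2) supp[of x] by (cases "x \<in> \<Omega>") (auto simp: indicator_def)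
        qed simp
        also have "\<dots> = measure ?\<nu> (G - L)"
          using em[of "G - L"] m by (simp add: \<nu>.emeasure_eq_measure set_lebesgue_integral_def)
        also have "\<dots> = measure ?\<nu> G - measure ?\<nu> L"
          using m L(1) G(1) by (intro \<nu>.finite_measure_Diff) auto
        finally show ?thesis using GL C(1,3) by (intro exI[of _ C]) auto
      qed
      then obtain C where "finite C \<and> (\<forall>c\<in>C. cbox (fst c) (snd c) \<subseteq> \<Omega>) \<and>
          (LINT x|K. \<bar>indicator A x - indicator (\<Union>c\<in>C. box (fst c) (snd c)) x\<bar> * \<bar>h x\<bar>) < e" ..
      then have C: "finite C" "\<And>c. c \<in> C \<Longrightarrow> cbox (fst c) (snd c) \<subseteq> \<Omega>"
          "(LINT x|K. \<bar>indicator A x - indicator (\<Union>c\<in>C. box (fst c) (snd c)) x\<bar> * \<bar>h x\<bar>) < e" by simp_all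
      let ?U = "\<Union>c\<in>C. box (fst c) (snd c)"
      have [measurable]: "?U \<in> sets K" unfolding K using C(1) by (intro sets.finite_UN) simp_all
      have t: "box_approx C n \<in> test_functions \<Omega>" for n by (rule box_approx_test[OF C(1,2)])
      have tm: "box_approx C n \<in> borel_measurable K" for n
        using test_functions_borel[OF t] measurable_cong_sets[OF K refl] by blast
      have "(\<lambda>n. LINT x|K. box_approx C n x * h x) \<longlonglongrightarrow> (LINT x|K. indicator ?U x * h x)"
      proof (rule integral_dominated_convergence[where w = "\<lambda>x. \<bar>h x\<bar>"])
        show "AE x in K. (\<lambda>n. box_approx C n x * h x) \<longlonglongrightarrow> indicator ?U x * h x"
          by (intro AE_I2 tendsto_mult box_approx_tendsto C(1) tendsto_const)
        show "AE x in K. norm (box_approx C n x * h x) \<le> \<bar>h x\<bar>" for n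
          using box_approx_bounds[of C n] by (intro AE_I2) (simp add: abs_mult mult_left_le_one_le)
      qed (use tm h in auto)
      then have U0: "(LINT x|K. indicator ?U x * h x) = 0"
        using z[OF t] by (simp add: LIMSEQ_const_iff)
      have i: "integrable K (\<lambda>x. indicator A x * h x)" "integrable K (\<lambda>x. indicator ?U x * h x)"
        using h A integrable_mult_indicator[of A K h] integrable_mult_indicator[of ?U K h] by auto
      have "(LINT x:A|K. h x) = (LINT x|K. (indicator A x - indicator ?U x) * h x)"
        using i U0 unfolding set_lebesgue_integral_def by (simp add: left_diff_distrib)
      then have "\<bar>LINT x:A|K. h x\<bar> \<le> (LINT x|K. \<bar>(indicator A x - indicator ?U x) * h x\<bar>)"
        by (simp add: integral_abs_bound)
      then show ?thesis using C(3) by (simp add: abs_mult)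
    qed
    then have "\<bar>LINT x:A|K. h x\<bar> \<le> 0" by (rule field_le_epsilon)
    then show ?thesis by simp
  qed
  have "AE x in K. h x = (\<lambda>_. 0) x"
    by (rule density_unique_real[OF h]) (simp_all add: set0 set_lebesgue_integral_def[of _ _ "\<lambda>_. 0"])
  then show ?thesis by simp
qed

context perforated
begin

abbreviation "MO \<equiv> restrict_space M \<Omega>"

lemma sets_MO: "sets MO = sets (restrict_space borel \<Omega>)"
  by (rule sets_restrict_space_cong) simp

lemma space_MO: "space MO = \<Omega>" by (simp add: space_restrict_space)

lemma sets_MO_iff: "A \<in> sets MO \<longleftrightarrow> A \<in> sets borel \<and> A \<subseteq> \<Omega>"
  by (auto simp: sets_restrict_space_iff)

lemma integral_MO:
  fixes f :: "real^3 \<Rightarrow> 'b::{banach, second_countable_topology}"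
  shows "(LINT x|MO. f x) = (LINT x:\<Omega>|M. f x)" and "integrable MO f \<longleftrightarrow> set_integrable M \<Omega> f"
  by (simp_all add: integral_restrict_space integrable_restrict_space set_lebesgue_integral_def set_integrable_def)

lemma set_integral_MO:
  fixes f :: "real^3 \<Rightarrow> 'b::{banach, second_countable_topology}"
  assumes "B \<subseteq> \<Omega>"
  shows "(LINT x:B|MO. f x) = (LINT x:B|M. f x)"
  unfolding set_lebesgue_integral_def integral_MO(1)
  using assms by (intro Bochner_Integration.integral_cong) (auto simp: indicator_def)

lemma bounded_linear_entry: "bounded_linear (\<lambda>A :: real^3^3. A $ i $ j)"
  using bounded_linear_compose[OF bounded_linear_vec_nth[of j] bounded_linear_vec_nth[of i]] .

text \<open>The two measures whose difference represents an entry of \<open>Eu\<close> are arbitrary, but against bounded functions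
  only their difference counts, which has the density \<open>g\<close>.\<close>

lemma E_distr_eq_integral:
  assumes u: "is_Eu \<Omega> u \<Lambda>" and g: "is_density \<Omega> \<Lambda> M g" and f: "f \<in> test_functions \<Omega>"
  shows "E_distr \<Omega> u i j f = (LINT x:\<Omega>|M. f x * g x $ i $ j)"
proof -
  obtain P N :: "3 \<Rightarrow> 3 \<Rightarrow> (real^3) measure" where PN:
      "\<And>i j. finite_measure (P i j) \<and> sets (P i j) = sets (restrict_space borel \<Omega>) \<and>
        finite_measure (N i j) \<and> sets (N i j) = sets (restrict_space borel \<Omega>) \<and>
        (\<forall>B\<in>sets (restrict_space borel \<Omega>). \<Lambda> B $ i $ j = measure (P i j) B - measure (N i j) B) \<and>
        (\<forall>f\<in>test_functions \<Omega>. E_distr \<Omega> u i j f = (LINT x|P i j. f x) - (LINT x|N i j. f x))"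
    using u unfolding is_Eu_def by blast
  have gi: "integrable MO g" and gL: "\<And>B. B \<in> sets (restrict_space borel \<Omega>) \<Longrightarrow> \<Lambda> B = (LINT x:B|M. g x)"
    using g integral_MO(2) unfolding is_density_def by auto
  obtain B where B: "\<And>x. \<bar>f x\<bar> \<le> B" using test_functions_bounded[OF f] by blast
  have "(LINT x|P i j. f x) - (LINT x|N i j. f x) = (LINT x|MO. f x * g x $ i $ j)"
  proof (rule signed_measure_integral)
    show "finite_measure (P i j)" "finite_measure (N i j)" using PN by blast+
    show "sets (P i j) = sets MO" "sets (N i j) = sets MO" unfolding sets_MO using PN by blast+
    show "integrable MO (\<lambda>x. g x $ i $ j)"
      by (rule integrable_bounded_linear[OF bounded_linear_entry gi])
    show "f \<in> borel_measurable MO"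
      using test_functions_borel[OF f] by (intro measurable_restrict_space1) simp
    show "\<bar>f x\<bar> \<le> B" for x by (rule B)
    fix A assume A: "A \<in> sets MO"
    then have A': "A \<in> sets (restrict_space borel \<Omega>)" "A \<subseteq> \<Omega>" using sets_MO sets_MO_iff by blast+
    have iA: "integrable MO (\<lambda>x. indicator A x *\<^sub>R g x)" using integrable_mult_indicator[OF A gi] .
    have "measure (P i j) A - measure (N i j) A = \<Lambda> A $ i $ j" using PN A' by simp
    also have "\<dots> = (LINT x:A|MO. g x) $ i $ j" using gL[OF A'(1)] set_integral_MO[OF A'(2), of g] by simp
    also have "\<dots> = (LINT x:A|MO. g x $ i $ j)"
      unfolding set_lebesgue_integral_def
      using integral_bounded_linear[OF bounded_linear_entry iA, of i j] by simp
    finally show "measure (P i j) A - measure (N i j) A = (LINT x:A|MO. g x $ i $ j)" .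
  qed
  then show ?thesis using PN f integral_MO(1) by simp
qed

lemma density_unique:
  assumes "is_Eu \<Omega> u \<Lambda>" "is_density \<Omega> \<Lambda> M g" "is_Eu \<Omega> u \<Lambda>'" "is_density \<Omega> \<Lambda>' M g'"
  shows "AE x in M. x \<in> \<Omega> \<longrightarrow> g x = g' x"
proof -
  have "AE x in M. x \<in> \<Omega> \<longrightarrow> g x $ i $ j = g' x $ i $ j" for i j
  proof -
    have gi: "integrable M (\<lambda>x. indicator \<Omega> x *\<^sub>R g x)" "integrable M (\<lambda>x. indicator \<Omega> x *\<^sub>R g' x)"
      using assms(2,4) by (auto simp: is_density_def set_integrable_def)
    have e: "integrable M (\<lambda>x. indicator \<Omega> x * (g x $ i $ j))" "integrable M (\<lambda>x. indicator \<Omega> x * (g' x $ i $ j))"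
      using integrable_bounded_linear[OF bounded_linear_entry gi(1), of i j]
        integrable_bounded_linear[OF bounded_linear_entry gi(2), of i j] by simp_all
    let ?h = "\<lambda>x. indicator \<Omega> x * (g x $ i $ j) - indicator \<Omega> x * (g' x $ i $ j)"
    have "AE x in M. ?h x = 0"
    proof (rule integrable_zero_on_test_functions[OF open_\<Omega> sets_mu])
      show "integrable M ?h" using e by simp
      fix f assume f: "f \<in> test_functions \<Omega>"
      obtain B where B: "\<And>x. \<bar>f x\<bar> \<le> B" "B \<ge> 0" using test_functions_bounded[OF f] by blast
      have fm: "f \<in> borel_measurable M" using test_functions_borel[OF f] by simp
      have fi: "integrable M (\<lambda>x. f x * k x)" if "integrable M k" for k :: "_ \<Rightarrow> real"
      proof (rule Bochner_Integration.integrable_bound)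
        show "integrable M (\<lambda>x. B * k x)" using that by simp
        show "(\<lambda>x. f x * k x) \<in> borel_measurable M" using fm that by simp
        show "AE x in M. norm (f x * k x) \<le> norm (B * k x)"
          using B by (auto simp: abs_mult intro!: mult_right_mono)
      qed
      have "(LINT x:\<Omega>|M. f x * g x $ i $ j) = (LINT x:\<Omega>|M. f x * g' x $ i $ j)"
        using E_distr_eq_integral[OF assms(1,2) f] E_distr_eq_integral[OF assms(3,4) f] by metis
      then have "(LINT x|M. f x * (indicator \<Omega> x * (g x $ i $ j))) = (LINT x|M. f x * (indicator \<Omega> x * (g' x $ i $ j)))"
        by (simp add: set_lebesgue_integral_def mult.left_commute)
      then show "(LINT x|M. f x * ?h x) = 0"
        using fi[OF e(1)] fi[OF e(2)] by (simp only: right_diff_distrib) simp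
    qed simp
    then show ?thesis by eventually_elim (auto simp: indicator_def)
  qed
  then have "AE x in M. \<forall>i\<in>UNIV. \<forall>j\<in>UNIV. x \<in> \<Omega> \<longrightarrow> g x $ i $ j = g' x $ i $ j"
    by (intro AE_finite_allI) auto
  then show ?thesis by eventually_elim (auto simp: vec_eq_iff)
qed

text \<open>\<^const>\<open>dEu\<close> is an arbitrary choice among the densities, and these coincide almost everywhere.\<close>

lemma dEu_AE:
  assumes "is_Eu \<Omega> u \<Lambda>" "is_density \<Omega> \<Lambda> M g"
  shows "AE x in M. x \<in> \<Omega> \<longrightarrow> dEu \<Omega> M u x = g x" and "\<exists>\<Lambda>'. is_Eu \<Omega> u \<Lambda>' \<and> is_density \<Omega> \<Lambda>' M (dEu \<Omega> M u)"
proof -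
  show 1: "\<exists>\<Lambda>'. is_Eu \<Omega> u \<Lambda>' \<and> is_density \<Omega> \<Lambda>' M (dEu \<Omega> M u)"
    unfolding dEu_def by (rule someI[of "\<lambda>g. \<exists>\<Lambda>. is_Eu \<Omega> u \<Lambda> \<and> is_density \<Omega> \<Lambda> M g" g]) (use assms in blast)
  then show "AE x in M. x \<in> \<Omega> \<longrightarrow> dEu \<Omega> M u x = g x" using density_unique assms by blast
qed

lemma F_eps_eq:
  assumes "is_Eu \<Omega> u \<Lambda>" "is_density \<Omega> \<Lambda> M g"
  shows "F_eps 2 \<Omega> \<epsilon> u = \<epsilon>\<^sup>2 * (LINT x:\<Omega>|M. (norm (g x))\<^sup>2)"
proof -
  have m: "(\<lambda>x. indicator \<Omega> x *\<^sub>R k x) \<in> borel_measurable M" if "is_density \<Omega> \<Lambda>' M k" for \<Lambda>' k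
    using that by (auto simp: is_density_def set_integrable_def)
  have sq: "(\<lambda>x. indicator \<Omega> x *\<^sub>R (norm (k x))\<^sup>2) = (\<lambda>x. (norm (indicator \<Omega> x *\<^sub>R k x))\<^sup>2)" for k :: "_ \<Rightarrow> real^3^3"
    by (auto simp: indicator_def)
  obtain \<Lambda>' where "is_density \<Omega> \<Lambda>' M (dEu \<Omega> M u)" using dEu_AE(2)[OF assms] by blast
  note mm = m[OF this] m[OF assms(2)]
  have "(LINT x:\<Omega>|M. (norm (dEu \<Omega> M u x))\<^sup>2) = (LINT x:\<Omega>|M. (norm (g x))\<^sup>2)"
    unfolding set_lebesgue_integral_def sq
  proof (rule integral_cong_AE)
    show "AE x in M. (norm (indicator \<Omega> x *\<^sub>R dEu \<Omega> M u x))\<^sup>2 = (norm (indicator \<Omega> x *\<^sub>R g x))\<^sup>2"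
      using dEu_AE(1)[OF assms] by eventually_elim (auto simp: indicator_def)
    have nm: "(\<lambda>x. (norm (k x))\<^sup>2) \<in> borel_measurable M" if [measurable]: "k \<in> borel_measurable M" for k :: "_ \<Rightarrow> real^3^3"
      by measurable
    show "(\<lambda>x. (norm (indicator \<Omega> x *\<^sub>R dEu \<Omega> M u x))\<^sup>2) \<in> borel_measurable M"
      "(\<lambda>x. (norm (indicator \<Omega> x *\<^sub>R g x))\<^sup>2) \<in> borel_measurable M"
      by (rule nm[OF mm(1)], rule nm[OF mm(2)])
  qed
  moreover have "\<epsilon> powr 2 = \<epsilon>\<^sup>2" using \<epsilon>_pos by (simp add: powr_numeral)
  ultimately show ?thesis by (simp add: F_eps_def)
qed

text \<open>A bounded density turns the identity on test functions into a representation by finite measures, the positive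
  and negative parts of its entries.\<close>

lemma bounded_density_LD2:
  assumes g [measurable]: "g \<in> borel_measurable borel" and gb: "\<And>x. x \<in> \<Omega> \<Longrightarrow> norm (g x) \<le> C"
    and E: "\<And>i j f. f \<in> test_functions \<Omega> \<Longrightarrow> E_distr \<Omega> u i j f = (LINT x:\<Omega>|M. f x * g x $ i $ j)"
    and u [measurable]: "u \<in> borel_measurable borel" and ub: "\<And>x. x \<in> \<Omega> \<Longrightarrow> norm (u x) \<le> D"
  shows "u \<in> LD2 \<Omega> M" and "F_eps 2 \<Omega> \<epsilon> u = \<epsilon>\<^sup>2 * (LINT x:\<Omega>|M. (norm (g x))\<^sup>2)"
proof -
  define \<Lambda> where "\<Lambda> B = (LINT x:B|M. g x)" for B
  have gint: "set_integrable M \<Omega> g" by (rule bounded_integrable_M[OF g gb])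
  then have gi: "integrable MO g" using integral_MO(2) by blast
  interpret MO: finite_measure MO
    by standard (use emeasure_M_finite in \<open>auto simp: space_MO emeasure_restrict_space\<close>)
  have dens: "is_density \<Omega> \<Lambda> M g" unfolding is_density_def \<Lambda>_def using gint by simp
  have Eu: "is_Eu \<Omega> u \<Lambda>"
    unfolding is_Eu_def
  proof (intro exI allI)
    fix i j
    let ?h = "\<lambda>x. g x $ i $ j"
    let ?P = "density MO (\<lambda>x. ennreal (?h x))" and ?N = "density MO (\<lambda>x. ennreal (- ?h x))"
    have hi: "integrable MO ?h" by (rule integrable_bounded_linear[OF bounded_linear_entry gi])
    have hm [measurable]: "?h \<in> borel_measurable MO" using hi by simp
    have pos: "(\<integral>\<^sup>+x. ennreal (?h x) \<partial>MO) \<noteq> \<infinity>" "(\<integral>\<^sup>+x. ennreal (- ?h x) \<partial>MO) \<noteq> \<infinity>"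
      using hi unfolding real_integrable_def by auto
    have fP: "finite_measure ?P" "finite_measure ?N"
    proof -
      have t: "emeasure (density MO k) (space (density MO k)) = integral\<^sup>N MO k" if "k \<in> borel_measurable MO" for k
        unfolding space_density emeasure_density[OF that sets.top] by (intro nn_integral_cong) simp
      show "finite_measure ?P" "finite_measure ?N"
        by (rule finite_measureI, subst t, simp, rule pos)+
    qed
    have sPN: "sets ?P = sets MO" "sets ?N = sets MO" by simp_all
    have diff: "measure ?P A - measure ?N A = (LINT x:A|MO. ?h x)" if A: "A \<in> sets MO" for A
    proof -
      have iA: "integrable MO (\<lambda>x. indicator A x *\<^sub>R ?h x)" using integrable_mult_indicator[OF A hi] .
      have "emeasure ?P A = (\<integral>\<^sup>+x. ennreal (indicator A x *\<^sub>R ?h x) \<partial>MO)"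
        "emeasure ?N A = (\<integral>\<^sup>+x. ennreal (- (indicator A x *\<^sub>R ?h x)) \<partial>MO)"
        using A by (auto simp: emeasure_density intro!: nn_integral_cong simp: indicator_def)
      then show ?thesis
        unfolding set_lebesgue_integral_def measure_def real_lebesgue_integral_def[OF iA] by simp
    qed
    show "finite_measure ?P \<and> sets ?P = sets (restrict_space borel \<Omega>) \<and>
        finite_measure ?N \<and> sets ?N = sets (restrict_space borel \<Omega>) \<and>
        (\<forall>B\<in>sets (restrict_space borel \<Omega>). \<Lambda> B $ i $ j = measure ?P B - measure ?N B) \<and>
        (\<forall>f\<in>test_functions \<Omega>. E_distr \<Omega> u i j f = (LINT x|?P. f x) - (LINT x|?N. f x))"
    proof (intro conjI ballI fP)
      show "sets ?P = sets (restrict_space borel \<Omega>)" "sets ?N = sets (restrict_space borel \<Omega>)"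
        unfolding sPN by (rule sets_MO)+
      fix B assume "B \<in> sets (restrict_space borel \<Omega>)"
      then have B: "B \<in> sets MO" using sets_MO by simp
      have iB: "integrable MO (\<lambda>x. indicator B x *\<^sub>R g x)" using integrable_mult_indicator[OF B gi] .
      have "\<Lambda> B = (LINT x:B|MO. g x)" unfolding \<Lambda>_def using B set_integral_MO sets_MO_iff by metis
      then have "\<Lambda> B $ i $ j = (LINT x:B|MO. ?h x)"
        unfolding set_lebesgue_integral_def using integral_bounded_linear[OF bounded_linear_entry iB, of i j] by simp
      then show "\<Lambda> B $ i $ j = measure ?P B - measure ?N B" using diff[OF B] by simp
    next
      fix f assume f: "f \<in> test_functions \<Omega>"
      obtain B where B: "\<And>x. \<bar>f x\<bar> \<le> B" using test_functions_bounded[OF f] by blast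
      have "(LINT x|?P. f x) - (LINT x|?N. f x) = (LINT x|MO. f x * ?h x)"
        using test_functions_borel[OF f]
        by (intro signed_measure_integral[OF fP(1) sPN(1) fP(2) sPN(2) hi diff _ B] measurable_restrict_space1) auto
      then show "E_distr \<Omega> u i j f = (LINT x|?P. f x) - (LINT x|?N. f x)"
        using E[OF f] integral_MO(1)[of "\<lambda>x. f x * ?h x"] by simp
    qed
  qed
  show "F_eps 2 \<Omega> \<epsilon> u = \<epsilon>\<^sup>2 * (LINT x:\<Omega>|M. (norm (g x))\<^sup>2)" by (rule F_eps_eq[OF Eu dens])
  have C2: "(norm (g x))\<^sup>2 \<le> C\<^sup>2" if "x \<in> \<Omega>" for x using gb[OF that] by (intro power_mono) auto
  have gL2: "g \<in> L2_space MO"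
  proof -
    have "set_integrable M \<Omega> (\<lambda>x. (norm (g x))\<^sup>2)"
      by (rule bounded_integrable_M[where B = "C\<^sup>2"]) (use C2 in auto)
    then show ?thesis using integral_MO(2) unfolding L2_space_def by (auto intro!: measurable_restrict_space1)
  qed
  have ac: "abs_cont \<Omega> \<Lambda> M"
    unfolding abs_cont_def
  proof (intro ballI impI)
    fix B assume "B \<in> sets (restrict_space borel \<Omega>)" "emeasure M B = 0"
    then have "B \<in> null_sets M" using sets_MO sets_MO_iff by (intro null_setsI) auto
    then have "AE x in M. x \<notin> B" by (rule AE_not_in)
    then have "AE x in M. indicator B x *\<^sub>R g x = 0" by eventually_elim simp
    then show "\<Lambda> B = 0" unfolding \<Lambda>_def set_lebesgue_integral_def by (rule integral_eq_zero_AE)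
  qed
  interpret L: finite_measure "lebesgue_on \<Omega>" using \<Omega>_lmeasurable by (rule finite_measure_lebesgue_on)
  have um: "u \<in> borel_measurable (lebesgue_on \<Omega>)"
    by (intro measurable_restrict_space1 measurable_completion) simp
  have u1: "integrable (lebesgue_on \<Omega>) u"
    using ub um by (intro L.integrable_const_bound[where B = D]) auto
  have "(norm (u x))\<^sup>2 \<le> D\<^sup>2" if "x \<in> \<Omega>" for x using ub[OF that] by (intro power_mono) auto
  then have u2: "integrable (lebesgue_on \<Omega>) (\<lambda>x. (norm (u x))\<^sup>2)"
    using um by (intro L.integrable_const_bound[where B = "D\<^sup>2"]) auto
  show "u \<in> LD2 \<Omega> M"
    unfolding LD2_def BD_def L1_space_def using u1 u2 um Eu dens gL2 ac by (auto simp: L2_space_def)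
qed

end

section \<open>A test strain concentrated near the cylinders\<close>

text \<open>In units of \<open>\<epsilon>\<close> the cylinder has radius \<open>1 / 4\<close> and its cell contains the disk of radius \<open>1 / 2\<close>; the
  transition from one to zero takes place between the radii \<open>1 / 3\<close> and \<open>1 / sqrt 5\<close>.\<close>

definition cutoff :: "real^3 \<Rightarrow> real" where
  "cutoff y = flat_exp 0 (1/5 - ((y$1)\<^sup>2 + (y$2)\<^sup>2)) *
     inverse (flat_exp 0 (1/5 - ((y$1)\<^sup>2 + (y$2)\<^sup>2)) + flat_exp 0 ((y$1)\<^sup>2 + (y$2)\<^sup>2 - 1/9))"

lemma smooth_square_sum: "smooth (\<lambda>y. (y$1)\<^sup>2 + (y$2)\<^sup>2)"
  unfolding power2_eq_square by (intro smooth_add smooth_mult smooth_proj)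

lemma smooth_cutoff: "smooth cutoff"
proof -
  have "flat_exp 0 (1/5 - q) + flat_exp 0 (q - 1/9) \<noteq> 0" for q :: real
  proof (cases "q < 1/5")
    case True
    then show ?thesis using flat_exp_pos[of "1/5 - q" 0] flat_exp_nonneg[of 0 "q - 1/9"] by linarith
  next
    case False
    then show ?thesis using flat_exp_pos[of "q - 1/9" 0] flat_exp_nonneg[of 0 "1/5 - q"] by linarith
  qed
  then show ?thesis
    unfolding cutoff_def[abs_def]
    by (intro smooth_mult smooth_inverse smooth_add smooth_flat_exp smooth_diff smooth_const smooth_square_sum)
qed

lemma cutoff_one: "(y$1)\<^sup>2 + (y$2)\<^sup>2 \<le> 1/9 \<Longrightarrow> cutoff y = 1"
  using flat_exp_pos[of "1/5 - ((y$1)\<^sup>2 + (y$2)\<^sup>2)" 0] by (simp add: cutoff_def flat_exp_zero)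

lemma cutoff_zero: "1/5 \<le> (y$1)\<^sup>2 + (y$2)\<^sup>2 \<Longrightarrow> cutoff y = 0"
  by (simp add: cutoff_def flat_exp_zero)

text \<open>In coordinates scaled by \<open>\<epsilon>\<close> and centred at a cylinder this field extends the unit normal of the
  lateral surface; it is linear near the cylinder and supported inside the cell.\<close>

definition rad_field :: "3 \<Rightarrow> real^3 \<Rightarrow> real" where
  "rad_field b y = (if b = 3 then 0 else 4 * y$b * cutoff y)"

lemma smooth_rad_field: "smooth (rad_field b)"
  unfolding rad_field_def[abs_def] by (cases "b = 3") (simp_all add: smooth_const smooth_mult smooth_proj smooth_cutoff)

lemma open_disk_cylinder: "open {y::real^3. (y$1)\<^sup>2 + (y$2)\<^sup>2 < s}" "open {y::real^3. s < (y$1)\<^sup>2 + (y$2)\<^sup>2}"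
  by (auto intro!: open_Collect_less continuous_intros)

lemma rad_field_linear: "(y$1)\<^sup>2 + (y$2)\<^sup>2 \<le> 1/9 \<Longrightarrow> rad_field b y = (if b = 3 then 0 else 4 * y$b)"
  by (simp add: rad_field_def cutoff_one)

lemma rad_field_zero: "1/5 \<le> (y$1)\<^sup>2 + (y$2)\<^sup>2 \<Longrightarrow> rad_field b y = 0"
  by (simp add: rad_field_def cutoff_zero)

lemma partial_rad_field_linear:
  assumes "(y$1)\<^sup>2 + (y$2)\<^sup>2 < 1/9"
  shows "partial a (rad_field b) y = (if a = b \<and> b \<noteq> 3 then 4 else 0)"
proof -
  let ?g = "\<lambda>y::real^3. (if b = 3 then 0 else 4) * y$b"
  have "partial a (rad_field b) y = partial a ?g y"
    using assms by (intro partial_cong_open[OF open_disk_cylinder(1)[of "1/9"]])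
      (auto simp: rad_field_linear intro!: smooth_differentiable)
  also have "\<dots> = (if b = 3 then 0 else 4) * partial a (\<lambda>y. y$b) y"
    by (rule partial_cmult) auto
  finally show ?thesis by (simp add: partial_proj)
qed

lemma partial_rad_field_zero:
  assumes "1/4 \<le> (y$1)\<^sup>2 + (y$2)\<^sup>2"
  shows "partial a (rad_field b) y = 0"
proof -
  have "partial a (rad_field b) y = partial a (\<lambda>y. 0) y"
    using assms by (intro partial_cong_open[OF open_disk_cylinder(2)[of "1/5"]]) (auto simp: rad_field_zero)
  then show ?thesis by (simp add: partial_const)
qed

lemma rad_field_bounds:
  obtains D where "D \<ge> 0" "\<And>b y. y$3 = 0 \<Longrightarrow> \<bar>rad_field b y\<bar> \<le> D" "\<And>a b y. y$3 = 0 \<Longrightarrow> \<bar>partial a (rad_field b) y\<bar> \<le> D"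
proof -
  have "\<exists>B\<ge>0. \<forall>y\<in>cball 0 1. \<bar>f y\<bar> \<le> B" if "smooth f" for f
    by (rule smooth_bounded_on[OF that bounded_cball[of 0 1]]) blast
  then obtain B where B: "\<And>f. smooth f \<Longrightarrow> B f \<ge> 0" "\<And>f y. smooth f \<Longrightarrow> y \<in> cball 0 1 \<Longrightarrow> \<bar>f y\<bar> \<le> B f" by metis
  define D where "D = (\<Sum>b\<in>UNIV. B (rad_field b)) + (\<Sum>a\<in>UNIV. \<Sum>b\<in>UNIV. B (partial a (rad_field b)))"
  note sm = smooth_rad_field smooth_partial[OF smooth_rad_field]
  have D1: "B (rad_field b) \<le> D" for b
    unfolding D_def using B(1)[OF sm(1)] B(1)[OF sm(2)]
    by (intro order_trans[OF member_le_sum[of b UNIV "\<lambda>b. B (rad_field b)"]] le_add_same_cancel1[THEN iffD2] sum_nonneg) auto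
  have D2: "B (partial a (rad_field b)) \<le> D" for a b
  proof -
    have "B (partial a (rad_field b)) \<le> (\<Sum>b\<in>UNIV. B (partial a (rad_field b)))"
      using B(1)[OF sm(2)] by (intro member_le_sum) auto
    also have "\<dots> \<le> (\<Sum>a\<in>UNIV. \<Sum>b\<in>UNIV. B (partial a (rad_field b)))"
      using B(1)[OF sm(2)] by (intro member_le_sum[of a UNIV "\<lambda>a. \<Sum>b\<in>UNIV. B (partial a (rad_field b))"] sum_nonneg) auto
    also have "\<dots> \<le> D" unfolding D_def using B(1)[OF sm(1)] by (simp add: sum_nonneg)
    finally show ?thesis .
  qed
  have small: "y \<in> cball 0 1" if "y$3 = 0" "(y$1)\<^sup>2 + (y$2)\<^sup>2 < 1/4" for y :: "real^3"
  proof -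
    have "(dist 0 y)\<^sup>2 = (y$1)\<^sup>2 + (y$2)\<^sup>2 + (y$3)\<^sup>2" by (subst dist3) simp
    then have "(dist 0 y)\<^sup>2 \<le> 1\<^sup>2" using that by simp
    then have "dist 0 y \<le> 1" by (rule power2_le_imp_le) simp
    then show ?thesis by simp
  qed
  have D0: "0 \<le> D" using B(1)[OF sm(1)] D1 order_trans by blast
  show ?thesis
  proof (rule that[OF D0])
    fix a b and y :: "real^3" assume y: "y$3 = 0"
    show "\<bar>rad_field b y\<bar> \<le> D"
      using B(2)[OF sm(1), of y b] D1[of b] D0 rad_field_zero[of y b] small[OF y]
      by (cases "(y$1)\<^sup>2 + (y$2)\<^sup>2 < 1/4") auto
    show "\<bar>partial a (rad_field b) y\<bar> \<le> D"
      using B(2)[OF sm(2), of y a b] D2[of a b] D0 partial_rad_field_zero[of y a b] small[OF y]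
      by (cases "(y$1)\<^sup>2 + (y$2)\<^sup>2 < 1/4") auto
  qed
qed

text \<open>The coefficients of the limit functional, by component.\<close>

definition weight :: "3 \<Rightarrow> real" where
  "weight k = (if k = 3 then pi / 4 else 3 / 8 * pi)"

lemma weight_pos: "weight k > 0" by (simp add: weight_def)

text \<open>The passage to the axis of a cell and to the unit cell, in the form to which the chain rule for coordinatewise
  affine maps applies.\<close>

definition freeze :: "real^2 \<Rightarrow> real^3 \<Rightarrow> real^3" where
  "freeze c x = (\<chi> j. (\<chi> j. if j = 3 then 1 else 0) $ j * x$j + (\<chi> j. if j = 1 then c$1 else if j = 2 then c$2 else 0) $ j)"

definition rescale :: "real \<Rightarrow> real^2 \<Rightarrow> real^3 \<Rightarrow> real^3" where
  "rescale e c x = (\<chi> j. (\<chi> j. if j = 3 then 0 else 1 / e) $ j * x$j + (\<chi> j. if j = 1 then - c$1 / e else if j = 2 then - c$2 / e else 0) $ j)"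

lemma freeze_nth [simp]: "freeze c x $ 1 = c$1" "freeze c x $ 2 = c$2" "freeze c x $ 3 = x$3"
  by (simp_all add: freeze_def)

lemma rescale_nth [simp]: "rescale e c x $ 1 = (x$1 - c$1) / e" "rescale e c x $ 2 = (x$2 - c$2) / e" "rescale e c x $ 3 = 0"
  by (simp_all add: rescale_def diff_divide_distrib)

lemma smooth_freeze: "smooth f \<Longrightarrow> smooth (\<lambda>x. f (freeze c x))"
  unfolding freeze_def by (rule smooth_affine)

lemma smooth_rescale: "smooth f \<Longrightarrow> smooth (\<lambda>x. f (rescale e c x))"
  unfolding rescale_def by (rule smooth_affine)

lemma partial_freeze: "smooth f \<Longrightarrow> partial i (\<lambda>x. f (freeze c x)) x = (if i = 3 then partial 3 f (freeze c x) else 0)"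
  unfolding freeze_def by (subst partial_affine(1)) (auto intro: smooth_differentiable)

lemma partial_rescale: "smooth f \<Longrightarrow> partial i (\<lambda>x. f (rescale e c x)) x = (if i = 3 then 0 else partial i f (rescale e c x) / e)"
  unfolding rescale_def by (subst partial_affine(1)) (auto intro: smooth_differentiable)

lemma continuous_freeze: "continuous_on S (freeze c)"
  unfolding freeze_def by (intro continuous_intros)

lemma abs_sum4: "\<bar>a + b + c + d\<bar> \<le> \<bar>a\<bar> + \<bar>b\<bar> + \<bar>c\<bar> + \<bar>d :: real\<bar>"
  by (meson abs_triangle_ineq add_right_mono order_trans)

text \<open>The square of the norm of the symmetrised product of a vector with the unit vector \<open>(C, S, 0)\<close>, sorted by
  trigonometric monomials for integration over a circle.\<close>

lemma strain_square:
  fixes z1 z2 z3 C S e :: real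
  assumes CS: "C\<^sup>2 + S\<^sup>2 = 1" and e: "e \<noteq> 0"
  shows "(1 / (2 * e) * (z1 * C + C * z1))\<^sup>2 + (1 / (2 * e) * (z1 * S + C * z2))\<^sup>2 + (1 / (2 * e) * (z1 * 0 + C * z3))\<^sup>2 +
    ((1 / (2 * e) * (z2 * C + S * z1))\<^sup>2 + (1 / (2 * e) * (z2 * S + S * z2))\<^sup>2 + (1 / (2 * e) * (z2 * 0 + S * z3))\<^sup>2) +
    ((1 / (2 * e) * (z3 * C + 0 * z1))\<^sup>2 + (1 / (2 * e) * (z3 * S + 0 * z2))\<^sup>2 + (1 / (2 * e) * (z3 * 0 + 0 * z3))\<^sup>2) =
    (z1\<^sup>2 + z2\<^sup>2 + z3\<^sup>2) / (2 * e\<^sup>2) + 0 * C + 0 * S + z1\<^sup>2 / (2 * e\<^sup>2) * C\<^sup>2 + (z1 * z2) / e\<^sup>2 * (C * S) + z2\<^sup>2 / (2 * e\<^sup>2) * S\<^sup>2"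
    (is "?lhs = ?rhs")
proof -
  define k where "k = 1 / (2 * e)"
  have "?lhs = k\<^sup>2 * (2 * (z1\<^sup>2 + z2\<^sup>2 + z3\<^sup>2) * (C\<^sup>2 + S\<^sup>2) + 2 * (z1 * C + z2 * S)\<^sup>2)"
    unfolding k_def[symmetric] by (simp add: power2_eq_square algebra_simps)
  also have "\<dots> = ?rhs"
    unfolding CS k_def using e by (simp add: power2_eq_square field_simps)
  finally show ?thesis .
qed

text \<open>The cells whose closure, as a column, lies in \<open>\<Omega>\<close>; only there can the test strain be supported.\<close>

definition inner_cells :: "(real^3) set \<Rightarrow> real \<Rightarrow> (int \<times> int) set" where
  "inner_cells \<Omega> e = {i. \<forall>x. \<bar>x$1 - center e i$1\<bar> \<le> e / 2 \<and> \<bar>x$2 - center e i$2\<bar> \<le> e / 2 \<and> 0 < x$3 \<and> x$3 < 1 \<longrightarrow> x \<in> \<Omega>}"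

context perforated
begin

abbreviation "IC \<equiv> inner_cells \<Omega> \<epsilon>"

lemma IC_subset: "IC \<subseteq> I"
proof
  fix i assume i: "i \<in> IC"
  have "cyl \<epsilon> i \<subseteq> \<Omega>"
  proof
    fix x assume "x \<in> cyl \<epsilon> i"
    then have "x \<in> T_cell \<epsilon> i" using cyl_subset_T_cell[OF \<epsilon>_pos] by blast
    then show "x \<in> \<Omega>" using i unfolding inner_cells_def mem_T_cell by fastforce
  qed
  then show "i \<in> I" by (simp add: cyl_index_def)
qed

lemma finite_IC: "finite IC" using IC_subset finite_I finite_subset by blast

end

locale test_strain = perforated +
  fixes \<zeta> :: "3 \<Rightarrow> real^3 \<Rightarrow> real"
  assumes \<zeta>_test: "\<zeta> k \<in> test_functions \<Omega>"
begin

abbreviation "qd i x \<equiv> (rescale \<epsilon> (center \<epsilon> i) x $ 1)\<^sup>2 + (rescale \<epsilon> (center \<epsilon> i) x $ 2)\<^sup>2"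
abbreviation "Z i k x \<equiv> \<zeta> k (freeze (center \<epsilon> i) x)"
abbreviation "N i b x \<equiv> rad_field b (rescale \<epsilon> (center \<epsilon> i) x)"

text \<open>On the lateral surfaces this is the strain density of a displacement whose outer trace exceeds the inner one by
  \<open>\<zeta>\<close>, for which the duality estimate is an equality.\<close>

definition \<Phi> :: "3 \<Rightarrow> 3 \<Rightarrow> real^3 \<Rightarrow> real" where
  "\<Phi> a b x = (\<Sum>i\<in>IC. 1 / (2 * \<epsilon>) * (Z i a x * N i b x + N i a x * Z i b x))"

text \<open>\<open>\<epsilon>\<^sup>2\<close> times the divergence of \<open>\<Phi>\<close>, split into the contributions of the cells.\<close>

definition \<tau> :: "int \<times> int \<Rightarrow> 3 \<Rightarrow> real^3 \<Rightarrow> real" where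
  "\<tau> i b x = \<epsilon> / 2 * (partial 3 (\<zeta> 3) (freeze (center \<epsilon> i) x) * N i b x) +
     1 / 2 * (Z i 1 x * partial 1 (rad_field b) (rescale \<epsilon> (center \<epsilon> i) x) + Z i 2 x * partial 2 (rad_field b) (rescale \<epsilon> (center \<epsilon> i) x)
      + (partial 1 (rad_field 1) (rescale \<epsilon> (center \<epsilon> i) x) + partial 2 (rad_field 2) (rescale \<epsilon> (center \<epsilon> i) x)) * Z i b x)"

definition \<psi> :: "3 \<Rightarrow> real^3 \<Rightarrow> real" where
  "\<psi> b x = (\<Sum>i\<in>IC. \<tau> i b x)"

lemma \<zeta>_smooth: "smooth (\<zeta> k)" using \<zeta>_test test_functions_smooth by blast

lemma \<Phi>_sym: "\<Phi> a b = \<Phi> b a" by (auto simp: \<Phi>_def fun_eq_iff algebra_simps)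

lemma qd_eq: "qd i x = ((x$1 - center \<epsilon> i$1)\<^sup>2 + (x$2 - center \<epsilon> i$2)\<^sup>2) / \<epsilon>\<^sup>2"
  by (simp add: power_divide add_divide_distrib)

lemma qd_less: "qd i x < s\<^sup>2 \<longleftrightarrow> (x$1 - center \<epsilon> i$1)\<^sup>2 + (x$2 - center \<epsilon> i$2)\<^sup>2 < (s * \<epsilon>)\<^sup>2"
  unfolding qd_eq using \<epsilon>_pos by (simp add: divide_less_eq power_mult_distrib)

lemma \<Phi>_test: "\<Phi> a b \<in> test_functions \<Omega>"
proof -
  have "(\<lambda>x. 1 / (2 * \<epsilon>) * (Z i a x * N i b x + N i a x * Z i b x)) \<in> test_functions \<Omega>" if i: "i \<in> IC" for i
  proof -
    have t: "(\<lambda>x. Z i a x * N i b x) \<in> test_functions \<Omega>" for a b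
    proof -
      obtain K where K: "compact K" "K \<subseteq> \<Omega>" "\<And>x. x \<notin> K \<Longrightarrow> \<zeta> a x = 0"
        using test_functions_support[OF \<zeta>_test] by blast
      let ?L = "{x. (x$1 - center \<epsilon> i$1)\<^sup>2 + (x$2 - center \<epsilon> i$2)\<^sup>2 \<le> \<epsilon>\<^sup>2 / 5} \<inter> freeze (center \<epsilon> i) -` K"
      have slab: "0 < x$3 \<and> x$3 < 1" if "x \<in> ?L" for x
        using that K(2) by (auto simp: \<Omega>_eq prism_def)
      have e5: "\<epsilon>\<^sup>2 / 5 < (\<epsilon> / 2)\<^sup>2" using \<epsilon>_pos by (simp add: power_divide)
      have cell: "x \<in> T_cell \<epsilon> i" if "x \<in> ?L" for x
        using that slab[OF that] e5 by (intro near_center_in_cell[OF \<epsilon>_pos]) auto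
      have "closed ?L"
        using K(1) continuous_freeze
        by (intro closed_Int closed_Collect_le continuous_intros closed_vimage compact_imp_closed)
      moreover have "bounded ?L"
      proof -
        have "?L \<subseteq> T_cell \<epsilon> i" using cell by blast
        moreover have "T_cell \<epsilon> i \<subseteq> \<Omega>" using i unfolding inner_cells_def by (fastforce simp: mem_T_cell simp del: center_nth)
        ultimately show ?thesis using bounded_\<Omega> bounded_subset by blast
      qed
      ultimately have "compact ?L" using compact_eq_bounded_closed by blast
      moreover have "?L \<subseteq> \<Omega>"
        using cell i unfolding inner_cells_def by (fastforce simp: mem_T_cell simp del: center_nth)
      moreover have "Z i a x * N i b x = 0" if "x \<notin> ?L" for x
      proof (cases "freeze (center \<epsilon> i) x \<in> K")
        case True
        then have "\<epsilon>\<^sup>2 / 5 < (x$1 - center \<epsilon> i$1)\<^sup>2 + (x$2 - center \<epsilon> i$2)\<^sup>2" using that by auto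
        then have "1 / 5 \<le> qd i x" unfolding qd_eq using \<epsilon>_pos by (simp add: field_simps)
        then show ?thesis using rad_field_zero by simp
      qed (simp add: K(3))
      ultimately show ?thesis
        by (intro test_functionsI[of _ ?L] smooth_mult smooth_freeze smooth_rescale \<zeta>_smooth smooth_rad_field) auto
    qed
    have "(\<lambda>x. Z i a x * N i b x + Z i b x * N i a x) \<in> test_functions \<Omega>" by (rule test_functions_add[OF t t])
    from test_functions_cmult[OF this, of "1 / (2 * \<epsilon>)"] show ?thesis by (simp add: mult.commute)
  qed
  from test_functions_sum[of IC, OF this] show ?thesis by (simp add: \<Phi>_def[abs_def])
qed

lemma divergence_\<Phi>: "\<epsilon>\<^sup>2 * (\<Sum>a\<in>UNIV. partial a (\<Phi> a b) x) = \<psi> b x"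
proof -
  have sN: "smooth (N i b)" and sZ: "smooth (Z i k)" for i b k
    by (intro smooth_rescale smooth_rad_field smooth_freeze \<zeta>_smooth)+
  have pN: "partial a (N i b) x = (if a = 3 then 0 else partial a (rad_field b) (rescale \<epsilon> (center \<epsilon> i) x) / \<epsilon>)" for a b i
    by (rule partial_rescale[OF smooth_rad_field])
  have pZ: "partial a (Z i k) x = (if a = 3 then partial 3 (\<zeta> k) (freeze (center \<epsilon> i) x) else 0)" for a k i
    by (rule partial_freeze[OF \<zeta>_smooth])
  have p: "partial a (\<Phi> a b) x = (\<Sum>i\<in>IC. 1 / (2 * \<epsilon>) *
      (Z i a x * partial a (N i b) x + partial a (Z i a) x * N i b x + (N i a x * partial a (Z i b) x + partial a (N i a) x * Z i b x)))" for a
  proof -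
    have "partial a (\<Phi> a b) x = (\<Sum>i\<in>IC. partial a (\<lambda>x. 1 / (2 * \<epsilon>) * (Z i a x * N i b x + N i a x * Z i b x)) x)"
      unfolding \<Phi>_def[abs_def] by (rule partial_sum) (intro smooth_mult smooth_const smooth_add sN sZ)
    also have "\<dots> = (\<Sum>i\<in>IC. 1 / (2 * \<epsilon>) *
      (Z i a x * partial a (N i b) x + partial a (Z i a) x * N i b x + (N i a x * partial a (Z i b) x + partial a (N i a) x * Z i b x)))"
    proof (intro sum.cong refl)
      fix i
      have "partial a (\<lambda>x. 1 / (2 * \<epsilon>) * (Z i a x * N i b x + N i a x * Z i b x)) x =
          1 / (2 * \<epsilon>) * partial a (\<lambda>x. Z i a x * N i b x + N i a x * Z i b x) x"
        by (intro partial_cmult smooth_add smooth_mult sN sZ)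
      also have "partial a (\<lambda>x. Z i a x * N i b x + N i a x * Z i b x) x =
          partial a (\<lambda>x. Z i a x * N i b x) x + partial a (\<lambda>x. N i a x * Z i b x) x"
        by (intro partial_add smooth_differentiable smooth_mult sN sZ)
      also have "partial a (\<lambda>x. Z i a x * N i b x) x = Z i a x * partial a (N i b) x + partial a (Z i a) x * N i b x"
        by (intro partial_mult smooth_differentiable sN sZ)
      also have "partial a (\<lambda>x. N i a x * Z i b x) x = N i a x * partial a (Z i b) x + partial a (N i a) x * Z i b x"
        by (intro partial_mult smooth_differentiable sN sZ)
      finally show "partial a (\<lambda>x. 1 / (2 * \<epsilon>) * (Z i a x * N i b x + N i a x * Z i b x)) x = 1 / (2 * \<epsilon>) *
        (Z i a x * partial a (N i b) x + partial a (Z i a) x * N i b x + (N i a x * partial a (Z i b) x + partial a (N i a) x * Z i b x))" .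
    qed
    finally show ?thesis .
  qed
  have N3: "N i 3 x = 0" for i by (simp add: rad_field_def)
  have "\<epsilon>\<^sup>2 * (\<Sum>a\<in>UNIV. partial a (\<Phi> a b) x) =
     (\<Sum>i\<in>IC. \<epsilon>\<^sup>2 * (\<Sum>a\<in>UNIV. 1 / (2 * \<epsilon>) *
      (Z i a x * partial a (N i b) x + partial a (Z i a) x * N i b x + (N i a x * partial a (Z i b) x + partial a (N i a) x * Z i b x))))"
    unfolding p by (subst sum.swap) (simp only: sum_distrib_left)
  also have "\<dots> = \<psi> b x"
    unfolding \<psi>_def
  proof (intro sum.cong refl)
    fix i
    have e: "\<epsilon>\<^sup>2 * (1 / (2 * \<epsilon>) * t) = \<epsilon> / 2 * t" for t
      using \<epsilon>_pos by (simp add: power2_eq_square)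
    have e2: "\<epsilon> / 2 * (t / \<epsilon>) = t / 2" for t using \<epsilon>_pos by simp
    show "\<epsilon>\<^sup>2 * (\<Sum>a\<in>UNIV. 1 / (2 * \<epsilon>) *
      (Z i a x * partial a (N i b) x + partial a (Z i a) x * N i b x + (N i a x * partial a (Z i b) x + partial a (N i a) x * Z i b x))) = \<tau> i b x"
      unfolding sum_distrib_left e sum_3 pN pZ N3 \<tau>_def using \<epsilon>_pos by (simp add: field_simps power2_eq_square)
  qed
  finally show ?thesis .
qed

lemma active_cell:
  assumes "x \<in> \<Omega>" "qd i x < 1 / 4"
  shows "x \<in> T_cell \<epsilon> i"
proof (rule near_center_in_cell[OF \<epsilon>_pos])
  have "qd i x < (1 / 2)\<^sup>2" using assms(2) by (simp add: power2_eq_square)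
  then show "(x$1 - center \<epsilon> i$1)\<^sup>2 + (x$2 - center \<epsilon> i$2)\<^sup>2 < (\<epsilon> / 2)\<^sup>2" unfolding qd_less by (simp add: mult.commute)
qed (use assms(1) in \<open>auto simp: \<Omega>_eq prism_def\<close>)

lemma inactive:
  assumes "1 / 4 \<le> qd i x"
  shows "N i b x = 0" "\<tau> i b x = 0"
  using assms by (simp_all add: \<tau>_def rad_field_zero partial_rad_field_zero)

lemma sum_inner_single:
  assumes "x \<in> T_cell \<epsilon> k" "x \<in> \<Omega>" and "\<And>i. 1 / 4 \<le> qd i x \<Longrightarrow> f i = (0::real)"
  shows "(\<Sum>i\<in>IC. f i) = (if k \<in> IC then f k else 0)"
proof -
  have "f i = 0" if "i \<noteq> k" for i
  proof (rule assms(3), rule ccontr)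
    assume "\<not> 1 / 4 \<le> qd i x"
    then have "x \<in> T_cell \<epsilon> i" using active_cell assms(2) by simp
    then show False using T_cell_disjoint[OF \<epsilon>_pos] assms(1) that by blast
  qed
  then have "(\<Sum>i\<in>IC. f i) = (\<Sum>i\<in>IC. if i = k then f k else 0)" by (intro sum.cong) auto
  then show ?thesis using finite_IC by simp
qed

lemma sum_inner_bound:
  assumes "x \<in> \<Omega>" and z: "\<And>i. 1 / 4 \<le> qd i x \<Longrightarrow> f i = (0::real)" and b: "\<And>i. \<bar>f i\<bar> \<le> C"
  shows "\<bar>\<Sum>i\<in>IC. f i\<bar> \<le> C"
proof (cases "\<exists>k. x \<in> T_cell \<epsilon> k")
  case True
  then obtain k where "x \<in> T_cell \<epsilon> k" by blast
  from sum_inner_single[OF this assms(1) z] show ?thesis using b[of k] abs_ge_zero[of "f k"] by auto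
next
  case False
  then have "f i = 0" for i using active_cell[OF assms(1)] z by (meson not_le)
  then show ?thesis using b[of undefined] by simp
qed

text \<open>The factor \<open>\<epsilon>\<^sup>2\<close> compensates both the factor \<open>1 / \<epsilon>\<close> in \<open>\<Phi>\<close> and the one from differentiating the cut-off,
  hence the bound is uniform in \<open>\<epsilon>\<close>.\<close>

lemma \<psi>_bound:
  assumes "\<epsilon> \<le> 1" "x \<in> \<Omega>"
    and B: "\<And>k x. \<bar>\<zeta> k x\<bar> \<le> B" "\<And>x. \<bar>partial 3 (\<zeta> 3) x\<bar> \<le> B"
    and D: "\<And>b y. y$3 = 0 \<Longrightarrow> \<bar>rad_field b y\<bar> \<le> D" "\<And>a b y. y$3 = 0 \<Longrightarrow> \<bar>partial a (rad_field b) y\<bar> \<le> D"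
  shows "\<bar>\<psi> b x\<bar> \<le> 3 * (B * D)"
  unfolding \<psi>_def
proof (rule sum_inner_bound[OF assms(2)])
  show "1 / 4 \<le> qd i x \<Longrightarrow> \<tau> i b x = 0" for i by (rule inactive)
  fix i
  have m: "\<bar>s * t\<bar> \<le> B * D" if "\<bar>s\<bar> \<le> B" "\<bar>t\<bar> \<le> D" for s t :: real
    using that mult_mono[of "\<bar>s\<bar>" B "\<bar>t\<bar>" D] by (simp add: abs_mult order_trans[OF abs_ge_zero])
  have m': "\<bar>t * s\<bar> \<le> B * D" if "\<bar>s\<bar> \<le> B" "\<bar>t\<bar> \<le> D" for s t :: real
    using m[OF that] by (simp add: mult.commute)
  let ?r = "rescale \<epsilon> (center \<epsilon> i) x"
  have y3: "?r $ 3 = 0" by simp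
  let ?t1 = "partial 3 (\<zeta> 3) (freeze (center \<epsilon> i) x) * N i b x"
  let ?t2 = "Z i 1 x * partial 1 (rad_field b) ?r" and ?t3 = "Z i 2 x * partial 2 (rad_field b) ?r"
  let ?t4 = "partial 1 (rad_field 1) ?r * Z i b x" and ?t5 = "partial 2 (rad_field 2) ?r * Z i b x"
  have bs: "\<bar>?t1\<bar> \<le> B * D" "\<bar>?t2\<bar> \<le> B * D" "\<bar>?t3\<bar> \<le> B * D" "\<bar>?t4\<bar> \<le> B * D" "\<bar>?t5\<bar> \<le> B * D"
    by (intro m m' B D y3)+
  have "\<bar>\<epsilon> / 2 * ?t1\<bar> \<le> B * D"
    using mult_mono[of "\<epsilon> / 2" 1 "\<bar>?t1\<bar>" "B * D"] bs(1) assms(1) \<epsilon>_pos by (simp add: abs_mult)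
  moreover have "\<tau> i b x = \<epsilon> / 2 * ?t1 + 1 / 2 * (?t2 + ?t3 + ?t4 + ?t5)"
    unfolding \<tau>_def by (simp add: distrib_right)
  moreover have "\<bar>e + 1 / 2 * (t2 + t3 + t4 + t5)\<bar> \<le> 3 * K"
    if "\<bar>e\<bar> \<le> K" "\<bar>t2\<bar> \<le> K" "\<bar>t3\<bar> \<le> K" "\<bar>t4\<bar> \<le> K" "\<bar>t5\<bar> \<le> K" for e t2 t3 t4 t5 K :: real
  proof -
    have "\<bar>t2 + t3 + t4 + t5\<bar> \<le> \<bar>t2\<bar> + \<bar>t3\<bar> + \<bar>t4\<bar> + \<bar>t5\<bar>" by (rule abs_sum4)
    then have "\<bar>t2 + t3 + t4 + t5\<bar> \<le> 4 * K" using that by linarith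
    then have "\<bar>1 / 2 * (t2 + t3 + t4 + t5)\<bar> \<le> 2 * K" unfolding abs_mult by simp
    then show ?thesis using that(1) abs_triangle_ineq[of e "1 / 2 * (t2 + t3 + t4 + t5)"] by linarith
  qed
  ultimately show "\<bar>\<tau> i b x\<bar> \<le> 3 * (B * D)" using bs by metis
qed

lemma qd_cyl: "x \<in> cyl \<epsilon> i \<Longrightarrow> qd i x \<le> 1 / 16"
  unfolding qd_eq using \<epsilon>_pos by (simp add: mem_cyl power_divide field_simps del: center_nth)

text \<open>Near the cylinder the radial field is linear: its gradient is constant there and produces the
  weights; only the vertical derivative of \<open>\<zeta>\<close> leaves a term of order \<open>\<epsilon>\<close>.\<close>

lemma \<psi>_cyl:
  assumes k: "k \<in> I" and x: "x \<in> cyl \<epsilon> k"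
  shows "\<psi> b x = (if k \<in> IC then 16 / pi * weight b * Z k b x +
    (if b = 3 then 0 else 2 * \<epsilon> * partial 3 (\<zeta> 3) (freeze (center \<epsilon> k) x) * rescale \<epsilon> (center \<epsilon> k) x $ b) else 0)"
proof -
  have xT: "x \<in> T_cell \<epsilon> k" using x cyl_subset_T_cell[OF \<epsilon>_pos] by blast
  have x\<Omega>: "x \<in> \<Omega>" using k x by (auto simp: cyl_index_def)
  have q: "qd k x < 1 / 9" "qd k x \<le> 1 / 9" using qd_cyl[OF x] by linarith+
  have "\<tau> k b x = 16 / pi * weight b * Z k b x +
    (if b = 3 then 0 else 2 * \<epsilon> * partial 3 (\<zeta> 3) (freeze (center \<epsilon> k) x) * rescale \<epsilon> (center \<epsilon> k) x $ b)"
    unfolding \<tau>_def partial_rad_field_linear[OF q(1)] rad_field_linear[OF q(2)]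
    using exhaust_3[of b] by (auto simp: weight_def)
  then show ?thesis unfolding \<psi>_def using sum_inner_single[OF xT x\<Omega> inactive(2)] by simp
qed

lemma \<Phi>_lateral:
  assumes k: "k \<in> I" and q: "q \<in> strip rad"
  shows "\<Phi> a b (wr k q) = (if k \<in> IC then 1 / (2 * \<epsilon>) *
     (Z k a (wr k q) * (if b = 1 then cos (fst q / rad) else if b = 2 then sin (fst q / rad) else 0) +
      (if a = 1 then cos (fst q / rad) else if a = 2 then sin (fst q / rad) else 0) * Z k b (wr k q)) else 0)"
proof -
  let ?x = "wr k q"
  have xT: "?x \<in> T_cell \<epsilon> k" using wr_cyl[OF q] cyl_subset_T_cell[OF \<epsilon>_pos] by blast
  have q9: "qd k ?x \<le> 1 / 9" using qd_cyl[OF wr_cyl[OF q], of k] by linarith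
  have N: "N k b ?x = (if b = 1 then cos (fst q / rad) else if b = 2 then sin (fst q / rad) else 0)" for b
    unfolding rad_field_linear[OF q9] using exhaust_3[of b] \<epsilon>_pos by auto
  have "\<Phi> a b ?x = (if k \<in> IC then 1 / (2 * \<epsilon>) * (Z k a ?x * N k b ?x + N k a ?x * Z k b ?x) else 0)"
    unfolding \<Phi>_def using inactive(1) by (intro sum_inner_single[OF xT wr_\<Omega>[OF k q]]) simp
  then show ?thesis unfolding N .
qed

text \<open>The weighted square of \<open>\<zeta>\<close> above the centre of a cell; \<open>Q\<close> is its integral over the cells.\<close>

definition profile :: "int \<times> int \<Rightarrow> real \<Rightarrow> real" where
  "profile i z = (\<Sum>k\<in>UNIV. weight k * (\<zeta> k (mk3 ((center \<epsilon> i$1, center \<epsilon> i$2), z)))\<^sup>2)"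

definition Q :: real where
  "Q = \<epsilon>\<^sup>2 * (\<Sum>i\<in>IC. LINT z:{0<..<1}|lborel. profile i z)"

lemma freeze_eq: "freeze c x = mk3 ((c$1, c$2), x$3)"
  by (simp add: vec_eq_iff forall_3)

text \<open>The means of \<open>cos\<^sup>2\<close> and \<open>sin\<^sup>2\<close> over the circle produce the weights.\<close>

lemma \<Phi>_energy: "\<epsilon>\<^sup>2 * (LINT x:\<Omega>|M. \<Sum>a\<in>UNIV. \<Sum>b\<in>UNIV. (\<Phi> a b x)\<^sup>2) = Q"
proof -
  let ?S = "\<lambda>x. \<Sum>a\<in>UNIV. \<Sum>b\<in>UNIV. (\<Phi> a b x)\<^sup>2"
  have sS: "smooth ?S" unfolding power2_eq_square
    by (intro smooth_sum smooth_mult test_functions_smooth[OF \<Phi>_test])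
  obtain B where B: "\<And>x. x \<in> \<Omega> \<Longrightarrow> \<bar>?S x\<bar> \<le> B" by (rule smooth_bounded_on[OF sS bounded_\<Omega>]) blast
  have "(LINT x:\<Omega>|M. ?S x) = \<epsilon> * (\<Sum>i\<in>I. LINT q:strip rad|lborel. ?S (wr i q))"
    by (rule integral_M[OF smooth_borel[OF sS] B])
  also have "(\<Sum>i\<in>I. LINT q:strip rad|lborel. ?S (wr i q)) = (\<Sum>i\<in>I. if i \<in> IC then 1 / \<epsilon> * (LINT z:{0<..<1}|lborel. profile i z) else 0)"
  proof (intro sum.cong refl)
    fix i assume i: "i \<in> I"
    show "(LINT q:strip rad|lborel. ?S (wr i q)) = (if i \<in> IC then 1 / \<epsilon> * (LINT z:{0<..<1}|lborel. profile i z) else 0)"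
    proof (cases "i \<in> IC")
      case False
      then have "(LINT q:strip rad|lborel. ?S (wr i q)) = (LINT q:strip rad|lborel. 0)"
        using \<Phi>_lateral[OF i] by (intro set_lebesgue_integral_cong) (auto simp: sum_3)
      then show ?thesis using False by (simp add: set_lebesgue_integral_def)
    next
      case True
      let ?z = "\<lambda>k z. \<zeta> k (mk3 ((center \<epsilon> i$1, center \<epsilon> i$2), z))"
      let ?A = "\<lambda>z. ((?z 1 z)\<^sup>2 + (?z 2 z)\<^sup>2 + (?z 3 z)\<^sup>2) / (2 * \<epsilon>\<^sup>2)"
      let ?g = "\<lambda>q. ?A (snd q) + 0 * cos (fst q / rad) + 0 * sin (fst q / rad) + (?z 1 (snd q))\<^sup>2 / (2 * \<epsilon>\<^sup>2) * (cos (fst q / rad))\<^sup>2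
          + (?z 1 (snd q) * ?z 2 (snd q)) / \<epsilon>\<^sup>2 * (cos (fst q / rad) * sin (fst q / rad)) + (?z 2 (snd q))\<^sup>2 / (2 * \<epsilon>\<^sup>2) * (sin (fst q / rad))\<^sup>2"
      have eq: "?S (wr i q) = ?g q" if q: "q \<in> strip rad" for q
      proof -
        let ?C = "cos (fst q / rad)" and ?D = "sin (fst q / rad)"
        let ?z1 = "?z 1 (snd q)" and ?z2 = "?z 2 (snd q)" and ?z3 = "?z 3 (snd q)" and ?k = "1 / (2 * \<epsilon>)"
        have "?S (wr i q) = (?k * (?z1 * ?C + ?C * ?z1))\<^sup>2 + (?k * (?z1 * ?D + ?C * ?z2))\<^sup>2 + (?k * (?z1 * 0 + ?C * ?z3))\<^sup>2 +
          ((?k * (?z2 * ?C + ?D * ?z1))\<^sup>2 + (?k * (?z2 * ?D + ?D * ?z2))\<^sup>2 + (?k * (?z2 * 0 + ?D * ?z3))\<^sup>2) +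
          ((?k * (?z3 * ?C + 0 * ?z1))\<^sup>2 + (?k * (?z3 * ?D + 0 * ?z2))\<^sup>2 + (?k * (?z3 * 0 + 0 * ?z3))\<^sup>2)"
          unfolding \<Phi>_lateral[OF i q] sum_3 freeze_eq using True by simp
        also have "\<dots> = ?g q" using \<epsilon>_pos by (intro strain_square) auto
        finally show ?thesis .
      qed
      have zc: "continuous_on S (\<lambda>t. ?z k (f t))" if "continuous_on S f" for S f k
        using that by (intro smooth_mk3_continuous \<zeta>_smooth continuous_intros)
      have gc: "continuous_on S ?g" for S
        unfolding divide_inverse by (intro continuous_intros zc)
      have gm: "?g \<in> borel_measurable borel" by (intro borel_measurable_continuous_onI gc)
      have bs: "bounded (strip rad)" unfolding strip_def by (intro bounded_Times) auto
      then have "bounded (?g ` closure (strip rad))"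
        by (intro compact_imp_bounded compact_continuous_image gc) auto
      then obtain B where B: "\<And>q. q \<in> closure (strip rad) \<Longrightarrow> \<bar>?g q\<bar> \<le> B" by (auto simp: bounded_iff)
      have gi: "set_integrable lborel (strip rad) ?g"
        by (rule bounded_set_integrable[OF gm strip_borel bs]) (use B closure_subset in blast)
      have "(LINT q:strip rad|lborel. ?S (wr i q)) = (LINT q:strip rad|lborel. ?g q)"
        using eq by (intro set_lebesgue_integral_cong) auto
      also have "\<dots> = (LINT z:{0<..<1}|lborel. integral {0..2 * pi * rad} (\<lambda>s. ?g (s, z)))"
      proof (rule strip_integral[OF gm gi])
        show "continuous_on {0..2 * pi * rad} (\<lambda>s. ?g (s, z))" for z
          by (rule continuous_on_compose2[OF gc[of UNIV]]) (auto intro: continuous_intros)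
      qed
      also have "\<dots> = (LINT z:{0<..<1}|lborel. 1 / \<epsilon> * profile i z)"
      proof (intro set_lebesgue_integral_cong allI impI)
        fix z :: real
        have "integral {0..2 * pi * rad} (\<lambda>s. ?g (s, z)) = 2 * pi * rad * ?A z + pi * rad * ((?z 1 z)\<^sup>2 / (2 * \<epsilon>\<^sup>2)) + pi * rad * ((?z 2 z)\<^sup>2 / (2 * \<epsilon>\<^sup>2))"
          unfolding fst_conv snd_conv by (rule circle_integral[OF rad_pos])
        also have "\<dots> = 1 / \<epsilon> * profile i z"
          unfolding profile_def sum_3 weight_def using \<epsilon>_pos by (simp add: field_simps power2_eq_square)
        finally show "integral {0..2 * pi * rad} (\<lambda>s. ?g (s, z)) = 1 / \<epsilon> * profile i z" .
      qed simp
      finally show ?thesis using True by simp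
    qed
  qed
  also have "\<dots> = (\<Sum>i\<in>IC. 1 / \<epsilon> * (LINT z:{0<..<1}|lborel. profile i z))"
  proof -
    have "I \<inter> IC = IC" using IC_subset by blast
    then show ?thesis by (simp add: sum.inter_restrict[OF finite_I, symmetric])
  qed
  finally show ?thesis using \<epsilon>_pos by (simp add: Q_def sum_divide_distrib[symmetric])
qed

end

section \<open>The lower bound\<close>

lemma norm3_square: "(norm (v::real^3))\<^sup>2 = (\<Sum>k\<in>UNIV. (v$k)\<^sup>2)"
  unfolding power2_norm_eq_inner inner_vec_def by (simp add: power2_eq_square)

lemma matrix_norm_square: "(norm (A::real^3^3))\<^sup>2 = (\<Sum>a\<in>UNIV. \<Sum>b\<in>UNIV. (A$a$b)\<^sup>2)"
  unfolding power2_norm_eq_inner inner_vec_def by (simp add: power2_eq_square)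

lemma component_square_le: "((v::real^3)$k)\<^sup>2 \<le> (norm v)\<^sup>2"
  using component_le_norm_cart[of v k] by (metis abs_le_square_iff abs_norm_cancel)

lemma L2_space_diff:
  fixes f g :: "'a \<Rightarrow> 'b::euclidean_space"
  assumes "f \<in> L2_space N" "g \<in> L2_space N"
  shows "(\<lambda>x. f x - g x) \<in> L2_space N"
proof -
  have m [measurable]: "f \<in> borel_measurable N" "g \<in> borel_measurable N"
    and i: "integrable N (\<lambda>x. (norm (f x))\<^sup>2)" "integrable N (\<lambda>x. (norm (g x))\<^sup>2)"
    using assms by (auto simp: L2_space_def)
  have "(norm (f x - g x))\<^sup>2 \<le> 2 * (norm (f x))\<^sup>2 + 2 * (norm (g x))\<^sup>2" for x
  proof -
    have "(norm (f x - g x))\<^sup>2 \<le> (norm (f x) + norm (g x))\<^sup>2"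
      by (intro power_mono norm_triangle_ineq4) auto
    then show ?thesis using square_sum_bound[of "norm (f x)" "norm (g x)"] by linarith
  qed
  then have b: "norm ((norm (f x - g x))\<^sup>2) \<le> norm (2 * (norm (f x))\<^sup>2 + 2 * (norm (g x))\<^sup>2)" for x by simp
  have "integrable N (\<lambda>x. (norm (f x - g x))\<^sup>2)"
  proof (rule Bochner_Integration.integrable_bound)
    show "integrable N (\<lambda>x. 2 * (norm (f x))\<^sup>2 + 2 * (norm (g x))\<^sup>2)" using i by simp
  qed (measurable, rule AE_I2, rule b)
  then show ?thesis by (simp add: L2_space_def)
qed

lemma L2_space_component:
  fixes f :: "'a \<Rightarrow> real^3"
  assumes "f \<in> L2_space N"
  shows "(\<lambda>x. f x $ k) \<in> borel_measurable N" "integrable N (\<lambda>x. (f x $ k)\<^sup>2)"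
proof -
  have m: "f \<in> borel_measurable N" and i: "integrable N (\<lambda>x. (norm (f x))\<^sup>2)"
    using assms by (auto simp: L2_space_def)
  show 1: "(\<lambda>x. f x $ k) \<in> borel_measurable N"
    using m by (rule measurable_compose) (simp add: borel_measurable_continuous_onI linear_continuous_on[OF bounded_linear_vec_nth])
  show "integrable N (\<lambda>x. (f x $ k)\<^sup>2)"
    by (rule Bochner_Integration.integrable_bound[OF i]) (use 1 component_square_le in auto)
qed

lemma square_integrable_mult:
  fixes f g :: "'a \<Rightarrow> real"
  assumes "f \<in> borel_measurable N" "integrable N (\<lambda>x. (f x)\<^sup>2)" "g \<in> borel_measurable N" "integrable N (\<lambda>x. (g x)\<^sup>2)"
  shows "integrable N (\<lambda>x. f x * g x)"
proof (rule Bochner_Integration.integrable_bound)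
  show "integrable N (\<lambda>x. (f x)\<^sup>2 + (g x)\<^sup>2)" using assms by simp
  have "\<bar>f x * g x\<bar> \<le> (f x)\<^sup>2 + (g x)\<^sup>2" for x
  proof -
    have "0 \<le> \<bar>f x\<bar> * \<bar>g x\<bar>" by simp
    then show ?thesis using zero_le_power2[of "\<bar>f x\<bar> - \<bar>g x\<bar>"] unfolding power2_diff abs_mult power2_abs by linarith
  qed
  then show "AE x in N. norm (f x * g x) \<le> norm ((f x)\<^sup>2 + (g x)\<^sup>2)" by auto
qed (use assms in simp)

definition cell_of :: "real \<Rightarrow> real^3 \<Rightarrow> int \<times> int" where
  "cell_of e x = (\<lfloor>x$1 / e\<rfloor>, \<lfloor>x$2 / e\<rfloor>)"

lemma cell_of_iff:
  assumes "e > 0"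
  shows "cell_of e x = i \<longleftrightarrow> e * of_int (fst i) \<le> x$1 \<and> x$1 < e * of_int (fst i) + e \<and>
    e * of_int (snd i) \<le> x$2 \<and> x$2 < e * of_int (snd i) + e"
proof -
  have "\<lfloor>t / e\<rfloor> = n \<longleftrightarrow> e * of_int n \<le> t \<and> t < e * of_int n + e" for t :: real and n
    using assms by (simp add: floor_eq_iff field_simps)
  then show ?thesis by (cases i) (auto simp: cell_of_def)
qed

lemma cell_of_T_cell: "e > 0 \<Longrightarrow> x \<in> T_cell e i \<Longrightarrow> cell_of e x = i"
  unfolding cell_of_iff by (auto simp: T_cell_def prism_def)

lemma cell_of_near_center:
  assumes "e > 0"
  shows "\<bar>x$1 - center e (cell_of e x)$1\<bar> \<le> e / 2" "\<bar>x$2 - center e (cell_of e x)$2\<bar> \<le> e / 2"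
proof -
  have "e * of_int (fst (cell_of e x)) \<le> x$1" "x$1 < e * of_int (fst (cell_of e x)) + e"
    "e * of_int (snd (cell_of e x)) \<le> x$2" "x$2 < e * of_int (snd (cell_of e x)) + e"
    using cell_of_iff[OF assms, of x "cell_of e x"] by blast+
  then show "\<bar>x$1 - center e (cell_of e x)$1\<bar> \<le> e / 2" "\<bar>x$2 - center e (cell_of e x)$2\<bar> \<le> e / 2"
    unfolding center_nth by linarith+
qed

text \<open>Horizontally constant on each cell, so that the square integrals over a cell and over its cylinder differ only by
  the factor of the areas.\<close>

definition step_approx :: "(real^3) set \<Rightarrow> real \<Rightarrow> (real^3 \<Rightarrow> real) \<Rightarrow> real^3 \<Rightarrow> real" where
  "step_approx \<Omega> e f x = (if cell_of e x \<in> inner_cells \<Omega> e then f (freeze (center e (cell_of e x)) x) else 0)"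

lemma step_approx_tendsto:
  assumes "open \<omega>" "\<Omega> = prism \<omega>" "x \<in> \<Omega>" and e: "\<And>j. e j > 0" "e \<longlonglongrightarrow> 0" and f: "continuous_on UNIV f"
  shows "(\<lambda>j. step_approx \<Omega> (e j) f x) \<longlonglongrightarrow> f x"
proof -
  let ?c = "\<lambda>j. center (e j) (cell_of (e j) x)"
  have c0: "(\<lambda>j. ?c j $ 1 - x$1) \<longlonglongrightarrow> 0" "(\<lambda>j. ?c j $ 2 - x$2) \<longlonglongrightarrow> 0"
  proof -
    have "norm (?c j $ 1 - x$1) \<le> e j" "norm (?c j $ 2 - x$2) \<le> e j" for j
      using cell_of_near_center[OF e(1)[of j], of x] e(1)[of j] unfolding real_norm_def by linarith+
    then show "(\<lambda>j. ?c j $ 1 - x$1) \<longlonglongrightarrow> 0" "(\<lambda>j. ?c j $ 2 - x$2) \<longlonglongrightarrow> 0"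
      by (intro Lim_null_comparison[OF _ e(2)] always_eventually allI; blast)+
  qed
  have "(\<lambda>j. freeze (?c j) x $ k) \<longlonglongrightarrow> x $ k" for k
    using LIM_zero_cancel[OF c0(1)] LIM_zero_cancel[OF c0(2)] exhaust_3[of k] by auto
  then have "(\<lambda>j. freeze (?c j) x) \<longlonglongrightarrow> x" by (rule vec_tendstoI)
  moreover have "isCont f x" using f by (simp add: continuous_on_eq_continuous_at)
  ultimately have lim: "(\<lambda>j. f (freeze (?c j) x)) \<longlonglongrightarrow> f x"
    by (rule isCont_tendsto_compose[rotated])
  obtain r where r: "r > 0" "ball (alpha x) r \<subseteq> \<omega>"
    using assms(1-3) by (auto simp: prism_def open_contains_ball)
  have "\<forall>\<^sub>F j in sequentially. 2 * e j < r"
  proof -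
    have "(\<lambda>j. 2 * e j) \<longlonglongrightarrow> 2 * 0" by (intro tendsto_intros e(2))
    then show ?thesis using r(1) by (intro order_tendstoD) auto
  qed
  then have "\<forall>\<^sub>F j in sequentially. cell_of (e j) x \<in> inner_cells \<Omega> (e j)"
  proof eventually_elim
    case (elim j)
    show ?case unfolding inner_cells_def
    proof (intro CollectI allI impI)
      fix y :: "real^3" assume y: "\<bar>y$1 - ?c j $ 1\<bar> \<le> e j / 2 \<and> \<bar>y$2 - ?c j $ 2\<bar> \<le> e j / 2 \<and> 0 < y$3 \<and> y$3 < 1"
      have "\<bar>x$1 - y$1\<bar> \<le> e j" "\<bar>x$2 - y$2\<bar> \<le> e j"
        using y cell_of_near_center[OF e(1), of x j] by linarith+
      then have "(x$1 - y$1)\<^sup>2 \<le> (e j)\<^sup>2" "(x$2 - y$2)\<^sup>2 \<le> (e j)\<^sup>2"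
        using e(1)[of j] by (metis abs_le_square_iff abs_of_pos)+
      then have "(dist (alpha x) (alpha y))\<^sup>2 \<le> 2 * (e j)\<^sup>2" by (simp add: dist2)
      also have "\<dots> \<le> (2 * e j)\<^sup>2" by (simp add: power_mult_distrib)
      finally have "dist (alpha x) (alpha y) \<le> 2 * e j" by (rule power2_le_imp_le) (use e(1)[of j] in simp)
      then have "alpha y \<in> \<omega>" using elim r(2) by auto
      then show "y \<in> \<Omega>" using y assms(2) by (simp add: prism_def)
    qed
  qed
  then have "\<forall>\<^sub>F j in sequentially. f (freeze (?c j) x) = step_approx \<Omega> (e j) f x"
    by eventually_elim (simp add: step_approx_def)
  from Lim_transform_eventually[OF lim this] show ?thesis .
qed

lemma young_inequality:
  fixes a b s :: real
  assumes "s > 0"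
  shows "2 * a * b \<ge> - (s * a\<^sup>2) - b\<^sup>2 / s"
proof -
  have "0 \<le> (s * a + b)\<^sup>2 / s" using assms by simp
  also have "\<dots> = s * a\<^sup>2 + 2 * a * b + b\<^sup>2 / s" using assms by (simp add: power2_eq_square field_simps)
  finally show ?thesis by linarith
qed

context perforated
begin

abbreviation "L \<equiv> lebesgue_on \<Omega>"

lemma space_L: "space L = \<Omega>" by (simp add: space_restrict_space)

lemma finite_L: "finite_measure L" using \<Omega>_lmeasurable by (rule finite_measure_lebesgue_on)

lemma borel_L: "f \<in> borel_measurable borel \<Longrightarrow> f \<in> borel_measurable L"
  by (intro measurable_restrict_space1 measurable_completion) simp

lemma L_integral:
  fixes f :: "real^3 \<Rightarrow> real"
  shows "(LINT x:\<Omega>|lebesgue. f x) = (LINT x|L. f x)"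
  using integral_restrict_space[of \<Omega> lebesgue f] by (simp add: set_lebesgue_integral_def)

lemma L_bounded_integrable:
  fixes f :: "real^3 \<Rightarrow> real"
  assumes "f \<in> borel_measurable L" "\<And>x. x \<in> \<Omega> \<Longrightarrow> \<bar>f x\<bar> \<le> B"
  shows "integrable L f"
  by (intro finite_measure.integrable_const_bound[OF finite_L, of f B] assms(1) AE_I2) (simp add: space_L assms(2))

lemma set_integral_L:
  fixes f :: "real^3 \<Rightarrow> real"
  assumes "A \<subseteq> \<Omega>"
  shows "(LINT x:A|lebesgue. f x) = (LINT x|L. indicator A x * f x)"
  unfolding L_integral[symmetric] set_lebesgue_integral_def
  using assms by (intro Bochner_Integration.integral_cong refl) (auto simp: indicator_def)

lemma sets_L: "A \<in> sets borel \<Longrightarrow> A \<subseteq> \<Omega> \<Longrightarrow> A \<in> sets L"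
  using \<Omega>_lmeasurable by (auto simp: sets_restrict_space_iff fmeasurableD)

lemma cyl_column: "cyl \<epsilon> i = column (disk (center \<epsilon> i) rad)"
  by (rule set_eqI) (simp only: mem_cyl[OF \<epsilon>_pos] column_disk mem_Collect_eq)

lemma cell_of_borel: "{x. cell_of \<epsilon> x = i} \<in> sets borel"
  unfolding cell_of_iff[OF \<epsilon>_pos] by measurable

end

context test_strain
begin

abbreviation "S k \<equiv> step_approx \<Omega> \<epsilon> (\<zeta> k)"

lemma L_mult_test:
  assumes h: "integrable L h" and f: "f \<in> test_functions \<Omega>"
  shows "integrable L (\<lambda>x. h x * f x)"
proof -
  obtain B where B: "B \<ge> 0" "\<And>x. \<bar>f x\<bar> \<le> B" using test_functions_bounded[OF f] by blast
  show ?thesis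
  proof (rule Bochner_Integration.integrable_bound)
    show "integrable L (\<lambda>x. B * h x)" using h by simp
    show "(\<lambda>x. h x * f x) \<in> borel_measurable L"
      using h borel_L[OF test_functions_borel[OF f]] by simp
    have "\<bar>h x * f x\<bar> \<le> \<bar>B * h x\<bar>" for x
      using mult_left_mono[OF B(2)[of x], of "\<bar>h x\<bar>"] B(1) by (simp add: abs_mult mult.commute)
    then show "AE x in L. norm (h x * f x) \<le> norm (B * h x)" by auto
  qed
qed

text \<open>By symmetry of \<open>\<Phi>\<close> the symmetrised gradient may be replaced by the full one.\<close>

lemma E_distr_pairing:
  assumes u: "\<And>b. integrable L (\<lambda>x. u x $ b)"
  shows "\<epsilon>\<^sup>2 * (\<Sum>a\<in>UNIV. \<Sum>b\<in>UNIV. E_distr \<Omega> u a b (\<Phi> a b)) = - (LINT x|L. (\<Sum>b\<in>UNIV. u x $ b * \<psi> b x))"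
proof -
  define X where "X a b = (LINT x|L. u x $ b * partial a (\<Phi> a b) x)" for a b
  have i: "integrable L (\<lambda>x. u x $ b * partial a (\<Phi> a' b') x)" for a b a' b'
    by (rule L_mult_test[OF u test_functions_partial[OF \<Phi>_test]])
  have E: "E_distr \<Omega> u a b (\<Phi> a b) = - (X a b + X b a) / 2" for a b
  proof -
    have "E_distr \<Omega> u a b (\<Phi> a b) = - (LINT x|L. (u x $ b * partial a (\<Phi> a b) x + u x $ a * partial b (\<Phi> a b) x) / 2)"
      unfolding E_distr_def L_integral ..
    also have "(LINT x|L. (u x $ b * partial a (\<Phi> a b) x + u x $ a * partial b (\<Phi> a b) x) / 2)
       = ((LINT x|L. u x $ b * partial a (\<Phi> a b) x) + (LINT x|L. u x $ a * partial b (\<Phi> a b) x)) / 2"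
      using i by simp
    finally show ?thesis unfolding X_def \<Phi>_sym[of b a] by (simp only: minus_divide_left)
  qed
  have "(\<Sum>a\<in>UNIV. \<Sum>b\<in>UNIV. E_distr \<Omega> u a b (\<Phi> a b)) = - (\<Sum>b\<in>UNIV. \<Sum>a\<in>UNIV. X a b)"
    unfolding E sum_3 by (simp add: field_simps)
  also have "(\<Sum>b\<in>UNIV. \<Sum>a\<in>UNIV. X a b) = (LINT x|L. (\<Sum>b\<in>UNIV. \<Sum>a\<in>UNIV. u x $ b * partial a (\<Phi> a b) x))"
    unfolding X_def using i by (simp add: Bochner_Integration.integral_sum)
  finally have "\<epsilon>\<^sup>2 * (\<Sum>a\<in>UNIV. \<Sum>b\<in>UNIV. E_distr \<Omega> u a b (\<Phi> a b)) =
     - (LINT x|L. \<epsilon>\<^sup>2 * (\<Sum>b\<in>UNIV. \<Sum>a\<in>UNIV. u x $ b * partial a (\<Phi> a b) x))" by simp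
  also have "(\<lambda>x. \<epsilon>\<^sup>2 * (\<Sum>b\<in>UNIV. \<Sum>a\<in>UNIV. u x $ b * partial a (\<Phi> a b) x)) = (\<lambda>x. \<Sum>b\<in>UNIV. u x $ b * \<psi> b x)"
    unfolding divergence_\<Phi>[symmetric] sum_distrib_left by (simp add: ac_simps)
  finally show ?thesis .
qed

text \<open>Expand \<open>\<bar>g - \<Phi>\<bar>\<^sup>2 \<ge> 0\<close>, with \<open>g\<close> the density of the strain; the mixed term is the pairing of \<open>Eu\<close> and \<open>\<Phi>\<close>.\<close>

lemma energy_duality:
  assumes u: "u \<in> LD2 \<Omega> M"
  shows "F_eps 2 \<Omega> \<epsilon> u \<ge> - 2 * (LINT x|L. (\<Sum>b\<in>UNIV. u x $ b * \<psi> b x)) - Q"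
proof -
  obtain \<Lambda> g where g: "is_Eu \<Omega> u \<Lambda>" "is_density \<Omega> \<Lambda> M g" "g \<in> L2_space MO"
    and u1: "integrable L u"
    using u unfolding LD2_def BD_def L1_space_def by blast
  have ui: "integrable L (\<lambda>x. u x $ b)" for b
    by (rule integrable_bounded_linear[OF bounded_linear_vec_nth u1])
  have gi: "integrable MO g" using g(2) integral_MO(2) unfolding is_density_def by auto
  have gij: "integrable MO (\<lambda>x. g x $ a $ b)" for a b
    by (rule integrable_bounded_linear[OF bounded_linear_entry gi])
  let ?G = "\<lambda>x. (norm (g x))\<^sup>2" and ?P = "\<lambda>x. \<Sum>a\<in>UNIV. \<Sum>b\<in>UNIV. \<Phi> a b x * g x $ a $ b"
    and ?S = "\<lambda>x. \<Sum>a\<in>UNIV. \<Sum>b\<in>UNIV. (\<Phi> a b x)\<^sup>2"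
  have G: "integrable MO ?G" using g(3) by (simp add: L2_space_def)
  have \<Phi>g: "integrable MO (\<lambda>x. \<Phi> a b x * g x $ a $ b)" for a b
  proof -
    obtain B where B: "B \<ge> 0" "\<And>x. \<bar>\<Phi> a b x\<bar> \<le> B" using test_functions_bounded[OF \<Phi>_test] by blast
    have m: "\<Phi> a b \<in> borel_measurable MO"
      using test_functions_borel[OF \<Phi>_test] by (intro measurable_restrict_space1) simp
    show ?thesis
    proof (rule Bochner_Integration.integrable_bound)
      show "integrable MO (\<lambda>x. B * g x $ a $ b)" using gij by simp
      show "(\<lambda>x. \<Phi> a b x * g x $ a $ b) \<in> borel_measurable MO" using m gij by simp
      have "\<bar>\<Phi> a b x * g x $ a $ b\<bar> \<le> \<bar>B * g x $ a $ b\<bar>" for x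
        using mult_right_mono[OF B(2)[of x], of "\<bar>g x $ a $ b\<bar>"] B(1) by (simp add: abs_mult)
      then show "AE x in MO. norm (\<Phi> a b x * g x $ a $ b) \<le> norm (B * g x $ a $ b)" by auto
    qed
  qed
  have sS: "smooth ?S" unfolding power2_eq_square
    by (intro smooth_sum smooth_mult test_functions_smooth[OF \<Phi>_test])
  obtain B where B: "\<And>x. x \<in> \<Omega> \<Longrightarrow> \<bar>?S x\<bar> \<le> B" by (rule smooth_bounded_on[OF sS bounded_\<Omega>]) blast
  have S: "integrable MO ?S"
    unfolding integral_MO(2) by (rule bounded_integrable_M[OF smooth_borel[OF sS]]) (use B in simp)
  have pt: "2 * ?P x - ?S x \<le> ?G x" for x
  proof -
    have "2 * (\<Phi> a b x * g x $ a $ b) - (\<Phi> a b x)\<^sup>2 \<le> (g x $ a $ b)\<^sup>2" for a b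
      using zero_le_power2[of "\<Phi> a b x - g x $ a $ b"] by (simp add: power2_diff)
    then have "(\<Sum>a\<in>UNIV. \<Sum>b\<in>UNIV. 2 * (\<Phi> a b x * g x $ a $ b) - (\<Phi> a b x)\<^sup>2) \<le> ?G x"
      unfolding matrix_norm_square by (intro sum_mono)
    then show ?thesis by (simp add: sum_subtractf sum_distrib_left)
  qed
  have P: "integrable MO ?P" using \<Phi>g by simp
  have "(LINT x|MO. 2 * ?P x - ?S x) \<le> (LINT x|MO. ?G x)"
    using P S G pt by (intro integral_mono) auto
  moreover have "(LINT x|MO. 2 * ?P x - ?S x) = 2 * (LINT x|MO. ?P x) - (LINT x|MO. ?S x)"
    using P S by simp
  moreover have "(LINT x|MO. ?P x) = (\<Sum>a\<in>UNIV. \<Sum>b\<in>UNIV. E_distr \<Omega> u a b (\<Phi> a b))"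
    unfolding E_distr_eq_integral[OF g(1,2) \<Phi>_test] integral_MO(1)[symmetric] using \<Phi>g by (simp add: Bochner_Integration.integral_sum)
  ultimately have "\<epsilon>\<^sup>2 * (2 * (\<Sum>a\<in>UNIV. \<Sum>b\<in>UNIV. E_distr \<Omega> u a b (\<Phi> a b)) - (LINT x|MO. ?S x)) \<le> \<epsilon>\<^sup>2 * (LINT x|MO. ?G x)"
    by (intro mult_left_mono) auto
  also have "\<dots> = F_eps 2 \<Omega> \<epsilon> u" unfolding F_eps_eq[OF g(1,2)] integral_MO(1) ..
  finally show ?thesis
    using E_distr_pairing[OF ui] \<Phi>_energy integral_MO(1)[of ?S] by (simp add: right_diff_distrib)
qed

lemma S_measurable: "S k \<in> borel_measurable borel"
proof -
  have "S k = (\<lambda>x. \<Sum>i\<in>IC. indicator {x. cell_of \<epsilon> x = i} x * Z i k x)"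
  proof
    fix x
    have "(\<Sum>i\<in>IC. indicator {x. cell_of \<epsilon> x = i} x * Z i k x) = (\<Sum>i\<in>IC. if i = cell_of \<epsilon> x then Z i k x else 0)"
      by (intro sum.cong) (auto simp: indicator_def)
    then show "S k x = (\<Sum>i\<in>IC. indicator {x. cell_of \<epsilon> x = i} x * Z i k x)"
      using finite_IC by (simp add: step_approx_def)
  qed
  moreover note cell_of_borel
  moreover have "Z i k \<in> borel_measurable borel" for i
    by (intro smooth_borel smooth_freeze \<zeta>_smooth)
  ultimately show ?thesis by simp
qed

lemma S_bounded: "(\<And>x. \<bar>\<zeta> k x\<bar> \<le> B) \<Longrightarrow> \<bar>S k x\<bar> \<le> B"
  by (auto simp: step_approx_def intro: order_trans[OF abs_ge_zero])

lemma half_open_cell: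
  "{x. cell_of \<epsilon> x = i \<and> 0 < x$3 \<and> x$3 < 1} =
    column ({\<epsilon> * of_int (fst i)..<\<epsilon> * of_int (fst i) + \<epsilon>} \<times> {\<epsilon> * of_int (snd i)..<\<epsilon> * of_int (snd i) + \<epsilon>})"
  by (auto simp: column_def cell_of_iff[OF \<epsilon>_pos])

lemma column_profile_integral:
  assumes D: "D \<in> sets borel" "bounded D"
  shows "(LINT x:column D|lborel. profile i (x$3)) = measure lborel D * (LINT z:{0<..<1}|lborel. profile i z)"
    and "set_integrable lborel (column D) (\<lambda>x. profile i (x$3))"
proof -
  have sp: "smooth (\<lambda>x. profile i (x$3))"
    unfolding profile_def power2_eq_square freeze_eq[symmetric]
    by (intro smooth_sum smooth_mult smooth_const smooth_freeze \<zeta>_smooth)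
  show int: "set_integrable lborel (column D) (\<lambda>x. profile i (x$3))"
    by (intro smooth_set_integrable sp column_borel D bounded_column)
  have fin: "emeasure lborel D < \<infinity>" using emeasure_bounded_finite[OF D(2)] by simp
  have "(LINT x:column D|lborel. profile i (x$3)) = (LINT z:{0<..<1}|lborel. LINT p:D|lborel. profile i z)"
    using column_integral(1)[OF smooth_borel[OF sp] int column_borel[OF D(1)]] by simp
  also have "\<dots> = (LINT z:{0<..<1}|lborel. measure lborel D * profile i z)"
    using fin D(1) by (simp add: set_lebesgue_integral_def)
  finally show "(LINT x:column D|lborel. profile i (x$3)) = measure lborel D * (LINT z:{0<..<1}|lborel. profile i z)"
    by (simp add: set_lebesgue_integral_def)
qed

lemma weighted_S: "(\<Sum>k\<in>UNIV. weight k * (S k x)\<^sup>2) = (if cell_of \<epsilon> x \<in> IC then profile (cell_of \<epsilon> x) (x$3) else 0)"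
  by (simp add: step_approx_def profile_def freeze_eq)

lemma S_borel_lebesgue: "(LINT x:A|lebesgue. \<Sum>k\<in>UNIV. weight k * (S k x)\<^sup>2) = (LINT x:A|lborel. \<Sum>k\<in>UNIV. weight k * (S k x)\<^sup>2)"
  if "A \<in> sets borel"
  unfolding set_lebesgue_integral_def
  using that S_measurable by (intro integral_completion) simp

text \<open>Both the cells and the cylinders carry \<open>Q\<close>, the latter after dividing by their volume fraction
  \<open>\<pi> / 16\<close>.\<close>

lemma Q_cells: "(LINT x|L. (\<Sum>k\<in>UNIV. weight k * (S k x)\<^sup>2)) = Q"
proof -
  let ?H = "\<lambda>i. {\<epsilon> * of_int (fst i)..<\<epsilon> * of_int (fst i) + \<epsilon>} \<times> {\<epsilon> * of_int (snd i)..<\<epsilon> * of_int (snd i) + \<epsilon>}"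
  have Hb: "?H i \<in> sets borel" "bounded (?H i)" "measure lborel (?H i) = \<epsilon>\<^sup>2" for i
  proof -
    show "?H i \<in> sets borel" unfolding borel_prod[symmetric] by (intro pair_measureI) auto
    show "bounded (?H i)" by (intro bounded_Times) auto
    have "emeasure lborel (?H i) = emeasure (lborel \<Otimes>\<^sub>M lborel) (?H i)" by (simp only: lborel_prod)
    also have "\<dots> = emeasure lborel {\<epsilon> * of_int (fst i)..<\<epsilon> * of_int (fst i) + \<epsilon>} * emeasure lborel {\<epsilon> * of_int (snd i)..<\<epsilon> * of_int (snd i) + \<epsilon>}"
      by (intro lborel.emeasure_pair_measure_Times) auto
    also have "\<dots> = ennreal (\<epsilon>\<^sup>2)" using \<epsilon>_pos by (simp add: power2_eq_square flip: ennreal_mult)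
    finally show "measure lborel (?H i) = \<epsilon>\<^sup>2" using \<epsilon>_pos by (simp add: measure_def)
  qed
  have ind: "indicator \<Omega> x * (\<Sum>k\<in>UNIV. weight k * (S k x)\<^sup>2) = (\<Sum>i\<in>IC. indicator (column (?H i)) x * profile i (x$3))" for x
  proof -
    have col: "x \<in> column (?H i) \<longleftrightarrow> cell_of \<epsilon> x = i \<and> 0 < x$3 \<and> x$3 < 1" for i
      using half_open_cell by blast
    show ?thesis
    proof (cases "cell_of \<epsilon> x \<in> IC \<and> 0 < x$3 \<and> x$3 < 1")
      case True
      then have "x \<in> \<Omega>" using cell_of_near_center[OF \<epsilon>_pos, of x] unfolding inner_cells_def by blast
      have "(\<Sum>i\<in>IC. indicator (column (?H i)) x * profile i (x$3)) = (\<Sum>i\<in>IC. if i = cell_of \<epsilon> x then profile i (x$3) else 0)"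
        using True by (intro sum.cong refl) (auto simp: indicator_def col)
      also have "\<dots> = profile (cell_of \<epsilon> x) (x$3)" using True finite_IC by simp
      finally show ?thesis unfolding weighted_S using True \<open>x \<in> \<Omega>\<close> by simp
    next
      case False
      then have "(\<Sum>i\<in>IC. indicator (column (?H i)) x * profile i (x$3)) = 0"
        by (intro sum.neutral) (auto simp: indicator_def col)
      moreover have "indicator \<Omega> x * (\<Sum>k\<in>UNIV. weight k * (S k x)\<^sup>2) = 0"
        unfolding weighted_S using False by (auto simp: indicator_def \<Omega>_eq prism_def)
      ultimately show ?thesis by simp
    qed
  qed
  have "(LINT x|L. (\<Sum>k\<in>UNIV. weight k * (S k x)\<^sup>2)) = (LINT x|lborel. indicator \<Omega> x * (\<Sum>k\<in>UNIV. weight k * (S k x)\<^sup>2))"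
    using S_borel_lebesgue[OF \<Omega>_borel] by (simp add: L_integral[symmetric] set_lebesgue_integral_def)
  also have "\<dots> = (\<Sum>i\<in>IC. LINT x:column (?H i)|lborel. profile i (x$3))"
    unfolding ind set_lebesgue_integral_def
    using column_profile_integral(2)[OF Hb(1,2)] by (subst Bochner_Integration.integral_sum) (auto simp: set_integrable_def)
  also have "\<dots> = Q" unfolding column_profile_integral(1)[OF Hb(1,2)] Hb(3) Q_def by (simp add: sum_distrib_left)
  finally show ?thesis .
qed

lemma measure_disk: "r > 0 \<Longrightarrow> measure lborel (disk c r) = pi * r\<^sup>2"
proof -
  assume r: "r > 0"
  have "disk c r = cball (c$1, c$2) r"
  proof (rule set_eqI)
    fix p :: "real \<times> real"
    have d: "(dist (c$1, c$2) p)\<^sup>2 = (fst p - c$1)\<^sup>2 + (snd p - c$2)\<^sup>2"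
      by (cases p) (simp add: dist_Pair_Pair dist_real_def power2_commute)
    have "p \<in> cball (c$1, c$2) r \<longleftrightarrow> (dist (c$1, c$2) p)\<^sup>2 \<le> r\<^sup>2"
      using r abs_le_square_iff[of "dist (c$1, c$2) p" r] by simp
    then show "p \<in> disk c r \<longleftrightarrow> p \<in> cball (c$1, c$2) r" unfolding d by simp
  qed
  then have "measure lborel (disk c r) = measure lborel (cball (c$1, c$2) r)" by simp
  also have "\<dots> = pi * r\<^sup>2" using r by (subst content_cball) (auto simp: unit_ball_vol_2 power2_eq_square)
  finally show ?thesis .
qed

lemma Q_cylinders: "(LINT x:E2 \<Omega> \<epsilon>|lebesgue. \<Sum>k\<in>UNIV. 16 / pi * weight k * (S k x)\<^sup>2) = Q"
proof -
  have ind: "indicator (E2 \<Omega> \<epsilon>) x * (\<Sum>k\<in>UNIV. weight k * (S k x)\<^sup>2) = (\<Sum>i\<in>IC. indicator (cyl \<epsilon> i) x * profile i (x$3))" for x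
  proof (cases "\<exists>i\<in>I. x \<in> cyl \<epsilon> i")
    case True
    then obtain i where i: "i \<in> I" "x \<in> cyl \<epsilon> i" by blast
    then have xE: "x \<in> E2 \<Omega> \<epsilon>" unfolding E2_def by blast
    have T: "x \<in> T_cell \<epsilon> i" using i cyl_subset_T_cell[OF \<epsilon>_pos] by blast
    have c: "cell_of \<epsilon> x = i" by (rule cell_of_T_cell[OF \<epsilon>_pos T])
    have "(\<Sum>k\<in>IC. indicator (cyl \<epsilon> k) x * profile k (x$3)) = (\<Sum>k\<in>IC. if k = i then profile k (x$3) else 0)"
    proof (intro sum.cong refl)
      fix k
      have "x \<in> cyl \<epsilon> k \<longleftrightarrow> k = i"
        using i T cyl_subset_T_cell[OF \<epsilon>_pos, of k] T_cell_disjoint[OF \<epsilon>_pos T, of k] by blast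
      then show "indicator (cyl \<epsilon> k) x * profile k (x$3) = (if k = i then profile k (x$3) else 0)"
        by (simp only: indicator_def) simp
    qed
    then show ?thesis unfolding weighted_S c using xE finite_IC by simp
  next
    case False
    then have "x \<notin> E2 \<Omega> \<epsilon>" unfolding E2_def by blast
    moreover have "(\<Sum>i\<in>IC. indicator (cyl \<epsilon> i) x * profile i (x$3)) = 0"
      using False IC_subset by (intro sum.neutral) (auto simp: indicator_def)
    ultimately show ?thesis by simp
  qed
  have E2b: "E2 \<Omega> \<epsilon> \<in> sets borel" using E2_borel bounded_\<Omega> \<epsilon>_pos by blast
  have "(LINT x:E2 \<Omega> \<epsilon>|lebesgue. \<Sum>k\<in>UNIV. 16 / pi * weight k * (S k x)\<^sup>2) = 16 / pi * (LINT x:E2 \<Omega> \<epsilon>|lebesgue. \<Sum>k\<in>UNIV. weight k * (S k x)\<^sup>2)"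
    unfolding mult.assoc sum_distrib_left[symmetric] by simp
  also have "(LINT x:E2 \<Omega> \<epsilon>|lebesgue. \<Sum>k\<in>UNIV. weight k * (S k x)\<^sup>2) = (LINT x|lborel. indicator (E2 \<Omega> \<epsilon>) x * (\<Sum>k\<in>UNIV. weight k * (S k x)\<^sup>2))"
    unfolding S_borel_lebesgue[OF E2b] by (simp add: set_lebesgue_integral_def)
  also have "\<dots> = (\<Sum>i\<in>IC. LINT x:column (disk (center \<epsilon> i) rad)|lborel. profile i (x$3))"
    unfolding ind set_lebesgue_integral_def cyl_column real_scaleR_def
    by (rule Bochner_Integration.integral_sum)
      (rule column_profile_integral(2)[OF disk_borel bounded_disk, unfolded set_integrable_def real_scaleR_def])
  also have "\<dots> = pi / 16 * Q"
    unfolding column_profile_integral(1)[OF disk_borel bounded_disk] measure_disk[OF rad_pos] Q_def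
    by (simp add: sum_distrib_left power_divide mult.assoc)
  finally show ?thesis by simp
qed

text \<open>Replacing \<open>w\<close> by \<open>\<zeta>\<close> in the pairing costs the distance of the two, weighted by \<open>s\<close>, and a term that is small
  for large \<open>s\<close>.\<close>

lemma cylinder_pairing:
  assumes s: "s > 0" and x: "x \<in> E2 \<Omega> \<epsilon>" and B: "\<And>x. \<bar>partial 3 (\<zeta> 3) x\<bar> \<le> B"
  shows "2 * (w * \<psi> b x) \<ge> 2 * (16 / pi * weight b * (S b x)\<^sup>2) - s * (w - S b x)\<^sup>2 - 36 / s * (S b x)\<^sup>2 - \<epsilon> * B * (1 + w\<^sup>2)"
proof -
  obtain k where k: "k \<in> I" "x \<in> cyl \<epsilon> k" using x unfolding E2_def by blast
  have c: "cell_of \<epsilon> x = k" using cell_of_T_cell[OF \<epsilon>_pos] cyl_subset_T_cell[OF \<epsilon>_pos] k by blast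
  have B0: "0 \<le> B" using B[of x] by linarith
  have e0: "0 \<le> \<epsilon> * B * (1 + w\<^sup>2)" using \<epsilon>_pos B0 by simp
  show ?thesis
  proof (cases "k \<in> IC")
    case False
    then have "S b x = 0" "\<psi> b x = 0" using \<psi>_cyl[OF k] by (simp_all add: step_approx_def c)
    moreover have "0 \<le> s * w\<^sup>2" using s by simp
    ultimately show ?thesis using e0 by simp
  next
    case True
    define z where "z = S b x"
    define \<kappa> where "\<kappa> = 16 / pi * weight b"
    define r where "r = (if b = 3 then 0 else 2 * partial 3 (\<zeta> 3) (freeze (center \<epsilon> k) x) * rescale \<epsilon> (center \<epsilon> k) x $ b)"
    have \<psi>: "\<psi> b x = \<kappa> * z + \<epsilon> * r"
      using \<psi>_cyl[OF k] True by (auto simp: z_def \<kappa>_def r_def step_approx_def c)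
    have \<kappa>: "0 \<le> \<kappa>" "\<kappa> \<le> 6" by (auto simp: \<kappa>_def weight_def)
    have r: "\<bar>r\<bar> \<le> B"
    proof (cases "b = 3")
      case False
      have q: "qd k x \<le> 1 / 16" by (rule qd_cyl[OF k(2)])
      have "(rescale \<epsilon> (center \<epsilon> k) x $ b)\<^sup>2 \<le> qd k x"
        using exhaust_3[of b] False zero_le_power2[of "rescale \<epsilon> (center \<epsilon> k) x $ 1"] zero_le_power2[of "rescale \<epsilon> (center \<epsilon> k) x $ 2"]
        by (auto simp del: rescale_nth zero_le_power2)
      also have "\<dots> \<le> 1 / 16" by (rule q)
      also have "1 / 16 \<le> (1 / 2 :: real)\<^sup>2" by (simp add: power2_eq_square)
      finally have "(rescale \<epsilon> (center \<epsilon> k) x $ b)\<^sup>2 \<le> (1 / 2)\<^sup>2" .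
      then have "\<bar>rescale \<epsilon> (center \<epsilon> k) x $ b\<bar> \<le> 1 / 2" by (metis abs_le_square_iff abs_of_nonneg zero_le_divide_1_iff zero_le_numeral)
      then have "\<bar>partial 3 (\<zeta> 3) (freeze (center \<epsilon> k) x)\<bar> * \<bar>rescale \<epsilon> (center \<epsilon> k) x $ b\<bar> \<le> B * (1 / 2)"
        using B B0 by (intro mult_mono) auto
      then show ?thesis unfolding r_def using False by (simp add: abs_mult)
    qed (simp add: r_def B0)
    have "2 * (w - z) * (\<kappa> * z) \<ge> - (s * (w - z)\<^sup>2) - (\<kappa> * z)\<^sup>2 / s" by (rule young_inequality[OF s])
    moreover have "(\<kappa> * z)\<^sup>2 / s \<le> 36 / s * z\<^sup>2"
    proof -
      have "\<kappa>\<^sup>2 \<le> 6\<^sup>2" using \<kappa> by (intro power_mono) auto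
      then have "\<kappa>\<^sup>2 * z\<^sup>2 \<le> 36 * z\<^sup>2" by (intro mult_right_mono) auto
      then show ?thesis using s by (simp add: power_mult_distrib divide_right_mono)
    qed
    moreover have "2 * (w * (\<epsilon> * r)) \<ge> - (\<epsilon> * B * (1 + w\<^sup>2))"
    proof -
      have "\<bar>2 * w\<bar> \<le> 1 + w\<^sup>2" using zero_le_power2[of "\<bar>w\<bar> - 1"] by (simp add: power2_diff)
      then have "\<bar>2 * w\<bar> * \<bar>r\<bar> \<le> (1 + w\<^sup>2) * B" using r by (intro mult_mono) auto
      then have "\<epsilon> * (\<bar>2 * w\<bar> * \<bar>r\<bar>) \<le> \<epsilon> * ((1 + w\<^sup>2) * B)" using \<epsilon>_pos by (intro mult_left_mono) auto
      moreover have "- (2 * (w * (\<epsilon> * r))) \<le> \<bar>2 * (w * (\<epsilon> * r))\<bar>" by simp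
      moreover have "\<bar>2 * (w * (\<epsilon> * r))\<bar> = \<epsilon> * (\<bar>2 * w\<bar> * \<bar>r\<bar>)" using \<epsilon>_pos by (simp add: abs_mult)
      ultimately show ?thesis by (simp add: mult_ac)
    qed
    moreover have "2 * (w * \<psi> b x) = 2 * (\<kappa> * z\<^sup>2) + 2 * (w - z) * (\<kappa> * z) + 2 * (w * (\<epsilon> * r))"
      unfolding \<psi> by (simp add: power2_eq_square algebra_simps)
    ultimately show ?thesis unfolding z_def[symmetric] \<kappa>_def[symmetric] by linarith
  qed
qed

end

lemma rigid_borel: "(\<lambda>x. cross3 a x + b) \<in> borel_measurable borel"
proof (intro borel_measurable_continuous_onI)
  have "continuous_on UNIV (\<lambda>x. \<chi> k. (cross3 a x + b) $ k)"
    by (intro continuous_on_vec_lambda smooth_continuous smooth_rigid)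
  then show "continuous_on UNIV (\<lambda>x. cross3 a x + b)" by (simp only: vec_nth_inverse)
qed

lemma rigid_L2_space:
  assumes "open \<Omega>" "bounded \<Omega>"
  shows "(\<lambda>x. cross3 a x + b) \<in> L2_space (lebesgue_on \<Omega>)"
proof -
  let ?U = "\<lambda>x. cross3 a x + b"
  have "\<Omega> \<in> lmeasurable" using assms lmeasurable_open by blast
  then have fin: "finite_measure (lebesgue_on \<Omega>)" by (rule finite_measure_lebesgue_on)
  have m: "?U \<in> borel_measurable (lebesgue_on \<Omega>)"
    by (intro measurable_restrict_space1 measurable_completion) (use rigid_borel in simp)
  have "smooth (\<lambda>x. \<Sum>k\<in>UNIV. (?U x $ k)\<^sup>2)" unfolding power2_eq_square by (intro smooth_sum smooth_mult smooth_rigid)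
  from smooth_bounded_on[OF this assms(2)] obtain C where C: "\<And>x. x \<in> \<Omega> \<Longrightarrow> \<bar>\<Sum>k\<in>UNIV. (?U x $ k)\<^sup>2\<bar> \<le> C" by blast
  then have C: "(norm (?U x))\<^sup>2 \<le> C" if "x \<in> \<Omega>" for x using that abs_ge_self order_trans unfolding norm3_square by blast
  have "integrable (lebesgue_on \<Omega>) (\<lambda>x. (norm (?U x))\<^sup>2)"
    by (intro finite_measure.integrable_const_bound[OF fin, of _ C] AE_I2)
      (use m C in \<open>auto simp: space_restrict_space\<close>)
  then show ?thesis using m by (simp add: L2_space_def)
qed

context test_strain
begin

text \<open>The parameters keep the errors apart: \<open>t\<close> weighs the distance of \<open>u\<close> from its limits, \<open>s\<close> the distance of
  \<open>\<zeta>\<close> from the limit jump \<open>w\<close>, and the vertical derivative of \<open>\<zeta>\<close> enters with the factor \<open>\<epsilon>\<close>. The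
  constants come from \<open>16 / \<pi> weight \<le> 6\<close> and from \<open>\<bar>\<psi>\<bar> \<le> 3 B D\<close> in each of the three components.\<close>

lemma lower_bound_static:
  fixes a b :: "real^3"
  assumes u: "u \<in> LD2 \<Omega> M" and u2: "u\<^sub>2 \<in> L2_space L" and e1: "\<epsilon> \<le> 1" and ts: "t > 0" "s > 0"
    and B: "\<And>k x. \<bar>\<zeta> k x\<bar> \<le> B" "\<And>x. \<bar>partial 3 (\<zeta> 3) x\<bar> \<le> B"
    and D: "\<And>b y. y$3 = 0 \<Longrightarrow> \<bar>rad_field b y\<bar> \<le> D" "\<And>a b y. y$3 = 0 \<Longrightarrow> \<bar>partial a (rad_field b) y\<bar> \<le> D"
    and w_def: "w = (\<lambda>k x. (cross3 a x + b - u\<^sub>2 x) $ k)"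
  shows "F_eps 2 \<Omega> \<epsilon> u \<ge> (LINT x|L. (\<Sum>k\<in>UNIV. weight k * (S k x)\<^sup>2)) - s * (LINT x|L. (\<Sum>k\<in>UNIV. (w k x - S k x)\<^sup>2))
    - 36 / s * (LINT x|L. (\<Sum>k\<in>UNIV. (S k x)\<^sup>2)) - \<epsilon> * B * (LINT x|L. (\<Sum>k\<in>UNIV. 1 + (w k x)\<^sup>2))
    - t * ((LINT x:E1 \<Omega> \<epsilon>|lebesgue. (norm (u x - (cross3 a x + b)))\<^sup>2) + (LINT x:E2 \<Omega> \<epsilon>|lebesgue. (norm (u x - u\<^sub>2 x))\<^sup>2))
    - 27 * (B * D)\<^sup>2 / t * measure L \<Omega>"
proof -
  interpret L: finite_measure L by (rule finite_L)
  let ?U = "\<lambda>x. cross3 a x + b"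
  have uL: "u \<in> L2_space L" using u unfolding LD2_def by blast
  have sU: "smooth (\<lambda>x. ?U x $ k)" for k by (rule smooth_rigid)
  have UL: "?U \<in> L2_space L" by (rule rigid_L2_space[OF open_\<Omega> bounded_\<Omega>])
  have wL: "w k \<in> borel_measurable L" "integrable L (\<lambda>x. (w k x)\<^sup>2)" for k
    using L2_space_component[OF L2_space_diff[OF UL u2], of k] by (simp_all add: w_def)
  have SL: "S k \<in> borel_measurable L" for k by (intro borel_L S_measurable)
  have Sb: "\<bar>S k x\<bar> \<le> B" for k x using S_bounded B(1) by blast
  have Si: "integrable L (\<lambda>x. (S k x)\<^sup>2)" for k
  proof (rule L_bounded_integrable[of _ "B\<^sup>2"])
    show "\<bar>(S k x)\<^sup>2\<bar> \<le> B\<^sup>2" for x using power_mono[OF Sb[of k x], of 2] by simp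
  qed (use SL in simp)
  have sm: "smooth (\<psi> b)" for b
    unfolding \<psi>_def[abs_def] \<tau>_def
    by (intro smooth_sum smooth_add smooth_mult smooth_const smooth_freeze smooth_rescale smooth_partial \<zeta>_smooth smooth_rad_field)
  have \<psi>L: "\<psi> b \<in> borel_measurable L" for b by (intro borel_L smooth_borel sm)
  have \<psi>b: "\<bar>\<psi> b x\<bar> \<le> 3 * (B * D)" if "x \<in> \<Omega>" for b x
    by (rule \<psi>_bound[OF e1 that B D])
  have \<psi>2: "(\<psi> b x)\<^sup>2 \<le> (3 * (B * D))\<^sup>2" if "x \<in> \<Omega>" for b x
    using power_mono[OF \<psi>b[OF that, of b] abs_ge_zero, of 2] by simp
  have \<psi>i: "integrable L (\<lambda>x. (\<psi> b x)\<^sup>2)" for b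
    by (rule L_bounded_integrable[of _ "(3 * (B * D))\<^sup>2"]) (use \<psi>L \<psi>2 in auto)
  have E2b: "E2 \<Omega> \<epsilon> \<in> sets borel" using E2_borel bounded_\<Omega> \<epsilon>_pos by blast
  have E1b: "E1 \<Omega> \<epsilon> \<in> sets borel" unfolding E1_def using E2b by simp
  have EL1: "E1 \<Omega> \<epsilon> \<in> sets L" and EL2: "E2 \<Omega> \<epsilon> \<in> sets L"
    using E1b E2b E2_subset by (auto intro!: sets_L simp: E1_def)
  let ?T1 = "\<lambda>x. indicator (E1 \<Omega> \<epsilon>) x * (norm (u x - ?U x))\<^sup>2"
  let ?T2 = "\<lambda>x. indicator (E2 \<Omega> \<epsilon>) x * (norm (u x - u\<^sub>2 x))\<^sup>2"
  let ?T3 = "\<lambda>x. \<Sum>k\<in>UNIV. (\<psi> k x)\<^sup>2"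
  let ?T4 = "\<lambda>x. indicator (E2 \<Omega> \<epsilon>) x * (\<Sum>k\<in>UNIV. 16 / pi * weight k * (S k x)\<^sup>2)"
  let ?T5 = "\<lambda>x. \<Sum>k\<in>UNIV. (w k x - S k x)\<^sup>2"
  let ?T6 = "\<lambda>x. \<Sum>k\<in>UNIV. (S k x)\<^sup>2"
  let ?T7 = "\<lambda>x. \<Sum>k\<in>UNIV. 1 + (w k x)\<^sup>2"
  have i1: "integrable L ?T1" and i2: "integrable L ?T2"
    using integrable_mult_indicator[OF EL1, of "\<lambda>x. (norm (u x - ?U x))\<^sup>2"] integrable_mult_indicator[OF EL2, of "\<lambda>x. (norm (u x - u\<^sub>2 x))\<^sup>2"]
      L2_space_diff[OF uL UL] L2_space_diff[OF uL u2] by (simp_all add: L2_space_def)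
  have i3: "integrable L ?T3" using \<psi>i by simp
  have i4: "integrable L ?T4"
    using integrable_mult_indicator[OF EL2, of "\<lambda>x. \<Sum>k\<in>UNIV. 16 / pi * weight k * (S k x)\<^sup>2"] Si by simp
  have i5: "integrable L ?T5"
  proof (rule Bochner_Integration.integrable_sum)
    fix k
    have "integrable L (\<lambda>x. w k x * S k x)" by (rule square_integrable_mult[OF wL SL Si])
    then have "integrable L (\<lambda>x. (w k x)\<^sup>2 + (S k x)\<^sup>2 - 2 * (w k x * S k x))" using wL(2)[of k] Si[of k] by simp
    then show "integrable L (\<lambda>x. (w k x - S k x)\<^sup>2)" by (simp add: power2_diff mult.assoc)
  qed
  have i6: "integrable L ?T6" using Si by simp
  have i7: "integrable L ?T7" using wL(2) by simp
  let ?f = "\<lambda>x. \<Sum>k\<in>UNIV. (u x - ?U x) $ k * \<psi> k x"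
  let ?R = "\<lambda>x. - t * (?T1 x + ?T2 x) - ?T3 x / t + 2 * ?T4 x - s * ?T5 x - 36 / s * ?T6 x - \<epsilon> * B * ?T7 x"
  have uU: "integrable L (\<lambda>x. (u x - ?U x) $ k * \<psi> k x)" for k
    by (rule square_integrable_mult[OF L2_space_component[OF L2_space_diff[OF uL UL]] \<psi>L \<psi>i])
  have Ui: "integrable L (\<lambda>x. ?U x $ k * \<psi> k x)" for k
    by (rule square_integrable_mult[OF L2_space_component[OF UL] \<psi>L \<psi>i])
  have U0: "(LINT x|L. (\<Sum>k\<in>UNIV. ?U x $ k * \<psi> k x)) = 0"
  proof -
    have "integrable L (\<lambda>x. ?U x $ k)" for k
    proof -
      obtain C where "\<And>x. x \<in> \<Omega> \<Longrightarrow> \<bar>?U x $ k\<bar> \<le> C" by (rule smooth_bounded_on[OF sU bounded_\<Omega>]) blast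
      then show ?thesis by (intro L_bounded_integrable[OF borel_L[OF smooth_borel[OF sU]]])
    qed
    from E_distr_pairing[OF this] show ?thesis using E_distr_rigid[OF \<Phi>_test] by simp
  qed
  have pt: "?R x \<le> - 2 * ?f x" if x: "x \<in> \<Omega>" for x
  proof -
    have nn: "0 \<le> ?T5 x" "0 \<le> ?T6 x" "0 \<le> ?T7 x" by (auto intro!: sum_nonneg add_nonneg_nonneg)
    have B0: "0 \<le> B" using B(2)[of x] by linarith
    show ?thesis
    proof (cases "x \<in> E2 \<Omega> \<epsilon>")
      case False
      then have ind: "indicator (E2 \<Omega> \<epsilon>) x = (0::real)" "indicator (E1 \<Omega> \<epsilon>) x = (1::real)" using x by (auto simp: E1_def)
      have y: "- (t * ((u x - ?U x) $ k)\<^sup>2) - (\<psi> k x)\<^sup>2 / t \<le> - 2 * ((u x - ?U x) $ k * \<psi> k x)" for k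
      proof -
        have "- (t * d\<^sup>2) - q\<^sup>2 / t \<le> - 2 * (d * q)" for d q using young_inequality[OF ts(1), of "- d" q] by simp
        then show ?thesis .
      qed
      have "(\<Sum>k\<in>UNIV. - (t * ((u x - ?U x) $ k)\<^sup>2) - (\<psi> k x)\<^sup>2 / t) \<le> (\<Sum>k\<in>UNIV. - 2 * ((u x - ?U x) $ k * \<psi> k x))"
        by (intro sum_mono y)
      then have "- (t * (norm (u x - ?U x))\<^sup>2) - ?T3 x / t \<le> - 2 * ?f x"
        unfolding norm3_square by (simp add: sum_subtractf sum_negf sum_distrib_left sum_divide_distrib)
      moreover have "0 \<le> s * ?T5 x" "0 \<le> 36 / s * ?T6 x" "0 \<le> \<epsilon> * B * ?T7 x"
        using nn ts \<epsilon>_pos B0 by (auto intro!: mult_nonneg_nonneg)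
      ultimately show ?thesis unfolding ind by simp
    next
      case True
      then have ind: "indicator (E2 \<Omega> \<epsilon>) x = (1::real)" "indicator (E1 \<Omega> \<epsilon>) x = (0::real)" by (auto simp: E1_def)
      have y: "- (t * ((u x - u\<^sub>2 x) $ k)\<^sup>2) - (\<psi> k x)\<^sup>2 / t + (2 * (16 / pi * weight k * (S k x)\<^sup>2) - s * (w k x - S k x)\<^sup>2 - 36 / s * (S k x)\<^sup>2 - \<epsilon> * B * (1 + (w k x)\<^sup>2))
         \<le> - 2 * ((u x - ?U x) $ k * \<psi> k x)" for k
      proof -
        have e: "- 2 * ((u x - ?U x) $ k * \<psi> k x) = 2 * (- (u x - u\<^sub>2 x) $ k) * \<psi> k x + 2 * (w k x * \<psi> k x)"
          by (simp add: w_def algebra_simps)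
        show ?thesis unfolding e
          using young_inequality[OF ts(1), of "- (u x - u\<^sub>2 x) $ k" "\<psi> k x"] cylinder_pairing[OF ts(2) True B(2), of k "w k x"]
          unfolding power2_minus by linarith
      qed
      have "(\<Sum>k\<in>UNIV. - (t * ((u x - u\<^sub>2 x) $ k)\<^sup>2) - (\<psi> k x)\<^sup>2 / t + (2 * (16 / pi * weight k * (S k x)\<^sup>2) - s * (w k x - S k x)\<^sup>2 - 36 / s * (S k x)\<^sup>2 - \<epsilon> * B * (1 + (w k x)\<^sup>2)))
        \<le> (\<Sum>k\<in>UNIV. - 2 * ((u x - ?U x) $ k * \<psi> k x))"
        by (intro sum_mono y)
      moreover have gen: "(\<Sum>k\<in>UNIV. - (t * A k) - P k / t + (2 * C k - s * R k - c * Z k - d * Y k)) =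
          - (t * (\<Sum>k\<in>UNIV. A k)) - (\<Sum>k\<in>UNIV. P k) / t + (2 * (\<Sum>k\<in>UNIV. C k) - s * (\<Sum>k\<in>UNIV. R k) - c * (\<Sum>k\<in>UNIV. Z k) - d * (\<Sum>k\<in>UNIV. Y k))"
        for A P C R Z Y :: "3 \<Rightarrow> real" and c d
        by (simp add: sum.distrib sum_subtractf sum_negf sum_distrib_left sum_divide_distrib)
      ultimately have "- (t * (norm (u x - u\<^sub>2 x))\<^sup>2) - ?T3 x / t + (2 * (\<Sum>k\<in>UNIV. 16 / pi * weight k * (S k x)\<^sup>2) - s * ?T5 x - 36 / s * ?T6 x - \<epsilon> * B * ?T7 x) \<le> - 2 * ?f x"
        unfolding gen norm3_square[symmetric] by (simp only: sum_distrib_left)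
      then show ?thesis unfolding ind by simp
    qed
  qed
  have Ri: "integrable L ?R" using i1 i2 i3 i4 i5 i6 i7 by simp
  have "(LINT x|L. ?R x) \<le> (LINT x|L. - 2 * ?f x)"
    using Ri uU pt by (intro integral_mono) (auto simp: space_L)
  also have "\<dots> = - 2 * (LINT x|L. ?f x)" by simp
  also have "(LINT x|L. ?f x) = (LINT x|L. (\<Sum>k\<in>UNIV. u x $ k * \<psi> k x))"
  proof -
    have "(LINT x|L. (\<Sum>k\<in>UNIV. u x $ k * \<psi> k x)) = (LINT x|L. ?f x + (\<Sum>k\<in>UNIV. ?U x $ k * \<psi> k x))"
      by (simp add: sum.distrib[symmetric] algebra_simps)
    also have "\<dots> = (LINT x|L. ?f x) + (LINT x|L. (\<Sum>k\<in>UNIV. ?U x $ k * \<psi> k x))"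
      using uU Ui by (intro Bochner_Integration.integral_add) auto
    finally show ?thesis using U0 by simp
  qed
  finally have main: "(LINT x|L. ?R x) - Q \<le> F_eps 2 \<Omega> \<epsilon> u" using energy_duality[OF u] by linarith
  have "(LINT x|L. ?R x) = - t * ((LINT x|L. ?T1 x) + (LINT x|L. ?T2 x)) - (LINT x|L. ?T3 x) / t + 2 * (LINT x|L. ?T4 x)
      - s * (LINT x|L. ?T5 x) - 36 / s * (LINT x|L. ?T6 x) - \<epsilon> * B * (LINT x|L. ?T7 x)"
    using i1 i2 i3 i4 i5 i6 i7 by (simp only: Bochner_Integration.integral_diff Bochner_Integration.integral_add
       integral_mult_right_zero integral_divide_zero Bochner_Integration.integrable_diff Bochner_Integration.integrable_add
       integrable_mult_right integrable_divide)
  moreover have "(LINT x|L. ?T4 x) = Q" using Q_cylinders set_integral_L[OF E2_subset] by simp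
  moreover have "(LINT x|L. ?T1 x) = (LINT x:E1 \<Omega> \<epsilon>|lebesgue. (norm (u x - ?U x))\<^sup>2)"
    by (rule set_integral_L[symmetric]) (auto simp: E1_def)
  moreover have "(LINT x|L. ?T2 x) = (LINT x:E2 \<Omega> \<epsilon>|lebesgue. (norm (u x - u\<^sub>2 x))\<^sup>2)"
    by (rule set_integral_L[symmetric]) (rule E2_subset)
  moreover have "(LINT x|L. ?T3 x) / t \<le> 27 * (B * D)\<^sup>2 / t * measure L \<Omega>"
  proof -
    have "(LINT x|L. ?T3 x) \<le> (LINT x|L. 27 * (B * D)\<^sup>2)"
    proof (intro integral_mono i3)
      fix x assume "x \<in> space L"
      then have x: "x \<in> \<Omega>" by (simp add: space_L)
      have "?T3 x \<le> (\<Sum>k\<in>(UNIV::3 set). (3 * (B * D))\<^sup>2)" by (intro sum_mono \<psi>2 x)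
      then show "?T3 x \<le> 27 * (B * D)\<^sup>2" by (simp add: power_mult_distrib)
    qed simp
    then have "(LINT x|L. ?T3 x) \<le> 27 * (B * D)\<^sup>2 * measure L \<Omega>" by (simp add: space_L mult_ac)
    then show ?thesis using ts(1) by (simp add: divide_right_mono)
  qed
  ultimately show ?thesis using main Q_cells by simp
qed

end

lemma ereal_le_limit:
  assumes "\<And>n. ereal (x n) \<le> y" "x \<longlonglongrightarrow> X"
  shows "ereal X \<le> y"
  by (rule LIMSEQ_le_const2[of "\<lambda>n. ereal (x n)"]) (use assms in auto)

lemma square_integral_tendsto:
  fixes W :: "'a \<Rightarrow> real"
  assumes W: "W \<in> borel_measurable N" "integrable N (\<lambda>x. (W x)\<^sup>2)"
    and f: "\<And>n. f n \<in> borel_measurable N" "\<And>n. integrable N (\<lambda>x. (W x - f n x)\<^sup>2)"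
    and close: "\<And>n. (LINT x|N. (W x - f n x)\<^sup>2) < 1 / (real (Suc n))\<^sup>2"
  shows "(\<lambda>n. LINT x|N. (f n x)\<^sup>2) \<longlonglongrightarrow> (LINT x|N. (W x)\<^sup>2)"
proof -
  have est: "norm ((LINT x|N. (f n x)\<^sup>2) - (LINT x|N. (W x)\<^sup>2)) \<le> inverse (real (Suc n)) * ((LINT x|N. (W x)\<^sup>2) + 2)" for n
  proof -
    let ?d = "inverse (real (Suc n))" and ?g = "\<lambda>x. W x - f n x"
    have m: "?g \<in> borel_measurable N" using W(1) f(1) by simp
    have p: "integrable N (\<lambda>x. W x * ?g x)" by (rule square_integrable_mult[OF W m f(2)])
    have e: "(f n x)\<^sup>2 = (W x)\<^sup>2 - 2 * (W x * ?g x) + (?g x)\<^sup>2" for x by (simp add: power2_eq_square algebra_simps)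
    have I: "(LINT x|N. (f n x)\<^sup>2) = (LINT x|N. (W x)\<^sup>2) - 2 * (LINT x|N. W x * ?g x) + (LINT x|N. (?g x)\<^sup>2)"
      unfolding e using W(2) p f(2)[of n] by simp
    have b: "\<bar>2 * (W x * ?g x)\<bar> \<le> ?d * (W x)\<^sup>2 + real (Suc n) * (?g x)\<^sup>2" for x
    proof -
      have d: "?d > 0" and e: "v / ?d = real (Suc n) * v" for v by (simp_all add: divide_inverse)
      have q: "2 * W x * ?g x = 2 * (W x * ?g x)" "2 * W x * (- ?g x) = - (2 * (W x * ?g x))"
        by (simp_all only: mult.assoc mult_minus_right)
      have "- (?d * (W x)\<^sup>2) - real (Suc n) * (?g x)\<^sup>2 \<le> 2 * (W x * ?g x)"
        "- (?d * (W x)\<^sup>2) - real (Suc n) * (?g x)\<^sup>2 \<le> - (2 * (W x * ?g x))"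
        using young_inequality[OF d, of "W x" "?g x"] young_inequality[OF d, of "W x" "- ?g x"] unfolding e power2_minus q .
      then show ?thesis by (intro abs_leI) linarith+
    qed
    have "\<bar>LINT x|N. 2 * (W x * ?g x)\<bar> \<le> (LINT x|N. \<bar>2 * (W x * ?g x)\<bar>)"
      by (rule integral_abs_bound)
    also have "\<dots> \<le> (LINT x|N. ?d * (W x)\<^sup>2 + real (Suc n) * (?g x)\<^sup>2)"
      using p W(2) f(2)[of n] b by (intro integral_mono) auto
    also have "\<dots> = ?d * (LINT x|N. (W x)\<^sup>2) + real (Suc n) * (LINT x|N. (?g x)\<^sup>2)"
      using W(2) f(2)[of n] by simp
    also have "real (Suc n) * (LINT x|N. (?g x)\<^sup>2) \<le> ?d"
    proof -
      have "real (Suc n) * (LINT x|N. (?g x)\<^sup>2) \<le> real (Suc n) * (1 / (real (Suc n))\<^sup>2)"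
        using close[of n] by (intro mult_left_mono) auto
      also have "\<dots> = ?d" by (simp add: power2_eq_square divide_inverse del: of_nat_Suc)
      finally show ?thesis .
    qed
    finally have 1: "\<bar>2 * (LINT x|N. W x * ?g x)\<bar> \<le> ?d * (LINT x|N. (W x)\<^sup>2) + ?d" by simp
    have "1 / (real (Suc n))\<^sup>2 \<le> 1 / real (Suc n)"
      by (intro divide_left_mono) (auto simp: power2_eq_square)
    then have 2: "(LINT x|N. (?g x)\<^sup>2) \<le> ?d" using close[of n] by (simp add: inverse_eq_divide)
    have 3: "0 \<le> (LINT x|N. (?g x)\<^sup>2)" by simp
    show ?thesis unfolding I real_norm_def distrib_left using 1 2 3 by linarith
  qed
  have "(\<lambda>n. inverse (real (Suc n)) * ((LINT x|N. (W x)\<^sup>2) + 2)) \<longlonglongrightarrow> 0 * ((LINT x|N. (W x)\<^sup>2) + 2)"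
    by (intro tendsto_intros LIMSEQ_inverse_real_of_nat)
  then have "(\<lambda>n. inverse (real (Suc n)) * ((LINT x|N. (W x)\<^sup>2) + 2)) \<longlonglongrightarrow> 0" by (simp only: mult_zero_left)
  with always_eventually[OF allI, OF est] have "(\<lambda>n. (LINT x|N. (f n x)\<^sup>2) - (LINT x|N. (W x)\<^sup>2)) \<longlonglongrightarrow> 0"
    by (rule Lim_null_comparison)
  then show ?thesis by (rule LIM_zero_cancel)
qed

lemma alpha_norm: "(norm (alpha x - alpha y))\<^sup>2 = ((x - y) $ 1)\<^sup>2 + ((x - y) $ 2)\<^sup>2"
  using dist2[of "alpha x" "alpha y"] by (simp add: dist_norm)

text \<open>Lebesgue measure being complete, the two integrands are measurable together.\<close>

lemma set_integral_AE_cong: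
  fixes f g :: "'a::euclidean_space \<Rightarrow> real"
  assumes S: "S \<in> sets lebesgue" and A: "A \<subseteq> S" and AE: "AE x in lebesgue_on S. f x = g x"
  shows "(LINT x:A|lebesgue. f x) = (LINT x:A|lebesgue. g x)"
proof -
  let ?f = "\<lambda>x. indicator A x *\<^sub>R f x" and ?g = "\<lambda>x. indicator A x *\<^sub>R g x"
  have e: "AE x in lebesgue. ?f x = ?g x"
    using AE unfolding AE_restrict_space_iff[of S lebesgue, simplified, OF S] by eventually_elim (use A in \<open>auto simp: indicator_def\<close>)
  then have e': "AE x in lebesgue. ?g x = ?f x" by eventually_elim (rule sym)
  \<comment> \<open>both sides are measurable or neither is, and then both integrals have the default value\<close>
  have "?f \<in> borel_measurable lebesgue \<longleftrightarrow> ?g \<in> borel_measurable lebesgue"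
    using borel_measurable_AE[OF _ e] borel_measurable_AE[OF _ e'] by blast
  then consider "?f \<in> borel_measurable lebesgue" "?g \<in> borel_measurable lebesgue"
    | "?f \<notin> borel_measurable lebesgue" "?g \<notin> borel_measurable lebesgue" by blast
  then show ?thesis unfolding set_lebesgue_integral_def
  proof cases
    case 1
    then show "(LINT x|lebesgue. ?f x) = (LINT x|lebesgue. ?g x)" using e by (rule integral_cong_AE)
  next
    case 2
    then have n: "\<not> integrable lebesgue ?f" "\<not> integrable lebesgue ?g" using borel_measurable_integrable by blast+
    show "(LINT x|lebesgue. ?f x) = (LINT x|lebesgue. ?g x)"
      by (simp only: not_integrable_integral_eq[OF n(1)] not_integrable_integral_eq[OF n(2)])
  qed
qed

lemma F_lim_weights:
  assumes \<Omega>: "open \<Omega>" "bounded \<Omega>"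
    and U: "U \<in> L2_space (lebesgue_on \<Omega>)" and u2: "u\<^sub>2 \<in> L2_space (lebesgue_on \<Omega>)"
  shows "F_lim (3 / 8 * pi) (pi / 4) \<Omega> U u\<^sub>2 = (\<Sum>k\<in>UNIV. weight k * (LINT x|lebesgue_on \<Omega>. ((U x - u\<^sub>2 x) $ k)\<^sup>2))"
proof -
  let ?L = "lebesgue_on \<Omega>"
  have O: "\<Omega> \<inter> space lebesgue \<in> sets lebesgue" using \<Omega>(1) by simp
  have L: "(LINT x:\<Omega>|lebesgue. f x) = (LINT x|?L. f x)" for f :: "_ \<Rightarrow> real"
    using integral_restrict_space[OF O, of f] by (simp add: set_lebesgue_integral_def)
  have W: "integrable ?L (\<lambda>x. ((U x - u\<^sub>2 x) $ k)\<^sup>2)" for k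
    using L2_space_component(2)[OF L2_space_diff[OF U u2]] .
  have "(LINT x:\<Omega>|lebesgue. (norm (alpha (U x) - alpha (u\<^sub>2 x)))\<^sup>2) = (LINT x|?L. ((U x - u\<^sub>2 x) $ 1)\<^sup>2) + (LINT x|?L. ((U x - u\<^sub>2 x) $ 2)\<^sup>2)"
    unfolding L alpha_norm using W by (intro Bochner_Integration.integral_add)
  moreover have "(LINT x:\<Omega>|lebesgue. \<bar>U x $ 3 - u\<^sub>2 x $ 3\<bar>\<^sup>2) = (LINT x|?L. ((U x - u\<^sub>2 x) $ 3)\<^sup>2)"
    unfolding L by simp
  ultimately show ?thesis unfolding F_lim_def by (simp add: sum_3 weight_def distrib_left)
qed

lemma step_integral_tendsto:
  assumes \<omega>: "open \<omega>" "bounded \<omega>" "\<Omega> = prism \<omega>" and e: "\<And>j. e j > 0" "e \<longlonglongrightarrow> 0"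
    and f: "f \<in> test_functions \<Omega>" and m: "\<And>j. step_approx \<Omega> (e j) f \<in> borel_measurable (lebesgue_on \<Omega>)"
    and W: "W \<in> borel_measurable (lebesgue_on \<Omega>)" "integrable (lebesgue_on \<Omega>) (\<lambda>x. (W x)\<^sup>2)"
  shows "(\<lambda>j. LINT x|lebesgue_on \<Omega>. (W x - step_approx \<Omega> (e j) f x)\<^sup>2) \<longlonglongrightarrow> (LINT x|lebesgue_on \<Omega>. (W x - f x)\<^sup>2)"
    and "integrable (lebesgue_on \<Omega>) (\<lambda>x. (W x - step_approx \<Omega> (e j) f x)\<^sup>2)"
proof -
  let ?S = "\<lambda>j. step_approx \<Omega> (e j) f"
  obtain B where B: "B \<ge> 0" "\<And>x. \<bar>f x\<bar> \<le> B" by (rule test_functions_bounded[OF f]) blast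
  have "\<Omega> \<in> lmeasurable" using lmeasurable_open[OF bounded_prism[OF \<omega>(2)] open_prism[OF \<omega>(1)]] \<omega>(3) by simp
  then interpret finite_measure "lebesgue_on \<Omega>" by (rule finite_measure_lebesgue_on)
  have fm: "f \<in> borel_measurable (lebesgue_on \<Omega>)" by (rule test_functions_lebesgue_on_measurable[OF f])
  have dom: "integrable (lebesgue_on \<Omega>) (\<lambda>x. 2 * (W x)\<^sup>2 + 2 * B\<^sup>2)" using W(2) by simp
  have b: "norm ((W x - ?S j x)\<^sup>2) \<le> 2 * (W x)\<^sup>2 + 2 * B\<^sup>2" for j x
  proof -
    have "\<bar>?S j x\<bar> \<le> B" using B by (simp add: step_approx_def)
    then have "(?S j x)\<^sup>2 \<le> B\<^sup>2" using power_mono[of "\<bar>?S j x\<bar>" B 2] by simp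
    then show ?thesis using square_sum_bound[of "W x" "- ?S j x"] by simp
  qed
  show "(\<lambda>j. LINT x|lebesgue_on \<Omega>. (W x - ?S j x)\<^sup>2) \<longlonglongrightarrow> (LINT x|lebesgue_on \<Omega>. (W x - f x)\<^sup>2)"
  proof (rule integral_dominated_convergence[OF _ _ dom])
    show "AE x in lebesgue_on \<Omega>. (\<lambda>j. (W x - ?S j x)\<^sup>2) \<longlonglongrightarrow> (W x - f x)\<^sup>2"
    proof (rule AE_I2)
      fix x assume "x \<in> space (lebesgue_on \<Omega>)"
      then have x: "x \<in> \<Omega>" by (simp add: space_restrict_space)
      have "continuous_on UNIV f" using test_functions_smooth[OF f] smooth_continuous by blast
      from step_approx_tendsto[OF \<omega>(1,3) x e this]
      show "(\<lambda>j. (W x - ?S j x)\<^sup>2) \<longlonglongrightarrow> (W x - f x)\<^sup>2" by (intro tendsto_intros)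
    qed
  qed (use W(1) m fm b in auto)
  show "integrable (lebesgue_on \<Omega>) (\<lambda>x. (W x - ?S j x)\<^sup>2)"
    by (rule Bochner_Integration.integrable_bound[OF dom]) (use W(1) m b order_trans[OF b abs_ge_self] in auto)
qed

text \<open>The limits are taken in the order \<open>\<epsilon> \<longlonglongrightarrow> 0\<close> with fixed \<open>\<zeta>\<close>, \<open>t \<longlonglongrightarrow> \<infinity>\<close>, \<open>\<zeta> \<longlonglongrightarrow> u\<^sub>1 - u\<^sub>2\<close>, \<open>s \<longlonglongrightarrow> \<infinity>\<close>; each error
  term then vanishes before the next parameter moves.\<close>

theorem liminf_inequality:
  fixes a b :: "real^3"
  assumes \<omega>: "open \<omega>" "bounded \<omega>" "\<Omega> = prism \<omega>" and e: "\<And>j. \<epsilon> j > 0" "\<epsilon> \<longlonglongrightarrow> 0"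
    and u2: "u\<^sub>2 \<in> L2_space (lebesgue_on \<Omega>)" and u: "\<And>j. u j \<in> LD2 \<Omega> (mu \<Omega> (\<epsilon> j))"
    and conv: "converges_to \<Omega> \<epsilon> u (\<lambda>x. cross3 a x + b) u\<^sub>2"
  shows "ereal (F_lim (3 / 8 * pi) (pi / 4) \<Omega> (\<lambda>x. cross3 a x + b) u\<^sub>2) \<le> liminf (\<lambda>j. ereal (F_eps 2 \<Omega> (\<epsilon> j) (u j)))"
    (is "_ \<le> ?lim")
proof -
  let ?L = "lebesgue_on \<Omega>"
  define W where "W k x = (cross3 a x + b - u\<^sub>2 x) $ k" for k and x :: "real^3"
  have o: "open \<Omega>" "bounded \<Omega>" using open_prism bounded_prism \<omega> by blast+
  note UL = rigid_L2_space[OF o, of a b]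
  have W: "W k \<in> borel_measurable ?L" "integrable ?L (\<lambda>x. (W k x)\<^sup>2)" for k
    using L2_space_component[OF L2_space_diff[OF UL u2], of k] unfolding W_def[abs_def] .
  define I where "I f = (LINT x|?L. (f x)\<^sup>2)" for f :: "real^3 \<Rightarrow> real"
  define lim where "lim = ?lim"
  have test: "ereal ((\<Sum>k\<in>UNIV. weight k * I (\<zeta> k)) - s * (\<Sum>k\<in>UNIV. I (\<lambda>x. W k x - \<zeta> k x)) - 36 / s * (\<Sum>k\<in>UNIV. I (\<zeta> k))) \<le> lim"
    if s: "s > 0" and z: "\<And>k. \<zeta> k \<in> test_functions \<Omega>" for s and \<zeta> :: "3 \<Rightarrow> real^3 \<Rightarrow> real"
  proof -
    define G where "G = (\<Sum>k\<in>UNIV. weight k * I (\<zeta> k)) - s * (\<Sum>k\<in>UNIV. I (\<lambda>x. W k x - \<zeta> k x)) - 36 / s * (\<Sum>k\<in>UNIV. I (\<zeta> k))"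
    obtain D where D: "\<And>b y. y$3 = 0 \<Longrightarrow> \<bar>rad_field b y\<bar> \<le> D" "\<And>a b y. y$3 = 0 \<Longrightarrow> \<bar>partial a (rad_field b) y\<bar> \<le> D"
      by (rule rad_field_bounds) blast
    have "\<exists>B\<ge>0. \<forall>x. \<bar>f x\<bar> \<le> B" if "f \<in> test_functions \<Omega>" for f
      by (rule test_functions_bounded[OF that]) blast
    then obtain Bf where Bf: "\<And>f. f \<in> test_functions \<Omega> \<Longrightarrow> Bf f \<ge> 0" "\<And>f x. f \<in> test_functions \<Omega> \<Longrightarrow> \<bar>f x\<bar> \<le> Bf f"
      by metis
    define B where "B = (\<Sum>k\<in>UNIV. Bf (\<zeta> k)) + Bf (partial 3 (\<zeta> 3))"
    have B: "\<bar>\<zeta> k x\<bar> \<le> B" "\<bar>partial 3 (\<zeta> 3) x\<bar> \<le> B" for k x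
    proof -
      note p = test_functions_partial[OF z[of 3], of 3]
      have "Bf (\<zeta> k) \<le> (\<Sum>k\<in>UNIV. Bf (\<zeta> k))" using Bf(1)[OF z] by (intro member_le_sum) auto
      then show "\<bar>\<zeta> k x\<bar> \<le> B" using Bf(2)[OF z, of k x] Bf(1)[OF p] unfolding B_def by linarith
      have "0 \<le> (\<Sum>k\<in>UNIV. Bf (\<zeta> k))" using Bf(1)[OF z] by (intro sum_nonneg) auto
      then show "\<bar>partial 3 (\<zeta> 3) x\<bar> \<le> B" using Bf(2)[OF p, of x] unfolding B_def by linarith
    qed
    define K where "K = 27 * (B * D)\<^sup>2 * measure ?L \<Omega>"
    have ts: "test_strain \<omega> \<Omega> (\<epsilon> j) \<zeta>" for j
      using \<omega> e z by unfold_locales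
    have m: "step_approx \<Omega> (\<epsilon> j) (\<zeta> k) \<in> borel_measurable ?L" for j k
      by (rule perforated.borel_L[OF test_strain.axioms(1)[OF ts] test_strain.S_measurable[OF ts]])
    have static: "ereal (G - K / t) \<le> lim" if t: "t > 0" for t
    proof -
      let ?S = "\<lambda>j k. step_approx \<Omega> (\<epsilon> j) (\<zeta> k)"
      let ?e1 = "\<lambda>j. LINT x:E1 \<Omega> (\<epsilon> j)|lebesgue. (norm (u j x - (cross3 a x + b)))\<^sup>2"
      let ?e2 = "\<lambda>j. LINT x:E2 \<Omega> (\<epsilon> j)|lebesgue. (norm (u j x - u\<^sub>2 x))\<^sup>2"
      let ?c = "LINT x|?L. (\<Sum>k\<in>UNIV. 1 + (W k x)\<^sup>2)"
      define R where "R j = (\<Sum>k\<in>UNIV. weight k * I (?S j k)) - s * (\<Sum>k\<in>UNIV. I (\<lambda>x. W k x - ?S j k x)) - 36 / s * (\<Sum>k\<in>UNIV. I (?S j k))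
        - \<epsilon> j * B * ?c - t * (?e1 j + ?e2 j) - K / t" for j
      have Si: "integrable ?L (\<lambda>x. (?S j k x)\<^sup>2)" "integrable ?L (\<lambda>x. (W k x - ?S j k x)\<^sup>2)" for j k
        using step_integral_tendsto(2)[OF \<omega> e z m, of "\<lambda>x. 0"] step_integral_tendsto(2)[OF \<omega> e z m W] by simp_all
      have le: "R j \<le> F_eps 2 \<Omega> (\<epsilon> j) (u j)" if "\<epsilon> j \<le> 1" for j
        using test_strain.lower_bound_static[OF ts u u2 that t s B D, of W a b] Si
        unfolding R_def I_def K_def by (simp add: W_def[abs_def] fun_eq_iff)
      have SI: "(\<lambda>j. I (?S j k)) \<longlonglongrightarrow> I (\<zeta> k)" "(\<lambda>j. I (\<lambda>x. W k x - ?S j k x)) \<longlonglongrightarrow> I (\<lambda>x. W k x - \<zeta> k x)" for k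
        using step_integral_tendsto(1)[OF \<omega> e z m, of "\<lambda>x. 0"] step_integral_tendsto(1)[OF \<omega> e z m W] by (simp_all add: I_def)
      have "R \<longlonglongrightarrow> G - 0 * B * ?c - t * (0 + 0) - K / t"
        unfolding R_def G_def using conv by (intro tendsto_intros SI e(2)) (simp_all add: converges_to_def)
      then have R: "R \<longlonglongrightarrow> G - K / t" by simp
      have "\<forall>\<^sub>F j in sequentially. \<epsilon> j < 1" using e(2) by (rule order_tendstoD) simp
      then have ev: "\<forall>\<^sub>F j in sequentially. ereal (R j) \<le> ereal (F_eps 2 \<Omega> (\<epsilon> j) (u j))"
        by eventually_elim (use le in simp)
      have "ereal (G - K / t) = liminf (\<lambda>j. ereal (R j))"
        by (rule lim_imp_Liminf[symmetric]) (use R in auto)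
      also have "\<dots> \<le> lim" unfolding lim_def by (rule Liminf_mono[OF ev])
      finally show ?thesis .
    qed
    have "(\<lambda>n. G - K * inverse (real (Suc n))) \<longlonglongrightarrow> G - K * 0"
      by (intro tendsto_intros LIMSEQ_inverse_real_of_nat)
    then have "(\<lambda>n. G - K * inverse (real (Suc n))) \<longlonglongrightarrow> G" by (simp only: mult_zero_right diff_zero)
    moreover have "ereal (G - K * inverse (real (Suc n))) \<le> lim" for n
      using static[of "real (Suc n)"] by (simp add: divide_inverse)
    ultimately have "ereal G \<le> lim" by (rule ereal_le_limit[rotated])
    then show ?thesis unfolding G_def .
  qed
  define close where "close n k f \<longleftrightarrow> f \<in> test_functions \<Omega> \<and> integrable ?L (\<lambda>x. (W k x - f x)\<^sup>2) \<and>
    I (\<lambda>x. W k x - f x) < 1 / (real (Suc n))\<^sup>2" for n k f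
  have ex: "\<exists>f. close n k f" for n k
  proof -
    have "0 < 1 / (real (Suc n))\<^sup>2" by simp
    with test_functions_dense_L2[OF o W, of k] show ?thesis unfolding L2_approximable_def I_def close_def by blast
  qed
  define f where "f n k = (SOME f. close n k f)" for n k
  have "close n k (f n k)" for n k unfolding f_def by (rule someI_ex[OF ex])
  then have f: "f n k \<in> test_functions \<Omega>" "integrable ?L (\<lambda>x. (W k x - f n k x)\<^sup>2)"
    "I (\<lambda>x. W k x - f n k x) < 1 / (real (Suc n))\<^sup>2" for k n
    unfolding close_def by blast+
  have fI: "(\<lambda>n. I (f n k)) \<longlonglongrightarrow> I (W k)" for k
    unfolding I_def
    by (rule square_integral_tendsto[OF W test_functions_lebesgue_on_measurable[OF f(1)] f(2) f(3)[unfolded I_def]])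
  have dI: "(\<lambda>n. I (\<lambda>x. W k x - f n k x)) \<longlonglongrightarrow> 0" for k
  proof (rule Lim_null_comparison)
    have "(\<lambda>n. (inverse (real (Suc n)))\<^sup>2) \<longlonglongrightarrow> 0\<^sup>2" by (intro tendsto_intros LIMSEQ_inverse_real_of_nat)
    then show "(\<lambda>n. (inverse (real (Suc n)))\<^sup>2) \<longlonglongrightarrow> 0" by simp
    have "norm (I (\<lambda>x. W k x - f n k x)) \<le> (inverse (real (Suc n)))\<^sup>2" for n
    proof -
      have "0 \<le> I (\<lambda>x. W k x - f n k x)" by (simp add: I_def)
      moreover have "I (\<lambda>x. W k x - f n k x) < 1 / (real (Suc n))\<^sup>2" by (rule f(3))
      moreover have "1 / (real (Suc n))\<^sup>2 = (inverse (real (Suc n)))\<^sup>2" by (simp only: inverse_eq_divide power_one_over)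
      ultimately show ?thesis by (simp only: real_norm_def)
    qed
    then show "\<forall>\<^sub>F n in sequentially. norm (I (\<lambda>x. W k x - f n k x)) \<le> (inverse (real (Suc n)))\<^sup>2" by (intro always_eventually allI)
  qed
  define T where "T = (\<Sum>k\<in>UNIV. weight k * I (W k))"
  define V where "V = (\<Sum>k\<in>UNIV. I (W k))"
  have st: "ereal (T - 36 / s * V) \<le> lim" if s: "s > 0" for s
  proof (rule ereal_le_limit)
    show "ereal ((\<Sum>k\<in>UNIV. weight k * I (f n k)) - s * (\<Sum>k\<in>UNIV. I (\<lambda>x. W k x - f n k x)) - 36 / s * (\<Sum>k\<in>UNIV. I (f n k))) \<le> lim" for n
      by (rule test[OF s f(1)])
    have "(\<lambda>n. (\<Sum>k\<in>UNIV. weight k * I (f n k)) - s * (\<Sum>k\<in>UNIV. I (\<lambda>x. W k x - f n k x)) - 36 / s * (\<Sum>k\<in>UNIV. I (f n k)))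
      \<longlonglongrightarrow> T - s * (\<Sum>k\<in>(UNIV::3 set). 0) - 36 / s * V"
      unfolding T_def V_def by (intro tendsto_intros fI dI)
    then show "(\<lambda>n. (\<Sum>k\<in>UNIV. weight k * I (f n k)) - s * (\<Sum>k\<in>UNIV. I (\<lambda>x. W k x - f n k x)) - 36 / s * (\<Sum>k\<in>UNIV. I (f n k))) \<longlonglongrightarrow> T - 36 / s * V"
      by simp
  qed
  have "(\<lambda>n. T - 36 * V * inverse (real (Suc n))) \<longlonglongrightarrow> T - 36 * V * 0"
    by (intro tendsto_intros LIMSEQ_inverse_real_of_nat)
  moreover have "ereal (T - 36 * V * inverse (real (Suc n))) \<le> lim" for n
    using st[of "real (Suc n)"] by (simp add: divide_inverse mult_ac)
  ultimately have "ereal T \<le> lim" using ereal_le_limit[of "\<lambda>n. T - 36 * V * inverse (real (Suc n))" lim "T - 36 * V * 0"] by simp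
  then show ?thesis unfolding F_lim_weights[OF o UL u2] T_def lim_def I_def W_def .
qed

section \<open>The energy of a rigid jump\<close>

lemma quadratic_integral:
  fixes h :: real
  assumes "h \<ge> 0"
  shows "(LINT t:{c - h<..<c + h}|lborel. A + B * (t - c) + D * (t - c)\<^sup>2) = 2 * h * A + 2 / 3 * h ^ 3 * D"
proof -
  let ?f = "\<lambda>t. A + B * (t - c) + D * (t - c)\<^sup>2" and ?P = "\<lambda>t. A * (t - c) + B / 2 * (t - c)\<^sup>2 + D / 3 * (t - c) ^ 3"
  have cont: "continuous_on S ?f" for S by (intro continuous_intros)
  have "(LINT t:{c - h<..<c + h}|lborel. ?f t) = integral {c - h..c + h} ?f"
    by (subst set_integral_endpoints(2)) (auto intro!: set_integral_continuous borel_measurable_continuous_onI cont)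
  also have "\<dots> = ?P (c + h) - ?P (c - h)"
  proof (rule integral_derivative)
    show "(?P has_real_derivative ?f t) (at t)" for t
      by (auto intro!: derivative_eq_intros simp: power2_eq_square field_simps)
  qed (use assms in simp)
  also have "\<dots> = 2 * h * A + 2 / 3 * h ^ 3 * D" by (simp add: power2_eq_square power3_eq_cube algebra_simps)
  finally show ?thesis .
qed

abbreviation square :: "real^2 \<Rightarrow> real \<Rightarrow> (real \<times> real) set" where
  "square c h \<equiv> {c$1 - h<..<c$1 + h} \<times> {c$2 - h<..<c$2 + h}"

lemma square_borel: "square c h \<in> sets borel"
  by (intro borel_open open_Times) auto

lemma bounded_square: "bounded (square c h)"
  by (intro bounded_Times) auto

lemma square_integral:
  fixes h :: real
  assumes h: "h \<ge> 0"
  shows "(LINT p:square c h|lborel. A + B * (fst p - c$1) + B' * (snd p - c$2) + D * (fst p - c$1)\<^sup>2 + D' * (snd p - c$2)\<^sup>2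
      + G * ((fst p - c$1) * (snd p - c$2))) = 4 * h\<^sup>2 * A + 4 / 3 * h ^ 4 * (D + D')"
    (is "(LINT p:_|lborel. ?f p) = _")
proof -
  have cont: "continuous_on S ?f" for S by (intro continuous_intros)
  have m: "?f \<in> borel_measurable borel" by (intro borel_measurable_continuous_onI cont)
  have "compact (closure (square c h))" using bounded_square by simp
  then have "bounded (?f ` closure (square c h))" by (intro compact_imp_bounded compact_continuous_image cont)
  then obtain K where K: "\<forall>y\<in>?f ` closure (square c h). \<bar>y\<bar> \<le> K" unfolding bounded_iff real_norm_def by blast
  have K: "\<bar>?f p\<bar> \<le> K" if "p \<in> square c h" for p
    by (rule bspec[OF K imageI[of p]]) (rule subsetD[OF closure_subset that])
  have int: "integrable lborel (\<lambda>p. indicator (square c h) p *\<^sub>R ?f p)"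
    using bounded_set_integrable[OF m square_borel bounded_square K] by (simp add: set_integrable_def)
  have "(LINT p:square c h|lborel. ?f p) = (LINT y|lborel. LINT x|lborel. indicator (square c h) (x, y) *\<^sub>R ?f (x, y))"
    unfolding set_lebesgue_integral_def by (rule rectangle_integral(1)[OF int])
  also have "\<dots> = (LINT y:{c$2 - h<..<c$2 + h}|lborel. LINT x:{c$1 - h<..<c$1 + h}|lborel. ?f (x, y))"
    unfolding set_lebesgue_integral_def
  proof (intro Bochner_Integration.integral_cong refl)
    fix y
    have ind: "indicator (square c h) (x, y) = indicator {c$2 - h<..<c$2 + h} y * (indicator {c$1 - h<..<c$1 + h} x :: real)" for x
      by (auto simp: indicator_def)
    show "(LINT x|lborel. indicator (square c h) (x, y) *\<^sub>R ?f (x, y)) =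
        indicator {c$2 - h<..<c$2 + h} y *\<^sub>R (LINT x|lborel. indicator {c$1 - h<..<c$1 + h} x *\<^sub>R ?f (x, y))"
      unfolding ind real_scaleR_def mult.assoc by (rule integral_mult_right_zero)
  qed
  also have "\<dots> = (LINT y:{c$2 - h<..<c$2 + h}|lborel. (2 * h * A + 2 / 3 * h ^ 3 * D) + (2 * h * B') * (y - c$2) + (2 * h * D') * (y - c$2)\<^sup>2)"
  proof (intro set_lebesgue_integral_cong allI impI)
    fix y
    have "?f (x, y) = (A + B' * (y - c$2) + D' * (y - c$2)\<^sup>2) + (B + G * (y - c$2)) * (x - c$1) + D * (x - c$1)\<^sup>2" for x
      by (simp add: algebra_simps)
    then have "(LINT x:{c$1 - h<..<c$1 + h}|lborel. ?f (x, y)) = 2 * h * (A + B' * (y - c$2) + D' * (y - c$2)\<^sup>2) + 2 / 3 * h ^ 3 * D"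
      by (simp only: quadratic_integral[OF h])
    then show "(LINT x:{c$1 - h<..<c$1 + h}|lborel. ?f (x, y)) = (2 * h * A + 2 / 3 * h ^ 3 * D) + (2 * h * B') * (y - c$2) + (2 * h * D') * (y - c$2)\<^sup>2"
      by (simp add: algebra_simps)
  qed simp
  also have "\<dots> = 2 * h * (2 * h * A + 2 / 3 * h ^ 3 * D) + 2 / 3 * h ^ 3 * (2 * h * D')" by (rule quadratic_integral[OF h])
  also have "\<dots> = 4 * h\<^sup>2 * A + 4 / 3 * h ^ 4 * (D + D')" by (simp add: power2_eq_square power3_eq_cube power4_eq_xxxx algebra_simps)
  finally show ?thesis .
qed

lemma unit_interval_integrable:
  fixes f :: "real \<Rightarrow> real"
  assumes "continuous_on {0..1} f"
  shows "set_integrable lborel {0<..<1} f"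
  by (rule set_integrable_subset[OF borel_integrable_atLeastAtMost'[OF assms]]) auto

text \<open>The unit normal of the lateral surface, extended to space as an affine field.\<close>

definition normal :: "real \<Rightarrow> int \<times> int \<Rightarrow> 3 \<Rightarrow> real^3 \<Rightarrow> real" where
  "normal \<epsilon> i k x = (if k = 3 then 0 else (x$k - (if k = 1 then center \<epsilon> i$1 else center \<epsilon> i$2)) * (4 / \<epsilon>))"

lemma smooth_normal: "smooth (normal \<epsilon> i k)"
proof (cases "k = 3")
  case True
  then show ?thesis unfolding normal_def[abs_def] by (simp add: smooth_const)
next
  case False
  define d where "d = (if k = 1 then center \<epsilon> i$1 else center \<epsilon> i$2)"
  have "normal \<epsilon> i k = (\<lambda>x. (x$k - d) * (4 / \<epsilon>))"
    using False by (simp only: normal_def d_def fun_eq_iff if_False simp_thms)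
  then show ?thesis by (simp only: smooth_mult smooth_diff smooth_proj smooth_const)
qed

context perforated
begin

lemma normal_wr: "normal \<epsilon> i 1 (wr i q) = cos (fst q / rad)" "normal \<epsilon> i 2 (wr i q) = sin (fst q / rad)" "normal \<epsilon> i 3 x = 0"
  using \<epsilon>_pos by (simp_all add: normal_def)

lemma gauss_normal:
  assumes F: "smooth F" and z: "\<And>x. x$3 = 0 \<or> x$3 = 1 \<Longrightarrow> F x = 0"
  shows "(LINT x:cyl \<epsilon> i|lborel. partial k F x) = (LINT q:strip rad|lborel. F (wr i q) * normal \<epsilon> i k (wr i q))"
proof -
  consider "k = 1" | "k = 2" | "k = 3" using exhaust_3 by blast
  then show ?thesis
  proof cases
    case 1
    show ?thesis unfolding cyl_column 1 normal_wr by (rule cylinder_gauss(1)[OF F rad_pos])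
  next
    case 2
    show ?thesis unfolding cyl_column 2 normal_wr by (rule cylinder_gauss(2)[OF F rad_pos])
  next
    case 3
    have "(LINT q:strip rad|lborel. F (wr i q) * 0) = 0" by (simp add: set_lebesgue_integral_def)
    moreover have "(LINT x:column (disk (center \<epsilon> i) rad)|lborel. partial 3 F x) = 0" by (rule cylinder_gauss(3)[OF F rad_pos z])
    ultimately show ?thesis unfolding cyl_column 3 normal_wr by (simp only:)
  qed
qed

lemma T_cell_column: "T_cell \<epsilon> i = column (square (center \<epsilon> i) (\<epsilon> / 2))"
proof (rule set_eqI)
  fix x
  have eq: "\<bar>t - c\<bar> < e \<longleftrightarrow> c - e < t \<and> t < c + e" for t c e :: real by (auto simp: abs_less_iff)
  then show "x \<in> T_cell \<epsilon> i \<longleftrightarrow> x \<in> column (square (center \<epsilon> i) (\<epsilon> / 2))"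
    unfolding mem_T_cell eq by (simp add: column_def del: center_nth)
qed

text \<open>On each horizontal slice the rigid displacement is affine. The mean values contribute equally to both
  sides, by the choice of the weights, while the linear part contributes at least as much to the cell.\<close>

lemma cell_inequality:
  fixes \<alpha> \<beta> :: "real^3"
  defines "v \<equiv> \<lambda>x. cross3 \<alpha> x + \<beta>"
  shows "\<epsilon> * (LINT q:strip rad|lborel. ((norm (v (wr i q)))\<^sup>2 + (\<Sum>k\<in>UNIV. v (wr i q) $ k * normal \<epsilon> i k (wr i q))\<^sup>2) / 2)
    \<le> (LINT x:T_cell \<epsilon> i|lborel. \<Sum>k\<in>UNIV. weight k * (v x $ k)\<^sup>2)"
proof -
  define c where "c = center \<epsilon> i"
  define s t m n where "s = \<alpha>$3" and "t = \<alpha>$1 * c$2 - \<alpha>$2 * c$1 + \<beta>$3" and "m = - \<alpha>$2" and "n = \<alpha>$1"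
  define P R where "P z = \<alpha>$2 * z - \<alpha>$3 * c$2 + \<beta>$1" and "R z = \<alpha>$3 * c$1 - \<alpha>$1 * z + \<beta>$2" for z
  have v: "v x $ 1 = P (x$3) - s * (x$2 - c$2)" "v x $ 2 = R (x$3) + s * (x$1 - c$1)"
    "v x $ 3 = t + m * (x$1 - c$1) + n * (x$2 - c$2)" for x
    by (simp_all add: v_def cross3_def P_def R_def s_def t_def m_def n_def algebra_simps)
  have sv: "smooth (\<lambda>x. v x $ k)" for k unfolding v_def by (rule smooth_rigid)
  have cP: "continuous_on S P" "continuous_on S R" for S unfolding P_def[abs_def] R_def[abs_def] by (intro continuous_intros)+
  let ?r = rad
  define F where "F x = ((\<Sum>k\<in>UNIV. v x $ k * v x $ k) + (\<Sum>k\<in>UNIV. v x $ k * normal \<epsilon> i k x) * (\<Sum>k\<in>UNIV. v x $ k * normal \<epsilon> i k x)) * (1 / 2)" for x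
  have sF: "smooth F" unfolding F_def[abs_def] by (intro smooth_mult smooth_add smooth_sum smooth_const sv smooth_normal)
  have eF: "((norm (v x))\<^sup>2 + (\<Sum>k\<in>UNIV. v x $ k * normal \<epsilon> i k x)\<^sup>2) / 2 = F x" for x
    unfolding F_def norm3_square by (simp add: power2_eq_square)
  note ss = strip_smooth[OF sF rad_pos, where t = "\<lambda>s. 1" and c = "center \<epsilon> i", simplified]
  define f where "f z = pi * ?r * (3 / 2 * ((P z)\<^sup>2 + (R z)\<^sup>2) + t\<^sup>2 + s\<^sup>2 * ?r\<^sup>2 + (m\<^sup>2 + n\<^sup>2) * ?r\<^sup>2 / 2)" for z
  define g where "g z = 3 / 8 * pi * (\<epsilon>\<^sup>2 * ((P z)\<^sup>2 + (R z)\<^sup>2) + s\<^sup>2 * \<epsilon> ^ 4 / 6) + pi / 4 * (\<epsilon>\<^sup>2 * t\<^sup>2 + (m\<^sup>2 + n\<^sup>2) * \<epsilon> ^ 4 / 12)" for z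
  have lhs: "(LINT q:strip ?r|lborel. F (wr i q)) = (LINT z:{0<..<1}|lborel. f z)"
  proof -
    have "(LINT q:strip ?r|lborel. F (wr i q)) = (LINT z:{0<..<1}|lborel. integral {0..2 * pi * ?r} (\<lambda>u. F (wr i (u, z))))"
      using ss by (intro strip_integral)
    moreover have "integral {0..2 * pi * ?r} (\<lambda>u. F (wr i (u, z))) = f z" for z
    proof -
      have "F (wr i (u, z)) = ((P z)\<^sup>2 + (R z)\<^sup>2 + t\<^sup>2) / 2 + (R z * s * ?r + t * m * ?r) * cos (u / ?r) + (t * n * ?r - P z * s * ?r) * sin (u / ?r)
        + (s\<^sup>2 * ?r\<^sup>2 + m\<^sup>2 * ?r\<^sup>2 + (P z)\<^sup>2) / 2 * (cos (u / ?r))\<^sup>2 + (m * n * ?r\<^sup>2 + P z * R z) * (cos (u / ?r) * sin (u / ?r))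
        + (s\<^sup>2 * ?r\<^sup>2 + n\<^sup>2 * ?r\<^sup>2 + (R z)\<^sup>2) / 2 * (sin (u / ?r))\<^sup>2" for u
      proof -
        define co si r where "co = cos (u / ?r)" and "si = sin (u / ?r)" and "r = ?r"
        have w: "v (wr i (u, z)) $ 1 = P z - s * (r * si)" "v (wr i (u, z)) $ 2 = R z + s * (r * co)"
          "v (wr i (u, z)) $ 3 = t + m * (r * co) + n * (r * si)"
          unfolding v by (simp_all add: co_def si_def r_def c_def)
        have N: "normal \<epsilon> i 1 (wr i (u, z)) = co" "normal \<epsilon> i 2 (wr i (u, z)) = si" "normal \<epsilon> i 3 (wr i (u, z)) = 0"
          unfolding normal_wr by (simp_all add: co_def si_def)
        show ?thesis
          unfolding F_def sum_3 w N unfolding co_def[symmetric] si_def[symmetric] unfolding r_def[symmetric]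
          by (simp add: power2_eq_square field_simps)
      qed
      then have "integral {0..2 * pi * ?r} (\<lambda>u. F (wr i (u, z))) =
        2 * pi * ?r * (((P z)\<^sup>2 + (R z)\<^sup>2 + t\<^sup>2) / 2) + pi * ?r * ((s\<^sup>2 * ?r\<^sup>2 + m\<^sup>2 * ?r\<^sup>2 + (P z)\<^sup>2) / 2) + pi * ?r * ((s\<^sup>2 * ?r\<^sup>2 + n\<^sup>2 * ?r\<^sup>2 + (R z)\<^sup>2) / 2)"
        by (simp only: circle_integral[OF rad_pos])
      also have "\<dots> = f z" by (simp add: f_def field_simps)
      finally show ?thesis .
    qed
    ultimately show ?thesis by simp
  qed
  define H where "H x = (\<Sum>k\<in>UNIV. weight k * (v x $ k * v x $ k))" for x
  have sH: "smooth H" unfolding H_def[abs_def] by (intro smooth_mult smooth_sum smooth_const sv)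
  have rhs: "(LINT x:T_cell \<epsilon> i|lborel. H x) = (LINT z:{0<..<1}|lborel. g z)"
  proof -
    note sq = square_borel[of c "\<epsilon> / 2"] bounded_square[of c "\<epsilon> / 2"]
    have "(LINT x:T_cell \<epsilon> i|lborel. H x) = (LINT z:{0<..<1}|lborel. LINT p:square c (\<epsilon> / 2)|lborel. H (mk3 (p, z)))"
      unfolding T_cell_column c_def[symmetric]
      by (intro column_integral(1) smooth_borel sH smooth_set_integrable column_borel bounded_column sq)
    moreover have "(LINT p:square c (\<epsilon> / 2)|lborel. H (mk3 (p, z))) = g z" for z
    proof -
      have "H (mk3 (p, z)) = (3 / 8 * pi * ((P z)\<^sup>2 + (R z)\<^sup>2) + pi / 4 * t\<^sup>2) + (3 / 4 * pi * (R z * s) + pi / 2 * (t * m)) * (fst p - c$1)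
        + (pi / 2 * (t * n) - 3 / 4 * pi * (P z * s)) * (snd p - c$2) + (3 / 8 * pi * s\<^sup>2 + pi / 4 * m\<^sup>2) * (fst p - c$1)\<^sup>2
        + (3 / 8 * pi * s\<^sup>2 + pi / 4 * n\<^sup>2) * (snd p - c$2)\<^sup>2 + pi / 2 * (m * n) * ((fst p - c$1) * (snd p - c$2))" for p
      proof -
        define y y' where "y = fst p - c$1" and "y' = snd p - c$2"
        have w: "v (mk3 (p, z)) $ 1 = P z - s * y'" "v (mk3 (p, z)) $ 2 = R z + s * y" "v (mk3 (p, z)) $ 3 = t + m * y + n * y'"
          unfolding v by (simp_all add: y_def y'_def)
        show ?thesis unfolding H_def sum_3 w y_def[symmetric] y'_def[symmetric] weight_def
          by (simp add: power2_eq_square field_simps)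
      qed
      then have "(LINT p:square c (\<epsilon> / 2)|lborel. H (mk3 (p, z))) = 4 * (\<epsilon> / 2)\<^sup>2 * (3 / 8 * pi * ((P z)\<^sup>2 + (R z)\<^sup>2) + pi / 4 * t\<^sup>2)
        + 4 / 3 * (\<epsilon> / 2) ^ 4 * ((3 / 8 * pi * s\<^sup>2 + pi / 4 * m\<^sup>2) + (3 / 8 * pi * s\<^sup>2 + pi / 4 * n\<^sup>2))"
        using \<epsilon>_pos by (simp only: square_integral[of "\<epsilon> / 2"])
      also have "\<dots> = g z" by (simp add: g_def power2_eq_square power4_eq_xxxx field_simps)
      finally show ?thesis .
    qed
    ultimately show ?thesis by simp
  qed
  have fg: "\<epsilon> * f z \<le> g z" for z
  proof -
    have "g z - \<epsilon> * f z = pi * \<epsilon> ^ 4 * (s\<^sup>2 * (3 / 64) + (m\<^sup>2 + n\<^sup>2) * (5 / 384))"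
      by (simp add: f_def g_def power2_eq_square power4_eq_xxxx field_simps)
    moreover have "0 \<le> pi * \<epsilon> ^ 4 * (s\<^sup>2 * (3 / 64) + (m\<^sup>2 + n\<^sup>2) * (5 / 384))" using \<epsilon>_pos by simp
    ultimately show ?thesis by linarith
  qed
  have cf: "continuous_on {0..1} (\<lambda>z. \<epsilon> * f z)" "continuous_on {0..1} g"
    unfolding f_def[abs_def] g_def[abs_def] by (intro continuous_intros cP)+
  have "\<epsilon> * (LINT z:{0<..<1}|lborel. f z) = (LINT z:{0<..<1}|lborel. \<epsilon> * f z)" by simp
  also have "\<dots> \<le> (LINT z:{0<..<1}|lborel. g z)"
    by (intro set_integral_mono unit_interval_integrable cf fg)
  finally show ?thesis unfolding eF lhs using rhs by (simp add: H_def power2_eq_square)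
qed

end

section \<open>The recovery sequence\<close>

text \<open>Only the cells inside \<open>\<Omega>\<close> are used: there the rigid approximation is controlled on the whole cell, which the
  cell inequality requires.\<close>

locale recovery = perforated +
  fixes a b :: "real^3" and A B :: "int \<times> int \<Rightarrow> real^3"
begin

definition jump :: "int \<times> int \<Rightarrow> real^3 \<Rightarrow> real^3" where
  "jump i x = cross3 (A i - a) x + (B i - b)"

definition field :: "real^3 \<Rightarrow> real^3" where
  "field x = (cross3 a x + b) + (\<Sum>i\<in>IC. indicator (cyl \<epsilon> i) x *\<^sub>R jump i x)"

text \<open>The matrix is extended from the lateral surface, which carries \<open>\<mu>\<^sub>\<epsilon>\<close>, to the cylinder. The sign is negative
  because the jump is the inner value minus the outer one.\<close>

definition jump_strain :: "int \<times> int \<Rightarrow> real^3 \<Rightarrow> real^3^3" where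
  "jump_strain i x = (\<chi> j k. - (1 / (2 * \<epsilon>)) * (jump i x $ j * normal \<epsilon> i k x + normal \<epsilon> i j x * jump i x $ k))"

definition strain :: "real^3 \<Rightarrow> real^3^3" where
  "strain x = (\<Sum>i\<in>IC. indicator (cyl \<epsilon> i) x *\<^sub>R jump_strain i x)"

lemma smooth_jump: "smooth (\<lambda>x. jump i x $ k)"
  unfolding jump_def by (rule smooth_rigid)

lemma smooth_jump_strain: "smooth (\<lambda>x. jump_strain i x $ j $ k)"
  unfolding jump_strain_def vec_lambda_beta by (intro smooth_mult smooth_add smooth_const smooth_jump smooth_normal)

lemma jump_eq: "cross3 a x + b + jump i x = cross3 (A i) x + B i"
  by (simp add: jump_def Cross3.left_diff_distrib)

lemma cyl_sum:
  fixes h :: "int \<times> int \<Rightarrow> 'b::real_vector"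
  assumes "x \<in> cyl \<epsilon> i"
  shows "(\<Sum>k\<in>IC. indicator (cyl \<epsilon> k) x *\<^sub>R h k) = (if i \<in> IC then h i else 0)"
proof -
  have "x \<in> cyl \<epsilon> k \<longleftrightarrow> k = i" for k
    using assms cyl_subset_T_cell[OF \<epsilon>_pos] T_cell_disjoint[OF \<epsilon>_pos, of x i k] by blast
  then have "(\<Sum>k\<in>IC. indicator (cyl \<epsilon> k) x *\<^sub>R h k) = (\<Sum>k\<in>IC. if k = i then h k else 0)"
    by (intro sum.cong refl) (simp only: indicator_def, simp)
  then show ?thesis using finite_IC by simp
qed

lemma field_cyl: "x \<in> cyl \<epsilon> i \<Longrightarrow> field x = (if i \<in> IC then cross3 (A i) x + B i else cross3 a x + b)"
  unfolding field_def by (subst cyl_sum) (auto simp: jump_eq)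

lemma field_E1: "x \<in> E1 \<Omega> \<epsilon> \<Longrightarrow> field x = cross3 a x + b"
proof -
  assume "x \<in> E1 \<Omega> \<epsilon>"
  then have "x \<notin> cyl \<epsilon> i" if "i \<in> IC" for i using that IC_subset unfolding E1_def E2_def by blast
  then show ?thesis by (simp add: field_def)
qed

lemma strain_wr: "q \<in> strip rad \<Longrightarrow> strain (wr i q) = (if i \<in> IC then jump_strain i (wr i q) else 0)"
  unfolding strain_def by (rule cyl_sum[OF wr_cyl])

lemma continuous_matrix:
  fixes f :: "real^3 \<Rightarrow> real^3^3"
  assumes "\<And>j k. continuous_on S (\<lambda>x. f x $ j $ k)"
  shows "continuous_on S f"
proof -
  have "continuous_on S (\<lambda>x. \<chi> j. \<chi> k. f x $ j $ k)" by (intro continuous_on_vec_lambda assms)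
  then show ?thesis by (simp only: vec_nth_inverse)
qed

lemma strain_borel: "strain \<in> borel_measurable borel"
proof -
  have "jump_strain i \<in> borel_measurable borel" for i
    by (intro borel_measurable_continuous_onI continuous_matrix smooth_continuous smooth_jump_strain)
  then show ?thesis unfolding strain_def[abs_def] using cyl_borel[OF \<epsilon>_pos] by simp
qed

lemma field_borel: "field \<in> borel_measurable borel"
  unfolding field_def[abs_def] jump_def using cyl_borel[OF \<epsilon>_pos] rigid_borel by simp

lemma cylinders_bounded:
  assumes "\<And>i. smooth (h i)"
  obtains C where "\<And>x. x \<in> \<Omega> \<Longrightarrow> \<bar>\<Sum>i\<in>IC. indicator (cyl \<epsilon> i) x * h i x\<bar> \<le> C" "C \<ge> 0"
proof -
  have "\<exists>C\<ge>0. \<forall>x\<in>\<Omega>. \<bar>h i x\<bar> \<le> C" for i by (rule smooth_bounded_on[OF assms bounded_\<Omega>]) blast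
  then obtain C where C: "\<And>i. C i \<ge> 0" "\<And>i x. x \<in> \<Omega> \<Longrightarrow> \<bar>h i x\<bar> \<le> C i" by metis
  show ?thesis
  proof (rule that[of "\<Sum>i\<in>IC. C i"])
    fix x assume x: "x \<in> \<Omega>"
    show "\<bar>\<Sum>i\<in>IC. indicator (cyl \<epsilon> i) x * h i x\<bar> \<le> (\<Sum>i\<in>IC. C i)"
    proof (rule order_trans[OF sum_abs sum_mono])
      show "\<bar>indicator (cyl \<epsilon> i) x * h i x\<bar> \<le> C i" for i
        using C(1)[of i] C(2)[OF x, of i] by (cases "x \<in> cyl \<epsilon> i") simp_all
    qed
  qed (simp add: C(1) sum_nonneg)
qed

lemma strain_bounded: obtains C where "\<And>x. x \<in> \<Omega> \<Longrightarrow> norm (strain x) \<le> C"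
proof -
  have "\<exists>C. \<forall>x\<in>\<Omega>. \<bar>strain x $ j $ k\<bar> \<le> C" for j k
    by (rule cylinders_bounded[of "\<lambda>i x. jump_strain i x $ j $ k", OF smooth_jump_strain]) (auto simp: strain_def)
  then obtain C where C: "\<And>j k x. x \<in> \<Omega> \<Longrightarrow> \<bar>strain x $ j $ k\<bar> \<le> C j k" by metis
  have "norm (strain x) \<le> 1 + (\<Sum>j\<in>UNIV. \<Sum>k\<in>UNIV. (C j k)\<^sup>2)" if x: "x \<in> \<Omega>" for x
  proof -
    have "(strain x $ j $ k)\<^sup>2 \<le> (C j k)\<^sup>2" for j k
      using power_mono[OF C[OF x, of j k] abs_ge_zero, of 2] by simp
    then have "(norm (strain x))\<^sup>2 \<le> (\<Sum>j\<in>UNIV. \<Sum>k\<in>UNIV. (C j k)\<^sup>2)"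
      unfolding matrix_norm_square by (intro sum_mono)
    moreover have "0 \<le> (norm (strain x))\<^sup>2 - 2 * norm (strain x) + 1"
      using zero_le_power2[of "norm (strain x) - 1"] by (simp add: power2_diff)
    ultimately show ?thesis using norm_ge_zero[of "strain x"] by linarith
  qed
  then show ?thesis by (rule that)
qed

lemma field_bounded: obtains C where "\<And>x. x \<in> \<Omega> \<Longrightarrow> norm (field x) \<le> C"
proof -
  have "\<exists>C. \<forall>x\<in>\<Omega>. \<bar>field x $ k\<bar> \<le> C" for k
  proof -
    obtain C where C: "\<And>x. x \<in> \<Omega> \<Longrightarrow> \<bar>\<Sum>i\<in>IC. indicator (cyl \<epsilon> i) x * jump i x $ k\<bar> \<le> C"
      by (rule cylinders_bounded[of "\<lambda>i x. jump i x $ k", OF smooth_jump]) blast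
    obtain D where D: "\<And>x. x \<in> \<Omega> \<Longrightarrow> \<bar>(cross3 a x + b) $ k\<bar> \<le> D"
      by (rule smooth_bounded_on[OF smooth_rigid bounded_\<Omega>]) blast
    have "\<bar>field x $ k\<bar> \<le> D + C" if x: "x \<in> \<Omega>" for x
    proof -
      have "field x $ k = (cross3 a x + b) $ k + (\<Sum>i\<in>IC. indicator (cyl \<epsilon> i) x * jump i x $ k)"
        by (simp add: field_def)
      then show ?thesis using C[OF x] D[OF x] by linarith
    qed
    then show ?thesis by blast
  qed
  then obtain C where C: "\<And>k x. x \<in> \<Omega> \<Longrightarrow> \<bar>field x $ k\<bar> \<le> C k" by metis
  have "norm (field x) \<le> (\<Sum>k\<in>UNIV. C k)" if "x \<in> \<Omega>" for x
    using norm_le_l1_cart[of "field x"] sum_mono[of UNIV "\<lambda>k. \<bar>field x $ k\<bar>" C] C[OF that] by fastforce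
  then show ?thesis by (rule that)
qed

text \<open>Inside a cylinder the jump is rigid, so the tested strain is a sum of pure derivatives. Gauss' theorem moves it
  to the lateral surface, and the test function vanishes on top and bottom.\<close>

lemma E_distr_field:
  assumes f: "f \<in> test_functions \<Omega>"
  shows "E_distr \<Omega> field j k f = (LINT x:\<Omega>|M. f x * strain x $ j $ k)"
proof -
  have sf: "smooth f" by (rule test_functions_smooth[OF f])
  have f0: "f x = 0" if "x$3 = 0 \<or> x$3 = 1" for x
    using that test_functions_outside[OF f, of x] by (auto simp: \<Omega>_eq prism_def)
  let ?U = "\<lambda>x. cross3 a x + b"
  define hU where "hU x = (?U x $ k * partial j f x + ?U x $ j * partial k f x) * (1 / 2)" for x
  define h where "h i x = (jump i x $ k * partial j f x + jump i x $ j * partial k f x) * (1 / 2)" for i x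
  have sU: "smooth hU" unfolding hU_def[abs_def] by (intro smooth_mult smooth_add smooth_const smooth_rigid smooth_partial sf)
  have sh: "smooth (h i)" for i unfolding h_def[abs_def] by (intro smooth_mult smooth_add smooth_const smooth_jump smooth_partial sf)
  have cylb: "bounded (cyl \<epsilon> i)" for i unfolding cyl_column by (intro bounded_column bounded_disk)
  have iU: "set_integrable lborel \<Omega> hU" by (intro smooth_set_integrable sU \<Omega>_borel bounded_\<Omega>)
  have ih: "set_integrable lborel (cyl \<epsilon> i) (h i)" for i by (intro smooth_set_integrable sh cyl_borel \<epsilon>_pos cylb)
  have split: "indicator \<Omega> x *\<^sub>R ((field x $ k * partial j f x + field x $ j * partial k f x) / 2) =
      indicator \<Omega> x *\<^sub>R hU x + (\<Sum>i\<in>IC. indicator (cyl \<epsilon> i) x *\<^sub>R h i x)" for x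
  proof (cases "\<exists>i\<in>IC. x \<in> cyl \<epsilon> i")
    case True
    then obtain i where i: "i \<in> IC" "x \<in> cyl \<epsilon> i" by blast
    then have "x \<in> \<Omega>" using IC_subset unfolding cyl_index_def by blast
    moreover have "field x = ?U x + jump i x" unfolding field_def cyl_sum[OF i(2)] using i(1) by simp
    ultimately show ?thesis unfolding cyl_sum[OF i(2)] using i(1) by (simp add: hU_def h_def algebra_simps)
  next
    case False
    then have z: "(\<Sum>i\<in>IC. indicator (cyl \<epsilon> i) x *\<^sub>R g i) = 0" for g :: "int \<times> int \<Rightarrow> 'b::real_vector"
      by (intro sum.neutral) auto
    have "field x = ?U x" unfolding field_def z by simp
    then show ?thesis unfolding z by (simp add: hU_def)
  qed
  have cylint: "(LINT x:cyl \<epsilon> i|lborel. h i x) =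
      (LINT q:strip rad|lborel. f (wr i q) * jump i (wr i q) $ k * normal \<epsilon> i j (wr i q) + f (wr i q) * jump i (wr i q) $ j * normal \<epsilon> i k (wr i q)) / 2" for i
  proof -
    let ?F = "\<lambda>l x. f x * jump i x $ l"
    have sF: "smooth (?F l)" for l by (intro smooth_mult sf smooth_jump)
    have iF: "set_integrable lborel (cyl \<epsilon> i) (partial p (?F l))" for p l
      by (intro smooth_set_integrable smooth_partial sF cyl_borel \<epsilon>_pos cylb)
    have iS: "set_integrable lborel (strip rad) (\<lambda>q. ?F l (wr i q) * normal \<epsilon> i p (wr i q))" for p l
      using strip_smooth(1)[OF smooth_mult[OF sF[of l] smooth_normal[of \<epsilon> i p]] rad_pos, of "\<lambda>s. 1" "center \<epsilon> i"] by simp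
    have hF: "h i x = (partial j (?F k) x + partial k (?F j) x) / 2" for x
      unfolding h_def jump_def rigid_partial_identity[OF sf] by simp
    have "(LINT x:cyl \<epsilon> i|lborel. h i x) = (LINT x:cyl \<epsilon> i|lborel. partial j (?F k) x + partial k (?F j) x) / 2"
      unfolding hF by (rule set_integral_divide_zero)
    also have "(LINT x:cyl \<epsilon> i|lborel. partial j (?F k) x + partial k (?F j) x) = (LINT x:cyl \<epsilon> i|lborel. partial j (?F k) x) + (LINT x:cyl \<epsilon> i|lborel. partial k (?F j) x)"
      by (intro set_integral_add iF)
    also have "\<dots> = (LINT q:strip rad|lborel. ?F k (wr i q) * normal \<epsilon> i j (wr i q)) + (LINT q:strip rad|lborel. ?F j (wr i q) * normal \<epsilon> i k (wr i q))"
      using f0 by (subst (1 2) gauss_normal[OF sF]) auto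
    also have "\<dots> = (LINT q:strip rad|lborel. ?F k (wr i q) * normal \<epsilon> i j (wr i q) + ?F j (wr i q) * normal \<epsilon> i k (wr i q))"
      by (intro set_integral_add(2)[symmetric] iS)
    finally show ?thesis .
  qed
  let ?u = "\<lambda>x. (field x $ k * partial j f x + field x $ j * partial k f x) / 2"
  have fb: "(\<lambda>x. field x $ l) \<in> borel_measurable borel" for l
    by (rule measurable_compose[OF field_borel]) (simp add: borel_measurable_continuous_onI linear_continuous_on[OF bounded_linear_vec_nth])
  have "?u \<in> borel_measurable borel"
    using fb smooth_borel[OF smooth_partial[OF sf]] by simp
  then have ub: "(\<lambda>x. indicator \<Omega> x *\<^sub>R ?u x) \<in> borel_measurable lborel"
    by (intro borel_measurable_scaleR borel_measurable_indicator) simp_all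
  have "E_distr \<Omega> field j k f = - (LINT x|lborel. indicator \<Omega> x *\<^sub>R ?u x)"
    unfolding E_distr_def set_lebesgue_integral_def by (simp only: integral_completion[OF ub])
  also have "(LINT x|lborel. indicator \<Omega> x *\<^sub>R ?u x) = (LINT x|lborel. indicator \<Omega> x *\<^sub>R hU x + (\<Sum>i\<in>IC. indicator (cyl \<epsilon> i) x *\<^sub>R h i x))"
    unfolding split ..
  also have "\<dots> = (LINT x:\<Omega>|lborel. hU x) + (LINT x|lborel. (\<Sum>i\<in>IC. indicator (cyl \<epsilon> i) x *\<^sub>R h i x))"
    unfolding set_lebesgue_integral_def
    by (intro Bochner_Integration.integral_add Bochner_Integration.integrable_sum iU[unfolded set_integrable_def] ih[unfolded set_integrable_def])
  also have "(LINT x|lborel. (\<Sum>i\<in>IC. indicator (cyl \<epsilon> i) x *\<^sub>R h i x)) = (\<Sum>i\<in>IC. LINT x:cyl \<epsilon> i|lborel. h i x)"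
    unfolding set_lebesgue_integral_def by (intro Bochner_Integration.integral_sum ih[unfolded set_integrable_def])
  also have "(LINT x:\<Omega>|lborel. hU x) = 0"
  proof -
    have "(LINT x:\<Omega>|lborel. hU x) = (LINT x:\<Omega>|lebesgue. hU x)"
      unfolding set_lebesgue_integral_def using smooth_borel[OF sU] by (intro integral_completion[symmetric]) simp
    also have "\<dots> = - E_distr \<Omega> ?U j k f" unfolding E_distr_def hU_def by simp
    finally show ?thesis using E_distr_rigid[OF f] by simp
  qed
  finally have lhs: "E_distr \<Omega> field j k f = - (\<Sum>i\<in>IC. LINT x:cyl \<epsilon> i|lborel. h i x)" by simp
  obtain C where C: "\<And>x. x \<in> \<Omega> \<Longrightarrow> \<bar>\<Sum>i\<in>IC. indicator (cyl \<epsilon> i) x * (f x * jump_strain i x $ j $ k)\<bar> \<le> C"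
    by (rule cylinders_bounded[of "\<lambda>i x. f x * jump_strain i x $ j $ k", OF smooth_mult[OF sf smooth_jump_strain]]) blast
  have gs: "f x * strain x $ j $ k = (\<Sum>i\<in>IC. indicator (cyl \<epsilon> i) x * (f x * jump_strain i x $ j $ k))" for x
    by (simp add: strain_def sum_distrib_left mult.left_commute)
  have gm: "(\<lambda>x. f x * strain x $ j $ k) \<in> borel_measurable borel"
    unfolding gs using smooth_borel[OF smooth_mult[OF sf smooth_jump_strain]] cyl_borel[OF \<epsilon>_pos] by simp
  have "(LINT x:\<Omega>|M. f x * strain x $ j $ k) = \<epsilon> * (\<Sum>i\<in>I. LINT q:strip rad|lborel. f (wr i q) * strain (wr i q) $ j $ k)"
    by (rule integral_M[OF gm, of C]) (simp only: gs C)
  also have "(\<Sum>i\<in>I. LINT q:strip rad|lborel. f (wr i q) * strain (wr i q) $ j $ k) = (\<Sum>i\<in>I. if i \<in> IC then - (1 / \<epsilon>) * (LINT x:cyl \<epsilon> i|lborel. h i x) else 0)"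
  proof (intro sum.cong refl)
    fix i
    have eq: "(LINT q:strip rad|lborel. f (wr i q) * strain (wr i q) $ j $ k) =
      (LINT q:strip rad|lborel. if i \<in> IC then - (1 / (2 * \<epsilon>)) * (f (wr i q) * jump i (wr i q) $ k * normal \<epsilon> i j (wr i q) + f (wr i q) * jump i (wr i q) $ j * normal \<epsilon> i k (wr i q)) else 0)"
      by (intro set_lebesgue_integral_cong) (auto simp: strain_wr jump_strain_def algebra_simps)
    show "(LINT q:strip rad|lborel. f (wr i q) * strain (wr i q) $ j $ k) = (if i \<in> IC then - (1 / \<epsilon>) * (LINT x:cyl \<epsilon> i|lborel. h i x) else 0)"
    proof (cases "i \<in> IC")
      case True
      have "- (1 / (2 * \<epsilon>)) * X = - (1 / \<epsilon>) * (X / 2)" for X :: real by simp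
      with True eq show ?thesis unfolding cylint by (simp only: if_True set_integral_mult_right set_integral_divide_zero)
    next
      case False
      with eq show ?thesis by (simp add: set_lebesgue_integral_def)
    qed
  qed
  also have "\<dots> = (\<Sum>i\<in>IC. - (1 / \<epsilon>) * (LINT x:cyl \<epsilon> i|lborel. h i x))"
    using IC_subset finite_I by (simp add: sum.If_cases Int_absorb1)
  also have "\<epsilon> * \<dots> = - (\<Sum>i\<in>IC. LINT x:cyl \<epsilon> i|lborel. h i x)"
    using \<epsilon>_pos unfolding sum_distrib_left[symmetric] by simp
  finally show ?thesis using lhs by simp
qed

lemma jump_strain_norm:
  "(norm (jump_strain i (wr i q)))\<^sup>2 = 1 / \<epsilon>\<^sup>2 * (((norm (jump i (wr i q)))\<^sup>2 + (\<Sum>k\<in>UNIV. jump i (wr i q) $ k * normal \<epsilon> i k (wr i q))\<^sup>2) / 2)"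
proof -
  define C S where "C = cos (fst q / rad)" and "S = sin (fst q / rad)"
  define w1 w2 w3 where "w1 = jump i (wr i q) $ 1" and "w2 = jump i (wr i q) $ 2" and "w3 = jump i (wr i q) $ 3"
  have N: "normal \<epsilon> i 1 (wr i q) = C" "normal \<epsilon> i 2 (wr i q) = S" "normal \<epsilon> i 3 (wr i q) = 0"
    unfolding normal_wr by (simp_all add: C_def S_def)
  have CS: "C\<^sup>2 + S\<^sup>2 = 1" unfolding C_def S_def by simp
  define \<kappa> where "\<kappa> = - (1 / (2 * \<epsilon>))"
  have "(norm (jump_strain i (wr i q)))\<^sup>2 = \<kappa>\<^sup>2 * (2 * (w1\<^sup>2 + w2\<^sup>2 + w3\<^sup>2) * (C\<^sup>2 + S\<^sup>2) + 2 * (w1 * C + w2 * S)\<^sup>2)"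
    unfolding matrix_norm_square jump_strain_def vec_lambda_beta sum_3 N w1_def[symmetric] w2_def[symmetric] w3_def[symmetric] \<kappa>_def[symmetric]
    by (simp add: power2_eq_square algebra_simps)
  also have "\<dots> = (1 / (2 * \<epsilon>))\<^sup>2 * (2 * (w1\<^sup>2 + w2\<^sup>2 + w3\<^sup>2) * (C\<^sup>2 + S\<^sup>2) + 2 * (w1 * C + w2 * S)\<^sup>2)"
    unfolding \<kappa>_def power2_minus ..
  also have "\<dots> = 1 / \<epsilon>\<^sup>2 * (((w1\<^sup>2 + w2\<^sup>2 + w3\<^sup>2) + (w1 * C + w2 * S)\<^sup>2) / 2)"
  proof -
    have "(1 / (2 * \<epsilon>))\<^sup>2 * (2 * W * 1 + 2 * Y) = 1 / \<epsilon>\<^sup>2 * ((W + Y) / 2)" for W Y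
      using \<epsilon>_pos by (simp add: power2_eq_square field_simps)
    then show ?thesis unfolding CS .
  qed
  finally show ?thesis unfolding norm3_square sum_3 N w1_def w2_def w3_def by simp
qed

theorem field_LD2: "field \<in> LD2 \<Omega> M"
  and field_energy: "F_eps 2 \<Omega> \<epsilon> field \<le> (\<Sum>i\<in>IC. LINT x:T_cell \<epsilon> i|lborel. (\<Sum>k\<in>UNIV. weight k * (jump i x $ k)\<^sup>2))"
proof -
  obtain C where C: "\<And>x. x \<in> \<Omega> \<Longrightarrow> norm (strain x) \<le> C" by (rule strain_bounded) blast
  obtain D where D: "\<And>x. x \<in> \<Omega> \<Longrightarrow> norm (field x) \<le> D" by (rule field_bounded) blast
  show "field \<in> LD2 \<Omega> M"
    by (rule bounded_density_LD2(1)[OF strain_borel C E_distr_field field_borel D])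
  have E: "F_eps 2 \<Omega> \<epsilon> field = \<epsilon>\<^sup>2 * (LINT x:\<Omega>|M. (norm (strain x))\<^sup>2)"
    by (rule bounded_density_LD2(2)[OF strain_borel C E_distr_field field_borel D])
  let ?e = "\<lambda>i q. ((norm (jump i (wr i q)))\<^sup>2 + (\<Sum>k\<in>UNIV. jump i (wr i q) $ k * normal \<epsilon> i k (wr i q))\<^sup>2) / 2"
  have "(LINT x:\<Omega>|M. (norm (strain x))\<^sup>2) = \<epsilon> * (\<Sum>i\<in>I. LINT q:strip rad|lborel. (norm (strain (wr i q)))\<^sup>2)"
  proof (rule integral_M)
    show "\<bar>(norm (strain x))\<^sup>2\<bar> \<le> C\<^sup>2" if "x \<in> \<Omega>" for x using power_mono[OF C[OF that] norm_ge_zero, of 2] by simp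
  qed (use strain_borel in simp)
  also have "(\<Sum>i\<in>I. LINT q:strip rad|lborel. (norm (strain (wr i q)))\<^sup>2) = (\<Sum>i\<in>I. if i \<in> IC then 1 / \<epsilon>\<^sup>2 * (LINT q:strip rad|lborel. ?e i q) else 0)"
  proof (intro sum.cong refl)
    fix i
    have "(LINT q:strip rad|lborel. (norm (strain (wr i q)))\<^sup>2) = (LINT q:strip rad|lborel. if i \<in> IC then 1 / \<epsilon>\<^sup>2 * ?e i q else 0)"
      by (intro set_lebesgue_integral_cong) (auto simp: strain_wr jump_strain_norm)
    then show "(LINT q:strip rad|lborel. (norm (strain (wr i q)))\<^sup>2) = (if i \<in> IC then 1 / \<epsilon>\<^sup>2 * (LINT q:strip rad|lborel. ?e i q) else 0)"
      by (cases "i \<in> IC") simp_all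
  qed
  also have "\<dots> = (\<Sum>i\<in>IC. 1 / \<epsilon>\<^sup>2 * (LINT q:strip rad|lborel. ?e i q))"
    using IC_subset finite_I by (simp add: sum.If_cases Int_absorb1)
  finally have "F_eps 2 \<Omega> \<epsilon> field = (\<Sum>i\<in>IC. \<epsilon> * (LINT q:strip rad|lborel. ?e i q))"
    unfolding E sum_distrib_left[symmetric] using \<epsilon>_pos by simp
  also have "\<dots> \<le> (\<Sum>i\<in>IC. LINT x:T_cell \<epsilon> i|lborel. (\<Sum>k\<in>UNIV. weight k * (jump i x $ k)\<^sup>2))"
    unfolding jump_def by (intro sum_mono cell_inequality)
  finally show "F_eps 2 \<Omega> \<epsilon> field \<le> (\<Sum>i\<in>IC. LINT x:T_cell \<epsilon> i|lborel. (\<Sum>k\<in>UNIV. weight k * (jump i x $ k)\<^sup>2))" .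
qed

end

context perforated
begin

lemma inner_T_cell: "i \<in> IC \<Longrightarrow> T_cell \<epsilon> i \<subseteq> \<Omega>"
  unfolding inner_cells_def mem_T_cell subset_iff by fastforce

lemma inner_cells_J_index: "IC \<subseteq> J_index \<Omega> \<epsilon>"
proof
  fix i assume i: "i \<in> IC"
  have "T_cell \<epsilon> i \<noteq> {}" using T_cell_center[OF \<epsilon>_pos] cyl_subset_T_cell[OF \<epsilon>_pos] by blast
  then show "i \<in> J_index \<Omega> \<epsilon>" using inner_T_cell[OF i] unfolding J_index_def by blast
qed

lemma T_cell_sum:
  assumes "x \<in> T_cell \<epsilon> i"
  shows "(\<Sum>k\<in>IC. indicator (T_cell \<epsilon> k) x * h k) = (if i \<in> IC then h i else (0::real))"
proof -
  have "x \<in> T_cell \<epsilon> k \<longleftrightarrow> k = i" for k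
    using assms T_cell_disjoint[OF \<epsilon>_pos, of x i k] by blast
  then have "(\<Sum>k\<in>IC. indicator (T_cell \<epsilon> k) x * h k) = (\<Sum>k\<in>IC. if k = i then h k else 0)"
    by (intro sum.cong refl) (simp only: indicator_def, simp)
  then show ?thesis using finite_IC by simp
qed

lemma step_one: "step_approx \<Omega> \<epsilon> (\<lambda>x. 1) x = (if cell_of \<epsilon> x \<in> IC then 1 else 0)"
  by (simp add: step_approx_def)

lemma step_one_borel: "step_approx \<Omega> \<epsilon> (\<lambda>x. 1) \<in> borel_measurable borel"
proof -
  have "step_approx \<Omega> \<epsilon> (\<lambda>x. 1) = (\<lambda>x. \<Sum>i\<in>IC. indicator {x. cell_of \<epsilon> x = i} x)"
  proof
    fix x
    have "(\<Sum>i\<in>IC. indicator {x. cell_of \<epsilon> x = i} x) = (\<Sum>i\<in>IC. if i = cell_of \<epsilon> x then 1 else (0::real))"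
      by (intro sum.cong) (auto simp: indicator_def)
    then show "step_approx \<Omega> \<epsilon> (\<lambda>x. 1) x = (\<Sum>i\<in>IC. indicator {x. cell_of \<epsilon> x = i} x)"
      unfolding step_one using finite_IC by simp
  qed
  then show ?thesis using cell_of_borel by simp
qed

end

text \<open>Young's inequality in each component; the weights are at most \<open>2\<close>.\<close>

lemma weighted_square_le:
  fixes r w :: "real^3"
  assumes \<delta>: "\<delta> > 0"
  shows "(\<Sum>k\<in>UNIV. weight k * ((- r - w) $ k)\<^sup>2) \<le> (1 + \<delta>) * (\<Sum>k\<in>UNIV. weight k * (w $ k)\<^sup>2) + 2 * (1 + 1 / \<delta>) * (norm r)\<^sup>2"
proof -
  have "weight k * ((- r - w) $ k)\<^sup>2 \<le> (1 + \<delta>) * (weight k * (w $ k)\<^sup>2) + 2 * (1 + 1 / \<delta>) * (r $ k)\<^sup>2" for k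
  proof -
    have "((- r - w) $ k)\<^sup>2 = (r$k)\<^sup>2 + 2 * w$k * r$k + (w$k)\<^sup>2" by (simp add: power2_eq_square algebra_simps)
    also have "2 * w$k * r$k \<le> \<delta> * (w$k)\<^sup>2 + (r$k)\<^sup>2 / \<delta>" using young_inequality[OF \<delta>, of "w$k" "- r$k"] by simp
    finally have *: "((- r - w) $ k)\<^sup>2 \<le> (1 + \<delta>) * (w$k)\<^sup>2 + (1 + 1 / \<delta>) * (r$k)\<^sup>2"
      by (simp add: distrib_right)
    have w: "0 \<le> weight k" "weight k \<le> 2" using weight_pos[of k] pi_less_4 by (auto simp: weight_def)
    have "weight k * ((- r - w) $ k)\<^sup>2 \<le> weight k * ((1 + \<delta>) * (w$k)\<^sup>2 + (1 + 1 / \<delta>) * (r$k)\<^sup>2)"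
      by (rule mult_left_mono[OF * w(1)])
    also have "\<dots> = (1 + \<delta>) * (weight k * (w$k)\<^sup>2) + weight k * ((1 + 1 / \<delta>) * (r$k)\<^sup>2)"
      by (simp add: distrib_left mult.left_commute)
    also have "weight k * ((1 + 1 / \<delta>) * (r$k)\<^sup>2) \<le> 2 * ((1 + 1 / \<delta>) * (r$k)\<^sup>2)"
      using w \<delta> by (intro mult_right_mono) auto
    finally show ?thesis by (simp only: mult.assoc)
  qed
  then have "(\<Sum>k\<in>UNIV. weight k * ((- r - w) $ k)\<^sup>2) \<le> (\<Sum>k\<in>UNIV. (1 + \<delta>) * (weight k * (w $ k)\<^sup>2) + 2 * (1 + 1 / \<delta>) * (r $ k)\<^sup>2)"
    by (rule sum_mono)
  then show ?thesis unfolding norm3_square sum.distrib sum_distrib_left .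
qed

context recovery
begin

abbreviation "rest u i x \<equiv> u x - (cross3 (A i) x + B i)"

lemma rest_integrable:
  assumes "u \<in> L2_space L" "i \<in> IC"
  shows "integrable L (\<lambda>x. indicator (T_cell \<epsilon> i) x * (norm (rest u i x))\<^sup>2)"
proof -
  have "integrable L (\<lambda>x. (norm (rest u i x))\<^sup>2)"
    using L2_space_diff[OF assms(1) rigid_L2_space[OF open_\<Omega> bounded_\<Omega>, of "A i" "B i"]] by (simp add: L2_space_def)
  from integrable_mult_indicator[OF sets_L[OF T_cell_borel inner_T_cell[OF assms(2)]] this]
  show ?thesis by simp
qed

lemma rest_integral:
  assumes "i \<in> IC"
  shows "(LINT x:T_cell \<epsilon> i \<inter> \<Omega>|lebesgue. (norm (rest u i x))\<^sup>2) = (LINT x|L. indicator (T_cell \<epsilon> i) x * (norm (rest u i x))\<^sup>2)"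
  using inner_T_cell[OF assms] set_integral_L[OF inner_T_cell[OF assms]] by (simp add: Int_absorb2)

lemma recovery_energy:
  assumes u2: "u\<^sub>2 \<in> L2_space L" and \<delta>: "\<delta> > 0"
  shows "F_eps 2 \<Omega> \<epsilon> field \<le> (1 + \<delta>) * F_lim (3 / 8 * pi) (pi / 4) \<Omega> (\<lambda>x. cross3 a x + b) u\<^sub>2
    + 2 * (1 + 1 / \<delta>) * (\<Sum>i\<in>IC. LINT x:T_cell \<epsilon> i \<inter> \<Omega>|lebesgue. (norm (rest u\<^sub>2 i x))\<^sup>2)"
proof -
  let ?U = "\<lambda>x. cross3 a x + b"
  note UL = rigid_L2_space[OF open_\<Omega> bounded_\<Omega>, of a b]
  define D where "D x = (\<Sum>k\<in>UNIV. weight k * ((?U x - u\<^sub>2 x) $ k)\<^sup>2)" for x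
  have Wi: "integrable L (\<lambda>x. ((?U x - u\<^sub>2 x) $ k)\<^sup>2)" for k
    using L2_space_component(2)[OF L2_space_diff[OF UL u2]] .
  have Di: "integrable L D" unfolding D_def[abs_def] using Wi by simp
  have DF: "(LINT x|L. D x) = F_lim (3 / 8 * pi) (pi / 4) \<Omega> ?U u\<^sub>2"
    unfolding F_lim_weights[OF open_\<Omega> bounded_\<Omega> UL u2] D_def using Wi by (subst Bochner_Integration.integral_sum) simp_all
  define j where "j i x = (\<Sum>k\<in>UNIV. weight k * (jump i x $ k)\<^sup>2)" for i x
  define e where "e i x = (norm (rest u\<^sub>2 i x))\<^sup>2" for i x
  have sj: "smooth (j i)" for i
    unfolding j_def[abs_def] power2_eq_square by (intro smooth_sum smooth_mult smooth_const smooth_jump)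
  have ji: "integrable L (\<lambda>x. indicator (T_cell \<epsilon> i) x * j i x)" if i: "i \<in> IC" for i
  proof -
    obtain C where C: "\<And>x. x \<in> \<Omega> \<Longrightarrow> \<bar>j i x\<bar> \<le> C" by (rule smooth_bounded_on[OF sj bounded_\<Omega>]) blast
    have "integrable L (j i)" by (rule L_bounded_integrable[OF borel_L[OF smooth_borel[OF sj]] C])
    from integrable_mult_indicator[OF sets_L[OF T_cell_borel inner_T_cell[OF i]] this] show ?thesis by simp
  qed
  have ei: "integrable L (\<lambda>x. indicator (T_cell \<epsilon> i) x * e i x)" if "i \<in> IC" for i
    unfolding e_def by (rule rest_integrable[OF u2 that])
  have je: "(LINT x:T_cell \<epsilon> i|lborel. j i x) = (LINT x|L. indicator (T_cell \<epsilon> i) x * j i x)" if i: "i \<in> IC" for i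
  proof -
    have "(LINT x:T_cell \<epsilon> i|lborel. j i x) = (LINT x:T_cell \<epsilon> i|lebesgue. j i x)"
      unfolding set_lebesgue_integral_def using smooth_borel[OF sj, of i] by (intro integral_completion[symmetric]) simp
    then show ?thesis using set_integral_L[OF inner_T_cell[OF i]] by simp
  qed
  have pt: "(\<Sum>i\<in>IC. indicator (T_cell \<epsilon> i) x * j i x) \<le> (1 + \<delta>) * D x + 2 * (1 + 1 / \<delta>) * (\<Sum>i\<in>IC. indicator (T_cell \<epsilon> i) x * e i x)" for x
  proof (cases "\<exists>i\<in>IC. x \<in> T_cell \<epsilon> i")
    case True
    then obtain i where i: "i \<in> IC" "x \<in> T_cell \<epsilon> i" by blast
    have "jump i x = - rest u\<^sub>2 i x - (?U x - u\<^sub>2 x)" using jump_eq[of x i] by (simp add: algebra_simps)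
    then have "j i x \<le> (1 + \<delta>) * D x + 2 * (1 + 1 / \<delta>) * e i x"
      unfolding j_def D_def e_def using weighted_square_le[OF \<delta>, of "rest u\<^sub>2 i x" "?U x - u\<^sub>2 x"] by (simp only:)
    then show ?thesis unfolding T_cell_sum[OF i(2)] using i(1) by simp
  next
    case False
    then have z: "(\<Sum>i\<in>IC. indicator (T_cell \<epsilon> i) x * g i) = 0" for g :: "int \<times> int \<Rightarrow> real"
      by (intro sum.neutral) auto
    have "0 \<le> D x" unfolding D_def using weight_pos by (intro sum_nonneg mult_nonneg_nonneg) (auto intro: less_imp_le)
    then show ?thesis unfolding z using \<delta> by simp
  qed
  have "F_eps 2 \<Omega> \<epsilon> field \<le> (\<Sum>i\<in>IC. LINT x:T_cell \<epsilon> i|lborel. j i x)"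
    using field_energy unfolding j_def .
  also have "\<dots> = (\<Sum>i\<in>IC. LINT x|L. indicator (T_cell \<epsilon> i) x * j i x)" by (intro sum.cong refl je)
  also have "\<dots> = (LINT x|L. (\<Sum>i\<in>IC. indicator (T_cell \<epsilon> i) x * j i x))"
    by (rule Bochner_Integration.integral_sum[symmetric]) (rule ji)
  also have "\<dots> \<le> (LINT x|L. (1 + \<delta>) * D x + 2 * (1 + 1 / \<delta>) * (\<Sum>i\<in>IC. indicator (T_cell \<epsilon> i) x * e i x))"
    by (intro integral_mono pt Bochner_Integration.integrable_sum Bochner_Integration.integrable_add integrable_mult_right Di ei ji)
  also have "\<dots> = (1 + \<delta>) * (LINT x|L. D x) + 2 * (1 + 1 / \<delta>) * (LINT x|L. (\<Sum>i\<in>IC. indicator (T_cell \<epsilon> i) x * e i x))"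
  proof -
    have "integrable L (\<lambda>x. (1 + \<delta>) * D x)" by (intro integrable_mult_right Di)
    moreover have "integrable L (\<lambda>x. 2 * (1 + 1 / \<delta>) * (\<Sum>i\<in>IC. indicator (T_cell \<epsilon> i) x * e i x))"
      by (intro integrable_mult_right Bochner_Integration.integrable_sum ei)
    ultimately show ?thesis by (simp only: Bochner_Integration.integral_add integral_mult_right_zero)
  qed
  also have "(LINT x|L. (\<Sum>i\<in>IC. indicator (T_cell \<epsilon> i) x * e i x)) = (\<Sum>i\<in>IC. LINT x|L. indicator (T_cell \<epsilon> i) x * e i x)"
    by (rule Bochner_Integration.integral_sum) (rule ei)
  also have "\<dots> = (\<Sum>i\<in>IC. LINT x:T_cell \<epsilon> i \<inter> \<Omega>|lebesgue. (norm (rest u\<^sub>2 i x))\<^sup>2)"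
    by (intro sum.cong refl) (simp only: rest_integral e_def)
  finally show ?thesis unfolding DF .
qed

text \<open>Inside the cylinders the error comes from the rigid approximation on the cells inside \<open>\<Omega>\<close> and from the
  cylinders whose cells meet the boundary, where the displacement was left unchanged.\<close>

lemma recovery_error:
  assumes u2: "u\<^sub>2 \<in> L2_space L"
  shows "(LINT x:E2 \<Omega> \<epsilon>|lebesgue. (norm (field x - u\<^sub>2 x))\<^sup>2) \<le>
    (\<Sum>i\<in>IC. LINT x:T_cell \<epsilon> i \<inter> \<Omega>|lebesgue. (norm (rest u\<^sub>2 i x))\<^sup>2)
    + (LINT x|L. (1 - step_approx \<Omega> \<epsilon> (\<lambda>x. 1) x) * (norm (cross3 a x + b - u\<^sub>2 x))\<^sup>2)"
proof -
  let ?U = "\<lambda>x. cross3 a x + b" and ?S = "step_approx \<Omega> \<epsilon> (\<lambda>x. 1)"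
  note UL = rigid_L2_space[OF open_\<Omega> bounded_\<Omega>, of a b]
  define e where "e i x = (norm (rest u\<^sub>2 i x))\<^sup>2" for i x
  have ei: "integrable L (\<lambda>x. indicator (T_cell \<epsilon> i) x * e i x)" if "i \<in> IC" for i
    unfolding e_def by (rule rest_integrable[OF u2 that])
  have dU: "integrable L (\<lambda>x. (norm (?U x - u\<^sub>2 x))\<^sup>2)" "(\<lambda>x. (norm (?U x - u\<^sub>2 x))\<^sup>2) \<in> borel_measurable L"
    using L2_space_diff[OF UL u2] by (auto simp: L2_space_def dest: borel_measurable_integrable)
  have Si: "integrable L (\<lambda>x. (1 - ?S x) * (norm (?U x - u\<^sub>2 x))\<^sup>2)"
  proof (rule Bochner_Integration.integrable_bound[OF dU(1)])
    have "?S \<in> borel_measurable L" by (rule borel_L[OF step_one_borel])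
    then show "(\<lambda>x. (1 - ?S x) * (norm (?U x - u\<^sub>2 x))\<^sup>2) \<in> borel_measurable L"
      using dU(2) by (intro borel_measurable_times borel_measurable_diff borel_measurable_const)
    show "AE x in L. norm ((1 - ?S x) * (norm (?U x - u\<^sub>2 x))\<^sup>2) \<le> norm ((norm (?U x - u\<^sub>2 x))\<^sup>2)"
      unfolding step_one by (intro AE_I2) simp
  qed
  have field_L2: "field \<in> L2_space L" using field_LD2 unfolding LD2_def by blast
  have fi: "integrable L (\<lambda>x. indicator (E2 \<Omega> \<epsilon>) x * (norm (field x - u\<^sub>2 x))\<^sup>2)"
    using integrable_mult_indicator[OF sets_L[OF E2_borel[OF bounded_\<Omega> \<epsilon>_pos] E2_subset], of "\<lambda>x. (norm (field x - u\<^sub>2 x))\<^sup>2"]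
      L2_space_diff[OF field_L2 u2] by (simp add: L2_space_def)
  have pt: "indicator (E2 \<Omega> \<epsilon>) x * (norm (field x - u\<^sub>2 x))\<^sup>2 \<le>
      (\<Sum>i\<in>IC. indicator (T_cell \<epsilon> i) x * e i x) + (1 - ?S x) * (norm (?U x - u\<^sub>2 x))\<^sup>2" for x
  proof -
    have s0: "0 \<le> (\<Sum>i\<in>IC. indicator (T_cell \<epsilon> i) x * e i x)" by (intro sum_nonneg) (simp add: e_def)
    have S0: "0 \<le> (1 - ?S x) * (norm (?U x - u\<^sub>2 x))\<^sup>2" unfolding step_one by simp
    show ?thesis
    proof (cases "x \<in> E2 \<Omega> \<epsilon>")
      case xE: True
      then obtain i where i: "x \<in> cyl \<epsilon> i" unfolding E2_def by blast
      have T: "x \<in> T_cell \<epsilon> i" using i cyl_subset_T_cell[OF \<epsilon>_pos] by blast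
      have c: "cell_of \<epsilon> x = i" by (rule cell_of_T_cell[OF \<epsilon>_pos T])
      show ?thesis
      proof (cases "i \<in> IC")
        case True
        have "(norm (field x - u\<^sub>2 x))\<^sup>2 = e i x" unfolding field_cyl[OF i] e_def using True by (simp add: norm_minus_commute)
        then show ?thesis using S0 True xE unfolding T_cell_sum[OF T] by simp
      next
        case False
        then have "(norm (field x - u\<^sub>2 x))\<^sup>2 = (1 - ?S x) * (norm (?U x - u\<^sub>2 x))\<^sup>2"
          unfolding field_cyl[OF i] step_one c by simp
        then show ?thesis using s0 xE by simp
      qed
    next
      case False
      then show ?thesis using s0 S0 by simp
    qed
  qed
  have "(LINT x:E2 \<Omega> \<epsilon>|lebesgue. (norm (field x - u\<^sub>2 x))\<^sup>2) = (LINT x|L. indicator (E2 \<Omega> \<epsilon>) x * (norm (field x - u\<^sub>2 x))\<^sup>2)"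
    by (rule set_integral_L[OF E2_subset])
  also have "\<dots> \<le> (LINT x|L. (\<Sum>i\<in>IC. indicator (T_cell \<epsilon> i) x * e i x) + (1 - ?S x) * (norm (?U x - u\<^sub>2 x))\<^sup>2)"
    by (intro integral_mono fi pt Bochner_Integration.integrable_add Bochner_Integration.integrable_sum ei Si)
  also have "\<dots> = (LINT x|L. (\<Sum>i\<in>IC. indicator (T_cell \<epsilon> i) x * e i x)) + (LINT x|L. (1 - ?S x) * (norm (?U x - u\<^sub>2 x))\<^sup>2)"
    by (intro Bochner_Integration.integral_add Bochner_Integration.integrable_sum ei Si)
  also have "(LINT x|L. (\<Sum>i\<in>IC. indicator (T_cell \<epsilon> i) x * e i x)) = (\<Sum>i\<in>IC. LINT x|L. indicator (T_cell \<epsilon> i) x * e i x)"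
    by (rule Bochner_Integration.integral_sum) (rule ei)
  also have "\<dots> = (\<Sum>i\<in>IC. LINT x:T_cell \<epsilon> i \<inter> \<Omega>|lebesgue. (norm (rest u\<^sub>2 i x))\<^sup>2)"
    by (intro sum.cong refl) (simp only: rest_integral e_def)
  finally show ?thesis .
qed

end

section \<open>The limit of the recovery sequence\<close>

lemma ereal_limit_le:
  assumes "\<And>n. x \<le> ereal (y n)" "y \<longlonglongrightarrow> Y"
  shows "x \<le> ereal Y"
  by (rule LIMSEQ_le_const[of "\<lambda>n. ereal (y n)"]) (use assms in auto)

text \<open>Cylinders near the boundary of \<open>\<omega>\<close> do not matter in the limit, because every point is eventually in a cell
  inside \<open>\<Omega>\<close>; the parameter \<open>\<delta>\<close> absorbs the distance of \<open>u\<^sub>2\<close> from its rigid approximations.\<close>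

theorem limsup_inequality:
  fixes a b :: "real^3"
  assumes \<omega>: "open \<omega>" "bounded \<omega>" "\<Omega> = prism \<omega>" and e: "\<And>j. \<epsilon> j > 0" "\<epsilon> \<longlonglongrightarrow> 0"
    and u2: "u\<^sub>2 \<in> U_space \<Omega>"
  shows "\<exists>u. (\<forall>j. u j \<in> LD2 \<Omega> (mu \<Omega> (\<epsilon> j))) \<and> converges_to \<Omega> \<epsilon> u (\<lambda>x. cross3 a x + b) u\<^sub>2 \<and>
    limsup (\<lambda>j. ereal (F_eps 2 \<Omega> (\<epsilon> j) (u j))) \<le> ereal (F_lim (3 / 8 * pi) (pi / 4) \<Omega> (\<lambda>x. cross3 a x + b) u\<^sub>2)"
proof -
  let ?U = "\<lambda>x. cross3 a x + b" and ?L = "lebesgue_on \<Omega>"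
  have o: "open \<Omega>" "bounded \<Omega>" using open_prism bounded_prism \<omega> by blast+
  have u2L: "u\<^sub>2 \<in> L2_space ?L" using u2 by (simp add: U_space_def)
  define err where "err \<eta> A B K = (\<Sum>k\<in>K. LINT x:T_cell \<eta> k \<inter> \<Omega>|lebesgue. (norm (u\<^sub>2 x - (cross3 (A k) x + B k)))\<^sup>2)"
    for \<eta> and A B :: "int \<times> int \<Rightarrow> real^3" and K
  obtain r where r: "(r \<longlongrightarrow> 0) (at_right 0)" "\<And>\<eta>. \<eta> > 0 \<Longrightarrow> \<exists>A B. err \<eta> A B (J_index \<Omega> \<eta>) \<le> r \<eta>"
    using u2 unfolding U_space_def err_def diff_diff_eq by blast
  have "\<exists>A B. err (\<epsilon> j) A B (J_index \<Omega> (\<epsilon> j)) \<le> r (\<epsilon> j)" for j by (rule r(2)[OF e(1)])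
  then obtain A B where AB: "err (\<epsilon> j) (A j) (B j) (J_index \<Omega> (\<epsilon> j)) \<le> r (\<epsilon> j)" for j by metis
  have R: "recovery \<omega> \<Omega> (\<epsilon> j)" for j using \<omega> e by unfold_locales
  have P: "perforated \<omega> \<Omega> (\<epsilon> j)" for j using \<omega> e by unfold_locales
  define u where "u j = recovery.field \<Omega> (\<epsilon> j) a b (A j) (B j)" for j
  define E where "E j = err (\<epsilon> j) (A j) (B j) (inner_cells \<Omega> (\<epsilon> j))" for j
  have E_nonneg: "0 \<le> E j" for j
    unfolding E_def err_def set_lebesgue_integral_def by (intro sum_nonneg integral_nonneg_AE AE_I2) simp
  have "E j \<le> err (\<epsilon> j) (A j) (B j) (J_index \<Omega> (\<epsilon> j))" for j
    unfolding E_def err_def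
  proof (intro sum_mono2 perforated.inner_cells_J_index[OF P])
    show "finite (J_index \<Omega> (\<epsilon> j))" unfolding J_index_def by (rule finite_cells[OF o(2) e(1)])
  qed (unfold set_lebesgue_integral_def, intro integral_nonneg_AE AE_I2, simp)
  then have E_le: "E j \<le> r (\<epsilon> j)" for j using AB order_trans by blast
  have "filterlim \<epsilon> (at_right 0) sequentially"
    unfolding filterlim_at using e by (auto simp: less_imp_neq[symmetric])
  with r(1) have "(\<lambda>j. r (\<epsilon> j)) \<longlonglongrightarrow> 0" by (rule filterlim_compose)
  then have E0: "E \<longlonglongrightarrow> 0"
    by (rule tendsto_sandwich[OF always_eventually always_eventually tendsto_const, rotated 2]) (use E_nonneg E_le in auto)
  have "(\<lambda>j. LINT x:E1 \<Omega> (\<epsilon> j)|lebesgue. (norm (u j x - ?U x))\<^sup>2) \<longlonglongrightarrow> 0"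
  proof -
    have z: "indicator (E1 \<Omega> (\<epsilon> j)) x *\<^sub>R (norm (u j x - ?U x))\<^sup>2 = 0" for j x
      unfolding u_def using recovery.field_E1[OF R, of x j] by (cases "x \<in> E1 \<Omega> (\<epsilon> j)") simp_all
    show ?thesis unfolding set_lebesgue_integral_def z by simp
  qed
  moreover have "(\<lambda>j. LINT x:E2 \<Omega> (\<epsilon> j)|lebesgue. (norm (u j x - u\<^sub>2 x))\<^sup>2) \<longlonglongrightarrow> 0"
  proof -
    let ?S = "\<lambda>j. step_approx \<Omega> (\<epsilon> j) (\<lambda>x. 1)" and ?d = "\<lambda>x. (norm (?U x - u\<^sub>2 x))\<^sup>2"
    have d: "integrable ?L ?d" "?d \<in> borel_measurable ?L"
      using L2_space_diff[OF rigid_L2_space[OF o, of a b] u2L] by (auto simp: L2_space_def dest: borel_measurable_integrable)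
    have "(\<lambda>j. LINT x|?L. (1 - ?S j x) * ?d x) \<longlonglongrightarrow> (LINT x|?L. 0)"
    proof (rule integral_dominated_convergence[OF _ _ d(1)])
      show "AE x in ?L. (\<lambda>j. (1 - ?S j x) * ?d x) \<longlonglongrightarrow> 0"
      proof (rule AE_I2)
        fix x assume "x \<in> space ?L"
        then have x: "x \<in> \<Omega>" by (simp add: space_restrict_space)
        have "(\<lambda>j. (1 - ?S j x) * ?d x) \<longlonglongrightarrow> (1 - 1) * ?d x"
          by (intro tendsto_mult tendsto_diff tendsto_const step_approx_tendsto[OF \<omega>(1,3) x e]) simp
        then show "(\<lambda>j. (1 - ?S j x) * ?d x) \<longlonglongrightarrow> 0" by simp
      qed
      fix j
      show "AE x in ?L. norm ((1 - ?S j x) * ?d x) \<le> ?d x"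
        unfolding perforated.step_one[OF P] by (intro AE_I2) simp
      have "?S j \<in> borel_measurable ?L" by (rule perforated.borel_L[OF P perforated.step_one_borel[OF P]])
      then show "(\<lambda>x. (1 - ?S j x) * ?d x) \<in> borel_measurable ?L"
        using d(2) by (intro borel_measurable_times borel_measurable_diff borel_measurable_const)
    qed simp
    then have "(\<lambda>j. E j + (LINT x|?L. (1 - ?S j x) * ?d x)) \<longlonglongrightarrow> 0 + 0" by (intro tendsto_add E0) simp
    then have up: "(\<lambda>j. E j + (LINT x|?L. (1 - ?S j x) * ?d x)) \<longlonglongrightarrow> 0" by simp
    have le: "(LINT x:E2 \<Omega> (\<epsilon> j)|lebesgue. (norm (u j x - u\<^sub>2 x))\<^sup>2) \<le> E j + (LINT x|?L. (1 - ?S j x) * ?d x)" for j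
      unfolding u_def E_def err_def by (rule recovery.recovery_error[OF R u2L])
    have nn: "0 \<le> (LINT x:E2 \<Omega> (\<epsilon> j)|lebesgue. (norm (u j x - u\<^sub>2 x))\<^sup>2)" for j
      unfolding set_lebesgue_integral_def by (intro integral_nonneg_AE AE_I2) simp
    show ?thesis
      by (rule tendsto_sandwich[OF always_eventually always_eventually tendsto_const up]) (use nn le in auto)
  qed
  ultimately have conv: "converges_to \<Omega> \<epsilon> u ?U u\<^sub>2" by (simp add: converges_to_def)
  define F where "F = F_lim (3 / 8 * pi) (pi / 4) \<Omega> ?U u\<^sub>2"
  have step: "limsup (\<lambda>j. ereal (F_eps 2 \<Omega> (\<epsilon> j) (u j))) \<le> ereal ((1 + \<delta>) * F)" if \<delta>: "\<delta> > 0" for \<delta>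
  proof -
    have "F_eps 2 \<Omega> (\<epsilon> j) (u j) \<le> (1 + \<delta>) * F + 2 * (1 + 1 / \<delta>) * E j" for j
      unfolding u_def E_def F_def err_def by (rule recovery.recovery_energy[OF R u2L \<delta>])
    then have "limsup (\<lambda>j. ereal (F_eps 2 \<Omega> (\<epsilon> j) (u j))) \<le> limsup (\<lambda>j. ereal ((1 + \<delta>) * F + 2 * (1 + 1 / \<delta>) * E j))"
      by (intro Limsup_mono always_eventually) simp
    also have "(\<lambda>j. (1 + \<delta>) * F + 2 * (1 + 1 / \<delta>) * E j) \<longlonglongrightarrow> (1 + \<delta>) * F + 2 * (1 + 1 / \<delta>) * 0"
      by (intro tendsto_intros E0)
    then have "limsup (\<lambda>j. ereal ((1 + \<delta>) * F + 2 * (1 + 1 / \<delta>) * E j)) = ereal ((1 + \<delta>) * F)"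
      by (intro lim_imp_Limsup) simp_all
    finally show ?thesis .
  qed
  have "(\<lambda>n. (1 + inverse (real (Suc n))) * F) \<longlonglongrightarrow> (1 + 0) * F"
    by (intro tendsto_intros LIMSEQ_inverse_real_of_nat)
  then have "(\<lambda>n. (1 + inverse (real (Suc n))) * F) \<longlonglongrightarrow> F" by (simp only: add_0_right mult_1_left)
  moreover have "limsup (\<lambda>j. ereal (F_eps 2 \<Omega> (\<epsilon> j) (u j))) \<le> ereal ((1 + inverse (real (Suc n))) * F)" for n
    by (rule step) simp
  ultimately have "limsup (\<lambda>j. ereal (F_eps 2 \<Omega> (\<epsilon> j) (u j))) \<le> ereal F" by (rule ereal_limit_le[rotated])
  moreover have "u j \<in> LD2 \<Omega> (mu \<Omega> (\<epsilon> j))" for j unfolding u_def by (rule recovery.field_LD2[OF R])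
  ultimately show ?thesis using conv unfolding F_def by blast
qed

lemma AE_cong_limit:
  assumes \<Omega>: "open \<Omega>" and AE: "AE x in lebesgue_on \<Omega>. u x = v x"
  shows "F_lim c\<^sub>1 c\<^sub>2 \<Omega> u w = F_lim c\<^sub>1 c\<^sub>2 \<Omega> v w"
    and "converges_to \<Omega> \<epsilon> f u w \<longleftrightarrow> converges_to \<Omega> \<epsilon> f v w"
proof -
  have L: "\<Omega> \<in> sets lebesgue" using \<Omega> by simp
  have E: "E1 \<Omega> e \<subseteq> \<Omega>" for e by (auto simp: E1_def)
  have "(LINT x:\<Omega>|lebesgue. (norm (alpha (u x) - alpha (w x)))\<^sup>2) = (LINT x:\<Omega>|lebesgue. (norm (alpha (v x) - alpha (w x)))\<^sup>2)"
    "(LINT x:\<Omega>|lebesgue. \<bar>u x $ 3 - w x $ 3\<bar>\<^sup>2) = (LINT x:\<Omega>|lebesgue. \<bar>v x $ 3 - w x $ 3\<bar>\<^sup>2)"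
    by (rule set_integral_AE_cong[OF L order_refl], use AE in eventually_elim, simp)+
  then show "F_lim c\<^sub>1 c\<^sub>2 \<Omega> u w = F_lim c\<^sub>1 c\<^sub>2 \<Omega> v w" by (simp only: F_lim_def)
  have "(LINT x:E1 \<Omega> e|lebesgue. (norm (g x - u x))\<^sup>2) = (LINT x:E1 \<Omega> e|lebesgue. (norm (g x - v x))\<^sup>2)" for g e
    by (rule set_integral_AE_cong[OF L E], use AE in eventually_elim, simp)
  then show "converges_to \<Omega> \<epsilon> f u w \<longleftrightarrow> converges_to \<Omega> \<epsilon> f v w" by (simp only: converges_to_def)
qed

theorem theorem6p4:
  fixes \<omega> :: "(real^2) set" and \<Omega> :: "(real^3) set"
    and u\<^sub>1 u\<^sub>2 :: "real^3 \<Rightarrow> real^3" and \<epsilon> :: "nat \<Rightarrow> real"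
  assumes "open \<omega>" and "connected \<omega>" and "bounded \<omega>"
    and "\<Omega> = prism \<omega>"
    and "u\<^sub>1 \<in> rigid \<Omega>" and "u\<^sub>2 \<in> U_space \<Omega>"
    and "\<And>j. \<epsilon> j > 0" and "\<epsilon> \<longlonglongrightarrow> 0"
  shows "(\<forall>u. (\<forall>j. u j \<in> LD2 \<Omega> (mu \<Omega> (\<epsilon> j))) \<longrightarrow> converges_to \<Omega> \<epsilon> u u\<^sub>1 u\<^sub>2 \<longrightarrow>
            ereal (F_lim (3 / 8 * pi) (pi / 4) \<Omega> u\<^sub>1 u\<^sub>2)
              \<le> liminf (\<lambda>j. ereal (F_eps 2 \<Omega> (\<epsilon> j) (u j)))) \<and>
         (\<exists>u. (\<forall>j. u j \<in> LD2 \<Omega> (mu \<Omega> (\<epsilon> j))) \<and> converges_to \<Omega> \<epsilon> u u\<^sub>1 u\<^sub>2 \<and>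
            ereal (F_lim (3 / 8 * pi) (pi / 4) \<Omega> u\<^sub>1 u\<^sub>2)
              \<ge> limsup (\<lambda>j. ereal (F_eps 2 \<Omega> (\<epsilon> j) (u j))))"
proof -
  obtain a b where AE: "AE x in lebesgue_on \<Omega>. u\<^sub>1 x = cross3 a x + b" using assms(5) by (auto simp: rigid_def)
  have "open \<Omega>" using open_prism assms(1,4) by blast
  note cong = AE_cong_limit[OF this AE]
  have u2: "u\<^sub>2 \<in> L2_space (lebesgue_on \<Omega>)" using assms(6) by (simp add: U_space_def)
  show ?thesis unfolding cong
    using liminf_inequality[OF assms(1,3,4,7,8) u2] limsup_inequality[OF assms(1,3,4,7,8,6)] by blast
qed

end
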